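(* Let $\lambda\in\mathbb{Q}\cap\,]0,1]$ and let $E$ be a rank $k\ge 2$ $[\lambda]$-primitive fresco with principal Jordan-Hölder sequence $(F_j)_{j\in[1,k]}$ and fundamental invariants $\lambda_1,\dots,\lambda_k$; define $p_j$ by $\lambda_{j+1}=\lambda_j+p_j-1$ and assume $p_j\ge1$ for $j\in[1,k-1]$. Assume that $F_{k-1}$ and $E/F_1$ are semi-simple and that the $\alpha$-invariant satisfies $\alpha(E)\ne 0$. Put $p(E):=\sum_{j=1}^{k-1}p_j$. Then there exists at least one rank 2 normal sub-theme in $E$, and each rank 2 normal sub-theme of $E$ is isomorphic to $$\tilde{\mathcal A}\big/\tilde{\mathcal A}\,(a-\lambda_1b)\,(1+\alpha(E)\,b^{p(E)})^{-1}\,(a-(\lambda_k+k-2)b).$$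
   Context: $\tilde{\mathcal A}$ is the $\mathbb{C}$-algebra of formal series $\sum_{\nu\ge 0}P_\nu(a)b^\nu$, $P_\nu\in\mathbb{C}[x]$, with $ab-ba=b^2$, left and right multiplication by $a$ being continuous for the $b$-adic filtration. An (a,b)-module is a left $\tilde{\mathcal A}$-module free of finite rank over $\mathbb{C}[[b]]$; submodule means left $\tilde{\mathcal A}$-submodule. It has a simple pole if $aE\subset bE$; then its Bernstein polynomial is the minimal polynomial of $-b^{-1}a$ on $E/bE$. It is regular if it embeds in a simple pole (a,b)-module; its Bernstein polynomial is then that of its saturation $E^\sharp$ by $b^{-1}a$. It is geometric if regular with all roots of the Bernstein polynomial rational and strictly negative. A fresco is a geometric (a,b)-module generated by one element over $\tilde{\mathcal A}$. A regular (a,b)-module is $[\lambda]$-primitive if all roots of its Bernstein polynomial lie in $-\lambda+\mathbb{Z}$; it is semi-simple if it is isomorphic to a submodule of a finite direct sum of regular rank 1 (a,b)-modules. A theme is an $\tilde{\mathcal A}$-module isomorphic to a submodule $\tilde{\mathcal A}\varphi\subset\bigoplus_{\mu\in\Lambda}\bigoplus_{j=0}^N\mathbb{C}[[s]]s^{\mu-1}(\log s)^j$ for some finite $\Lambda\subset\mathbb{Q}\cap\,]0,1]$, some $N\in\mathbb{N}$ and some element $\varphi$, where $a$ acts as multiplication by $s$ and $b$ as the primitive in $s$ without constant. A submodule $F\subset E$ is normal if $F\cap bE=bF$. For $\mu\in\mathbb{C}$, $E_\mu:=\tilde{\mathcal A}/\tilde{\mathcal A}(a-\mu b)$. A Jordan-Hölder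 sequence of $E$ of rank $k$ is a sequence $0=F_0\subset F_1\subset\dots\subset F_k=E$ of normal submodules with $F_j/F_{j-1}\simeq E_{\lambda_j}$ of rank 1. A $[\lambda]$-primitive fresco has a unique J-H. sequence, called principal, for which $j\mapsto\lambda_j+j$ is non decreasing; the corresponding tuple $(\lambda_1,\dots,\lambda_k)$ is the fundamental invariants of $E$. The $\alpha$-invariant $\alpha(E)\in\mathbb{C}$ is defined for $[\lambda]$-primitive frescos $E$ of rank $k\ge2$ with all $p_j\ge 1$ such that $F_{k-1}$ and $E/F_1$ are semi-simple, by induction on $k$: for $k=2$, $\alpha(E)$ is the unique $x\in\mathbb{C}$ with $E\simeq\tilde{\mathcal A}/\tilde{\mathcal A}(a-\lambda_1b)(1+xb^{p_1})^{-1}(a-\lambda_2b)$; for $k\ge 3$, $\alpha(E):=\alpha(G_{k-1})$, where $e$ is any generator of $E$ such that $(a-\lambda_{k-1}b)(a-\lambda_kb)e\in F_{k-2}$ (such generators exist) and $G_{k-1}:=\tilde{\mathcal A}(a-(\lambda_{k-1}-1)b)e$, a normal rank $k-1$ submodule satisfying the same conditions with fundamental invariants $(\lambda_1,\dots,\lambda_{k-2},\lambda_k+1)$. It is a theorem that this is independent of the choice of $e$ and depends only on the isomorphism class of $E$. *)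

theory Defs
  imports "HOL-Computational_Algebra.Polynomial_FPS"
    "HOL-Algebra.Module" "HOL-Algebra.AbelCoset"
begin

unbundle fps_syntax

text \<open>
  An element \<open>\<Sum>\<nu>. P\<^sub>\<nu>(a) b^\<nu>\<close> of the algebra is stored as the power series whose \<open>\<nu>\<close>-th coefficient
  is the polynomial \<open>P\<^sub>\<nu>\<close>. Only the additive structure of \<^typ>\<open>complex poly fps\<close> is used;
  the product is \<open>ab_mult\<close> below. From \<open>ab - ba = b^2\<close> one gets
  \<open>b^m Q(a) = \<Sum>j. (-m gchoose j) Q^(j)(a) b^(m+j)\<close> with \<open>Q^(j)\<close> the \<open>j\<close>-th derivative,
  hence the coefficient of \<open>b^N\<close> in \<open>P(a) b^m Q(a) b^n\<close>, and \<open>b\<close>-adic continuity gives all products.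
\<close>

type_synonym ab_series = "complex poly fps"

definition ab_mult :: "ab_series \<Rightarrow> ab_series \<Rightarrow> ab_series" where
  "ab_mult f g = Abs_fps (\<lambda>N. \<Sum>m\<le>N. \<Sum>n\<le>N - m.
     [: (- of_nat m) gchoose (N - m - n) :] * (f $ m * (pderiv ^^ (N - m - n)) (g $ n)))"

definition Atilde :: "ab_series ring" where
  "Atilde = \<lparr>carrier = UNIV, mult = ab_mult, one = 1, zero = 0, add = (+)\<rparr>"

definition ab_T :: "nat \<Rightarrow> nat \<Rightarrow> complex poly \<Rightarrow> complex poly \<Rightarrow> nat \<Rightarrow> complex poly" where
  "ab_T m n P Q N = (if m + n \<le> N then [: (- of_nat m) gchoose (N - m - n) :] * (P * (pderiv ^^ (N - m - n)) Q) else 0)"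

lemma ab_mult_nth_T:
  assumes "N \<le> K"
  shows "ab_mult f g $ N = (\<Sum>m\<le>K. \<Sum>n\<le>K. ab_T m n (f $ m) (g $ n) N)"
proof -
  have in1: "(\<Sum>n\<le>K. ab_T m n (f $ m) (g $ n) N) = (\<Sum>n\<le>N-m. ab_T m n (f $ m) (g $ n) N)" if "m \<le> N" for m
    by (rule sum.mono_neutral_right) (use assms that in \<open>auto simp: ab_T_def\<close>)
  have "(\<Sum>m\<le>K. \<Sum>n\<le>K. ab_T m n (f $ m) (g $ n) N) = (\<Sum>m\<le>N. \<Sum>n\<le>K. ab_T m n (f $ m) (g $ n) N)"
    by (rule sum.mono_neutral_right) (use assms in \<open>auto simp: ab_T_def\<close>)
  also have "\<dots> = (\<Sum>m\<le>N. \<Sum>n\<le>N-m. ab_T m n (f $ m) (g $ n) N)"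
    by (rule sum.cong) (auto simp: in1)
  also have "\<dots> = ab_mult f g $ N"
    by (auto simp: ab_mult_def ab_T_def intro!: sum.cong)
  finally show ?thesis by simp
qed

lemma ab_T_add_left: "ab_T m n (P + P') Q N = ab_T m n P Q N + ab_T m n P' Q N"
  and ab_T_add_right: "ab_T m n P (Q + Q') N = ab_T m n P Q N + ab_T m n P Q' N"
  and ab_T_0_left: "ab_T m n 0 Q N = 0"
  and ab_T_0_right: "ab_T m n P 0 N = 0"
  by (auto simp: ab_T_def algebra_simps higher_pderiv_add simp flip: smult_add_right)

lemma ab_T_sum_left: "ab_T m n (sum f A) Q N = (\<Sum>x\<in>A. ab_T m n (f x) Q N)"
  by (induction A rule: infinite_finite_induct) (auto simp: ab_T_add_left ab_T_0_left)

lemma ab_T_sum_right: "ab_T m n P (sum f A) N = (\<Sum>x\<in>A. ab_T m n P (f x) N)"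
  by (induction A rule: infinite_finite_induct) (auto simp: ab_T_add_right ab_T_0_right)

lemma higher_pderiv_mult:
  "(pderiv ^^ n) (P * Q :: complex poly) =
     (\<Sum>i\<le>n. of_nat (n choose i) * ((pderiv ^^ i) P * (pderiv ^^ (n - i)) Q))"
proof (induction n)
  case 0 then show ?case by simp
next
  case (Suc n)
  let ?t = "\<lambda>i j. (pderiv ^^ i) P * (pderiv ^^ j) Q"
  have d: "pderiv (\<Sum>i\<le>n. f i) = (\<Sum>i\<le>n. pderiv (f i :: complex poly))" for f
    by (induction n) (auto simp: pderiv_add)
  have dn: "pderiv (of_nat k * R) = of_nat k * pderiv R" for k and R :: "complex poly"
    by (induction k) (auto simp: algebra_simps pderiv_add)
  have "(pderiv ^^ Suc n) (P * Q) = (\<Sum>i\<le>n. of_nat (n choose i) * (?t (Suc i) (n - i) + ?t i (Suc (n - i))))"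
    by (simp add: Suc d dn pderiv_mult algebra_simps)
  also have "\<dots> = (\<Sum>i\<le>n. of_nat (n choose i) * ?t (Suc i) (n - i)) + (\<Sum>i\<le>n. of_nat (n choose i) * ?t i (Suc n - i))"
    by (simp add: algebra_simps sum.distrib Suc_diff_le)
  also have "(\<Sum>i\<le>n. of_nat (n choose i) * ?t i (Suc n - i)) = (\<Sum>i\<le>Suc n. of_nat (n choose i) * ?t i (Suc n - i))"
    by simp
  also have "\<dots> = ?t 0 (Suc n) + (\<Sum>i\<le>n. of_nat (n choose Suc i) * ?t (Suc i) (n - i))"
    by (subst sum.atMost_Suc_shift) simp
  also have "(\<Sum>i\<le>n. of_nat (n choose i) * ?t (Suc i) (n - i)) + (?t 0 (Suc n) + (\<Sum>i\<le>n. of_nat (n choose Suc i) * ?t (Suc i) (n - i)))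
     = ?t 0 (Suc n) + (\<Sum>i\<le>n. of_nat (Suc n choose Suc i) * ?t (Suc i) (n - i))"
    by (simp add: algebra_simps sum.distrib)
  also have "\<dots> = (\<Sum>i\<le>Suc n. of_nat (Suc n choose i) * ?t i (Suc n - i))"
    by (simp only: sum.atMost_Suc_shift) simp
  finally show ?case .
qed

lemma gchoose_step: "((x::complex) gchoose i) * ((x - of_nat i) gchoose r) = (x gchoose (i + r)) * of_nat ((i + r) choose i)"
proof -
  have "(x gchoose (i + r)) * (of_nat (i + r) gchoose i) = (x gchoose i) * ((x - of_nat i) gchoose (i + r - i))"
    by (rule gbinomial_trinomial_revision) simp
  then show ?thesis by (simp add: binomial_gbinomial)
qed

lemma ab_T_assoc:
  "(\<Sum>M\<le>N. ab_T M l (ab_T m n P Q M) R N) = (\<Sum>K\<le>N. ab_T m K P (ab_T n l Q R K) N)"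
proof (cases "m + n + l \<le> N")
  case False
  have "(\<Sum>M\<le>N. ab_T M l (ab_T m n P Q M) R N) = 0"
    by (rule sum.neutral) (use False in \<open>auto simp: ab_T_def\<close>)
  moreover have "(\<Sum>K\<le>N. ab_T m K P (ab_T n l Q R K) N) = 0"
    by (rule sum.neutral) (use False in \<open>auto simp: ab_T_def\<close>)
  ultimately show ?thesis by simp
next
  case True
  define d where "d = N - m - n - l"
  have N: "N = m + n + l + d" using True by (simp add: d_def)
  let ?c = "\<lambda>(m::nat) (j::nat). (- of_nat m :: complex) gchoose j"
  let ?D = "\<lambda>j p. (pderiv ^^ j) p"
  have "(\<Sum>M\<le>N. ab_T M l (ab_T m n P Q M) R N) = (\<Sum>M\<in>(\<lambda>i. m + n + i) ` {..d}. ab_T M l (ab_T m n P Q M) R N)"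
    by (rule sum.mono_neutral_right) (auto simp: ab_T_def N image_iff,
        metis Nat.le_diff_conv2 add.commute add_diff_inverse_nat atMost_iff diff_le_mono2 le_diff_conv linorder_not_less nat_le_linear add_le_imp_le_right add.assoc le_add_diff_inverse)
  also have "\<dots> = (\<Sum>i\<le>d. ab_T (m + n + i) l (ab_T m n P Q (m + n + i)) R N)"
    by (subst sum.reindex) (auto simp: inj_on_def)
  also have "\<dots> = (\<Sum>i\<le>d. [: ?c m i * ?c (m + n + i) (d - i) :] * (P * ?D i Q * ?D (d - i) R))"
    by (rule sum.cong) (auto simp: ab_T_def N algebra_simps)
  also have "\<dots> = (\<Sum>i\<le>d. \<Sum>k\<le>d - i. [: ?c n k * ?c m (d - k) * of_nat ((d - k) choose i) :] * (P * ?D i Q * ?D (d - i) R))"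
  proof (rule sum.cong)
    fix i assume "i \<in> {..d}"
    then have i: "i \<le> d" by simp
    have "?c (m + n + i) (d - i) = (\<Sum>k\<le>d - i. ?c n k * ?c (m + i) (d - i - k))"
      using gbinomial_Vandermonde[of "- of_nat n" "- of_nat (m + i) :: complex" "d - i"]
      by (simp add: algebra_simps atMost_atLeast0)
    then have "?c m i * ?c (m + n + i) (d - i) = (\<Sum>k\<le>d - i. ?c n k * (?c m i * ?c (m + i) (d - i - k)))"
      by (simp add: sum_distrib_left algebra_simps)
    also have "\<dots> = (\<Sum>k\<le>d - i. ?c n k * ?c m (d - k) * of_nat ((d - k) choose i))"
    proof (rule sum.cong)
      fix k assume "k \<in> {..d - i}"
      then have "i + (d - i - k) = d - k" using i by auto
      then show "?c n k * (?c m i * ?c (m + i) (d - i - k)) = ?c n k * ?c m (d - k) * of_nat ((d - k) choose i)"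
        using gchoose_step[of "- of_nat m" i "d - i - k"]
        by (simp only: of_nat_add minus_add_distrib diff_conv_add_uminus mult.assoc)
    qed simp
    finally have e: "?c m i * ?c (m + n + i) (d - i) = \<dots>" .
    have s: "[:\<Sum>k\<le>K. f k:] * X = (\<Sum>k\<le>K. [:f k:] * X)" for K :: nat and f and X :: "complex poly"
      by (induction K) (auto simp: algebra_simps smult_add_left)
    show "[: ?c m i * ?c (m + n + i) (d - i) :] * (P * ?D i Q * ?D (d - i) R) =
      (\<Sum>k\<le>d - i. [: ?c n k * ?c m (d - k) * of_nat ((d - k) choose i) :] * (P * ?D i Q * ?D (d - i) R))"
      by (simp only: e s)
  qed simp
  also have "\<dots> = (\<Sum>k\<le>d. \<Sum>i\<le>d - k. [: ?c n k * ?c m (d - k) * of_nat ((d - k) choose i) :] * (P * ?D i Q * ?D (d - i) R))"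
    by (subst sum.Sigma, simp, simp, subst sum.Sigma, simp, simp)
       (rule sum.reindex_bij_witness[of _ "\<lambda>(x,y). (y,x)" "\<lambda>(x,y). (y,x)"], auto)
  also have "\<dots> = (\<Sum>k\<le>d. [: ?c m (d - k) * ?c n k :] * (P * ?D (d - k) (Q * ?D k R)))"
  proof (rule sum.cong)
    fix k assume "k \<in> {..d}"
    then have k: "k \<le> d" by simp
    have D: "?D (d - k - i) (?D k R) = ?D (d - i) R" if "i \<le> d - k" for i
    proof -
      have "d - i = (d - k - i) + k" using that k by simp
      then show ?thesis by (simp add: funpow_add)
    qed
    have "[: ?c m (d - k) * ?c n k :] * (P * ?D (d - k) (Q * ?D k R)) =
       (\<Sum>i\<le>d - k. [: ?c m (d - k) * ?c n k :] * (P * (of_nat ((d - k) choose i) * (?D i Q * ?D (d - i) R))))"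
      unfolding higher_pderiv_mult sum_distrib_left by (intro sum.cong refl) (simp only: D atMost_iff)
    also have "\<dots> = (\<Sum>i\<le>d - k. [: ?c n k * ?c m (d - k) * of_nat ((d - k) choose i) :] * (P * ?D i Q * ?D (d - i) R))"
      by (rule sum.cong) (auto simp: algebra_simps of_nat_poly)
    finally show "(\<Sum>i\<le>d - k. [: ?c n k * ?c m (d - k) * of_nat ((d - k) choose i) :] * (P * ?D i Q * ?D (d - i) R)) =
         [: ?c m (d - k) * ?c n k :] * (P * ?D (d - k) (Q * ?D k R))" by simp
  qed simp
  also have "\<dots> = (\<Sum>k\<le>d. ab_T m (n + l + k) P (ab_T n l Q R (n + l + k)) N)"
    by (rule sum.cong) (auto simp: ab_T_def N higher_pderiv_smult algebra_simps)
  also have "\<dots> = (\<Sum>K\<in>(\<lambda>i. n + l + i) ` {..d}. ab_T m K P (ab_T n l Q R K) N)"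
    by (subst sum.reindex) (auto simp: inj_on_def)
  also have "\<dots> = (\<Sum>K\<le>N. ab_T m K P (ab_T n l Q R K) N)"
  proof (rule sum.mono_neutral_left)
    show "\<forall>K\<in>{..N} - (\<lambda>i. n + l + i) ` {..d}. ab_T m K P (ab_T n l Q R K) N = 0"
    proof
      fix K assume "K \<in> {..N} - (\<lambda>i. n + l + i) ` {..d}"
      moreover have "K \<in> (\<lambda>i. n + l + i) ` {..d}" if "n + l \<le> K" "m + K \<le> N"
        by (rule image_eqI[of _ _ "K - n - l"]) (use that N in auto)
      ultimately have "\<not> n + l \<le> K \<or> \<not> m + K \<le> N" by auto
      then show "ab_T m K P (ab_T n l Q R K) N = 0"
        by (auto simp: ab_T_def)
    qed
  qed (auto simp: N)
  finally show ?thesis .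
qed

lemma ab_mult_assoc: "ab_mult (ab_mult f g) h = ab_mult f (ab_mult g h)"
proof (rule fps_ext)
  fix N
  have "ab_mult (ab_mult f g) h $ N =
      (\<Sum>M\<le>N. \<Sum>l\<le>N. ab_T M l (\<Sum>m\<le>N. \<Sum>n\<le>N. ab_T m n (f $ m) (g $ n) M) (h $ l) N)"
    unfolding ab_mult_nth_T[OF order.refl, of "ab_mult f g" h N]
    by (intro sum.cong refl arg_cong[where f = "\<lambda>x. ab_T _ _ x _ _"] ab_mult_nth_T) auto
  also have "\<dots> = (\<Sum>M\<le>N. \<Sum>l\<le>N. \<Sum>m\<le>N. \<Sum>n\<le>N. ab_T M l (ab_T m n (f $ m) (g $ n) M) (h $ l) N)"
    by (simp add: ab_T_sum_left)
  also have "\<dots> = (\<Sum>l\<le>N. \<Sum>M\<le>N. \<Sum>m\<le>N. \<Sum>n\<le>N. ab_T M l (ab_T m n (f $ m) (g $ n) M) (h $ l) N)"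
    by (rule sum.swap)
  also have "\<dots> = (\<Sum>l\<le>N. \<Sum>m\<le>N. \<Sum>M\<le>N. \<Sum>n\<le>N. ab_T M l (ab_T m n (f $ m) (g $ n) M) (h $ l) N)"
    by (intro sum.cong refl sum.swap)
  also have "\<dots> = (\<Sum>l\<le>N. \<Sum>m\<le>N. \<Sum>n\<le>N. \<Sum>M\<le>N. ab_T M l (ab_T m n (f $ m) (g $ n) M) (h $ l) N)"
    by (intro sum.cong refl sum.swap)
  also have "\<dots> = (\<Sum>l\<le>N. \<Sum>m\<le>N. \<Sum>n\<le>N. \<Sum>K\<le>N. ab_T m K (f $ m) (ab_T n l (g $ n) (h $ l) K) N)"
    by (simp only: ab_T_assoc)
  also have "\<dots> = (\<Sum>m\<le>N. \<Sum>l\<le>N. \<Sum>n\<le>N. \<Sum>K\<le>N. ab_T m K (f $ m) (ab_T n l (g $ n) (h $ l) K) N)"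
    by (rule sum.swap)
  also have "\<dots> = (\<Sum>m\<le>N. \<Sum>n\<le>N. \<Sum>l\<le>N. \<Sum>K\<le>N. ab_T m K (f $ m) (ab_T n l (g $ n) (h $ l) K) N)"
    by (intro sum.cong refl sum.swap)
  also have "\<dots> = (\<Sum>m\<le>N. \<Sum>n\<le>N. \<Sum>K\<le>N. \<Sum>l\<le>N. ab_T m K (f $ m) (ab_T n l (g $ n) (h $ l) K) N)"
    by (intro sum.cong refl sum.swap)
  also have "\<dots> = (\<Sum>m\<le>N. \<Sum>K\<le>N. \<Sum>n\<le>N. \<Sum>l\<le>N. ab_T m K (f $ m) (ab_T n l (g $ n) (h $ l) K) N)"
    by (intro sum.cong refl sum.swap)
  also have "\<dots> = (\<Sum>m\<le>N. \<Sum>K\<le>N. ab_T m K (f $ m) (\<Sum>n\<le>N. \<Sum>l\<le>N. ab_T n l (g $ n) (h $ l) K) N)"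
    by (simp add: ab_T_sum_right)
  also have "\<dots> = ab_mult f (ab_mult g h) $ N"
    unfolding ab_mult_nth_T[OF order.refl, of f "ab_mult g h" N]
    by (intro sum.cong refl arg_cong[where f = "\<lambda>x. ab_T _ _ _ x _"] ab_mult_nth_T[symmetric]) auto
  finally show "ab_mult (ab_mult f g) h $ N = ab_mult f (ab_mult g h) $ N" .
qed

lemma ab_mult_add_left: "ab_mult (f + f') g = ab_mult f g + ab_mult f' g"
  and ab_mult_add_right: "ab_mult f (g + g') = ab_mult f g + ab_mult f g'"
  by (auto simp: fps_eq_iff ab_mult_nth_T[OF order.refl] ab_T_add_left ab_T_add_right sum.distrib)

lemma gchoose_0_left: "(0::complex) gchoose j = (if j = 0 then 1 else 0)"
  by (cases j) auto

lemma ab_mult_const_left: "ab_mult (fps_const P) g = fps_const P * g"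
proof (rule fps_ext)
  fix N
  have "ab_mult (fps_const P) g $ N = (\<Sum>m\<in>{0}. \<Sum>n\<le>N - m.
     [: (- of_nat m) gchoose (N - m - n) :] * (fps_const P $ m * (pderiv ^^ (N - m - n)) (g $ n)))"
    unfolding ab_mult_def fps_nth_Abs_fps by (rule sum.mono_neutral_right) auto
  also have "\<dots> = (\<Sum>n\<le>N. [: 0 gchoose (N - n) :] * (P * (pderiv ^^ (N - n)) (g $ n)))"
    by simp
  also have "\<dots> = (\<Sum>n\<in>{N}. [: 0 gchoose (N - n) :] * (P * (pderiv ^^ (N - n)) (g $ n)))"
    by (rule sum.mono_neutral_right) (auto simp: gchoose_0_left)
  also have "\<dots> = P * g $ N" by simp
  finally show "ab_mult (fps_const P) g $ N = (fps_const P * g) $ N" by simp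
qed

lemma higher_pderiv_const: "0 < n \<Longrightarrow> (pderiv ^^ n) [:c::complex:] = 0"
  by (cases n) (simp_all del: funpow.simps add: funpow_Suc_right pderiv_pCons)

lemma ab_mult_b_right:
  "ab_mult f (Abs_fps (\<lambda>n. [: S n :])) = f * Abs_fps (\<lambda>n. [: S n :])"
proof (rule fps_ext)
  fix N
  have "(\<Sum>n\<le>N-m. [: (- of_nat m) gchoose (N - m - n) :] * (f $ m * (pderiv ^^ (N - m - n)) [: S n :])) =
      f $ m * [: S (N - m) :]" (is "?l = _") if "m \<le> N" for m
  proof -
    have "?l = (\<Sum>n\<in>{N-m}. [: (- of_nat m) gchoose (N - m - n) :] * (f $ m * (pderiv ^^ (N - m - n)) [: S n :]))"
      by (rule sum.mono_neutral_right) (auto simp: higher_pderiv_const)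
    then show ?thesis by simp
  qed
  then show "ab_mult f (Abs_fps (\<lambda>n. [: S n :])) $ N = (f * Abs_fps (\<lambda>n. [: S n :])) $ N"
    by (simp add: ab_mult_def fps_mult_nth atMost_atLeast0)
qed

lemma ab_mult_1_left: "ab_mult 1 g = g"
  using ab_mult_const_left[of 1 g] by simp

lemma ab_mult_1_right: "ab_mult f 1 = f"
proof -
  have "(1 :: complex poly fps) = Abs_fps (\<lambda>n. [: if n = 0 then 1 else 0 :])"
    by (rule fps_ext) (auto simp: one_pCons)
  then show ?thesis using ab_mult_b_right[of f "\<lambda>n. if n = 0 then 1 else 0"] by simp
qed

lemma Atilde_ring: "ring Atilde"
proof (rule ringI)
  show "abelian_group Atilde"
    by (rule abelian_groupI) (auto simp: Atilde_def intro: exI[of _ "- x" for x])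
  show "Group.monoid Atilde"
    by (rule monoidI) (auto simp: Atilde_def ab_mult_assoc ab_mult_1_left ab_mult_1_right)
qed (auto simp: Atilde_def ab_mult_add_left ab_mult_add_right)

definition ab_a :: ab_series where "ab_a = fps_const [:0, 1:]"

text \<open>The inclusion of \<open>\<complex>[[b]]\<close>.\<close>

definition ab_of_b :: "complex fps \<Rightarrow> ab_series" where
  "ab_of_b S = Abs_fps (\<lambda>n. [: S $ n :])"

abbreviation ab_b :: ab_series where "ab_b \<equiv> ab_of_b fps_X"

lemma ab_b_eq: "ab_b = fps_X"
  by (rule fps_ext) (auto simp: ab_of_b_def one_pCons)

lemma ab_commutator:
  "ab_mult ab_a ab_b - ab_mult ab_b ab_a = ab_mult ab_b ab_b"
proof (rule fps_ext)
  fix N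
  have X: "fps_X = Abs_fps (\<lambda>n. [: if n = 1 then 1 else 0 :: complex :])"
    by (rule fps_ext) (auto simp: one_pCons)
  have r: "ab_mult f ab_b = f * fps_X" for f
    unfolding ab_b_eq by (subst (1 2) X) (rule ab_mult_b_right)
  have "ab_mult ab_b ab_a $ N = (\<Sum>m\<in>{1} \<inter> {..N}. \<Sum>n\<le>N - m.
     [: (- of_nat m) gchoose (N - m - n) :] * (ab_b $ m * (pderiv ^^ (N - m - n)) (ab_a $ n)))"
    unfolding ab_mult_def fps_nth_Abs_fps by (rule sum.mono_neutral_right) (auto simp: ab_b_eq)
  also have "\<dots> = (if N = 0 then 0 else (\<Sum>n\<in>{0}.
     [: (- 1) gchoose (N - 1 - n) :] * ((pderiv ^^ (N - 1 - n)) (ab_a $ n))))"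
  proof (cases "N = 0")
    case False
    have "(\<Sum>n\<in>{1} \<inter> {..N}. \<Sum>k\<le>N - n.
      [: (- of_nat n) gchoose (N - n - k) :] * (ab_b $ n * (pderiv ^^ (N - n - k)) (ab_a $ k))) =
      (\<Sum>k\<le>N - 1. [: (- 1) gchoose (N - 1 - k) :] * ((pderiv ^^ (N - 1 - k)) (ab_a $ k)))"
      using False by (simp add: ab_b_eq Int_absorb2)
    also have "\<dots> = (\<Sum>k\<in>{0}. [: (- 1) gchoose (N - 1 - k) :] * ((pderiv ^^ (N - 1 - k)) (ab_a $ k)))"
      by (rule sum.mono_neutral_right) (auto simp: ab_a_def)
    finally show ?thesis using False by simp
  qed simp
  also have "\<dots> = (if N = 1 then [:0,1:] else if N = 2 then -1 else 0)"
  proof -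
    have "(pderiv ^^ (N - 1)) [:0, 1::complex:] = 0" if "N > 2"
    proof -
      have "N - 1 = Suc (Suc (N - 3))" using that by simp
      then show ?thesis by (simp del: funpow.simps add: funpow_Suc_right pderiv_pCons)
    qed
    moreover have "N = 0 \<or> N = 1 \<or> N = 2 \<or> N > 2" by linarith
    ultimately show ?thesis by (auto simp: ab_a_def pderiv_pCons one_pCons numeral_2_eq_2)
  qed
  finally have m: "ab_mult ab_b ab_a $ N = (if N = 1 then [:0,1:] else if N = 2 then -1 else 0)" .
  show "(ab_mult ab_a ab_b - ab_mult ab_b ab_a) $ N = ab_mult ab_b ab_b $ N"
    unfolding fps_sub_nth r[of ab_a] r[of ab_b] m
    by (auto simp: ab_b_eq ab_a_def numeral_2_eq_2)
qed

text \<open>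
  The library's \<^locale>\<open>module\<close> needs a commutative ring of scalars. Left modules over an arbitrary
  ring are set up on the same record type; the library's \<^locale>\<open>submodule\<close> applies unchanged.
\<close>

locale left_module = R?: ring R + M?: abelian_group M for R (structure) and M (structure) +
  assumes smult_closed [simp, intro]:
      "\<lbrakk>r \<in> carrier R; x \<in> carrier M\<rbrakk> \<Longrightarrow> r \<odot>\<^bsub>M\<^esub> x \<in> carrier M"
    and smult_l_distr:
      "\<lbrakk>r \<in> carrier R; s \<in> carrier R; x \<in> carrier M\<rbrakk> \<Longrightarrow>
        (r \<oplus> s) \<odot>\<^bsub>M\<^esub> x = r \<odot>\<^bsub>M\<^esub> x \<oplus>\<^bsub>M\<^esub> s \<odot>\<^bsub>M\<^esub> x"
    and smult_r_distr:
      "\<lbrakk>r \<in> carrier R; x \<in> carrier M; y \<in> carrier M\<rbrakk> \<Longrightarrow>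
        r \<odot>\<^bsub>M\<^esub> (x \<oplus>\<^bsub>M\<^esub> y) = r \<odot>\<^bsub>M\<^esub> x \<oplus>\<^bsub>M\<^esub> r \<odot>\<^bsub>M\<^esub> y"
    and smult_assoc:
      "\<lbrakk>r \<in> carrier R; s \<in> carrier R; x \<in> carrier M\<rbrakk> \<Longrightarrow>
        (r \<otimes> s) \<odot>\<^bsub>M\<^esub> x = r \<odot>\<^bsub>M\<^esub> (s \<odot>\<^bsub>M\<^esub> x)"
    and smult_one [simp]: "x \<in> carrier M \<Longrightarrow> \<one> \<odot>\<^bsub>M\<^esub> x = x"

definition lmod_hom ::
    "('a, 'b) ring_scheme \<Rightarrow> ('a, 'm, 'c) module_scheme \<Rightarrow> ('a, 'n, 'd) module_scheme \<Rightarrow> ('m \<Rightarrow> 'n) set" where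
  "lmod_hom R M N = {f \<in> hom (add_monoid M) (add_monoid N).
     \<forall>r\<in>carrier R. \<forall>x\<in>carrier M. f (r \<odot>\<^bsub>M\<^esub> x) = r \<odot>\<^bsub>N\<^esub> f x}"

definition lmod_iso ::
    "('a, 'b) ring_scheme \<Rightarrow> ('a, 'm, 'c) module_scheme \<Rightarrow> ('a, 'n, 'd) module_scheme \<Rightarrow> bool" where
  "lmod_iso R M N \<longleftrightarrow> (\<exists>f \<in> lmod_hom R M N. bij_betw f (carrier M) (carrier N))"

abbreviation restrict_to :: "('a, 'm) module \<Rightarrow> 'm set \<Rightarrow> ('a, 'm) module" (infixl \<open>\<downharpoonright>\<close> 70) where
  "M \<downharpoonright> H \<equiv> M\<lparr>carrier := H\<rparr>"

definition lmod_quot :: "('a, 'm) module \<Rightarrow> 'm set \<Rightarrow> ('a, 'm set) module" (infixl \<open>LQuot\<close> 70) where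
  "M LQuot H = \<lparr>carrier = a_rcosets\<^bsub>M\<^esub> H, mult = undefined, one = undefined, zero = H,
     add = set_add M, smult = (\<lambda>r X. \<Union>x\<in>X. H +>\<^bsub>M\<^esub> (r \<odot>\<^bsub>M\<^esub> x))\<rparr>"

definition cyc_sub :: "('a, 'b) ring_scheme \<Rightarrow> ('a, 'm) module \<Rightarrow> 'm \<Rightarrow> 'm set" where
  "cyc_sub R M x = {r \<odot>\<^bsub>M\<^esub> x |r. r \<in> carrier R}"

definition regular_lmod :: "('a, 'b) ring_scheme \<Rightarrow> ('a, 'a) module" where
  "regular_lmod R = \<lparr>carrier = carrier R, mult = mult R, one = \<one>\<^bsub>R\<^esub>, zero = \<zero>\<^bsub>R\<^esub>,
     add = add R, smult = mult R\<rparr>"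

definition lmod_dsum :: "nat \<Rightarrow> (nat \<Rightarrow> ('a, 'm) module) \<Rightarrow> ('a, nat \<Rightarrow> 'm) module" where
  "lmod_dsum n M = \<lparr>carrier = (\<Pi>\<^sub>E i\<in>{..<n}. carrier (M i)), mult = undefined, one = undefined,
     zero = (\<lambda>i\<in>{..<n}. \<zero>\<^bsub>M i\<^esub>), add = (\<lambda>x y. \<lambda>i\<in>{..<n}. x i \<oplus>\<^bsub>M i\<^esub> y i),
     smult = (\<lambda>r x. \<lambda>i\<in>{..<n}. r \<odot>\<^bsub>M i\<^esub> x i)\<rparr>"

lemma left_module_sub:
  assumes "left_module R M" "submodule H R M"
  shows "left_module R (M \<downharpoonright> H)"
proof -
  interpret left_module R M by fact
  interpret H: submodule H R M by fact
  have sub: "x \<in> carrier M" if "x \<in> H" for x using H.subset that by auto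
  have neg: "\<ominus>\<^bsub>M\<^esub> x \<in> H" if "x \<in> H" for x
    using H.m_inv_closed[OF that] by (simp add: a_inv_def)
  have add: "x \<oplus>\<^bsub>M\<^esub> y \<in> H" if "x \<in> H" "y \<in> H" for x y
    using H.m_closed[OF that] by simp
  have zero: "\<zero>\<^bsub>M\<^esub> \<in> H" using H.one_closed by simp
  have "abelian_group (M \<downharpoonright> H)"
  proof (rule abelian_groupI)
    fix x assume x: "x \<in> carrier (M \<downharpoonright> H)"
    then show "\<exists>y\<in>carrier (M \<downharpoonright> H). y \<oplus>\<^bsub>M \<downharpoonright> H\<^esub> x = \<zero>\<^bsub>M \<downharpoonright> H\<^esub>"
      by (intro bexI[of _ "\<ominus>\<^bsub>M\<^esub> x"]) (simp_all add: M.l_neg sub neg)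
  qed (simp_all add: add zero sub M.a_ac)
  then show ?thesis
    by (intro left_module.intro left_module_axioms.intro R.ring_axioms)
       (simp_all add: smult_l_distr smult_r_distr smult_assoc sub)
qed

lemma left_module_quot:
  assumes "left_module R M" "submodule H R M"
  shows "left_module R (M LQuot H)"
proof -
  interpret left_module R M by fact
  interpret H: submodule H R M by fact
  have ab: "abelian_subgroup H M"
    by (intro abelian_subgroupI3 additive_subgroup.intro H.subgroup_axioms M.abelian_group_axioms)
  interpret H': abelian_subgroup H M by fact
  have sm: "smult (M LQuot H) r (H +>\<^bsub>M\<^esub> x) = H +>\<^bsub>M\<^esub> (r \<odot>\<^bsub>M\<^esub> x)"
    if "r \<in> carrier R" "x \<in> carrier M" for r x
  proof -
    have "H +>\<^bsub>M\<^esub> (r \<odot>\<^bsub>M\<^esub> y) = H +>\<^bsub>M\<^esub> (r \<odot>\<^bsub>M\<^esub> x)" if "y \<in> H +>\<^bsub>M\<^esub> x" for y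
    proof -
      from that obtain h where h: "h \<in> H" "y = h \<oplus>\<^bsub>M\<^esub> x" by (auto simp: a_r_coset_def')
      then have "r \<odot>\<^bsub>M\<^esub> y = r \<odot>\<^bsub>M\<^esub> h \<oplus>\<^bsub>M\<^esub> r \<odot>\<^bsub>M\<^esub> x"
        using \<open>r \<in> _\<close> \<open>x \<in> _\<close> H.subset by (simp add: smult_r_distr subset_iff)
      then have "r \<odot>\<^bsub>M\<^esub> y \<in> H +>\<^bsub>M\<^esub> (r \<odot>\<^bsub>M\<^esub> x)"
        using H.smult_closed[OF \<open>r \<in> _\<close> h(1)] by (auto simp: a_r_coset_def')
      then show ?thesis using \<open>r \<in> _\<close> \<open>x \<in> _\<close>
        by (intro M.a_repr_independence[symmetric] H'.a_subgroup) simp_all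
    qed
    moreover have "x \<in> H +>\<^bsub>M\<^esub> x" using H'.a_rcos_self[OF that(2)] .
    ultimately have "(\<Union>y\<in>H +>\<^bsub>M\<^esub> x. H +>\<^bsub>M\<^esub> (r \<odot>\<^bsub>M\<^esub> y)) = (\<Union>y\<in>H +>\<^bsub>M\<^esub> x. H +>\<^bsub>M\<^esub> (r \<odot>\<^bsub>M\<^esub> x))"
      by (intro SUP_cong refl)
    also have "\<dots> = H +>\<^bsub>M\<^esub> (r \<odot>\<^bsub>M\<^esub> x)" using \<open>x \<in> H +>\<^bsub>M\<^esub> x\<close> by blast
    finally show ?thesis by (simp add: lmod_quot_def)
  qed
  have car: "carrier (M LQuot H) = (\<lambda>x. H +>\<^bsub>M\<^esub> x) ` carrier M"
    by (auto simp: lmod_quot_def A_RCOSETS_def')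
  have pl: "(H +>\<^bsub>M\<^esub> x) \<oplus>\<^bsub>M LQuot H\<^esub> (H +>\<^bsub>M\<^esub> y) = H +>\<^bsub>M\<^esub> (x \<oplus>\<^bsub>M\<^esub> y)"
    if "x \<in> carrier M" "y \<in> carrier M" for x y
    using H'.a_rcos_sum that by (simp add: lmod_quot_def)
  have ze: "\<zero>\<^bsub>M LQuot H\<^esub> = H +>\<^bsub>M\<^esub> \<zero>\<^bsub>M\<^esub>"
    using M.a_coset_add_zero[OF H'.a_subset] by (simp add: lmod_quot_def)
  have grp: "abelian_group (M LQuot H)"
  proof (rule abelian_groupI)
    fix X assume "X \<in> carrier (M LQuot H)"
    then obtain x where x: "X = H +>\<^bsub>M\<^esub> x" "x \<in> carrier M" by (auto simp: car)
    then have "(H +>\<^bsub>M\<^esub> \<ominus>\<^bsub>M\<^esub> x) \<oplus>\<^bsub>M LQuot H\<^esub> X = \<zero>\<^bsub>M LQuot H\<^esub>"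
      by (simp add: pl ze M.l_neg)
    then show "\<exists>Y\<in>carrier (M LQuot H). Y \<oplus>\<^bsub>M LQuot H\<^esub> X = \<zero>\<^bsub>M LQuot H\<^esub>"
      using x by (intro bexI[of _ "H +>\<^bsub>M\<^esub> \<ominus>\<^bsub>M\<^esub> x"]) (auto simp: car)
  qed (auto simp: car ze pl M.a_ac intro!: imageI)
  show ?thesis
    by (intro left_module.intro left_module_axioms.intro R.ring_axioms grp)
       (auto simp: car sm pl smult_l_distr smult_r_distr smult_assoc intro!: imageI)
qed

lemma left_module_regular: "ring R \<Longrightarrow> left_module R (regular_lmod R)"
proof -
  assume "ring R"
  then interpret ring R .
  have "abelian_group (regular_lmod R)"
  proof (rule abelian_groupI)
    fix x assume "x \<in> carrier (regular_lmod R)"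
    then show "\<exists>y\<in>carrier (regular_lmod R). y \<oplus>\<^bsub>regular_lmod R\<^esub> x = \<zero>\<^bsub>regular_lmod R\<^esub>"
      by (intro bexI[of _ "\<ominus>\<^bsub>R\<^esub> x"]) (auto simp: regular_lmod_def l_neg)
  qed (auto simp: regular_lmod_def a_ac)
  then show ?thesis
    by (intro left_module.intro left_module_axioms.intro ring_axioms)
       (auto simp: regular_lmod_def l_distr r_distr m_assoc)
qed

lemma Atilde_simps [simp]:
  "carrier Atilde = UNIV" "x \<otimes>\<^bsub>Atilde\<^esub> y = ab_mult x y" "x \<oplus>\<^bsub>Atilde\<^esub> y = x + y"
  "\<one>\<^bsub>Atilde\<^esub> = 1" "\<zero>\<^bsub>Atilde\<^esub> = 0"
  by (simp_all add: Atilde_def)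

text \<open>
  The module \<open>\<Oplus>\<mu>\<in>\<Lambda>. \<Oplus>j\<le>N. \<complex>[[s]] s^(\<mu>-1) (log s)^j\<close>: \<open>\<phi> \<mu> j\<close> is the power series in front of
  \<open>s^(\<mu>-1) (log s)^j\<close>. With \<open>c = \<mu> + m\<close>, the primitive without constant of \<open>s^(c-1) (log s)^j\<close> is
  \<open>\<Sum>i\<le>j. (-1)^(j-i) (j!/i!) c^-(j-i+1) s^c (log s)^i\<close>, which gives \<open>log_prim\<close>
  (see \<open>log_theta_prim\<close> below, where \<open>log_theta\<close> is \<open>s d/ds\<close>). Since \<open>b\<close> raises the order in \<open>s\<close>,
  only the terms \<open>\<nu> \<le> n\<close> of \<open>\<Sum>\<nu>. P\<^sub>\<nu>(a) b^\<nu>\<close> contribute to the coefficient of index \<open>n\<close> in \<open>log_act\<close>.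
\<close>

definition log_prim :: "complex \<Rightarrow> nat \<Rightarrow> (nat \<Rightarrow> complex fps) \<Rightarrow> nat \<Rightarrow> complex fps" where
  "log_prim \<mu> N \<phi> i = Abs_fps (\<lambda>n. case n of 0 \<Rightarrow> 0 | Suc m \<Rightarrow>
     \<Sum>j=i..N. (- 1) ^ (j - i) * (fact j / fact i) / (\<mu> + of_nat m) ^ (j - i + 1) * \<phi> j $ m)"

definition log_act :: "complex \<Rightarrow> nat \<Rightarrow> ab_series \<Rightarrow> (nat \<Rightarrow> complex fps) \<Rightarrow> nat \<Rightarrow> complex fps" where
  "log_act \<mu> N u \<phi> j = Abs_fps (\<lambda>n. \<Sum>\<nu>\<le>n. (fps_of_poly (u $ \<nu>) * (log_prim \<mu> N ^^ \<nu>) \<phi> j) $ n)"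

definition log_module :: "rat set \<Rightarrow> nat \<Rightarrow> (ab_series, rat \<Rightarrow> nat \<Rightarrow> complex fps) module" where
  "log_module \<Lambda> N = \<lparr>carrier = {\<phi>. \<forall>\<mu> j. \<phi> \<mu> j \<noteq> 0 \<longrightarrow> \<mu> \<in> \<Lambda> \<and> j \<le> N},
     mult = undefined, one = undefined, zero = (\<lambda>\<mu> j. 0), add = (\<lambda>\<phi> \<psi> \<mu> j. \<phi> \<mu> j + \<psi> \<mu> j),
     smult = (\<lambda>u \<phi> \<mu>. log_act (of_rat \<mu>) N u (\<phi> \<mu>))\<rparr>"

definition log_theta :: "complex \<Rightarrow> (nat \<Rightarrow> complex fps) \<Rightarrow> nat \<Rightarrow> complex fps" where
  "log_theta \<mu> \<psi> i = Abs_fps (\<lambda>n. (\<mu> - 1 + of_nat n) * \<psi> i $ n + of_nat (Suc i) * \<psi> (Suc i) $ n)"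

lemma log_theta_prim:
  assumes "\<And>n. \<mu> + of_nat n \<noteq> 0" "i \<le> N"
  shows "log_theta \<mu> (log_prim \<mu> N \<phi>) i = fps_X * \<phi> i"
proof (rule fps_ext)
  fix n
  show "log_theta \<mu> (log_prim \<mu> N \<phi>) i $ n = (fps_X * \<phi> i) $ n"
  proof (cases n)
    case 0 then show ?thesis by (simp add: log_theta_def log_prim_def)
  next
    case (Suc m)
    define c where "c = \<mu> + of_nat m"
    have c: "c \<noteq> 0" using assms by (simp add: c_def)
    let ?t = "\<lambda>i j. (- 1) ^ (j - i) * (fact j / fact i) / c ^ (j - i + 1) * \<phi> j $ m"
    have 1: "c * ?t i j + of_nat (Suc i) * ?t (Suc i) j = 0" if "j \<in> {Suc i..N}" for j
    proof -
      from that have "Suc i \<le> j" by simp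
      then obtain d where d: "j = Suc i + d" using le_Suc_ex by blast
      have "c * ((- 1) ^ Suc d * (f / g) / c ^ (Suc d + 1) * x) + s * ((- 1) ^ d * (f / (s * g)) / c ^ (d + 1) * x) = 0"
        if "s \<noteq> 0" "g \<noteq> 0" for f g s x :: complex
        using that c by (simp add: field_simps)
      from this[of "of_nat (Suc i)" "fact i" "fact j" "\<phi> j $ m"] show ?thesis
        by (simp add: d del: of_nat_Suc power_Suc)
    qed
    have "log_theta \<mu> (log_prim \<mu> N \<phi>) i $ n = c * (\<Sum>j=i..N. ?t i j) + of_nat (Suc i) * (\<Sum>j=Suc i..N. ?t (Suc i) j)"
      by (simp add: log_theta_def log_prim_def Suc c_def)
    also have "(\<Sum>j=i..N. ?t i j) = ?t i i + (\<Sum>j=Suc i..N. ?t i j)"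
      using assms(2) by (rule sum.atLeast_Suc_atMost)
    also have "c * (?t i i + (\<Sum>j=Suc i..N. ?t i j)) + of_nat (Suc i) * (\<Sum>j=Suc i..N. ?t (Suc i) j) =
       c * ?t i i + (\<Sum>j=Suc i..N. c * ?t i j + of_nat (Suc i) * ?t (Suc i) j)"
      by (simp only: sum.distrib sum_distrib_left ring_distribs add.assoc)
    also have "\<dots> = \<phi> i $ m" using c by (subst sum.neutral[OF ballI[OF 1]]) auto
    finally show ?thesis by (simp add: Suc)
  qed
qed

lemma log_theta_inj:
  assumes \<mu>: "\<And>n. \<mu> + of_nat n \<noteq> 0"
    and "\<And>i. i \<le> N \<Longrightarrow> log_theta \<mu> \<psi> i = log_theta \<mu> \<psi>' i"
    and "\<And>i. N < i \<Longrightarrow> \<psi> i = \<psi>' i" and "\<And>i. \<psi> i $ 0 = \<psi>' i $ 0"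
  shows "\<psi> = \<psi>'"
proof
  fix i
  have "\<psi> (Suc N - d) = \<psi>' (Suc N - d)" for d
  proof (induction d)
    case 0 then show ?case using assms(3) by simp
  next
    case (Suc d)
    show ?case
    proof (cases "d \<le> N")
      case False then show ?thesis using Suc by simp
    next
      case True
      let ?i = "Suc N - Suc d"
      have s: "Suc ?i = Suc N - d" using True by simp
      show ?thesis
      proof (rule fps_ext)
        fix n
        have "(\<mu> - 1 + of_nat n) * \<psi> ?i $ n = (\<mu> - 1 + of_nat n) * \<psi>' ?i $ n"
          using assms(2)[of ?i] Suc True unfolding log_theta_def fps_eq_iff s
          by (auto dest!: spec[of _ n])
        then show "\<psi> ?i $ n = \<psi>' ?i $ n"
        proof (cases n)
          case 0 then show ?thesis using assms(4) by simp
        next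
          case (Suc m)
          have "\<mu> - 1 + of_nat n = \<mu> + of_nat m" by (simp add: Suc)
          then show ?thesis
            using \<open>(\<mu> - 1 + of_nat n) * _ = _\<close> \<mu>[of m] by (metis mult_cancel_left)
        qed
      qed
    qed
  qed
  from this[of "Suc N - i"] show "\<psi> i = \<psi>' i" using assms(3)[of i] by (cases "i \<le> Suc N") auto
qed

lemma log_prim_0 [simp]: "log_prim \<mu> N \<phi> i $ 0 = 0"
  and log_prim_big: "N < i \<Longrightarrow> log_prim \<mu> N \<phi> i = 0"
  by (auto simp: log_prim_def fps_eq_iff split: nat.splits)

lemma log_prim_add: "log_prim \<mu> N (\<lambda>j. \<phi> j + \<psi> j) = (\<lambda>j. log_prim \<mu> N \<phi> j + log_prim \<mu> N \<psi> j)"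
  by (auto simp: log_prim_def fps_eq_iff fun_eq_iff algebra_simps sum.distrib add_divide_distrib split: nat.splits)

lemma log_prim_cmult: "log_prim \<mu> N (\<lambda>j. fps_const c * \<phi> j) = (\<lambda>j. fps_const c * log_prim \<mu> N \<phi> j)"
  by (auto simp: log_prim_def fps_eq_iff fun_eq_iff algebra_simps sum_distrib_left split: nat.splits)

lemma log_prim_pow_add: "(log_prim \<mu> N ^^ k) (\<lambda>j. \<phi> j + \<psi> j) = (\<lambda>j. (log_prim \<mu> N ^^ k) \<phi> j + (log_prim \<mu> N ^^ k) \<psi> j)"
  by (induction k) (simp_all add: log_prim_add)

lemma log_prim_pow_cmult: "(log_prim \<mu> N ^^ k) (\<lambda>j. fps_const c * \<phi> j) = (\<lambda>j. fps_const c * (log_prim \<mu> N ^^ k) \<phi> j)"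
  by (induction k) (simp_all add: log_prim_cmult)

lemma log_prim_comm:
  assumes \<mu>: "\<And>n. \<mu> + of_nat n \<noteq> 0" and big: "\<And>i. N < i \<Longrightarrow> \<phi> i = 0"
  shows "log_prim \<mu> N (\<lambda>j. fps_X * \<phi> j) =
    (\<lambda>j. fps_X * log_prim \<mu> N \<phi> j - log_prim \<mu> N (log_prim \<mu> N \<phi>) j)"
proof (rule log_theta_inj[OF \<mu>, of N])
  fix i assume i: "i \<le> N"
  let ?b = "log_prim \<mu> N"
  have tX: "log_theta \<mu> (\<lambda>j. fps_X * \<psi> j) i = fps_X * log_theta \<mu> \<psi> i + fps_X * \<psi> i" for \<psi>
    by (rule fps_ext, case_tac n) (auto simp: log_theta_def algebra_simps)
  have tm: "log_theta \<mu> (\<lambda>j. \<psi> j - \<psi>' j) i = log_theta \<mu> \<psi> i - log_theta \<mu> \<psi>' i" for \<psi> \<psi>'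
    by (rule fps_ext) (auto simp: log_theta_def algebra_simps)
  show "log_theta \<mu> (?b (\<lambda>j. fps_X * \<phi> j)) i = log_theta \<mu> (\<lambda>j. fps_X * ?b \<phi> j - ?b (?b \<phi>) j) i"
    by (simp add: tm tX log_theta_prim[OF \<mu> i])
qed (simp_all add: log_prim_big)

lemma log_prim_pow_big: "(\<And>i. N < i \<Longrightarrow> \<phi> i = 0) \<Longrightarrow> N < i \<Longrightarrow> (log_prim \<mu> N ^^ k) \<phi> i = 0"
  by (cases k) (simp_all add: log_prim_big)

lemma log_prim_pow_comm:
  assumes \<mu>: "\<And>n. \<mu> + of_nat n \<noteq> 0" and big: "\<And>i. N < i \<Longrightarrow> \<phi> i = 0"
  shows "(log_prim \<mu> N ^^ k) (\<lambda>j. fps_X * \<phi> j) =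
    (\<lambda>j. fps_X * (log_prim \<mu> N ^^ k) \<phi> j + fps_const (- of_nat k) * (log_prim \<mu> N ^^ Suc k) \<phi> j)"
proof (induction k)
  case (Suc k)
  let ?b = "log_prim \<mu> N"
  have "(?b ^^ Suc k) (\<lambda>j. fps_X * \<phi> j) =
     ?b (\<lambda>j. fps_X * (?b ^^ k) \<phi> j + fps_const (- of_nat k) * (?b ^^ Suc k) \<phi> j)"
    by (simp only: funpow.simps o_apply Suc)
  also have "\<dots> = (\<lambda>j. ?b (\<lambda>j. fps_X * (?b ^^ k) \<phi> j) j + fps_const (- of_nat k) * ?b ((?b ^^ Suc k) \<phi>) j)"
    by (simp only: log_prim_add log_prim_cmult)
  also have "?b (\<lambda>j. fps_X * (?b ^^ k) \<phi> j) = (\<lambda>j. fps_X * ?b ((?b ^^ k) \<phi>) j - ?b (?b ((?b ^^ k) \<phi>)) j)"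
    by (rule log_prim_comm[OF \<mu>]) (rule log_prim_pow_big[OF big])
  finally have 1: "(?b ^^ Suc k) (\<lambda>j. fps_X * \<phi> j) = (\<lambda>j. fps_X * (?b ^^ Suc k) \<phi> j - (?b ^^ Suc (Suc k)) \<phi> j
      + fps_const (- of_nat k) * (?b ^^ Suc (Suc k)) \<phi> j)"
    by simp
  have 2: "fps_const (- of_nat (Suc k)) = fps_const (- of_nat k) - (1 :: complex fps)"
    by (rule fps_ext) simp
  then show ?case unfolding 1 2 by (simp add: algebra_simps del: funpow.simps)
qed simp

definition ord_ge :: "nat \<Rightarrow> (nat \<Rightarrow> complex fps) \<Rightarrow> bool" where
  "ord_ge r \<psi> \<longleftrightarrow> (\<forall>j. \<forall>i<r. \<psi> j $ i = 0)"

lemma ord_ge_prim: "ord_ge r \<psi> \<Longrightarrow> ord_ge (Suc r) (log_prim \<mu> N \<psi>)"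
  by (auto simp: ord_ge_def log_prim_def split: nat.splits intro!: sum.neutral)

lemma ord_ge_prim_pow: "ord_ge r \<psi> \<Longrightarrow> ord_ge (r + k) ((log_prim \<mu> N ^^ k) \<psi>)"
  by (induction k) (auto intro: ord_ge_prim)

lemma ord_ge_prim_pow': "n < k \<Longrightarrow> (log_prim \<mu> N ^^ k) \<psi> j $ n = 0"
  using ord_ge_prim_pow[of 0 \<psi> k] by (auto simp: ord_ge_def)

lemma fps_mult_low: "(\<And>i. i \<le> n \<Longrightarrow> g $ i = 0) \<Longrightarrow> (f * g :: complex fps) $ n = 0"
  by (auto simp: fps_mult_nth intro!: sum.neutral)

lemma log_act_nth:
  assumes "n \<le> K"
  shows "log_act \<mu> N u \<phi> j $ n = (\<Sum>\<nu>\<le>K. (fps_of_poly (u $ \<nu>) * (log_prim \<mu> N ^^ \<nu>) \<phi> j) $ n)"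
  unfolding log_act_def fps_nth_Abs_fps
  by (rule sum.mono_neutral_left) (use assms in \<open>auto intro!: fps_mult_low ord_ge_prim_pow'\<close>)

lemma log_act_add_left: "log_act \<mu> N (u + v) \<phi> = (\<lambda>j. log_act \<mu> N u \<phi> j + log_act \<mu> N v \<phi> j)"
  by (auto simp: fun_eq_iff fps_eq_iff log_act_def sum.distrib fps_of_poly_add ring_distribs)

lemma log_act_add_right: "log_act \<mu> N u (\<lambda>j. \<phi> j + \<psi> j) = (\<lambda>j. log_act \<mu> N u \<phi> j + log_act \<mu> N u \<psi> j)"
  by (auto simp: fun_eq_iff fps_eq_iff log_act_def sum.distrib ring_distribs log_prim_pow_add)

lemma log_act_const: "log_act \<mu> N (fps_const P) \<phi> = (\<lambda>j. fps_of_poly P * \<phi> j)"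
proof (intro ext fps_ext)
  fix j n
  have "log_act \<mu> N (fps_const P) \<phi> j $ n = (\<Sum>\<nu>\<in>{0}. (fps_of_poly (fps_const P $ \<nu>) * (log_prim \<mu> N ^^ \<nu>) \<phi> j) $ n)"
    unfolding log_act_def fps_nth_Abs_fps by (rule sum.mono_neutral_right) auto
  then show "log_act \<mu> N (fps_const P) \<phi> j $ n = (fps_of_poly P * \<phi> j) $ n" by simp
qed

lemma log_act_b: "log_act \<mu> N fps_X \<phi> = log_prim \<mu> N \<phi>"
proof (intro ext fps_ext)
  fix j n
  have "log_act \<mu> N fps_X \<phi> j $ n = (\<Sum>\<nu>\<in>{1}. (fps_of_poly (fps_X $ \<nu>) * (log_prim \<mu> N ^^ \<nu>) \<phi> j) $ n)"
    unfolding log_act_nth[OF le_SucI[OF order.refl]]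
    by (rule sum.mono_neutral_right) auto
  then show "log_act \<mu> N fps_X \<phi> j $ n = log_prim \<mu> N \<phi> j $ n" by simp
qed

lemma log_act_big: "(\<And>i. N < i \<Longrightarrow> \<phi> i = 0) \<Longrightarrow> N < i \<Longrightarrow> log_act \<mu> N u \<phi> i = 0"
  by (auto simp: log_act_def fps_eq_iff log_prim_pow_big)

lemma log_act_ord: "ord_ge r \<psi> \<Longrightarrow> ord_ge r (log_act \<mu> N u \<psi>)"
proof -
  assume "ord_ge r \<psi>"
  then have "(log_prim \<mu> N ^^ k) \<psi> j $ i = 0" if "i < r" for i j k
    using ord_ge_prim_pow[of r \<psi> k \<mu> N] that by (auto simp: ord_ge_def)
  then show ?thesis
    by (auto simp: ord_ge_def log_act_def intro!: sum.neutral fps_mult_low)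
qed

lemma log_act_ord': "(\<And>i. i < r \<Longrightarrow> u $ i = 0) \<Longrightarrow> ord_ge r (log_act \<mu> N u \<psi>)"
  by (auto simp: ord_ge_def log_act_def intro!: sum.neutral)

lemma ab_mult_X_right: "ab_mult f fps_X = f * fps_X"
proof -
  have X: "fps_X = Abs_fps (\<lambda>n. [: if n = 1 then 1 else 0 :: complex :])"
    by (rule fps_ext) (auto simp: one_pCons)
  show ?thesis by (subst (1 2) X) (rule ab_mult_b_right)
qed

lemma ab_mult_a_right_nth: "ab_mult f (fps_const [:0,1:]) $ n = [:0,1:] * f $ n - (if n = 0 then 0 else of_nat (n - 1) * f $ (n - 1))"
proof -
  have "ab_mult f (fps_const [:0,1:]) $ n = (\<Sum>m\<le>n. (\<Sum>k\<in>{0}. [: (- of_nat m) gchoose (n - m - k) :] * (f $ m * (pderiv ^^ (n - m - k)) (fps_const [:0,1:] $ k))))"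
    unfolding ab_mult_def fps_nth_Abs_fps
    by (intro sum.cong refl sum.mono_neutral_right) auto
  also have "\<dots> = (\<Sum>m\<le>n. [: (- of_nat m) gchoose (n - m) :] * (f $ m * (pderiv ^^ (n - m)) [:0,1:]))"
    by simp
  also have "\<dots> = (\<Sum>m\<in>{n, n - 1}. [: (- of_nat m) gchoose (n - m) :] * (f $ m * (pderiv ^^ (n - m)) [:0,1:]))"
  proof (rule sum.mono_neutral_right)
    show "\<forall>m\<in>{..n} - {n, n - 1}. [: (- of_nat m) gchoose (n - m) :] * (f $ m * (pderiv ^^ (n - m)) [:0,1::complex:]) = 0"
    proof
      fix m assume "m \<in> {..n} - {n, n - 1}"
      then have "n - m = Suc (Suc (n - m - 2))" by auto
      moreover have "(pderiv ^^ Suc (Suc k)) [:0,1::complex:] = 0" for k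
        by (simp del: funpow.simps add: funpow_Suc_right pderiv_pCons)
      ultimately have "(pderiv ^^ (n - m)) [:0,1::complex:] = 0" by metis
      then show "[: (- of_nat m) gchoose (n - m) :] * (f $ m * (pderiv ^^ (n - m)) [:0,1::complex:]) = 0" by simp
    qed
  qed auto
  also have "\<dots> = [:0,1:] * f $ n - (if n = 0 then 0 else of_nat (n - 1) * f $ (n - 1))"
    by (cases n) (auto simp: pderiv_pCons of_nat_poly)
  finally show ?thesis .
qed

lemma log_act_mult:
  assumes \<mu>: "\<And>n. \<mu> + of_nat n \<noteq> 0" and big: "\<And>i. N < i \<Longrightarrow> \<phi> i = 0"
  shows "log_act \<mu> N (ab_mult u v) \<phi> = log_act \<mu> N u (log_act \<mu> N v \<phi>)"
proof -
  let ?A = "log_act \<mu> N" let ?b = "log_prim \<mu> N"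
  define V where "V = {v. \<forall>u \<phi>. (\<forall>i>N. \<phi> i = 0) \<longrightarrow> ?A (ab_mult u v) \<phi> = ?A u (?A v \<phi>)}"
  have Vadd: "v + w \<in> V" if "v \<in> V" "w \<in> V" for v w
    using that by (auto simp: V_def ab_mult_add_right log_act_add_left log_act_add_right)
  have Vmult: "ab_mult v w \<in> V" if "v \<in> V" "w \<in> V" for v w
  proof -
    have "?A (ab_mult u (ab_mult v w)) \<phi> = ?A u (?A (ab_mult v w) \<phi>)" if z: "\<forall>i>N. \<phi> i = 0" for u \<phi>
    proof -
      have z': "\<forall>i>N. ?A w \<phi> i = 0" using z by (auto intro!: log_act_big)
      have "?A (ab_mult u (ab_mult v w)) \<phi> = ?A (ab_mult (ab_mult u v) w) \<phi>" by (simp add: ab_mult_assoc)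
      also have "\<dots> = ?A (ab_mult u v) (?A w \<phi>)" using \<open>w \<in> V\<close> z by (auto simp: V_def)
      also have "\<dots> = ?A u (?A v (?A w \<phi>))" using \<open>v \<in> V\<close> z' by (auto simp: V_def)
      also have "?A v (?A w \<phi>) = ?A (ab_mult v w) \<phi>" using \<open>w \<in> V\<close> z by (auto simp: V_def)
      finally show ?thesis .
    qed
    then show ?thesis by (auto simp: V_def)
  qed
  have Vconst: "fps_const [:c:] \<in> V" for c
  proof -
    have "ab_mult u (fps_const [:c:]) = u * fps_const [:c:]" for u
    proof -
      have "fps_const [:c:] = Abs_fps (\<lambda>n. [: if n = 0 then c else 0 :])" by (rule fps_ext) auto
      then show ?thesis using ab_mult_b_right[of u "\<lambda>n. if n = 0 then c else 0"] by simp
    qed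
    moreover have "?A (u * fps_const [:c:]) \<phi> = ?A u (\<lambda>j. fps_const c * \<phi> j)" for u \<phi>
    proof (intro ext fps_ext)
      fix j n
      have "?A u (\<lambda>j. fps_const c * \<phi> j) j $ n = (\<Sum>\<nu>\<le>n. (fps_of_poly (u $ \<nu>) * (fps_const c * (?b ^^ \<nu>) \<phi> j)) $ n)"
        by (simp only: log_act_def log_prim_pow_cmult fps_nth_Abs_fps)
      then show "?A (u * fps_const [:c:]) \<phi> j $ n = ?A u (\<lambda>j. fps_const c * \<phi> j) j $ n"
        by (simp add: log_act_def fps_of_poly_smult mult.assoc mult.left_commute)
    qed
    ultimately show ?thesis by (simp add: V_def log_act_const fps_of_poly_const)
  qed
  have Vb: "fps_X \<in> V"
  proof -
    have "?A (u * fps_X) \<phi> = ?A u (?b \<phi>)" for u \<phi>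
    proof (intro ext fps_ext)
      fix j n
      have "?A (u * fps_X) \<phi> j $ n = (\<Sum>\<nu>\<le>Suc n. (fps_of_poly ((u * fps_X) $ \<nu>) * (?b ^^ \<nu>) \<phi> j) $ n)"
        by (rule log_act_nth) simp
      also have "\<dots> = (\<Sum>\<nu>\<le>n. (fps_of_poly (u $ \<nu>) * (?b ^^ Suc \<nu>) \<phi> j) $ n)"
        by (subst sum.atMost_Suc_shift) simp
      also have "\<dots> = ?A u (?b \<phi>) j $ n"
        by (simp add: log_act_def funpow_Suc_right del: funpow.simps)
      finally show "?A (u * fps_X) \<phi> j $ n = ?A u (?b \<phi>) j $ n" .
    qed
    then show ?thesis by (auto simp: V_def log_act_b ab_mult_X_right)
  qed
  have Va: "fps_const [:0,1:] \<in> V"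
  proof -
    have "?A (ab_mult u (fps_const [:0,1:])) \<phi> = ?A u (\<lambda>j. fps_X * \<phi> j)" if z: "\<forall>i>N. \<phi> i = 0" for u \<phi>
    proof (intro ext fps_ext)
      fix j n
      let ?f = "\<lambda>\<nu>. fps_of_poly (u $ \<nu>)"
      have c: "(?b ^^ \<nu>) (\<lambda>j. fps_X * \<phi> j) = (\<lambda>j. fps_X * (?b ^^ \<nu>) \<phi> j + fps_const (- of_nat \<nu>) * (?b ^^ Suc \<nu>) \<phi> j)" for \<nu>
        by (rule log_prim_pow_comm[OF \<mu>]) (use z in auto)
      have "?A (ab_mult u (fps_const [:0,1:])) \<phi> j $ n =
         (\<Sum>\<nu>\<le>Suc n. (fps_of_poly ([:0,1:] * u $ \<nu> - (if \<nu> = 0 then 0 else of_nat (\<nu> - 1) * u $ (\<nu> - 1))) * (?b ^^ \<nu>) \<phi> j) $ n)"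
        by (subst log_act_nth[OF le_SucI[OF order.refl]]) (simp only: ab_mult_a_right_nth)
      also have "\<dots> = (\<Sum>\<nu>\<le>Suc n. (fps_X * ?f \<nu> * (?b ^^ \<nu>) \<phi> j) $ n)
          - (\<Sum>\<nu>\<le>Suc n. (fps_of_poly (if \<nu> = 0 then 0 else of_nat (\<nu> - 1) * u $ (\<nu> - 1)) * (?b ^^ \<nu>) \<phi> j) $ n)"
        by (simp only: fps_of_poly_diff fps_of_poly_mult fps_of_poly_fps_X left_diff_distrib fps_sub_nth sum_subtractf)
      also have "(\<Sum>\<nu>\<le>Suc n. (fps_of_poly (if \<nu> = 0 then 0 else of_nat (\<nu> - 1) * u $ (\<nu> - 1)) * (?b ^^ \<nu>) \<phi> j) $ n)
         = (\<Sum>\<nu>\<le>n. (fps_const (of_nat \<nu>) * ?f \<nu> * (?b ^^ Suc \<nu>) \<phi> j) $ n)"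
        by (subst sum.atMost_Suc_shift) (simp add: of_nat_poly fps_of_poly_smult)
      also have "(\<Sum>\<nu>\<le>Suc n. (fps_X * ?f \<nu> * (?b ^^ \<nu>) \<phi> j) $ n) = (\<Sum>\<nu>\<le>n. (fps_X * ?f \<nu> * (?b ^^ \<nu>) \<phi> j) $ n)"
        by (rule sum.mono_neutral_right) (auto intro!: fps_mult_low ord_ge_prim_pow' simp: not_le simp del: funpow.simps)
      also have "(\<Sum>\<nu>\<le>n. (fps_X * ?f \<nu> * (?b ^^ \<nu>) \<phi> j) $ n) - (\<Sum>\<nu>\<le>n. (fps_const (of_nat \<nu>) * ?f \<nu> * (?b ^^ Suc \<nu>) \<phi> j) $ n)
         = (\<Sum>\<nu>\<le>n. (?f \<nu> * (fps_X * (?b ^^ \<nu>) \<phi> j + fps_const (- of_nat \<nu>) * (?b ^^ Suc \<nu>) \<phi> j)) $ n)"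
      proof -
        have "F * (fps_X * G + fps_const (- of_nat k) * H) = fps_X * F * G - fps_const (of_nat k) * F * H"
          for F G H :: "complex fps" and k
        proof -
          have "fps_const (- of_nat k) = - (fps_const (of_nat k) :: complex fps)" by simp
          then show ?thesis by (simp only: ring_distribs mult_ac mult_minus_left mult_minus_right diff_conv_add_uminus)
        qed
        then show ?thesis by (simp only: sum_subtractf[symmetric] fps_sub_nth)
      qed
      also have "\<dots> = ?A u (\<lambda>j. fps_X * \<phi> j) j $ n"
        by (simp only: log_act_def fps_nth_Abs_fps c)
      finally show "?A (ab_mult u (fps_const [:0,1:])) \<phi> j $ n = ?A u (\<lambda>j. fps_X * \<phi> j) j $ n" .
    qed
    then show ?thesis by (auto simp: V_def log_act_const fps_of_poly_fps_X)
  qed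
  have Vpoly: "fps_const P \<in> V" for P
  proof (induction P)
    case (pCons c P)
    have "fps_const (pCons c P) = fps_const [:c:] + ab_mult (fps_const [:0,1:]) (fps_const P)"
      by (auto simp: ab_mult_const_left)
    then show ?case using Vadd[OF Vconst Vmult[OF Va pCons.IH]] by simp
  qed (use Vconst[of 0] in simp)
  have Vpow: "fps_X ^ m \<in> V" for m
  proof (induction m)
    case 0 then show ?case using Vpoly[of 1] by simp
  next
    case (Suc m)
    then show ?case using Vmult[OF Suc Vb] by (simp add: ab_mult_X_right mult.commute)
  qed
  have Vmon: "fps_const P * fps_X ^ m \<in> V" for P m
    using Vmult[OF Vpoly Vpow, of P m] by (simp add: ab_mult_const_left)
  have Vsum: "sum f A \<in> V" if "\<And>x. x \<in> A \<Longrightarrow> f x \<in> V" for f :: "nat \<Rightarrow> ab_series" and A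
    using that Vconst[of 0] by (induction A rule: infinite_finite_induct) (auto intro!: Vadd)
  show ?thesis
  proof (intro ext fps_ext)
    fix j n
    define w where "w = (\<Sum>m\<le>n. fps_const (v $ m) * fps_X ^ m)"
    define z where "z = v - w"
    have w: "w \<in> V" unfolding w_def by (rule Vsum) (rule Vmon)
    have wn: "w $ i = v $ i" if "i \<le> n" for i
    proof -
      have "w $ i = (\<Sum>m\<le>n. if i = m then v $ m else 0)"
        by (simp add: w_def fps_sum_nth fps_X_power_nth if_distrib cong: if_cong)
      then show ?thesis using that by simp
    qed
    have z: "z $ i = 0" if "i < Suc n" for i using wn[of i] that by (simp add: z_def)
    have v: "v = w + z" by (simp add: z_def)
    have "ab_mult u z $ i = 0" if "i < Suc n" for i
      using z that by (auto simp: ab_mult_def intro!: sum.neutral)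
    then have 1: "?A (ab_mult u z) \<phi> j $ n = 0"
      using log_act_ord'[of "Suc n" "ab_mult u z" \<mu> N \<phi>] by (auto simp: ord_ge_def)
    have 2: "?A u (?A z \<phi>) j $ n = 0"
      using log_act_ord[OF log_act_ord'[of "Suc n" z \<mu> N \<phi>, OF z], of \<mu> N u] by (auto simp: ord_ge_def)
    have 3: "?A (ab_mult u w) \<phi> = ?A u (?A w \<phi>)" using w big by (auto simp: V_def)
    show "?A (ab_mult u v) \<phi> j $ n = ?A u (?A v \<phi>) j $ n"
      unfolding v ab_mult_add_right log_act_add_left log_act_add_right by (simp add: 1 2 3)
  qed
qed

lemma left_module_log_module:
  assumes "\<Lambda> \<subseteq> {0<..}"
  shows "left_module Atilde (log_module \<Lambda> N)"
proof -
  have nz: "of_rat \<mu> + of_nat n \<noteq> (0 :: complex)" if "\<mu> \<in> \<Lambda>" for \<mu> n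
  proof -
    have "\<mu> + of_nat n > 0" using that assms by (auto intro: add_pos_nonneg)
    then have "of_rat (\<mu> + of_nat n) \<noteq> (0 :: complex)" by (simp only: of_rat_eq_0_iff)
    then show ?thesis by (simp add: of_rat_add)
  qed
  have z0: "log_act \<mu> M u (\<lambda>j. 0) = (\<lambda>j. 0)" for \<mu> M u
  proof -
    have "(log_prim \<mu> M ^^ k) (\<lambda>j. 0) = (\<lambda>j. 0)" for k
      by (induction k) (auto simp: log_prim_def fun_eq_iff fps_eq_iff split: nat.splits)
    then have "log_act \<mu> M u (\<lambda>j. 0) j $ n = 0" for j n by (simp only: log_act_def fps_nth_Abs_fps) simp
    then show ?thesis by (simp add: fun_eq_iff fps_eq_iff)
  qed
  have ag: "abelian_group (log_module \<Lambda> N)"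
  proof (rule abelian_groupI)
    fix x assume "x \<in> carrier (log_module \<Lambda> N)"
    then show "\<exists>y\<in>carrier (log_module \<Lambda> N). y \<oplus>\<^bsub>log_module \<Lambda> N\<^esub> x = \<zero>\<^bsub>log_module \<Lambda> N\<^esub>"
      by (intro bexI[of _ "\<lambda>\<mu> j. - x \<mu> j"]) (auto simp: log_module_def)
  next
    fix x y assume "x \<in> carrier (log_module \<Lambda> N)" "y \<in> carrier (log_module \<Lambda> N)"
    then have "\<mu> \<in> \<Lambda> \<and> j \<le> N" if "x \<mu> j + y \<mu> j \<noteq> 0" for \<mu> j
      using that by (cases "x \<mu> j = 0") (simp_all add: log_module_def)
    then show "x \<oplus>\<^bsub>log_module \<Lambda> N\<^esub> y \<in> carrier (log_module \<Lambda> N)"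
      by (simp add: log_module_def)
  qed (simp_all add: log_module_def add_ac)
  show ?thesis
  proof (intro left_module.intro left_module_axioms.intro Atilde_ring ag)
    fix u x assume x: "x \<in> carrier (log_module \<Lambda> N)"
    have 1: "x \<mu> = (\<lambda>j. 0)" if "\<mu> \<notin> \<Lambda>" for \<mu> using x that by (auto simp: log_module_def)
    have 2: "x \<mu> i = 0" if "N < i" for \<mu> i using x that by (force simp: log_module_def)
    show "u \<odot>\<^bsub>log_module \<Lambda> N\<^esub> x \<in> carrier (log_module \<Lambda> N)"
    proof -
      have "\<mu> \<in> \<Lambda> \<and> j \<le> N" if "log_act (of_rat \<mu>) N u (x \<mu>) j \<noteq> 0" for \<mu> j
        using that 1[of \<mu>] z0 log_act_big[of N "x \<mu>" j, OF 2] by (metis linorder_not_le)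
      then show ?thesis by (simp add: log_module_def)
    qed
    show "\<one>\<^bsub>Atilde\<^esub> \<odot>\<^bsub>log_module \<Lambda> N\<^esub> x = x"
      using log_act_const[of _ N 1] by (auto simp: log_module_def)
    fix v
    show "(u \<otimes>\<^bsub>Atilde\<^esub> v) \<odot>\<^bsub>log_module \<Lambda> N\<^esub> x = u \<odot>\<^bsub>log_module \<Lambda> N\<^esub> (v \<odot>\<^bsub>log_module \<Lambda> N\<^esub> x)"
    proof -
      have "log_act (of_rat \<mu>) N (ab_mult u v) (x \<mu>) = log_act (of_rat \<mu>) N u (log_act (of_rat \<mu>) N v (x \<mu>))" for \<mu>
      proof (cases "\<mu> \<in> \<Lambda>")
        case True then show ?thesis by (intro log_act_mult nz 2)
      qed (simp add: 1 z0)
      then show ?thesis by (simp add: log_module_def)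
    qed
  qed (auto simp: log_module_def log_act_add_left log_act_add_right)
qed

type_synonym 'm ab_mod = "(ab_series, 'm) module"

abbreviation ab_iso :: "'m ab_mod \<Rightarrow> 'n ab_mod \<Rightarrow> bool" (infix \<open>\<simeq>\<close> 50) where
  "M \<simeq> N \<equiv> lmod_iso Atilde M N"

text \<open>Free of rank \<open>k\<close> over \<open>\<complex>[[b]]\<close>.\<close>

definition ab_rank :: "'m ab_mod \<Rightarrow> nat \<Rightarrow> bool" where
  "ab_rank E k \<longleftrightarrow> (\<exists>e \<in> {..<k} \<rightarrow> carrier E. \<forall>x\<in>carrier E.
     \<exists>!S. S \<in> {..<k} \<rightarrow>\<^sub>E UNIV \<and> x = (\<Oplus>\<^bsub>E\<^esub>i\<in>{..<k}. ab_of_b (S i) \<odot>\<^bsub>E\<^esub> e i))"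

definition ab_module :: "'m ab_mod \<Rightarrow> bool" where
  "ab_module E \<longleftrightarrow> left_module Atilde E \<and> (\<exists>k. ab_rank E k)"

definition b_image :: "'m ab_mod \<Rightarrow> 'm set \<Rightarrow> 'm set" where
  "b_image E F = (\<lambda>x. ab_b \<odot>\<^bsub>E\<^esub> x) ` F"

definition simple_pole :: "'m ab_mod \<Rightarrow> bool" where
  "simple_pole E \<longleftrightarrow> ab_module E \<and> (\<lambda>x. ab_a \<odot>\<^bsub>E\<^esub> x) ` carrier E \<subseteq> b_image E (carrier E)"

text \<open>
  \<open>Q(T) = 0\<close> and the minimal polynomial, for a \<open>\<complex>\<close>-linear endomorphism \<open>T\<close> of \<open>V\<close>;
  a scalar \<open>c\<close> acts as the constant series \<open>c\<close>.
\<close>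

definition annihilates :: "'m ab_mod \<Rightarrow> ('m \<Rightarrow> 'm) \<Rightarrow> complex poly \<Rightarrow> bool" where
  "annihilates V T Q \<longleftrightarrow> (\<forall>x\<in>carrier V.
     (\<Oplus>\<^bsub>V\<^esub>i\<in>{..degree Q}. fps_const [:coeff Q i:] \<odot>\<^bsub>V\<^esub> (T ^^ i) x) = \<zero>\<^bsub>V\<^esub>)"

definition min_poly :: "'m ab_mod \<Rightarrow> ('m \<Rightarrow> 'm) \<Rightarrow> complex poly" where
  "min_poly V T = (THE P. lead_coeff P = 1 \<and> (\<forall>Q. annihilates V T Q \<longleftrightarrow> P dvd Q))"

text \<open>
  The endomorphism \<open>-b\<inverse>a\<close> of \<open>E/bE\<close>, on cosets. On a simple pole module \<open>b y = a x\<close> has exactly one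
  solution \<open>y\<close>, and all members \<open>x\<close> of one coset \<open>X\<close> give the same coset of \<open>-y\<close>.
\<close>

definition neg_binv_a :: "'m ab_mod \<Rightarrow> 'm set \<Rightarrow> 'm set" where
  "neg_binv_a E X = (\<Union>x\<in>X. \<Union>y\<in>{y \<in> carrier E. ab_b \<odot>\<^bsub>E\<^esub> y = ab_a \<odot>\<^bsub>E\<^esub> x}.
     b_image E (carrier E) +>\<^bsub>E\<^esub> (\<ominus>\<^bsub>E\<^esub> y))"

definition bernstein_sp :: "'m ab_mod \<Rightarrow> complex poly" where
  "bernstein_sp E = min_poly (E LQuot b_image E (carrier E)) (neg_binv_a E)"

definition is_embedding :: "'m ab_mod \<Rightarrow> 'n ab_mod \<Rightarrow> ('m \<Rightarrow> 'n) \<Rightarrow> bool" where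
  "is_embedding E S f \<longleftrightarrow> f \<in> lmod_hom Atilde E S \<and> inj_on f (carrier E)"

text \<open>
  Existential quantifiers over modules cannot range over types. Every (a,b)-module of rank \<open>n\<close> is
  isomorphic to one carried by a set of \<open>n\<close>-tuples of power series (lemma \<open>ab_module_coord\<close> below),
  so asking for modules on the type \<open>ab_coord\<close> is no restriction.
\<close>

type_synonym ab_coord = "nat \<Rightarrow> complex fps"

definition ab_regular :: "'m ab_mod \<Rightarrow> bool" where
  "ab_regular E \<longleftrightarrow> ab_module E \<and> (\<exists>(S :: ab_coord ab_mod) f. simple_pole S \<and> is_embedding E S f)"

text \<open>
  \<open>S\<close> is the closure of (the image of) \<open>E\<close> under \<open>b\<inverse>a\<close>: the only submodule of \<open>S\<close> that contains \<open>E\<close>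
  and is stable under \<open>b\<inverse>a\<close> is \<open>S\<close> itself. This determines \<open>S\<close> up to isomorphism, and \<open>bernstein\<close> picks
  one representative. For a simple pole module \<open>E\<close> the saturation is \<open>E\<close>.
\<close>

definition is_saturation :: "'m ab_mod \<Rightarrow> 'n ab_mod \<Rightarrow> bool" where
  "is_saturation E S \<longleftrightarrow> simple_pole S \<and> (\<exists>f. is_embedding E S f \<and>
     (\<forall>H. submodule H Atilde S \<and> f ` carrier E \<subseteq> H \<and>
        (\<forall>x\<in>H. \<forall>y\<in>carrier S. ab_b \<odot>\<^bsub>S\<^esub> y = ab_a \<odot>\<^bsub>S\<^esub> x \<longrightarrow> y \<in> H) \<longrightarrow> H = carrier S))"

definition bernstein :: "'m ab_mod \<Rightarrow> complex poly" where
  "bernstein E = bernstein_sp (SOME S :: ab_coord ab_mod. is_saturation E S)"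

definition ab_geometric :: "'m ab_mod \<Rightarrow> bool" where
  "ab_geometric E \<longleftrightarrow> ab_regular E \<and> (\<forall>z. poly (bernstein E) z = 0 \<longrightarrow> (\<exists>q::rat. q < 0 \<and> z = of_rat q))"

definition fresco :: "'m ab_mod \<Rightarrow> bool" where
  "fresco E \<longleftrightarrow> ab_geometric E \<and> (\<exists>e\<in>carrier E. cyc_sub Atilde E e = carrier E)"

definition ab_primitive :: "complex \<Rightarrow> 'm ab_mod \<Rightarrow> bool" where
  "ab_primitive lam E \<longleftrightarrow> ab_regular E \<and> (\<forall>z. poly (bernstein E) z = 0 \<longrightarrow> (\<exists>n::int. z = - lam + of_int n))"

definition ab_semi_simple :: "'m ab_mod \<Rightarrow> bool" where
  "ab_semi_simple E \<longleftrightarrow> ab_regular E \<and> (\<exists>n (M :: nat \<Rightarrow> ab_coord ab_mod) H.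
     (\<forall>i<n. ab_regular (M i) \<and> ab_rank (M i) 1) \<and>
     submodule H Atilde (lmod_dsum n M) \<and> E \<simeq> lmod_dsum n M \<downharpoonright> H)"

definition theme :: "'m ab_mod \<Rightarrow> bool" where
  "theme E \<longleftrightarrow> left_module Atilde E \<and> (\<exists>\<Lambda> N \<phi>. finite \<Lambda> \<and> \<Lambda> \<subseteq> {0<..1} \<and>
     \<phi> \<in> carrier (log_module \<Lambda> N) \<and> E \<simeq> log_module \<Lambda> N \<downharpoonright> cyc_sub Atilde (log_module \<Lambda> N) \<phi>)"

definition normal_sub :: "'m set \<Rightarrow> 'm ab_mod \<Rightarrow> bool" where
  "normal_sub F E \<longleftrightarrow> submodule F Atilde E \<and> F \<inter> b_image E (carrier E) = b_image E F"

definition ab_lin :: "complex \<Rightarrow> ab_series" where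
  "ab_lin \<mu> = ab_a \<ominus>\<^bsub>Atilde\<^esub> (fps_const [:\<mu>:] \<otimes>\<^bsub>Atilde\<^esub> ab_b)"

definition ab_cyclic :: "ab_series \<Rightarrow> ab_series set ab_mod" where
  "ab_cyclic P = regular_lmod Atilde LQuot cyc_sub Atilde (regular_lmod Atilde) P"

text \<open>Sequences \<open>F\<close> are indexed by \<open>{0..k}\<close>, the numbers \<open>l\<close> and \<open>p\<close> by \<open>{1..k}\<close> and \<open>{1..k-1}\<close>.\<close>

definition JH_seq :: "'m ab_mod \<Rightarrow> nat \<Rightarrow> (nat \<Rightarrow> 'm set) \<Rightarrow> (nat \<Rightarrow> complex) \<Rightarrow> bool" where
  "JH_seq E k F l \<longleftrightarrow> F 0 = {\<zero>\<^bsub>E\<^esub>} \<and> F k = carrier E \<and> (\<forall>j\<le>k. normal_sub (F j) E) \<and>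
     (\<forall>j\<in>{1..k}. F (j - 1) \<subseteq> F j \<and> (E \<downharpoonright> F j) LQuot F (j - 1) \<simeq> ab_cyclic (ab_lin (l j)))"

text \<open>"\<open>j \<mapsto> l j + j\<close> is non decreasing" is meaningful over \<open>\<complex>\<close> when the differences are real.\<close>

definition principal_JH :: "'m ab_mod \<Rightarrow> nat \<Rightarrow> (nat \<Rightarrow> 'm set) \<Rightarrow> (nat \<Rightarrow> complex) \<Rightarrow> bool" where
  "principal_JH E k F l \<longleftrightarrow> JH_seq E k F l \<and>
     (\<forall>i\<in>{1..k}. \<forall>j\<in>{i..k}. \<exists>r::real. 0 \<le> r \<and> (l j + of_nat j) - (l i + of_nat i) = of_real r)"

text \<open>The quotient by the left ideal generated by \<open>(a - l1 b) (1 + x b^p)\<inverse> (a - l2 b)\<close>; the inverse is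
  taken in \<open>\<complex>[[b]]\<close>, where it exists for \<open>p \<ge> 1\<close>.\<close>

definition ab_rank2_quot :: "complex \<Rightarrow> complex \<Rightarrow> nat \<Rightarrow> complex \<Rightarrow> ab_series set ab_mod" where
  "ab_rank2_quot l1 x p l2 = ab_cyclic
     (ab_lin l1 \<otimes>\<^bsub>Atilde\<^esub> ab_of_b (inverse (1 + fps_const x * fps_X ^ p)) \<otimes>\<^bsub>Atilde\<^esub> ab_lin l2)"

definition alpha_data ::
    "complex \<Rightarrow> 'm ab_mod \<Rightarrow> nat \<Rightarrow> (nat \<Rightarrow> 'm set) \<Rightarrow> (nat \<Rightarrow> complex) \<Rightarrow> (nat \<Rightarrow> nat) \<Rightarrow> bool" where
  "alpha_data lam E k F l p \<longleftrightarrow> fresco E \<and> ab_primitive lam E \<and> 2 \<le> k \<and> ab_rank E k \<and>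
     principal_JH E k F l \<and>
     (\<forall>j\<in>{1..k-1}. l (j + 1) = l j + of_nat (p j) - 1 \<and> 1 \<le> p j) \<and>
     ab_semi_simple (E \<downharpoonright> F (k - 1)) \<and> ab_semi_simple (E LQuot F 1)"

text \<open>
  \<open>alpha_value E x\<close>: the value \<open>x\<close> of the \<open>\<alpha>\<close>-invariant is obtained from \<open>E\<close> by some choice of generators
  in the inductive construction. The value does not depend on these choices, so \<open>alpha_inv\<close> may pick any.
\<close>

inductive alpha_value :: "'m ab_mod \<Rightarrow> complex \<Rightarrow> bool" where
  rank2: "alpha_value E x"
    if "alpha_data lam E 2 F l p" and "E \<simeq> ab_rank2_quot (l 1) x (p 1) (l 2)"
| step: "alpha_value E x"
    if "alpha_data lam E k F l p" and "3 \<le> k"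
      and "e \<in> carrier E" and "cyc_sub Atilde E e = carrier E"
      and "(ab_lin (l (k - 1)) \<otimes>\<^bsub>Atilde\<^esub> ab_lin (l k)) \<odot>\<^bsub>E\<^esub> e \<in> F (k - 2)"
      and "alpha_value (E \<downharpoonright> cyc_sub Atilde E (ab_lin (l (k - 1) - 1) \<odot>\<^bsub>E\<^esub> e)) x"

definition alpha_inv :: "'m ab_mod \<Rightarrow> complex" where
  "alpha_inv E = (SOME x. alpha_value E x)"

lemma lmod_transport:
  fixes M :: "('a, 'm) module" and h :: "'m \<Rightarrow> 'n"
  assumes "left_module R M" "inj_on h (carrier M)"
  shows "\<exists>N :: ('a, 'n) module. left_module R N \<and> carrier N = h ` carrier M \<and> h \<in> lmod_hom R M N"
proof -
  interpret left_module R M by fact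
  define g where "g = inv_into (carrier M) h"
  define N :: "('a, 'n) module" where
    "N = \<lparr>carrier = h ` carrier M, mult = undefined, one = undefined, zero = h \<zero>\<^bsub>M\<^esub>,
       add = (\<lambda>x y. h (g x \<oplus>\<^bsub>M\<^esub> g y)), smult = (\<lambda>r x. h (r \<odot>\<^bsub>M\<^esub> g x))\<rparr>"
  have g [simp]: "g (h x) = x" if "x \<in> carrier M" for x
    using that assms(2) by (simp add: g_def)
  have N: "carrier N = h ` carrier M" "\<zero>\<^bsub>N\<^esub> = h \<zero>\<^bsub>M\<^esub>"
    "\<And>x y. x \<in> carrier M \<Longrightarrow> y \<in> carrier M \<Longrightarrow> h x \<oplus>\<^bsub>N\<^esub> h y = h (x \<oplus>\<^bsub>M\<^esub> y)"
    "\<And>r x. x \<in> carrier M \<Longrightarrow> r \<odot>\<^bsub>N\<^esub> h x = h (r \<odot>\<^bsub>M\<^esub> x)"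
    by (auto simp: N_def)
  have "abelian_group N"
  proof (rule abelian_groupI)
    fix y assume "y \<in> carrier N"
    then obtain x where "y = h x" "x \<in> carrier M" by (auto simp: N)
    then show "\<exists>z\<in>carrier N. z \<oplus>\<^bsub>N\<^esub> y = \<zero>\<^bsub>N\<^esub>"
      by (intro bexI[of _ "h (\<ominus>\<^bsub>M\<^esub> x)"]) (auto simp: N M.l_neg)
  qed (auto simp: N M.a_ac intro!: imageI)
  then have "left_module R N"
    by (intro left_module.intro left_module_axioms.intro R.ring_axioms)
       (auto simp: N smult_l_distr smult_r_distr smult_assoc intro!: imageI)
  moreover have "h \<in> lmod_hom R M N"
    by (auto simp: lmod_hom_def hom_def N)
  ultimately show ?thesis using N(1) by blast
qed

lemma lmod_hom_finsum:
  assumes "left_module R M" "left_module R N" "h \<in> lmod_hom R M N" "finite A" "f \<in> A \<rightarrow> carrier M"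
  shows "h (\<Oplus>\<^bsub>M\<^esub>i\<in>A. f i) = (\<Oplus>\<^bsub>N\<^esub>i\<in>A. h (f i))"
proof -
  interpret M: left_module R M by fact
  interpret N: left_module R N by fact
  have h: "h x \<in> carrier N" "h (x \<oplus>\<^bsub>M\<^esub> y) = h x \<oplus>\<^bsub>N\<^esub> h y" if "x \<in> carrier M" "y \<in> carrier M" for x y
    using assms(3) that by (auto simp: lmod_hom_def hom_def)
  have h0: "h \<zero>\<^bsub>M\<^esub> = \<zero>\<^bsub>N\<^esub>"
    using h[of "\<zero>\<^bsub>M\<^esub>" "\<zero>\<^bsub>M\<^esub>"] N.M.add.l_cancel_one[of "h \<zero>\<^bsub>M\<^esub>" "h \<zero>\<^bsub>M\<^esub>"] by simp
  show ?thesis using assms(4,5)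
  proof (induction A)
    case empty then show ?case by (simp add: h0)
  next
    case (insert a A)
    then have 1: "f \<in> A \<rightarrow> carrier M" "f a \<in> carrier M" "(\<lambda>i. h (f i)) \<in> A \<rightarrow> carrier N" "h (f a) \<in> carrier N"
      using h(1) by (auto simp: Pi_iff)
    then show ?case using insert by (simp add: h)
  qed
qed

lemma ab_module_coord:
  fixes M :: "'m ab_mod"
  assumes "ab_module M"
  shows "\<exists>N :: ab_coord ab_mod. ab_module N \<and> M \<simeq> N"
proof -
  from assms obtain k where M: "left_module Atilde M" and "ab_rank M k" by (auto simp: ab_module_def)
  interpret M: left_module Atilde M by fact
  from \<open>ab_rank M k\<close> obtain e where e: "e \<in> {..<k} \<rightarrow> carrier M"
    and ex: "\<forall>x\<in>carrier M. \<exists>!S. S \<in> {..<k} \<rightarrow>\<^sub>E UNIV \<and> x = (\<Oplus>\<^bsub>M\<^esub>i\<in>{..<k}. ab_of_b (S i) \<odot>\<^bsub>M\<^esub> e i)"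
    unfolding ab_rank_def by (elim bexE) (rule that)
  define G where "G S = (\<Oplus>\<^bsub>M\<^esub>i\<in>{..<k}. ab_of_b (S i) \<odot>\<^bsub>M\<^esub> e i)" for S
  define h where "h x = (THE S. S \<in> {..<k} \<rightarrow>\<^sub>E UNIV \<and> x = G S)" for x
  have ex: "\<exists>!S. S \<in> {..<k} \<rightarrow>\<^sub>E UNIV \<and> x = G S" if "x \<in> carrier M" for x
    unfolding G_def by (rule bspec[OF ex that])
  have h: "G (h x) = x" if "x \<in> carrier M" for x
    using conjunct2[OF theI'[OF ex[OF that]]] unfolding h_def by (rule sym)
  have inj: "inj_on h (carrier M)"
  proof (rule inj_onI)
    fix x y assume "x \<in> carrier M" "y \<in> carrier M" "h x = h y"
    then show "x = y" using h[of x] h[of y] by metis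
  qed
  from lmod_transport[OF M inj] obtain N :: "ab_coord ab_mod" where N: "left_module Atilde N" "carrier N = h ` carrier M" "h \<in> lmod_hom Atilde M N"
    by blast
  interpret N: left_module Atilde N by fact
  define G' where "G' S = (\<Oplus>\<^bsub>N\<^esub>i\<in>{..<k}. ab_of_b (S i) \<odot>\<^bsub>N\<^esub> h (e i))" for S
  have ei: "e i \<in> carrier M" if "i < k" for i using e that by auto
  have hc: "h x \<in> carrier N" "h (u \<odot>\<^bsub>M\<^esub> x) = u \<odot>\<^bsub>N\<^esub> h x" if "x \<in> carrier M" for x u
    using N that by (simp_all add: lmod_hom_def)
  have Gc: "G S \<in> carrier M" for S
    unfolding G_def by (intro M.M.finsum_closed) (simp add: ei)
  have sm: "h (G S) = G' S" for S
  proof -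
    have "h (G S) = (\<Oplus>\<^bsub>N\<^esub>i\<in>{..<k}. h (ab_of_b (S i) \<odot>\<^bsub>M\<^esub> e i))"
      unfolding G_def by (rule lmod_hom_finsum[OF M N(1,3)]) (simp_all add: ei)
    also have "\<dots> = G' S"
      unfolding G'_def by (intro N.M.finsum_cong') (simp_all add: ei hc)
    finally show ?thesis .
  qed
  have "ab_rank N k" unfolding ab_rank_def
  proof (intro bexI[of _ "\<lambda>i. h (e i)"] ballI)
    fix y assume "y \<in> carrier N"
    then obtain x where x: "x \<in> carrier M" "y = h x" unfolding N(2) by blast
    have "(y = G' S) \<longleftrightarrow> (x = G S)" for S
      unfolding x(2) sm[symmetric] using inj_on_eq_iff[OF inj x(1) Gc] .
    then show "\<exists>!S. S \<in> {..<k} \<rightarrow>\<^sub>E UNIV \<and> y = (\<Oplus>\<^bsub>N\<^esub>i\<in>{..<k}. ab_of_b (S i) \<odot>\<^bsub>N\<^esub> h (e i))"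
      using ex[OF x(1)] unfolding G'_def[symmetric] by simp
  qed (simp add: ei hc)
  then have "ab_module N" using N(1) unfolding ab_module_def by blast
  moreover have "M \<simeq> N" unfolding lmod_iso_def bij_betw_def
    using N(3) inj N(2)[symmetric] by (intro bexI[of _ h] conjI)
  ultimately show ?thesis by blast
qed

end

theory Submission
  imports Defs
begin

text \<open>
  The semi-simplicity of \<open>F\<^bsub>k-1\<^esub>\<close> and \<open>E/F\<^sub>1\<close> provides coordinates \<open>\<psi>\<^sub>1, \<dots>, \<psi>\<^sub>k\<close> on \<open>E\<close> with values
  in \<open>\<complex>[[b]]\<close>, in which \<open>a\<close> acts by \<open>\<kappa>b + b\<^sup>2 d/db\<close>, except that \<open>c b \<psi>\<^sub>k\<close> is added to the first one. The coordinates
  of a generator have orders \<open>n\<^sub>1 < \<dots> < n\<^sub>k\<close>, the roots of the Bernstein polynomial are \<open>-(\<kappa> + n\<^sub>j)\<close>, and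
  \<open>\<lambda>\<^sub>j = \<kappa> + n\<^sub>j + k - j\<close>. One step \<open>E \<leadsto> G\<^bsub>k-1\<^esub>\<close> of the induction defining \<open>\<alpha>\<close> cuts \<open>E\<close> by
  \<open>\<psi>\<^bsub>k-1\<^esub> = w \<psi>\<^sub>k\<close>, which leads after \<open>k - 2\<close> steps to a normal submodule of rank 2, a model of which can be
  written down with logarithms when \<open>\<alpha> \<noteq> 0\<close>. Conversely, in a theme each \<open>a - \<nu>b\<close> has a kernel of dimension at
  most 1. Hence a normal theme of rank 2 meets \<open>F\<^sub>1\<close> and is not contained in \<open>F\<^bsub>k-1\<^esub>\<close>, and a Wronskian
  argument shows that it is given by \<open>\<psi>\<^sub>j = w\<^sub>j \<psi>\<^sub>k\<close> for \<open>2 \<le> j < k\<close>. All these submodules have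
  isomorphic structures: the ratio of the leading coefficients of a generator does not depend on \<open>w\<close>.
\<close>

section \<open>Arithmetic of the algebra\<close>

text \<open>The rank 1 modules provided by semi-simplicity have different constants, differing by
  integers. Multiplying homomorphisms by powers of b and by units sends all of them to one and the
  same target, with constant \<kappa> = \<lambda>_1 - M for a large M. Only because the coordinates
  share this operator are the differences \<psi>_i - w \<psi>_j (i, j >= 2) again homomorphisms, and
  the invariants turn into natural numbers n_j. The constant c is an obstruction: the first
  coordinate is a homomorphism on F_(k-1), and its extension to E is governed by a first order
  equation that can be solved at all indices but one. The failure at that index is what c records.
  In rank 2, \<alpha> is c times the ratio of the leading coefficients of a generator, divided by
  n_1 - n_2. Every operator a - l b used along the way multiplies leading coefficients by
  differences n_j - n_i, so the strict growth of the n_j, that is p_j >= 1, keeps everything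
  nonzero. The value picked by \<open>alpha_inv\<close> is realized by a concrete normal submodule
  of rank 2, and this submodule then serves as the model for all others.\<close>

lemma ab_of_b_nth [simp]: "ab_of_b S $ n = [: S $ n :]"
  by (simp add: ab_of_b_def)

lemma ab_of_b_add: "ab_of_b (S + R) = ab_of_b S + ab_of_b R"
  and ab_of_b_minus: "ab_of_b (- S) = - ab_of_b S"
  and ab_of_b_0 [simp]: "ab_of_b 0 = 0"
  and ab_of_b_1 [simp]: "ab_of_b 1 = 1"
  and ab_of_b_const: "ab_of_b (fps_const c) = fps_const [:c:]"
  by (auto simp: fps_eq_iff one_pCons)

lemma ab_mult_of_b_right: "ab_mult f (ab_of_b S) = f * ab_of_b S"
  unfolding ab_of_b_def by (rule ab_mult_b_right)

lemma const_sum_pCons: "(\<Sum>i\<in>A. [: f i :]) = [: \<Sum>i\<in>A. f i :: complex :]"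
  by (induction A rule: infinite_finite_induct) auto

lemma ab_mult_of_b: "ab_mult (ab_of_b S) (ab_of_b R) = ab_of_b (S * R)"
  by (rule fps_ext) (simp add: ab_mult_of_b_right fps_mult_nth const_sum_pCons mult.commute)

text \<open>The relation ab - ba = b^2 makes the bracket with a the derivation b^2 d/db of C[[b]].
  All operators acting on coordinates below are built from it.\<close>

lemma ab_mult_a_of_b:
  "ab_mult ab_a (ab_of_b S) = ab_mult (ab_of_b S) ab_a + ab_of_b (fps_X\<^sup>2 * fps_deriv S)"
proof (rule fps_ext)
  fix n
  show "ab_mult ab_a (ab_of_b S) $ n = (ab_mult (ab_of_b S) ab_a + ab_of_b (fps_X\<^sup>2 * fps_deriv S)) $ n"
  proof (cases n)
    case 0 then show ?thesis
      using ab_mult_a_right_nth[of "ab_of_b S" 0]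
      by (simp add: ab_mult_of_b_right fps_mult_nth ab_a_def power2_eq_square)
  next
    case (Suc m)
    have "(fps_X\<^sup>2 * fps_deriv S) $ Suc m = of_nat m * S $ m"
      by (cases m) (auto simp: power2_eq_square mult.assoc)
    then show ?thesis using Suc ab_mult_a_right_nth[of "ab_of_b S" n]
      by (simp add: ab_mult_of_b_right ab_a_def mult.commute of_nat_poly)
  qed
qed

lemma ab_mult_b_left_nth:
  "ab_mult ab_b w $ N = (\<Sum>n<N. [: (- 1) ^ (N - 1 - n) :] * (pderiv ^^ (N - 1 - n)) (w $ n))"
proof -
  have "ab_mult ab_b w $ N = (\<Sum>m\<in>{1} \<inter> {..N}. \<Sum>n\<le>N - m.
     [: (- of_nat m) gchoose (N - m - n) :] * (ab_b $ m * (pderiv ^^ (N - m - n)) (w $ n)))"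
    unfolding ab_mult_def fps_nth_Abs_fps by (rule sum.mono_neutral_right) (auto simp: ab_b_eq)
  also have "\<dots> = (\<Sum>n<N. [: (- 1) ^ (N - 1 - n) :] * (pderiv ^^ (N - 1 - n)) (w $ n))"
  proof (cases "N = 0")
    case False
    have g: "((- 1 :: complex) gchoose j) = (- 1) ^ j" for j
      using gbinomial_minus[of "1::complex" j] by (simp flip: binomial_gbinomial)
    from False have "{1} \<inter> {..N} = {1}" "{..N - 1} = {..<N}" by auto
    then show ?thesis by (simp add: g one_pCons[symmetric])
  qed simp
  finally show ?thesis .
qed

text \<open>Moving b to the right of Q(a) gives the alternating sum of Q^(j)(a) b^(j+1). The
  contribution of the derivative, shifted once more by b, telescopes against all terms but the
  first. The left ideal of b thus lies in its right ideal.\<close>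

lemma ab_mult_b_right_shift:
  "ab_mult w ab_b = ab_mult ab_b (w + ab_mult (Abs_fps (\<lambda>n. pderiv (w $ n))) ab_b)"
proof (rule fps_ext)
  fix N
  let ?d = "Abs_fps (\<lambda>n. pderiv (w $ n))"
  let ?t = "\<lambda>M n. [: (- 1) ^ (M - n) :] * (pderiv ^^ (M - n)) (w $ n)"
  have 1: "ab_mult w ab_b $ N = (if N = 0 then 0 else w $ (N - 1))"
    by (simp add: ab_b_eq ab_mult_X_right)
  show "ab_mult w ab_b $ N = ab_mult ab_b (w + ab_mult ?d ab_b) $ N"
  proof (cases N)
    case 0 then show ?thesis unfolding 1 ab_mult_b_left_nth by simp
  next
    case (Suc M)
    have b: "ab_mult ab_b w $ N = (\<Sum>n<M. ?t M n) + w $ M"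
      unfolding ab_mult_b_left_nth Suc by (simp add: one_pCons[symmetric])
    have "ab_mult ab_b (ab_mult ?d ab_b) $ N = ab_mult (ab_mult ab_b ?d) ab_b $ N"
      by (simp add: ab_mult_assoc)
    also have "\<dots> = ab_mult ab_b ?d $ M" by (simp add: Suc ab_b_eq ab_mult_X_right)
    also have "\<dots> = (\<Sum>n<M. - ?t M n)"
      unfolding ab_mult_b_left_nth
    proof (rule sum.cong)
      fix n assume "n \<in> {..<M}"
      then have e: "M - n = Suc (M - 1 - n)" by auto
      show "[: (- 1) ^ (M - 1 - n) :] * (pderiv ^^ (M - 1 - n)) (?d $ n) = - ?t M n"
        unfolding e by (simp add: funpow_swap1)
    qed simp
    finally have "ab_mult ab_b (ab_mult ?d ab_b) $ N = - (\<Sum>n<M. ?t M n)" by (simp add: sum_negf)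
    then show ?thesis using 1 b by (simp add: Suc ab_mult_add_right)
  qed
qed

text \<open>With b on the left, its action can be pulled out of a coordinate as multiplication by
  the variable. This drives the inductions on the index of a coefficient.\<close>

lemma ab_series_decomp: "\<exists>w. u = fps_const (u $ 0) + ab_mult ab_b w"
proof -
  have "u - fps_const (u $ 0) = ab_mult (fps_shift 1 u) ab_b"
    by (rule fps_ext) (simp add: ab_b_eq ab_mult_X_right split: nat.splits)
  also obtain w where "\<dots> = ab_mult ab_b w" using ab_mult_b_right_shift by blast
  finally have "u = fps_const (u $ 0) + ab_mult ab_b w" by (simp add: algebra_simps)
  then show ?thesis by blast
qed

text \<open>Powers of b pass to the right of any element. This makes multiplication by b^(k-1), used
  to clear denominators in a saturation, compatible with submodules.\<close>

lemma ab_mult_b_left_commute: "\<exists>w. ab_mult (ab_of_b (fps_X ^ k)) u = ab_mult w (ab_of_b (fps_X ^ k))"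
proof (induction k arbitrary: u)
  case 0
  show ?case by (simp add: ab_mult_1_left ab_mult_1_right)
next
  case (Suc k)
  have 1: "\<exists>w. ab_mult ab_b v = ab_mult w ab_b" for v
  proof -
    \<comment> \<open>The product b v has no term of index 0, so dividing it by b on the right is a
      shift of coefficients.\<close>
    have "ab_mult ab_b v = ab_mult (fps_shift 1 (ab_mult ab_b v)) ab_b"
      by (rule fps_ext) (simp add: ab_b_eq ab_mult_X_right ab_mult_b_left_nth[unfolded ab_b_eq] split: nat.splits)
    then show ?thesis by blast
  qed
  have e: "ab_of_b (fps_X ^ Suc k) = ab_mult ab_b (ab_of_b (fps_X ^ k))" by (simp add: ab_mult_of_b)
  from Suc obtain w where w: "ab_mult (ab_of_b (fps_X ^ k)) u = ab_mult w (ab_of_b (fps_X ^ k))" by blast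
  from 1 obtain w' where w': "ab_mult ab_b w = ab_mult w' ab_b" by blast
  have "ab_mult (ab_of_b (fps_X ^ Suc k)) u = ab_mult w' (ab_of_b (fps_X ^ Suc k))"
    unfolding e by (metis ab_mult_assoc w w')
  then show ?case by blast
qed

lemma Atilde_a_inv [simp]: "\<ominus>\<^bsub>Atilde\<^esub> x = - x"
proof -
  interpret ring Atilde by (rule Atilde_ring)
  show ?thesis by (rule minus_equality) simp_all
qed

lemma ab_lin_eq: "ab_lin l = ab_a - ab_of_b (fps_const l * fps_X)"
proof -
  have "ab_mult (fps_const [:l:]) ab_b = ab_of_b (fps_const l * fps_X)"
    by (simp flip: ab_of_b_const add: ab_mult_of_b)
  then show ?thesis by (simp add: ab_lin_def a_minus_def)
qed

lemma ab_mult_lin_nth: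
  "ab_mult q (ab_lin l) $ n = [:0, 1:] * q $ n - (if n = 0 then 0 else [: of_nat (n - 1) + l :] * q $ (n - 1))"
proof -
  have 1: "ab_mult q (ab_lin l) = ab_mult q ab_a - q * ab_of_b (fps_const l * fps_X)"
    using ab_mult_add_right[of q "ab_lin l" "ab_of_b (fps_const l * fps_X)"]
    by (simp add: ab_lin_eq ab_mult_of_b_right algebra_simps)
  have 2: "ab_of_b (fps_const l * fps_X) = fps_const [:l:] * fps_X"
    by (rule fps_ext) auto
  have 3: "(q * (fps_const [:l:] * fps_X)) $ n = (if n = 0 then 0 else [:l:] * q $ (n - 1))"
    by (subst mult.left_commute) simp
  have 4: "ab_mult q ab_a $ n = [:0, 1:] * q $ n - (if n = 0 then 0 else of_nat (n - 1) * q $ (n - 1))"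
    unfolding ab_a_def by (rule ab_mult_a_right_nth)
  have 5: "[: of_nat (n - 1) + l :] * q $ (n - 1) = of_nat (n - 1) * q $ (n - 1) + [:l:] * q $ (n - 1)"
    by (simp add: of_nat_poly smult_add_left)
  show ?thesis unfolding 1 2 fps_sub_nth 3 4 5 by simp
qed

text \<open>Euclidean division by a - l b, one coefficient at a time: the coefficient of index n + 1
  of q (a - l b) is x q_(n+1) - (n + l) q_n, so q_(n+1) is the quotient by x that leaves a
  constant.\<close>

fun ab_div_lin :: "complex \<Rightarrow> ab_series \<Rightarrow> nat \<Rightarrow> complex poly" where
  "ab_div_lin l u 0 = u $ 0 div [:0, 1:]"
| "ab_div_lin l u (Suc n) = (u $ Suc n + [: of_nat n + l :] * ab_div_lin l u n) div [:0, 1:]"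

lemma poly_mod_X: "\<exists>s. (P :: complex poly) = [:0, 1:] * (P div [:0, 1:]) + [:s:]"
proof -
  have "degree (P mod [:0, 1:]) = 0"
    using degree_mod_less'[of "[:0, 1::complex:]" P] by (cases "P mod [:0, 1:] = 0") auto
  then obtain s where "P mod [:0, 1:] = [:s:]" by (metis degree_eq_zeroE)
  then show ?thesis by (metis mult_div_mod_eq)
qed

text \<open>Since every coefficient leaves a constant, the remainder lies in C[[b]]. For a cyclic
  module this splits u e into a multiple of (a - l b) e and a C[[b]]-multiple of e, the basic device
  for computing generators and annihilators below.\<close>

lemma ab_lin_division: "\<exists>q S. u = ab_mult q (ab_lin l) + ab_of_b S"
proof -
  have aux: "x - (y - w) = r" if "x + w = y + r" for x y w r :: "complex poly"
    using that by (simp add: algebra_simps)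
  define q where "q = Abs_fps (ab_div_lin l u)"
  have "\<exists>s. (u - ab_mult q (ab_lin l)) $ n = [:s:]" for n
  proof (cases n)
    case 0
    obtain s where "u $ 0 = [:0, 1:] * (u $ 0 div [:0, 1:]) + [:s:]" using poly_mod_X by blast
    then have "u $ 0 - ([:0, 1:] * (u $ 0 div [:0, 1:]) - 0) = [:s:]"
      by (metis add_diff_cancel_left' diff_0_right)
    then have "(u - ab_mult q (ab_lin l)) $ n = [:s:]"
      by (simp only: ab_mult_lin_nth q_def 0 fps_sub_nth fps_nth_Abs_fps ab_div_lin.simps if_True simp_thms)
    then show ?thesis by blast
  next
    case (Suc m)
    let ?v = "u $ Suc m + [: of_nat m + l :] * ab_div_lin l u m"
    obtain s where "?v = [:0, 1:] * (?v div [:0, 1:]) + [:s:]" using poly_mod_X by blast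
    then have "u $ Suc m - ([:0, 1:] * (?v div [:0, 1:]) - [: of_nat m + l :] * ab_div_lin l u m) = [:s:]"
      by (rule aux)
    then have "(u - ab_mult q (ab_lin l)) $ n = [:s:]"
      by (simp only: ab_mult_lin_nth q_def Suc fps_sub_nth fps_nth_Abs_fps ab_div_lin.simps if_False nat.distinct diff_Suc_1)
    then show ?thesis by blast
  qed
  then obtain s where s: "\<And>n. (u - ab_mult q (ab_lin l)) $ n = [: s n :]" by metis
  have "u - ab_mult q (ab_lin l) = ab_of_b (Abs_fps s)" by (rule fps_ext) (simp only: s ab_of_b_nth fps_nth_Abs_fps)
  then show ?thesis by (metis add.commute diff_add_cancel)
qed

text \<open>From the lowest index upwards: x q_n can be a constant only if q_n = 0, and then the
  next coefficient has the same shape.\<close>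

lemma ab_lin_division_unique:
  assumes "ab_mult q (ab_lin l) = ab_of_b S"
  shows "q = 0" "S = 0"
proof -
  have n: "ab_mult q (ab_lin l) $ n = [: S $ n :]" for n using assms by simp
  have z: "P = 0" if "[:0, 1:] * P = [:s::complex:]" for P s
  proof (rule ccontr)
    assume "P \<noteq> 0"
    then have "degree ([:0, 1:] * P) = Suc (degree P)" by (simp add: degree_mult_eq)
    then show False using that by simp
  qed
  have "q $ n = 0" for n
  proof (induction n)
    case 0 show ?case using n[of 0] by (intro z[of _ "S $ 0"]) (simp add: ab_mult_lin_nth)
  next
    case (Suc m) then show ?case using n[of "Suc m"] by (intro z[of _ "S $ Suc m"]) (simp add: ab_mult_lin_nth)
  qed
  then show q: "q = 0" by (simp add: fps_eq_iff)
  have "S $ n = 0" for n using n[of n] by (simp add: q ab_mult_lin_nth split: if_splits)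
  then show "S = 0" by (simp add: fps_eq_iff)
qed

section \<open>Left modules over the algebra\<close>

abbreviation bmul :: "'m ab_mod \<Rightarrow> complex fps \<Rightarrow> 'm \<Rightarrow> 'm" where
  "bmul E S x \<equiv> ab_of_b S \<odot>\<^bsub>E\<^esub> x"

lemma ab_minus_1: "- 1 = ab_of_b (- 1)"
  by (rule fps_ext) (simp add: one_pCons)

locale abmod = left_module Atilde E for E :: "'m ab_mod" (structure)
begin

lemma smul_closed [simp, intro]: "x \<in> carrier E \<Longrightarrow> u \<odot> x \<in> carrier E"
  using smult_closed[of u x] by simp

lemma smul_add_left: "x \<in> carrier E \<Longrightarrow> (u + v) \<odot> x = u \<odot> x \<oplus> v \<odot> x"
  using smult_l_distr[of u v x] by simp

lemma smul_mult: "x \<in> carrier E \<Longrightarrow> ab_mult u v \<odot> x = u \<odot> (v \<odot> x)"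
  using smult_assoc[of u v x] by simp

lemma smul_add_right: "x \<in> carrier E \<Longrightarrow> y \<in> carrier E \<Longrightarrow> u \<odot> (x \<oplus> y) = u \<odot> x \<oplus> u \<odot> y"
  using smult_r_distr[of u x y] by simp

lemma smul_1 [simp]: "x \<in> carrier E \<Longrightarrow> 1 \<odot> x = x"
  using smult_one[of x] by simp

lemma smul_0_left [simp]: "x \<in> carrier E \<Longrightarrow> 0 \<odot> x = \<zero>"
  using smul_add_left[of x 0 0] M.add.l_cancel_one[of "0 \<odot> x" "0 \<odot> x"] by simp

lemma smul_0_right [simp]: "u \<odot> \<zero> = \<zero>"
  using smul_add_right[of \<zero> \<zero> u] M.add.l_cancel_one[of "u \<odot> \<zero>" "u \<odot> \<zero>"] by simp

lemma smul_uminus: "x \<in> carrier E \<Longrightarrow> (- u) \<odot> x = \<ominus> (u \<odot> x)"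
  using smul_add_left[of x "- u" u] by (intro M.minus_equality[symmetric]) auto

lemma neg_eq: "x \<in> carrier E \<Longrightarrow> \<ominus> x = (- 1) \<odot> x"
  using smul_uminus[of x 1] by simp

lemma smul_minus: "x \<in> carrier E \<Longrightarrow> (u - v) \<odot> x = u \<odot> x \<ominus> v \<odot> x"
  using smul_add_left[of x u "- v"] by (simp add: smul_uminus a_minus_def)

lemma smul_neg: "x \<in> carrier E \<Longrightarrow> u \<odot> (\<ominus> x) = \<ominus> (u \<odot> x)"
  using smul_add_right[of "\<ominus> x" x u] by (intro M.minus_equality[symmetric]) (auto simp: M.l_neg)

lemma smul_minus_right: "x \<in> carrier E \<Longrightarrow> y \<in> carrier E \<Longrightarrow> u \<odot> (x \<ominus> y) = u \<odot> x \<ominus> u \<odot> y"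
  by (simp add: a_minus_def smul_add_right smul_neg)

lemma bmul_mult: "x \<in> carrier E \<Longrightarrow> bmul E (S * R) x = bmul E S (bmul E R x)"
  by (simp flip: smul_mult ab_mult_of_b)

lemma bmul_add: "x \<in> carrier E \<Longrightarrow> bmul E (S + R) x = bmul E S x \<oplus> bmul E R x"
  by (simp add: ab_of_b_add smul_add_left)

lemma a_bmul:
  "x \<in> carrier E \<Longrightarrow> ab_a \<odot> bmul E S x = bmul E S (ab_a \<odot> x) \<oplus> bmul E (fps_X\<^sup>2 * fps_deriv S) x"
  by (simp flip: smul_mult smul_add_left add: ab_mult_a_of_b)

lemma lin_smul: "x \<in> carrier E \<Longrightarrow> ab_lin l \<odot> x = ab_a \<odot> x \<ominus> bmul E (fps_const l * fps_X) x"
  by (simp add: ab_lin_eq smul_minus)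

lemma minus_add_cancel: "x \<in> carrier E \<Longrightarrow> y \<in> carrier E \<Longrightarrow> (x \<ominus> y) \<oplus> y = x"
  by (simp add: a_minus_def M.a_assoc M.l_neg)

lemma minus_eq_0_iff: "x \<in> carrier E \<Longrightarrow> y \<in> carrier E \<Longrightarrow> x \<ominus> y = \<zero> \<longleftrightarrow> x = y"
  by (metis M.minus_closed M.r_neg M.l_zero minus_add_cancel a_minus_def)

lemma a_eq_lin: "x \<in> carrier E \<Longrightarrow> ab_a \<odot> x = ab_lin l \<odot> x \<oplus> bmul E (fps_const l * fps_X) x"
  by (simp add: lin_smul minus_add_cancel)

lemma submodI:
  assumes "H \<subseteq> carrier E" "\<zero> \<in> H" "\<And>x y. x \<in> H \<Longrightarrow> y \<in> H \<Longrightarrow> x \<oplus> y \<in> H" "\<And>u x. x \<in> H \<Longrightarrow> u \<odot> x \<in> H"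
  shows "submodule H Atilde E"
proof -
  have "\<ominus> x \<in> H" if "x \<in> H" for x
    using assms(4)[OF that, of "- 1"] assms(1) that smul_uminus[of x 1] by auto
  then have "subgroup H (add_monoid E)"
    using assms by (intro M.add.subgroupI) (auto simp: a_inv_def)
  then show ?thesis using assms(4) by (intro submodule.intro submodule_axioms.intro) auto
qed

lemma submodD:
  assumes "submodule H Atilde E"
  shows "H \<subseteq> carrier E" "\<zero> \<in> H" "\<And>x y. x \<in> H \<Longrightarrow> y \<in> H \<Longrightarrow> x \<oplus> y \<in> H" "\<And>u x. x \<in> H \<Longrightarrow> u \<odot> x \<in> H"
    "\<And>x y. x \<in> H \<Longrightarrow> y \<in> H \<Longrightarrow> x \<ominus> y \<in> H" "\<And>x. x \<in> H \<Longrightarrow> x \<in> carrier E"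
proof -
  interpret H: submodule H Atilde E by fact
  show s: "H \<subseteq> carrier E" using H.subset by simp
  show "\<zero> \<in> H" using H.one_closed by simp
  show a: "x \<oplus> y \<in> H" if "x \<in> H" "y \<in> H" for x y using H.m_closed[OF that] by simp
  show m: "u \<odot> x \<in> H" if "x \<in> H" for u x using H.smult_closed[OF _ that, of u] by simp
  show "x \<in> carrier E" if "x \<in> H" for x using s that by blast
  show "x \<ominus> y \<in> H" if "x \<in> H" "y \<in> H" for x y
  proof -
    have y: "y \<in> carrier E" using s that(2) by blast
    have "\<ominus> y \<in> H" using m[OF that(2), of "- 1"] unfolding neg_eq[OF y] .
    then show ?thesis unfolding a_minus_def by (rule a[OF that(1)])
  qed
qed

lemma sub_abmod: "submodule H Atilde E \<Longrightarrow> abmod (E \<downharpoonright> H)"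
  using left_module_sub[OF left_module_axioms] by (rule abmod.intro)

lemma quot_abmod: "submodule H Atilde E \<Longrightarrow> abmod (E LQuot H)"
  using left_module_quot[OF left_module_axioms] by (rule abmod.intro)

lemma submodule_carrier: "submodule (carrier E) Atilde E"
  by (rule submodI) auto

lemma submodule_sub_iff:
  assumes "submodule G Atilde E"
  shows "submodule H Atilde (E \<downharpoonright> G) \<longleftrightarrow> submodule H Atilde E \<and> H \<subseteq> G"
proof -
  interpret G: abmod "E \<downharpoonright> G" by (rule sub_abmod[OF assms])
  show ?thesis
  proof safe
    assume H: "submodule H Atilde (E \<downharpoonright> G)"
    from G.submodD[OF H] submodD(1)[OF assms] show "submodule H Atilde E" by (intro submodI) auto
    from G.submodD(1)[OF H] show "x \<in> H \<Longrightarrow> x \<in> G" for x by auto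
  next
    assume "submodule H Atilde E" "H \<subseteq> G"
    then show "submodule H Atilde (E \<downharpoonright> G)" using submodD by (intro G.submodI) auto
  qed
qed

lemma minus_sub: "submodule H Atilde E \<Longrightarrow> x \<in> H \<Longrightarrow> y \<in> H \<Longrightarrow> x \<ominus>\<^bsub>E \<downharpoonright> H\<^esub> y = x \<ominus> y"
proof -
  assume H: "submodule H Atilde E" and xy: "x \<in> H" "y \<in> H"
  interpret H: abmod "E \<downharpoonright> H" by (rule sub_abmod[OF H])
  have "x \<ominus>\<^bsub>E \<downharpoonright> H\<^esub> y = x \<oplus> (- 1) \<odot> y"
    using H.smul_uminus[of y 1] H.smul_1[of y] xy by (simp add: a_minus_def)
  then show ?thesis using smul_uminus[of y 1] xy submodD(6)[OF H] by (simp add: a_minus_def)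
qed

lemma cyc_sub_submodule: "x \<in> carrier E \<Longrightarrow> submodule (cyc_sub Atilde E x) Atilde E"
proof (rule submodI)
  assume x: "x \<in> carrier E"
  show "cyc_sub Atilde E x \<subseteq> carrier E" "\<zero> \<in> cyc_sub Atilde E x"
    using x smul_0_left[OF x, symmetric] by (auto simp: cyc_sub_def intro!: exI[of _ 0])
  show "y \<oplus> z \<in> cyc_sub Atilde E x" if "y \<in> cyc_sub Atilde E x" "z \<in> cyc_sub Atilde E x" for y z
    using that by (auto simp: cyc_sub_def simp flip: smul_add_left[OF x])
  show "u \<odot> y \<in> cyc_sub Atilde E x" if "y \<in> cyc_sub Atilde E x" for u y
    using that by (auto simp: cyc_sub_def simp flip: smul_mult[OF x])
qed

lemma cyc_sub_least: "submodule H Atilde E \<Longrightarrow> x \<in> H \<Longrightarrow> cyc_sub Atilde E x \<subseteq> H"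
  using submodD(4)[of H] by (auto simp: cyc_sub_def)

lemma cyc_sub_self: "x \<in> carrier E \<Longrightarrow> x \<in> cyc_sub Atilde E x"
  unfolding cyc_sub_def by (auto intro!: exI[of _ 1])

lemma cyc_subE: "y \<in> cyc_sub Atilde E x \<Longrightarrow> (\<And>u. y = u \<odot> x \<Longrightarrow> thesis) \<Longrightarrow> thesis"
  by (auto simp: cyc_sub_def)

end

lemma cyc_sub_restrict [simp]: "cyc_sub Atilde (E \<downharpoonright> G) x = cyc_sub Atilde E x"
  by (simp add: cyc_sub_def)

lemma lmod_homI:
  assumes "\<And>x. x \<in> carrier M \<Longrightarrow> f x \<in> carrier N"
    "\<And>x y. x \<in> carrier M \<Longrightarrow> y \<in> carrier M \<Longrightarrow> f (x \<oplus>\<^bsub>M\<^esub> y) = f x \<oplus>\<^bsub>N\<^esub> f y"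
    "\<And>u x. x \<in> carrier M \<Longrightarrow> f (u \<odot>\<^bsub>M\<^esub> x) = u \<odot>\<^bsub>N\<^esub> f x"
  shows "f \<in> lmod_hom Atilde M N"
  using assms by (auto simp: lmod_hom_def hom_def)

lemma lmod_homD:
  assumes "f \<in> lmod_hom Atilde M N"
  shows "\<And>x. x \<in> carrier M \<Longrightarrow> f x \<in> carrier N"
    "\<And>x y. x \<in> carrier M \<Longrightarrow> y \<in> carrier M \<Longrightarrow> f (x \<oplus>\<^bsub>M\<^esub> y) = f x \<oplus>\<^bsub>N\<^esub> f y"
    "\<And>u x. x \<in> carrier M \<Longrightarrow> f (u \<odot>\<^bsub>M\<^esub> x) = u \<odot>\<^bsub>N\<^esub> f x"
  using assms by (auto simp: lmod_hom_def hom_def)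

lemma lmod_hom_zero:
  assumes "abmod M" "abmod N" "f \<in> lmod_hom Atilde M N"
  shows "f \<zero>\<^bsub>M\<^esub> = \<zero>\<^bsub>N\<^esub>"
proof -
  interpret M: abmod M by fact
  interpret N: abmod N by fact
  have "f (0 \<odot>\<^bsub>M\<^esub> \<zero>\<^bsub>M\<^esub>) = 0 \<odot>\<^bsub>N\<^esub> f \<zero>\<^bsub>M\<^esub>" using lmod_homD(3)[OF assms(3)] by blast
  then show ?thesis using lmod_homD(1)[OF assms(3)] by simp
qed

lemma lmod_hom_comp: "f \<in> lmod_hom Atilde M N \<Longrightarrow> g \<in> lmod_hom Atilde N P \<Longrightarrow> g \<circ> f \<in> lmod_hom Atilde M P"
  by (intro lmod_homI) (simp_all add: lmod_homD)

lemma ab_iso_trans: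
  assumes "M \<simeq> N" "N \<simeq> P" shows "M \<simeq> P"
proof -
  from assms obtain f g where "f \<in> lmod_hom Atilde M N" "bij_betw f (carrier M) (carrier N)"
    "g \<in> lmod_hom Atilde N P" "bij_betw g (carrier N) (carrier P)"
    by (auto simp: lmod_iso_def)
  then show ?thesis unfolding lmod_iso_def by (intro bexI[of _ "g \<circ> f"] bij_betw_trans lmod_hom_comp)
qed

lemma ab_iso_sym:
  assumes "abmod M" "M \<simeq> N" shows "N \<simeq> M"
proof -
  interpret M: abmod M by fact
  from assms obtain f where f: "f \<in> lmod_hom Atilde M N" "bij_betw f (carrier M) (carrier N)"
    by (auto simp: lmod_iso_def)
  let ?g = "inv_into (carrier M) f"
  have g: "?g y \<in> carrier M" "f (?g y) = y" if "y \<in> carrier N" for y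
    using f(2) that by (auto simp: bij_betw_def inv_into_into f_inv_into_f)
  have i: "?g (f x) = x" if "x \<in> carrier M" for x using f(2) that by (simp add: bij_betw_def)
  have "?g \<in> lmod_hom Atilde N M"
  proof (rule lmod_homI)
    fix x y assume "x \<in> carrier N" "y \<in> carrier N"
    then show "?g (x \<oplus>\<^bsub>N\<^esub> y) = ?g x \<oplus>\<^bsub>M\<^esub> ?g y"
      using i[of "?g x \<oplus>\<^bsub>M\<^esub> ?g y"] g lmod_homD(2)[OF f(1), of "?g x" "?g y"] by simp
  next
    fix u x assume "x \<in> carrier N"
    then show "?g (u \<odot>\<^bsub>N\<^esub> x) = u \<odot>\<^bsub>M\<^esub> ?g x"
      using i[of "u \<odot>\<^bsub>M\<^esub> ?g x"] g lmod_homD(3)[OF f(1), of "?g x" u] by simp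
  qed (rule g)
  then show ?thesis unfolding lmod_iso_def using bij_betw_inv_into[OF f(2)] by blast
qed

context abmod
begin

context
  fixes H assumes H: "submodule H Atilde E"
begin

interpretation HA: abelian_subgroup H E
proof -
  interpret H: submodule H Atilde E by (rule H)
  show "abelian_subgroup H E"
    by (intro abelian_subgroupI3 additive_subgroup.intro H.subgroup_axioms M.abelian_group_axioms)
qed

lemma quot_coset_eq:
  assumes "x \<in> carrier E" "y \<in> carrier E"
  shows "H +> x = H +> y \<longleftrightarrow> x \<ominus> y \<in> H"
proof
  assume "H +> x = H +> y"
  then have "x \<in> H +> y" using HA.a_rcos_self[OF assms(1)] by simp
  then obtain h where "h \<in> H" "x = h \<oplus> y" by (auto simp: a_r_coset_def')
  then show "x \<ominus> y \<in> H" using assms submodD(6)[OF H] by (simp add: a_minus_def M.a_assoc M.r_neg)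
next
  assume "x \<ominus> y \<in> H"
  moreover have "x = (x \<ominus> y) \<oplus> y" using assms by (simp add: minus_add_cancel)
  ultimately have "x \<in> H +> y" by (auto simp: a_r_coset_def')
  then show "H +> x = H +> y" using M.a_repr_independence[OF _ assms(2) HA.a_subgroup] by auto
qed

lemma quot_carrier: "carrier (E LQuot H) = (\<lambda>x. H +> x) ` carrier E"
  by (auto simp: lmod_quot_def A_RCOSETS_def')

lemma quot_add: "x \<in> carrier E \<Longrightarrow> y \<in> carrier E \<Longrightarrow> (H +> x) \<oplus>\<^bsub>E LQuot H\<^esub> (H +> y) = H +> (x \<oplus> y)"
  using HA.a_rcos_sum by (simp add: lmod_quot_def)

lemma quot_zero: "\<zero>\<^bsub>E LQuot H\<^esub> = H +> \<zero>"
  using M.a_coset_add_zero[OF HA.a_subset] by (simp add: lmod_quot_def)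

lemma quot_smul:
  assumes x: "x \<in> carrier E"
  shows "u \<odot>\<^bsub>E LQuot H\<^esub> (H +> x) = H +> (u \<odot> x)"
proof -
  have "H +> (u \<odot> y) = H +> (u \<odot> x)" if "y \<in> H +> x" for y
  proof -
    from that obtain h where h: "h \<in> H" "y = h \<oplus> x" by (auto simp: a_r_coset_def')
    then have "u \<odot> y \<ominus> u \<odot> x = u \<odot> h"
      using x submodD(6)[OF H] by (simp add: smul_add_right a_minus_def M.a_assoc M.r_neg)
    then show ?thesis using h x submodD(6)[OF H h(1)] submodD(4)[OF H h(1)] by (subst quot_coset_eq) auto
  qed
  moreover have "x \<in> H +> x" using HA.a_rcos_self[OF x] .
  ultimately have "(\<Union>y\<in>H +> x. H +> (u \<odot> y)) = H +> (u \<odot> x)" by blast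
  then show ?thesis by (simp add: lmod_quot_def)
qed

lemma quot_proj_hom: "(\<lambda>x. H +> x) \<in> lmod_hom Atilde E (E LQuot H)"
  by (rule lmod_homI) (auto simp: quot_carrier quot_add quot_smul)

lemma quot_eq_zero: "x \<in> carrier E \<Longrightarrow> H +> x = \<zero>\<^bsub>E LQuot H\<^esub> \<longleftrightarrow> x \<in> H"
  using quot_coset_eq[of x \<zero>] neg_eq[of \<zero>] by (simp add: quot_zero a_minus_def)

lemma rcos_self: "x \<in> carrier E \<Longrightarrow> x \<in> H +> x"
  by (rule HA.a_rcos_self)

lemma rcos_memD: "y \<in> H +> x \<Longrightarrow> x \<in> carrier E \<Longrightarrow> y \<in> carrier E \<and> H +> y = H +> x"
proof -
  assume y: "y \<in> H +> x" and x: "x \<in> carrier E"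
  then obtain h where h: "h \<in> H" "y = h \<oplus> x" by (auto simp: a_r_coset_def')
  then have "y \<ominus> x = h" "y \<in> carrier E" using x submodD(6)[OF H] by (simp_all add: a_minus_def M.a_assoc M.r_neg)
  then show ?thesis using quot_coset_eq[of y x] h x by auto
qed

end

end

text \<open>Cosets, their sums and their multiples are defined without reference to the carrier,
  hence an equality of structures and not just an isomorphism. It lets semi-simplicity of E/F_1 pass
  to quotients of submodules.\<close>

lemma lmod_quot_sub: "G \<subseteq> carrier E \<Longrightarrow> (E \<downharpoonright> G) LQuot H = (E LQuot H) \<downharpoonright> ((\<lambda>x. H +>\<^bsub>E\<^esub> x) ` G)"
  by (auto simp: lmod_quot_def A_RCOSETS_def' a_r_coset_def' set_add_def' fun_eq_iff)

lemma regular_abmod: "abmod (regular_lmod Atilde)"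
  by (intro abmod.intro left_module_regular Atilde_ring)

text \<open>The map u x -> class of u is well defined and injective because the annihilator of x is
  the left ideal of \<open>P\<close>; the choice of u by SOME is therefore harmless.\<close>

lemma ab_cyclic_iso:
  assumes "abmod M" "x \<in> carrier M" "cyc_sub Atilde M x = carrier M"
    "\<And>u. u \<odot>\<^bsub>M\<^esub> x = \<zero>\<^bsub>M\<^esub> \<longleftrightarrow> (\<exists>q. u = ab_mult q P)"
  shows "M \<simeq> ab_cyclic P"
proof -
  interpret M: abmod M by fact
  interpret R: abmod "regular_lmod Atilde" by (rule regular_abmod)
  let ?I = "cyc_sub Atilde (regular_lmod Atilde) P"
  have I: "submodule ?I Atilde (regular_lmod Atilde)"
    by (rule R.cyc_sub_submodule) (simp add: regular_lmod_def)
  interpret Q: abmod "ab_cyclic P" unfolding ab_cyclic_def by (rule R.quot_abmod[OF I])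
  have car: "u \<in> carrier (regular_lmod Atilde)" for u by (simp add: regular_lmod_def)
  have sm: "u \<odot>\<^bsub>regular_lmod Atilde\<^esub> v = ab_mult u v" "u \<oplus>\<^bsub>regular_lmod Atilde\<^esub> v = u + v" for u v
    by (auto simp: regular_lmod_def)
  have mi: "u \<ominus>\<^bsub>regular_lmod Atilde\<^esub> v = u - v" for u v
  proof -
    have "\<ominus>\<^bsub>regular_lmod Atilde\<^esub> v = - v"
      by (rule R.M.minus_equality) (auto simp: regular_lmod_def)
    then show ?thesis by (simp add: a_minus_def sm)
  qed
  define g where "g u = ?I +>\<^bsub>regular_lmod Atilde\<^esub> u" for u
  have g: "g u = g v \<longleftrightarrow> (u - v) \<odot>\<^bsub>M\<^esub> x = \<zero>\<^bsub>M\<^esub>" for u v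
    using R.quot_coset_eq[OF I car car, of u v] unfolding g_def assms(4) mi
    by (auto simp: cyc_sub_def sm)
  have gx: "g u = g v \<longleftrightarrow> u \<odot>\<^bsub>M\<^esub> x = v \<odot>\<^bsub>M\<^esub> x" for u v
    unfolding g using assms(2) by (simp add: M.smul_minus M.minus_eq_0_iff)
  have gc: "carrier (ab_cyclic P) = range g"
    unfolding ab_cyclic_def R.quot_carrier[OF I] g_def by (simp add: regular_lmod_def)
  define f where "f y = g (SOME u. y = u \<odot>\<^bsub>M\<^esub> x)" for y
  have f: "f (u \<odot>\<^bsub>M\<^esub> x) = g u" for u
    unfolding f_def gx by (rule someI[of "\<lambda>v. u \<odot>\<^bsub>M\<^esub> x = v \<odot>\<^bsub>M\<^esub> x", symmetric]) simp
  have ex: "\<exists>u. y = u \<odot>\<^bsub>M\<^esub> x" if "y \<in> carrier M" for y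
    using that unfolding assms(3)[symmetric] by (auto simp: cyc_sub_def)
  have "f \<in> lmod_hom Atilde M (ab_cyclic P)"
  proof (rule lmod_homI)
    fix y z assume "y \<in> carrier M" "z \<in> carrier M"
    then obtain u v where uv: "y = u \<odot>\<^bsub>M\<^esub> x" "z = v \<odot>\<^bsub>M\<^esub> x" using ex by metis
    then show "f y \<in> carrier (ab_cyclic P)" by (simp add: f gc)
    have "y \<oplus>\<^bsub>M\<^esub> z = (u + v) \<odot>\<^bsub>M\<^esub> x" using uv assms(2) by (simp add: M.smul_add_left)
    then show "f (y \<oplus>\<^bsub>M\<^esub> z) = f y \<oplus>\<^bsub>ab_cyclic P\<^esub> f z"
      using R.quot_add[OF I car car, of u v] uv by (simp add: f g_def ab_cyclic_def sm)
    show "f (w \<odot>\<^bsub>M\<^esub> y) = w \<odot>\<^bsub>ab_cyclic P\<^esub> f y" for w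
      using R.quot_smul[OF I car, of w u] uv assms(2) M.smul_mult[of x w u, symmetric]
      by (simp add: f g_def ab_cyclic_def sm)
  qed
  moreover have "bij_betw f (carrier M) (carrier (ab_cyclic P))"
    unfolding bij_betw_def
  proof
    show "inj_on f (carrier M)"
      by (rule inj_onI) (metis ex f gx)
    show "f ` carrier M = carrier (ab_cyclic P)"
      unfolding gc using ex f assms(2) by (auto simp: image_iff) (metis M.smul_closed)
  qed
  ultimately show ?thesis unfolding lmod_iso_def by blast
qed

lemma ab_cyclic_isoD:
  assumes "abmod M" "M \<simeq> ab_cyclic P"
  obtains x where "x \<in> carrier M" "cyc_sub Atilde M x = carrier M"
    "\<And>u. u \<odot>\<^bsub>M\<^esub> x = \<zero>\<^bsub>M\<^esub> \<longleftrightarrow> (\<exists>q. u = ab_mult q P)"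
proof -
  interpret M: abmod M by fact
  interpret R: abmod "regular_lmod Atilde" by (rule regular_abmod)
  let ?I = "cyc_sub Atilde (regular_lmod Atilde) P"
  have I: "submodule ?I Atilde (regular_lmod Atilde)"
    by (rule R.cyc_sub_submodule) (simp add: regular_lmod_def)
  interpret Q: abmod "ab_cyclic P" unfolding ab_cyclic_def by (rule R.quot_abmod[OF I])
  have car: "u \<in> carrier (regular_lmod Atilde)" for u by (simp add: regular_lmod_def)
  define g where "g u = ?I +>\<^bsub>regular_lmod Atilde\<^esub> u" for u
  have g0: "g u = \<zero>\<^bsub>ab_cyclic P\<^esub> \<longleftrightarrow> (\<exists>q. u = ab_mult q P)" for u
    using R.quot_eq_zero[OF I car, of u] by (auto simp: g_def ab_cyclic_def cyc_sub_def regular_lmod_def)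
  have gm: "g u = u \<odot>\<^bsub>ab_cyclic P\<^esub> g 1" for u
    using R.quot_smul[OF I car, of u 1] by (simp add: g_def ab_cyclic_def regular_lmod_def ab_mult_1_right)
  have gc: "carrier (ab_cyclic P) = range g"
    unfolding ab_cyclic_def R.quot_carrier[OF I] g_def by (simp add: regular_lmod_def)
  from ab_iso_sym[OF assms] obtain f where f: "f \<in> lmod_hom Atilde (ab_cyclic P) M" "bij_betw f (carrier (ab_cyclic P)) (carrier M)"
    by (auto simp: lmod_iso_def)
  have c: "g u \<in> carrier (ab_cyclic P)" for u by (simp add: gc)
  have fu: "u \<odot>\<^bsub>M\<^esub> f (g 1) = f (g u)" for u
    using lmod_homD(3)[OF f(1) c, of u 1] gm[of u] by simp
  show ?thesis
  proof
    show "f (g 1) \<in> carrier M" using lmod_homD(1)[OF f(1) c] .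
    show "cyc_sub Atilde M (f (g 1)) = carrier M"
      using f(2) unfolding gc bij_betw_def by (auto simp: cyc_sub_def fu)
    have "f \<zero>\<^bsub>ab_cyclic P\<^esub> = \<zero>\<^bsub>M\<^esub>" by (rule lmod_hom_zero[OF Q.abmod_axioms M.abmod_axioms f(1)])
    then have "f (g u) = \<zero>\<^bsub>M\<^esub> \<longleftrightarrow> g u = \<zero>\<^bsub>ab_cyclic P\<^esub>" for u
      using f(2) c Q.M.zero_closed unfolding bij_betw_def by (metis inj_onD)
    then show "u \<odot>\<^bsub>M\<^esub> f (g 1) = \<zero>\<^bsub>M\<^esub> \<longleftrightarrow> (\<exists>q. u = ab_mult q P)" for u
      by (simp add: fu g0)
  qed
qed

section \<open>Coordinates with values in power series\<close>

text \<open>The action of a on a rank 1 module C[[b]] e with a e = R e, read off on the coefficient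
  f of f e.\<close>

definition rop :: "complex fps \<Rightarrow> complex fps \<Rightarrow> complex fps" where
  "rop R f = R * f + fps_X\<^sup>2 * fps_deriv f"

abbreviation dop :: "complex \<Rightarrow> complex fps \<Rightarrow> complex fps" where
  "dop \<kappa> \<equiv> rop (fps_const \<kappa> * fps_X)"

text \<open>A homomorphism to the rank 1 module on C[[b]] with a 1 = R, expressed without
  constructing that module. By \<open>eqv_transfer\<close> the two conditions on b and a control the
  whole algebra.\<close>

definition bhom :: "'m ab_mod \<Rightarrow> complex fps \<Rightarrow> ('m \<Rightarrow> complex fps) \<Rightarrow> bool" where
  "bhom E R \<chi> \<longleftrightarrow> (\<forall>x\<in>carrier E. \<forall>y\<in>carrier E. \<chi> (x \<oplus>\<^bsub>E\<^esub> y) = \<chi> x + \<chi> y) \<and>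
     (\<forall>x\<in>carrier E. \<forall>S. \<chi> (bmul E S x) = S * \<chi> x) \<and> (\<forall>x\<in>carrier E. \<chi> (ab_a \<odot>\<^bsub>E\<^esub> x) = rop R (\<chi> x))"

text \<open>Unlike in \<open>bhom\<close>, the operator \<open>A\<close> may mix the coordinates;
  this accommodates the term with c.\<close>

definition eqv :: "'m ab_mod \<Rightarrow> ((nat \<Rightarrow> complex fps) \<Rightarrow> nat \<Rightarrow> complex fps) \<Rightarrow> ('m \<Rightarrow> nat \<Rightarrow> complex fps) \<Rightarrow> bool" where
  "eqv E A \<psi> \<longleftrightarrow> (\<forall>x\<in>carrier E. \<forall>y\<in>carrier E. \<psi> (x \<oplus>\<^bsub>E\<^esub> y) = (\<lambda>j. \<psi> x j + \<psi> y j)) \<and>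
     (\<forall>x\<in>carrier E. \<forall>S. \<psi> (bmul E S x) = (\<lambda>j. S * \<psi> x j)) \<and> (\<forall>x\<in>carrier E. \<psi> (ab_a \<odot>\<^bsub>E\<^esub> x) = A (\<psi> x))"

text \<open>The one entry off the diagonal is the logarithmic part. The index \<open>k\<close> is a
  parameter because the reductions shorten the list of coordinates while c stays attached to the
  last one.\<close>

definition logop :: "complex \<Rightarrow> complex \<Rightarrow> nat \<Rightarrow> (nat \<Rightarrow> complex fps) \<Rightarrow> nat \<Rightarrow> complex fps" where
  "logop \<kappa> c k f j = dop \<kappa> (f j) + (if j = 1 then fps_const c * fps_X * f k else 0)"

lemma X2_deriv_nth: "(fps_X\<^sup>2 * fps_deriv f) $ n = (of_nat (n - 1) * f $ (n - 1) :: complex)"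
proof (cases n)
  case (Suc m) then show ?thesis by (cases m) (auto simp: power2_eq_square mult.assoc)
qed (simp add: power2_eq_square mult.assoc)

lemma dop_nth: "dop \<kappa> f $ n = (if n = 0 then 0 else (\<kappa> + of_nat (n - 1)) * f $ (n - 1))"
  by (simp add: rop_def X2_deriv_nth mult.assoc) (simp add: algebra_simps)

lemma rop_minus: "rop R f - rop R g = rop R (f - g)" and rop_0 [simp]: "rop R 0 = 0"
  and rop_add: "rop R (f + g) = rop R f + rop R g" and rop_cmult: "rop R (fps_const c * f) = fps_const c * rop R f"
  by (auto simp: rop_def algebra_simps)

lemma rop_mult: "rop R (S * f) = S * rop R f + fps_X\<^sup>2 * fps_deriv S * f"
  by (simp add: rop_def algebra_simps)

lemma bhomD:
  assumes "bhom E R \<chi>" "x \<in> carrier E"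
  shows "y \<in> carrier E \<Longrightarrow> \<chi> (x \<oplus>\<^bsub>E\<^esub> y) = \<chi> x + \<chi> y" "\<chi> (bmul E S x) = S * \<chi> x" "\<chi> (ab_a \<odot>\<^bsub>E\<^esub> x) = rop R (\<chi> x)"
  using assms by (auto simp: bhom_def)

lemma eqvD:
  assumes "eqv E A \<psi>" "x \<in> carrier E"
  shows "y \<in> carrier E \<Longrightarrow> \<psi> (x \<oplus>\<^bsub>E\<^esub> y) = (\<lambda>j. \<psi> x j + \<psi> y j)" "\<psi> (bmul E S x) = (\<lambda>j. S * \<psi> x j)"
    "\<psi> (ab_a \<odot>\<^bsub>E\<^esub> x) = A (\<psi> x)"
  using assms by (auto simp: eqv_def)

lemma eqv_bhom: "bhom E R \<chi> \<Longrightarrow> eqv E (\<lambda>f j. rop R (f j)) (\<lambda>x j. \<chi> x)"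
  by (auto simp: bhom_def eqv_def)

lemma bhom_sub: "bhom E R \<chi> \<Longrightarrow> H \<subseteq> carrier E \<Longrightarrow> bhom (E \<downharpoonright> H) R \<chi>"
  by (auto simp: bhom_def subset_iff)

text \<open>
  Writing \<open>u = P(a) + b w\<close>, the coefficient of index \<open>n\<close> of the coordinates of \<open>u x\<close> only involves the
  coordinates of \<open>x\<close> and coefficients of index \<open>n - 1\<close> of those of \<open>w x\<close>.
\<close>

lemma eqv_transfer:
  assumes "abmod E" "abmod E'" "eqv E A \<psi>" "eqv E' A \<psi>'" "x \<in> carrier E" "x' \<in> carrier E'" "\<psi> x = \<psi>' x'"
  shows "\<psi> (u \<odot>\<^bsub>E\<^esub> x) = \<psi>' (u \<odot>\<^bsub>E'\<^esub> x')"
proof -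
  interpret E: abmod E by fact
  interpret E': abmod E' by fact
  have const: "\<psi> (fps_const P \<odot>\<^bsub>E\<^esub> x) = \<psi>' (fps_const P \<odot>\<^bsub>E'\<^esub> x')" for P
  proof (induction P)
    case 0 show ?case using eqvD(2)[OF assms(3,5), of 0] eqvD(2)[OF assms(4,6), of 0] by simp
  next
    case (pCons p P)
    have e: "fps_const (pCons p P) = ab_of_b (fps_const p) + ab_mult ab_a (fps_const P)"
      by (auto simp: ab_of_b_const ab_a_def ab_mult_const_left)
    show ?case unfolding e using assms(5-7) pCons.IH
      by (simp add: E.smul_add_left E'.smul_add_left E.smul_mult E'.smul_mult eqvD[OF assms(3)] eqvD[OF assms(4)])
  qed
  have "\<psi> (u \<odot>\<^bsub>E\<^esub> x) j $ n = \<psi>' (u \<odot>\<^bsub>E'\<^esub> x') j $ n" for j n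
  proof (induction n arbitrary: u)
    case (0 u)
    obtain w where "u = fps_const (u $ 0) + ab_mult ab_b w" using ab_series_decomp by blast
    then have "u \<odot>\<^bsub>E\<^esub> x = fps_const (u $ 0) \<odot>\<^bsub>E\<^esub> x \<oplus>\<^bsub>E\<^esub> bmul E fps_X (w \<odot>\<^bsub>E\<^esub> x)"
       "u \<odot>\<^bsub>E'\<^esub> x' = fps_const (u $ 0) \<odot>\<^bsub>E'\<^esub> x' \<oplus>\<^bsub>E'\<^esub> bmul E' fps_X (w \<odot>\<^bsub>E'\<^esub> x')"
      using assms by (metis E.smul_add_left E.smul_mult, metis E'.smul_add_left E'.smul_mult)
    then show ?case using assms(5,6) const by (simp add: eqvD[OF assms(3)] eqvD[OF assms(4)])
  next
    case (Suc n u)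
    obtain w where "u = fps_const (u $ 0) + ab_mult ab_b w" using ab_series_decomp by blast
    then have "u \<odot>\<^bsub>E\<^esub> x = fps_const (u $ 0) \<odot>\<^bsub>E\<^esub> x \<oplus>\<^bsub>E\<^esub> bmul E fps_X (w \<odot>\<^bsub>E\<^esub> x)"
       "u \<odot>\<^bsub>E'\<^esub> x' = fps_const (u $ 0) \<odot>\<^bsub>E'\<^esub> x' \<oplus>\<^bsub>E'\<^esub> bmul E' fps_X (w \<odot>\<^bsub>E'\<^esub> x')"
      using assms by (metis E.smul_add_left E.smul_mult, metis E'.smul_add_left E'.smul_mult)
    then show ?case using assms(5,6) const Suc[of w] by (simp add: eqvD[OF assms(3)] eqvD[OF assms(4)])
  qed
  then show ?thesis by (simp add: fun_eq_iff fps_eq_iff)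
qed

context abmod
begin

lemma eqv_zero: "eqv E A \<psi> \<Longrightarrow> \<psi> \<zero> j = 0"
  using eqvD(2)[of E A \<psi> \<zero> 0] by simp

lemma eqv_minus: "eqv E A \<psi> \<Longrightarrow> x \<in> carrier E \<Longrightarrow> y \<in> carrier E \<Longrightarrow> \<psi> (x \<ominus> y) j = \<psi> x j - \<psi> y j"
proof -
  assume e: "eqv E A \<psi>" and xy: "x \<in> carrier E" "y \<in> carrier E"
  have "x \<ominus> y = x \<oplus> bmul E (- 1) y" using xy by (simp add: a_minus_def ab_of_b_minus smul_uminus)
  then show ?thesis using xy by (simp add: eqvD[OF e])
qed

lemma bhom_zero: "bhom E R \<chi> \<Longrightarrow> \<chi> \<zero> = 0"
  using eqv_zero[OF eqv_bhom] by blast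

lemma bhom_minus: "bhom E R \<chi> \<Longrightarrow> x \<in> carrier E \<Longrightarrow> y \<in> carrier E \<Longrightarrow> \<chi> (x \<ominus> y) = \<chi> x - \<chi> y"
  using eqv_minus[OF eqv_bhom] by blast

lemma bhom_smul_0: "bhom E R \<chi> \<Longrightarrow> x \<in> carrier E \<Longrightarrow> \<chi> x = 0 \<Longrightarrow> \<chi> (u \<odot> x) = 0"
proof -
  assume h: "bhom E R \<chi>" and x: "x \<in> carrier E" "\<chi> x = 0"
  have "(\<lambda>j::nat. \<chi> (u \<odot> x)) = (\<lambda>j. \<chi> (u \<odot> \<zero>))"
    by (rule eqv_transfer[OF abmod_axioms abmod_axioms eqv_bhom[OF h] eqv_bhom[OF h] x(1)])
       (use x bhom_zero[OF h] in auto)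
  then show ?thesis using bhom_zero[OF h] by (simp add: fun_eq_iff)
qed

lemma bhom_lin: "bhom E R \<chi> \<Longrightarrow> x \<in> carrier E \<Longrightarrow> \<chi> (ab_lin l \<odot> x) = rop (R - fps_const l * fps_X) (\<chi> x)"
  by (simp add: lin_smul bhom_minus bhomD rop_def algebra_simps)

lemma bhom_dop_lin_nth:
  assumes "bhom E (fps_const \<kappa> * fps_X) \<chi>" "x \<in> carrier E"
  shows "\<chi> (ab_lin l \<odot> x) $ n = (if n = 0 then 0 else (\<kappa> + of_nat (n - 1) - l) * \<chi> x $ (n - 1))"
proof -
  have "fps_const \<kappa> * fps_X - fps_const l * fps_X = fps_const (\<kappa> - l) * fps_X"
    by (simp add: fps_const_sub[symmetric] algebra_simps del: fps_const_sub)
  then show ?thesis by (simp only: bhom_lin[OF assms] dop_nth) (simp add: algebra_simps)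
qed

lemma bhom_ker_sub:
  assumes "\<And>i. i \<in> I \<Longrightarrow> \<exists>R. bhom E R (\<chi> i)"
  shows "submodule {x \<in> carrier E. \<forall>i\<in>I. \<chi> i x = 0} Atilde E"
proof (rule submodI)
  show "\<zero> \<in> {x \<in> carrier E. \<forall>i\<in>I. \<chi> i x = 0}" using assms bhom_zero by fastforce
  show "x \<oplus> y \<in> {x \<in> carrier E. \<forall>i\<in>I. \<chi> i x = 0}"
    if "x \<in> {x \<in> carrier E. \<forall>i\<in>I. \<chi> i x = 0}" "y \<in> {x \<in> carrier E. \<forall>i\<in>I. \<chi> i x = 0}" for x y
    using that assms by (auto simp: bhomD) (metis add_0 bhomD(1))
  show "u \<odot> x \<in> {x \<in> carrier E. \<forall>i\<in>I. \<chi> i x = 0}" if "x \<in> {x \<in> carrier E. \<forall>i\<in>I. \<chi> i x = 0}" for u x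
    using that assms by (auto dest: bhom_smul_0)
qed auto

end

lemma bhom_cmult: "bhom E R \<chi> \<Longrightarrow> bhom E R (\<lambda>x. fps_const c * \<chi> x)"
  by (auto simp: bhom_def rop_cmult algebra_simps)

lemma bhom_diff: "bhom E R \<chi> \<Longrightarrow> bhom E R \<chi>' \<Longrightarrow> bhom E R (\<lambda>x. \<chi> x - \<chi>' x)"
  by (auto simp: bhom_def rop_minus[symmetric] algebra_simps)

text \<open>A gauge change: passing from f to U f replaces R by R - b^2 U'/U.\<close>

lemma bhom_rescale:
  assumes "bhom E R \<chi>" "fps_X\<^sup>2 * fps_deriv U = (R - R') * U"
  shows "bhom E R' (\<lambda>x. U * \<chi> x)"
proof -
  have "U * rop R f = rop R' (U * f)" for f
    unfolding rop_mult assms(2) by (simp add: rop_def algebra_simps)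
  then show ?thesis using assms(1) by (auto simp: bhom_def algebra_simps)
qed

text \<open>Coordinates without a generator. The exponents \<open>n\<close> are here only a strictly
  increasing sequence; \<open>vals\<close> attaches them to elements. For k = 1 the extra term would
  lead from coordinate 1 to itself and shift \<kappa>, hence c = 0 in that case.\<close>

locale coords = abmod E for E :: "'m ab_mod" (structure) +
  fixes k :: nat and \<kappa> c :: complex and \<psi> :: "'m \<Rightarrow> nat \<Rightarrow> complex fps" and n :: "nat \<Rightarrow> nat"
  assumes k: "1 \<le> k" and c: "k = 1 \<Longrightarrow> c = 0"
    and eqv: "eqv E (logop \<kappa> c k) \<psi>"
    and out: "\<And>x j. x \<in> carrier E \<Longrightarrow> j \<notin> {1..k} \<Longrightarrow> \<psi> x j = 0"
    and inj: "\<And>x. x \<in> carrier E \<Longrightarrow> (\<And>j. j \<in> {1..k} \<Longrightarrow> \<psi> x j = 0) \<Longrightarrow> x = \<zero>"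
    and mono: "\<And>i j. 1 \<le> i \<Longrightarrow> i < j \<Longrightarrow> j \<le> k \<Longrightarrow> n i < n j"
begin

lemma psi_add: "x \<in> carrier E \<Longrightarrow> y \<in> carrier E \<Longrightarrow> \<psi> (x \<oplus> y) j = \<psi> x j + \<psi> y j"
  using eqvD(1)[OF eqv] by simp

lemma psi_minus: "x \<in> carrier E \<Longrightarrow> y \<in> carrier E \<Longrightarrow> \<psi> (x \<ominus> y) j = \<psi> x j - \<psi> y j"
  by (rule eqv_minus[OF eqv])

lemma psi_bmul: "x \<in> carrier E \<Longrightarrow> \<psi> (bmul E S x) j = S * \<psi> x j"
  using eqvD(2)[OF eqv] by simp

lemma psi_zero [simp]: "\<psi> \<zero> j = 0"
  by (rule eqv_zero[OF eqv])

lemma psi_a: "x \<in> carrier E \<Longrightarrow> \<psi> (ab_a \<odot> x) j = dop \<kappa> (\<psi> x j) + (if j = 1 then fps_const c * fps_X * \<psi> x k else 0)"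
  using eqvD(3)[OF eqv] by (simp add: logop_def)

text \<open>Apart from the term with c, a - l b moves the coefficient of index m - 1 to index m with
  the factor \<kappa> + m - 1 - l. A suitable l erases one chosen coefficient and scales the others
  by differences of indices.\<close>

lemma psi_lin_nth: "x \<in> carrier E \<Longrightarrow> \<psi> (ab_lin l \<odot> x) j $ m =
    (if m = 0 then 0 else (\<kappa> + of_nat (m - 1) - l) * \<psi> x j $ (m - 1) + (if j = 1 then c * \<psi> x k $ (m - 1) else 0))"
  by (simp add: lin_smul psi_minus psi_a psi_bmul dop_nth mult.assoc) (simp add: algebra_simps)

lemma bhom_psi: "j \<noteq> 1 \<Longrightarrow> bhom E (fps_const \<kappa> * fps_X) (\<lambda>x. \<psi> x j)"
  by (simp add: bhom_def psi_add psi_bmul psi_a)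

lemma psi_eqI: "x \<in> carrier E \<Longrightarrow> y \<in> carrier E \<Longrightarrow> (\<And>j. j \<in> {1..k} \<Longrightarrow> \<psi> x j = \<psi> y j) \<Longrightarrow> x = y"
  using inj[of "x \<ominus> y"] by (simp add: psi_minus minus_eq_0_iff)

lemma b_inj: "x \<in> carrier E \<Longrightarrow> y \<in> carrier E \<Longrightarrow> S \<noteq> 0 \<Longrightarrow> bmul E S x = bmul E S y \<Longrightarrow> x = y"
  by (rule psi_eqI) (metis psi_bmul mult_cancel_left)+

text \<open>
  By \<open>d 1 \<le> d k\<close>, the term \<open>c b \<psi>\<^sub>k\<close> in the first coordinate does not affect the leading coefficient.
\<close>

lemma psi_val:
  assumes d: "d 1 \<le> d k" and x: "x \<in> carrier E" "\<And>j i. i < d j \<Longrightarrow> \<psi> x j $ i = 0"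
  shows "i < d j \<Longrightarrow> \<psi> (u \<odot> x) j $ i = 0"
    and "\<psi> (u \<odot> x) j $ d j = coeff (u $ 0) 0 * \<psi> x j $ d j"
proof -
  \<comment> \<open>The elements of order at least d. On them a raises all orders by 1, so only the
    constant term of the polynomial part of u reaches index d j.\<close>
  define W where "W = {y \<in> carrier E. \<forall>j. \<forall>i<d j. \<psi> y j $ i = 0}"
  have aW: "\<psi> (ab_a \<odot> y) j $ i = 0" if "y \<in> W" "i \<le> d j" for y i j
  proof -
    have y: "y \<in> carrier E" "\<And>j i. i < d j \<Longrightarrow> \<psi> y j $ i = 0" using that by (auto simp: W_def)
    show ?thesis
    proof (cases i)
      case (Suc i')
      then have "\<psi> y j $ i' = 0" "j = 1 \<Longrightarrow> \<psi> y k $ i' = 0" using that d by (auto intro!: y(2))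
      then show ?thesis using Suc by (auto simp: psi_a[OF y(1)] dop_nth mult.assoc)
    qed (simp add: psi_a[OF y(1)] dop_nth mult.assoc)
  qed
  have P: "fps_const P \<odot> x \<in> W \<and> (\<forall>j. \<psi> (fps_const P \<odot> x) j $ d j = coeff P 0 * \<psi> x j $ d j)" for P
  proof (induction P)
    case 0 then show ?case using x by (simp add: W_def)
  next
    case (pCons p P)
    have "fps_const (pCons p P) = ab_of_b (fps_const p) + ab_mult ab_a (fps_const P)"
      by (auto simp: ab_of_b_const ab_a_def ab_mult_const_left)
    then have e: "fps_const (pCons p P) \<odot> x = bmul E (fps_const p) x \<oplus> ab_a \<odot> (fps_const P \<odot> x)"
      using x by (simp add: smul_add_left smul_mult)
    show ?case unfolding e using x pCons.IH aW[of "fps_const P \<odot> x"] by (simp add: W_def psi_add psi_bmul)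
  qed
  have u: "\<exists>w. u \<odot> x = fps_const (u $ 0) \<odot> x \<oplus> bmul E fps_X (w \<odot> x)" for u
  proof -
    obtain w where "u = fps_const (u $ 0) + ab_mult ab_b w" using ab_series_decomp by blast
    then have "u \<odot> x = fps_const (u $ 0) \<odot> x \<oplus> bmul E fps_X (w \<odot> x)"
      using x by (metis smul_add_left smul_mult)
    then show ?thesis by blast
  qed
  have W: "\<psi> (u \<odot> x) j $ i = 0" if "i < d j" for u j i
    using that
  proof (induction i arbitrary: u)
    case (0 u)
    from u obtain w where w: "u \<odot> x = fps_const (u $ 0) \<odot> x \<oplus> bmul E fps_X (w \<odot> x)" by blast
    show ?case unfolding w using 0 x P[of "u $ 0"] by (simp add: psi_add psi_bmul W_def)
  next
    case (Suc i u)
    from u obtain w where w: "u \<odot> x = fps_const (u $ 0) \<odot> x \<oplus> bmul E fps_X (w \<odot> x)" by blast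
    show ?case unfolding w using Suc x P[of "u $ 0"] by (simp add: psi_add psi_bmul W_def)
  qed
  show "i < d j \<Longrightarrow> \<psi> (u \<odot> x) j $ i = 0" by (rule W)
  from u obtain w where w: "u \<odot> x = fps_const (u $ 0) \<odot> x \<oplus> bmul E fps_X (w \<odot> x)" by blast
  have "(fps_X * \<psi> (w \<odot> x) j) $ d j = 0" using W[of "d j - 1" j w] by (cases "d j") auto
  then show "\<psi> (u \<odot> x) j $ d j = coeff (u $ 0) 0 * \<psi> x j $ d j"
    unfolding w using x P[of "u $ 0"] by (simp add: psi_add psi_bmul)
qed

lemma n_mono: "1 \<le> i \<Longrightarrow> i \<le> j \<Longrightarrow> j \<le> k \<Longrightarrow> n i \<le> n j"
  using mono[of i j] by (cases "i = j") auto

text \<open>In the presence of a suitable generator this is the principal Jordan-Hoelder sequence,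
  see \<open>frame_principal_JH\<close>.\<close>

definition fl :: "nat \<Rightarrow> 'm set" where
  "fl j = {x \<in> carrier E. \<forall>i>j. \<psi> x i = 0}"

lemma fl_sub: "submodule (fl j) Atilde E"
proof (cases "j = 0")
  case True
  \<comment> \<open>For j = 0 the conditions include coordinate 1, which fails to be a homomorphism
    if c is nonzero; the set is zero by injectivity instead.\<close>
  have "x = \<zero>" if "x \<in> fl j" for x using that True by (intro inj) (auto simp: fl_def)
  moreover have "\<zero> \<in> fl j" by (simp add: fl_def)
  ultimately have e: "fl j = {\<zero>}" by blast
  show ?thesis unfolding e by (rule submodI) simp_all
next
  case False
  have "fl j = {x \<in> carrier E. \<forall>i\<in>{j<..}. (\<lambda>x. \<psi> x i) x = 0}" by (auto simp: fl_def)
  also have "submodule \<dots> Atilde E" by (rule bhom_ker_sub, rule exI, rule bhom_psi) (use False in auto)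
  finally show ?thesis .
qed

lemma fl_0: "fl 0 = {\<zero>}"
proof -
  have "x = \<zero>" if "x \<in> fl 0" for x using that by (intro inj) (auto simp: fl_def)
  then show ?thesis by (auto simp: fl_def)
qed

lemma fl_k: "k \<le> j \<Longrightarrow> fl j = carrier E"
  by (auto simp: fl_def out)

lemma fl_carrier: "x \<in> fl j \<Longrightarrow> x \<in> carrier E" by (simp add: fl_def)

lemma fl_mono: "i \<le> j \<Longrightarrow> fl i \<subseteq> fl j" by (auto simp: fl_def)

end

text \<open>Elimination from the last coordinate downwards: on elements whose coordinates beyond j
  vanish, coordinate j takes values in the ideal of b^(d j) and attains its generator. Elements
  attaining these generators form a basis over C[[b]].\<close>

lemma ab_rank_triangular:
  assumes "abmod E"
    and add: "\<And>x y j. x \<in> carrier E \<Longrightarrow> y \<in> carrier E \<Longrightarrow> \<psi> (x \<oplus>\<^bsub>E\<^esub> y) j = \<psi> x j + \<psi> y j"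
    and sc: "\<And>x S j. x \<in> carrier E \<Longrightarrow> \<psi> (bmul E S x) j = S * \<psi> x j"
    and inj: "\<And>x. x \<in> carrier E \<Longrightarrow> (\<And>j. j \<in> {1..k} \<Longrightarrow> \<psi> x j = 0) \<Longrightarrow> x = \<zero>\<^bsub>E\<^esub>"
    and ex: "\<And>j. j \<in> {1..k} \<Longrightarrow> \<exists>y\<in>carrier E. (\<forall>i\<in>{j<..k}. \<psi> y i = 0) \<and> \<psi> y j = fps_X ^ d j"
    and dv: "\<And>x j. x \<in> carrier E \<Longrightarrow> j \<in> {1..k} \<Longrightarrow> (\<forall>i\<in>{j<..k}. \<psi> x i = 0) \<Longrightarrow> fps_X ^ d j dvd \<psi> x j"
  shows "ab_rank E k"
proof -
  interpret abmod E by fact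
  have minus: "\<psi> (x \<ominus>\<^bsub>E\<^esub> y) j = \<psi> x j - \<psi> y j" if "x \<in> carrier E" "y \<in> carrier E" for x y j
    using add[OF that(1), of "(- 1) \<odot>\<^bsub>E\<^esub> y" j] sc[OF that(2), of "- 1" j] that
    by (simp add: a_minus_def neg_eq[OF that(2)] ab_minus_1[symmetric])
  have "\<forall>i. \<exists>y. i < k \<longrightarrow> y \<in> carrier E \<and> (\<forall>j\<in>{Suc i<..k}. \<psi> y j = 0) \<and> \<psi> y (Suc i) = fps_X ^ d (Suc i)"
    using ex by (metis Suc_le_eq atLeastAtMost_iff le_add1 plus_1_eq_Suc)
  then obtain y where y: "\<And>i. i < k \<Longrightarrow> y i \<in> carrier E"
    "\<And>i j. i < k \<Longrightarrow> Suc i < j \<Longrightarrow> j \<le> k \<Longrightarrow> \<psi> (y i) j = 0" "\<And>i. i < k \<Longrightarrow> \<psi> (y i) (Suc i) = fps_X ^ d (Suc i)"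
    by (metis greaterThanAtMost_iff)
  have z0: "\<psi> \<zero>\<^bsub>E\<^esub> j = 0" for j using sc[of "\<zero>\<^bsub>E\<^esub>" 0 j] by simp
  define G where "G S m = (\<Oplus>\<^bsub>E\<^esub>i\<in>{..<m}. bmul E (S i) (y i))" for S and m :: nat
  have Gc: "G S m \<in> carrier E \<and> \<psi> (G S m) j = (\<Sum>i<m. S i * \<psi> (y i) j)" if "m \<le> k" for S m j
    using that
  proof (induction m)
    case 0 then show ?case by (simp add: G_def z0)
  next
    case (Suc m)
    have "G S (Suc m) = bmul E (S m) (y m) \<oplus>\<^bsub>E\<^esub> G S m"
      unfolding G_def lessThan_Suc using Suc.prems by (subst M.finsum_insert) (auto simp: y)
    then show ?case using Suc y(1)[of m] by (simp add: add sc)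
  qed
  have P: "\<exists>S. \<forall>j\<in>{1..k}. \<psi> x j = (\<Sum>i<m. S i * \<psi> (y i) j)"
    if "m \<le> k" "x \<in> carrier E" "\<forall>i\<in>{m<..k}. \<psi> x i = 0" for m x
    using that
  proof (induction m arbitrary: x)
    case 0
    then have "x = \<zero>\<^bsub>E\<^esub>" by (intro inj) auto
    then show ?case by (simp add: z0)
  next
    case (Suc m)
    from dv[of x "Suc m"] Suc.prems obtain T where T: "\<psi> x (Suc m) = fps_X ^ d (Suc m) * T" by (auto simp: dvd_def)
    let ?x = "x \<ominus>\<^bsub>E\<^esub> bmul E T (y m)"
    have ym: "y m \<in> carrier E" using y Suc by simp
    have px: "\<psi> ?x j = \<psi> x j - T * \<psi> (y m) j" for j
      using Suc.prems ym by (simp add: minus sc)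
    have "\<psi> ?x i = 0" if "i \<in> {m<..k}" for i
      using that y(2,3)[of m] Suc.prems by (cases "i = Suc m") (auto simp: px T)
    then obtain S where S: "\<forall>j\<in>{1..k}. \<psi> ?x j = (\<Sum>i<m. S i * \<psi> (y i) j)"
      using Suc.IH[of ?x] Suc.prems ym by auto
    then have "\<forall>j\<in>{1..k}. \<psi> x j = (\<Sum>i<Suc m. (S(m := T)) i * \<psi> (y i) j)"
      by (auto simp: px algebra_simps)
    then show ?case by blast
  qed
  have U: "D i = 0" if "\<forall>j\<in>{1..k}. (\<Sum>i<k. D i * \<psi> (y i) j) = 0" "i < k" for D :: "nat \<Rightarrow> complex fps" and i
    using that(2)
  proof (induction "k - i" arbitrary: i rule: less_induct)
    case less
    have "(\<Sum>i'<k. D i' * \<psi> (y i') (Suc i)) = (\<Sum>i'\<in>{i}. D i' * \<psi> (y i') (Suc i))"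
    proof (rule sum.mono_neutral_right)
      show "\<forall>i'\<in>{..<k} - {i}. D i' * \<psi> (y i') (Suc i) = 0"
      proof
        fix i' assume i': "i' \<in> {..<k} - {i}"
        show "D i' * \<psi> (y i') (Suc i) = 0"
          using i' y(2)[of i' "Suc i"] less.hyps[of i'] less.prems by (cases "i' < i") auto
      qed
    qed (use less in auto)
    then have "D i * fps_X ^ d (Suc i) = 0" using that(1) less.prems y(3)[of i] by auto
    then show ?case by simp
  qed
  show ?thesis unfolding ab_rank_def
  proof (intro bexI[of _ y] ballI)
    fix x assume x: "x \<in> carrier E"
    from P[of k x] x obtain S where S: "\<forall>j\<in>{1..k}. \<psi> x j = (\<Sum>i<k. S i * \<psi> (y i) j)" by auto
    have eqG: "x = G S' k \<longleftrightarrow> (\<forall>j\<in>{1..k}. \<psi> x j = (\<Sum>i<k. S' i * \<psi> (y i) j))" for S'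
    proof
      assume "\<forall>j\<in>{1..k}. \<psi> x j = (\<Sum>i<k. S' i * \<psi> (y i) j)"
      then have "x \<ominus>\<^bsub>E\<^esub> G S' k = \<zero>\<^bsub>E\<^esub>" using Gc[of k S'] x by (intro inj) (auto simp: minus)
      then show "x = G S' k" using Gc[of k S'] x by (simp add: minus_eq_0_iff)
    qed (use Gc[of k S'] in auto)
    show "\<exists>!S. S \<in> {..<k} \<rightarrow>\<^sub>E UNIV \<and> x = (\<Oplus>\<^bsub>E\<^esub>i\<in>{..<k}. bmul E (S i) (y i))"
      unfolding G_def[symmetric]
    proof (rule ex1I[of _ "restrict S {..<k}"])
      show "restrict S {..<k} \<in> {..<k} \<rightarrow>\<^sub>E UNIV \<and> x = G (restrict S {..<k}) k"
        unfolding eqG using S by auto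
      fix S' assume S': "S' \<in> {..<k} \<rightarrow>\<^sub>E UNIV \<and> x = G S' k"
      then have "\<forall>j\<in>{1..k}. (\<Sum>i<k. (S' i - S i) * \<psi> (y i) j) = 0"
        using S unfolding eqG by (auto simp: left_diff_distrib sum_subtractf)
      from U[OF this] have "S' i = S i" if "i < k" for i using that by auto
      then show "S' = restrict S {..<k}" using S' by (auto simp: fun_eq_iff PiE_def extensional_def)
    qed
  qed (use y in auto)
qed

text \<open>The unit has constant term 1, so multiplying a generator by it changes none of its
  leading coefficients.\<close>

lemma fps_normalize:
  assumes "f $ m \<noteq> (0::complex)" "\<And>i. i < m \<Longrightarrow> f $ i = 0"
  shows "\<exists>V. V $ 0 = 1 \<and> V * f = fps_const (f $ m) * fps_X ^ m"
proof -
  let ?g = "fps_shift m f"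
  have g: "?g $ 0 \<noteq> 0" using assms by simp
  have f: "f = ?g * fps_X ^ m" by (rule fps_ext) (simp add: fps_X_power_mult_right_nth assms(2))
  show ?thesis
  proof (intro exI[of _ "fps_const (f $ m) * inverse ?g"] conjI)
    show "(fps_const (f $ m) * inverse ?g) $ 0 = 1" using g by simp
    have "fps_const (f $ m) * inverse ?g * f = fps_const (f $ m) * (inverse ?g * ?g) * fps_X ^ m"
      by (subst f) (simp add: mult.assoc)
    then show "fps_const (f $ m) * inverse ?g * f = fps_const (f $ m) * fps_X ^ m"
      by (simp only: inverse_mult_eq_1[OF g] mult_1_right)
  qed
qed

lemma fps_X_power_dvd_iff: "fps_X ^ m dvd (f :: complex fps) \<longleftrightarrow> (\<forall>i<m. f $ i = 0)"
proof
  assume "\<forall>i<m. f $ i = 0"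
  then have "f = fps_X ^ m * fps_shift m f" by (intro fps_ext) (simp add: fps_X_power_mult_nth)
  then show "fps_X ^ m dvd f" by (rule dvdI)
qed (auto simp: dvd_def fps_X_power_mult_nth)

lemma monom_nth: "(fps_const g * fps_X ^ m) $ i = (if i = m then g else (0::complex))"
  by (simp add: fps_X_power_nth)

context coords
begin

text \<open>The orders that characterize generators, see \<open>frame_gen_iff\<close> and
  \<open>gen_lead\<close>.\<close>

definition vals :: "'m \<Rightarrow> bool" where
  "vals x \<longleftrightarrow> x \<in> carrier E \<and> (\<forall>j. \<forall>i<n j. \<psi> x j $ i = 0) \<and> (\<forall>j\<in>{1..k}. \<psi> x j $ n j \<noteq> 0)"

text \<open>On F_(k-1) the last coordinate vanishes and with it the term with c. The exponents go up
  by 1 because a generator of F_(k-1) arises from one of E by some a - l b, which raises all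
  orders.\<close>

lemma coords_down:
  assumes "2 \<le> k"
  shows "coords (E \<downharpoonright> fl (k - 1)) (k - 1) \<kappa> 0 \<psi> (\<lambda>j. n j + 1)"
proof -
  interpret F: abmod "E \<downharpoonright> fl (k - 1)" by (rule sub_abmod[OF fl_sub])
  have fk: "\<psi> x j = 0" if "x \<in> fl (k - 1)" "j \<notin> {1..k - 1}" for x j
    using that out[of x j] by (cases "j > k - 1") (auto simp: fl_def)
  show ?thesis
  proof
    show "eqv (E \<downharpoonright> fl (k - 1)) (logop \<kappa> 0 (k - 1)) \<psi>"
      unfolding eqv_def
    proof (intro conjI ballI allI)
      fix x assume "x \<in> carrier (E \<downharpoonright> fl (k - 1))"
      then have "x \<in> fl (k - 1)" by simp
      then show "\<psi> (ab_a \<odot>\<^bsub>E \<downharpoonright> fl (k - 1)\<^esub> x) = logop \<kappa> 0 (k - 1) (\<psi> x)"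
        using fk[of x k] assms by (auto simp: fun_eq_iff logop_def psi_a fl_carrier)
    qed (auto simp: fun_eq_iff psi_add psi_bmul fl_carrier)
    show "x = \<zero>\<^bsub>E \<downharpoonright> fl (k - 1)\<^esub>" if "x \<in> carrier (E \<downharpoonright> fl (k - 1))" "\<And>j. j \<in> {1..k - 1} \<Longrightarrow> \<psi> x j = 0" for x
    proof -
      have x: "x \<in> fl (k - 1)" using that by simp
      then have "\<psi> x j = 0" for j using fk[OF x, of j] that(2)[of j] by (cases "j \<in> {1..k - 1}") auto
      then show ?thesis using x fl_carrier inj by simp
    qed
  qed (use assms fk mono in \<open>auto simp: fl_carrier\<close>)
qed

lemma vals_bmul:
  assumes "vals x" "V $ 0 \<noteq> 0"
  shows "vals (bmul E V x)" "\<psi> (bmul E V x) j $ n j = V $ 0 * \<psi> x j $ n j"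
proof -
  have d: "n 1 \<le> n k" using n_mono[of 1 k] k by auto
  note v = psi_val[where d = n, OF d]
  show "\<psi> (bmul E V x) j $ n j = V $ 0 * \<psi> x j $ n j" for j
    using v(2)[where x = x and j = j and u = "ab_of_b V"] assms by (simp add: vals_def)
  then show "vals (bmul E V x)" using v(1)[where x = x and u = "ab_of_b V"] assms unfolding vals_def by auto
qed

lemma vals_lin:
  assumes "vals x"
  shows "i < n j + 1 \<Longrightarrow> \<psi> (ab_lin l \<odot> x) j $ i = 0"
    "2 \<le> k \<Longrightarrow> \<psi> (ab_lin l \<odot> x) j $ (n j + 1) = (\<kappa> + of_nat (n j) - l) * \<psi> x j $ n j"
proof -
  have x: "x \<in> carrier E" "\<And>i j. i < n j \<Longrightarrow> \<psi> x j $ i = 0" using assms by (auto simp: vals_def)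
  have d: "n 1 \<le> n k" using n_mono[of 1 k] k by auto
  show "\<psi> (ab_lin l \<odot> x) j $ i = 0" if "i < n j + 1"
  proof (cases i)
    case (Suc m)
    then have "\<psi> x j $ m = 0" "j = 1 \<Longrightarrow> \<psi> x k $ m = 0" using that d by (auto intro!: x(2))
    then show ?thesis using Suc by (auto simp: psi_lin_nth[OF x(1)])
  qed (simp add: psi_lin_nth[OF x(1)])
  show "\<psi> (ab_lin l \<odot> x) j $ (n j + 1) = (\<kappa> + of_nat (n j) - l) * \<psi> x j $ n j" if "2 \<le> k"
    using x(2)[of "n j" k] mono[of 1 k] that by (auto simp: psi_lin_nth[OF x(1)])
qed

text \<open>A unit V makes the last coordinate a monomial. Then a - (\<kappa> + n_k) b kills it and
  multiplies the leading coefficient of coordinate j by n_j - n_k, which is nonzero for j <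
  k.\<close>

lemma vals_down:
  assumes "2 \<le> k" "vals x"
  obtains V where "V $ 0 = 1" "\<psi> (bmul E V x) k = fps_const (\<psi> x k $ n k) * fps_X ^ n k" "vals (bmul E V x)"
    "coords.vals (E \<downharpoonright> fl (k - 1)) (k - 1) \<psi> (\<lambda>j. n j + 1) (ab_lin (\<kappa> + of_nat (n k)) \<odot> bmul E V x)"
proof -
  interpret F: coords "E \<downharpoonright> fl (k - 1)" "k - 1" \<kappa> 0 \<psi> "\<lambda>j. n j + 1" by (rule coords_down[OF assms(1)])
  have x: "x \<in> carrier E" using assms by (simp add: vals_def)
  obtain V where V: "V $ 0 = 1" "V * \<psi> x k = fps_const (\<psi> x k $ n k) * fps_X ^ n k"
    using fps_normalize[of "\<psi> x k" "n k"] assms k unfolding vals_def by auto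
  let ?x = "bmul E V x" let ?y = "ab_lin (\<kappa> + of_nat (n k)) \<odot> ?x"
  have v: "vals ?x" by (rule vals_bmul) (use assms V in auto)
  have pk: "\<psi> ?x k = fps_const (\<psi> x k $ n k) * fps_X ^ n k" using V x by (simp add: psi_bmul)
  have y: "?y \<in> carrier E" using x by simp
  have "\<psi> ?y k = 0"
  proof (rule fps_ext)
    fix m show "\<psi> ?y k $ m = 0 $ m"
      using x assms(1) by (cases m) (auto simp: psi_lin_nth pk monom_nth)
  qed
  then have "\<psi> ?y i = 0" if "k - 1 < i" for i
    using out[OF y, of i] that by (cases "i = k") auto
  then have "?y \<in> fl (k - 1)" using y by (simp add: fl_def)
  moreover have "\<psi> ?y j $ (n j + 1) \<noteq> 0" if "j \<in> {1..k - 1}" for j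
  proof -
    have "1 \<le> j" "j < k" using that assms(1) by auto
    then have "n j \<noteq> n k" "j \<in> {1..k}" using mono[of j k] by auto
    then show ?thesis using v unfolding vals_lin(2)[OF v assms(1)] by (auto simp: vals_def)
  qed
  ultimately have "F.vals ?y" using vals_lin(1)[OF v] unfolding F.vals_def by auto
  with that V pk v show ?thesis by blast
qed

text \<open>Division by a - l b writes z = u x as a multiple of (a - l b) x plus S x. The last
  coordinate of z and of the first part vanish, so S \<psi>_k(x) = 0 and S = 0.\<close>

lemma gen_down:
  assumes "2 \<le> k" "x \<in> carrier E" "cyc_sub Atilde E x = carrier E" "\<psi> x k = fps_const g * fps_X ^ n k" "g \<noteq> 0"
    "ab_lin l \<odot> x \<in> fl (k - 1)"
  shows "cyc_sub Atilde E (ab_lin l \<odot> x) = fl (k - 1)"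
proof
  show "cyc_sub Atilde E (ab_lin l \<odot> x) \<subseteq> fl (k - 1)" by (rule cyc_sub_least[OF fl_sub assms(6)])
  show "fl (k - 1) \<subseteq> cyc_sub Atilde E (ab_lin l \<odot> x)"
  proof
    fix z assume z: "z \<in> fl (k - 1)"
    then obtain u where u: "z = u \<odot> x" using assms(3) fl_carrier by (metis cyc_subE)
    obtain q S where "u = ab_mult q (ab_lin l) + ab_of_b S" using ab_lin_division by blast
    then have z': "z = q \<odot> (ab_lin l \<odot> x) \<oplus> bmul E S x" using u assms(2) by (simp add: smul_add_left smul_mult)
    have "q \<odot> (ab_lin l \<odot> x) \<in> fl (k - 1)" by (rule submodD(4)[OF fl_sub assms(6)])
    then have "S * \<psi> x k = 0"
      using z assms(1,2) arg_cong[OF z', of "\<lambda>z. \<psi> z k"] by (simp add: fl_def psi_add psi_bmul)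
    then have "S = 0" using assms(4,5) by auto
    then show "z \<in> cyc_sub Atilde E (ab_lin l \<odot> x)" using z' assms(2) by (auto simp: cyc_sub_def)
  qed
qed

end

text \<open>Coordinates together with a cyclic generator of the prescribed orders. The inductions on
  the rank pass from one frame to another.\<close>

locale frame = coords +
  fixes e
  assumes e: "cyc_sub Atilde E e = carrier E" "vals e"
begin

lemma e_car [simp]: "e \<in> carrier E" using e by (simp add: vals_def)

lemma genE: "x \<in> carrier E \<Longrightarrow> (\<And>u. x = u \<odot> e \<Longrightarrow> thesis) \<Longrightarrow> thesis"
  using e(1) by (metis cyc_subE)

lemma frame_down:
  assumes "2 \<le> k"
  obtains V where "V $ 0 = 1" "\<psi> (bmul E V e) k = fps_const (\<psi> e k $ n k) * fps_X ^ n k" "vals (bmul E V e)"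
    "frame (E \<downharpoonright> fl (k - 1)) (k - 1) \<kappa> 0 \<psi> (\<lambda>j. n j + 1) (ab_lin (\<kappa> + of_nat (n k)) \<odot> bmul E V e)"
proof -
  interpret F: coords "E \<downharpoonright> fl (k - 1)" "k - 1" \<kappa> 0 \<psi> "\<lambda>j. n j + 1" by (rule coords_down[OF assms(1)])
  obtain V where V: "V $ 0 = 1" "\<psi> (bmul E V e) k = fps_const (\<psi> e k $ n k) * fps_X ^ n k" "vals (bmul E V e)"
    "F.vals (ab_lin (\<kappa> + of_nat (n k)) \<odot> bmul E V e)"
    using vals_down[OF assms e(2)] by metis
  have "e = bmul E (inverse V * V) e" using V(1) by (simp add: inverse_mult_eq_1)
  then have e': "e = ab_of_b (inverse V) \<odot> bmul E V e" using e_car by (metis bmul_mult)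
  have g: "cyc_sub Atilde E (bmul E V e) = carrier E"
  proof
    show "cyc_sub Atilde E (bmul E V e) \<subseteq> carrier E" by (rule cyc_sub_least[OF submodule_carrier]) simp
    have "e \<in> cyc_sub Atilde E (bmul E V e)" using e' by (auto simp: cyc_sub_def)
    then show "carrier E \<subseteq> cyc_sub Atilde E (bmul E V e)"
      using cyc_sub_least[OF cyc_sub_submodule, of "bmul E V e" e] e(1) by simp
  qed
  have "ab_lin (\<kappa> + of_nat (n k)) \<odot> bmul E V e \<in> fl (k - 1)" using V(4) unfolding F.vals_def by simp
  then have "cyc_sub Atilde E (ab_lin (\<kappa> + of_nat (n k)) \<odot> bmul E V e) = fl (k - 1)"
    by (intro gen_down[OF assms _ g V(2)]) (use e(2) k in \<open>auto simp: vals_def\<close>)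
  then have "frame (E \<downharpoonright> fl (k - 1)) (k - 1) \<kappa> 0 \<psi> (\<lambda>j. n j + 1) (ab_lin (\<kappa> + of_nat (n k)) \<odot> bmul E V e)"
    using V(4) by unfold_locales auto
  with V that show ?thesis by blast
qed

lemma psi_order: "x \<in> carrier E \<Longrightarrow> i < n j \<Longrightarrow> \<psi> x j $ i = 0"
  using psi_val(1)[of n e i j] e n_mono[of 1 k] k by (metis genE vals_def order_refl)

lemma psi_k_dvd: "x \<in> carrier E \<Longrightarrow> fps_X ^ n k dvd \<psi> x k"
  using psi_order fps_X_power_dvd_iff by blast

end

text \<open>Modulo C[[b]]-multiples of x every element falls into F_(k-1), since \<psi>_k(x)
  generates the ideal of values of \<psi>_k. By induction F_(k-1) is generated by a - (\<kappa> +
  n_k) b applied to a unit multiple of x. The right orders thus suffice for generating E, which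
  allows generators to be modified freely.\<close>

lemma frame_gen_iff:
  assumes "frame E k \<kappa> c \<psi> n e" "coords.vals E k \<psi> n x"
  shows "cyc_sub Atilde E x = carrier E"
  using assms
proof (induction k arbitrary: E c n e x)
  case 0
  then interpret frame E 0 \<kappa> c \<psi> n e by simp
  show ?case using k by simp
next
  case (Suc k)
  interpret frame E "Suc k" \<kappa> c \<psi> n e by fact
  have x: "x \<in> carrier E" using Suc.prems(2) by (simp add: vals_def)
  let ?C = "cyc_sub Atilde E x"
  have C: "submodule ?C Atilde E" by (rule cyc_sub_submodule[OF x])
  have xC: "bmul E S x \<in> ?C" for S by (auto simp: cyc_sub_def)
  obtain V where V: "V $ 0 = 1" "V * \<psi> x (Suc k) = fps_const (\<psi> x (Suc k) $ n (Suc k)) * fps_X ^ n (Suc k)"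
    using fps_normalize[of "\<psi> x (Suc k)" "n (Suc k)"] Suc.prems(2) unfolding vals_def by auto
  have g: "\<psi> x (Suc k) $ n (Suc k) \<noteq> 0" using Suc.prems(2) by (auto simp: vals_def)
  have red: "\<exists>S. z \<ominus>\<^bsub>E\<^esub> bmul E S x \<in> fl k" if z: "z \<in> carrier E" for z
  proof -
    obtain T where T: "\<psi> z (Suc k) = fps_X ^ n (Suc k) * T" using psi_k_dvd[OF z] by (auto simp: dvd_def)
    \<comment> \<open>V turns \<psi>_k(x) into a monomial, whose coefficient is then inverted; this
      makes the last coordinates of z and of S x agree.\<close>
    let ?S = "fps_const (inverse (\<psi> x (Suc k) $ n (Suc k))) * T * V"
    have "?S * \<psi> x (Suc k) = fps_const (inverse (\<psi> x (Suc k) $ n (Suc k))) * T * (V * \<psi> x (Suc k))"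
      by (simp only: mult.assoc)
    also have "\<dots> = fps_const (inverse (\<psi> x (Suc k) $ n (Suc k)) * (\<psi> x (Suc k) $ n (Suc k))) * (fps_X ^ n (Suc k) * T)"
      unfolding V(2) by (simp only: fps_const_mult[symmetric] mult_ac)
    finally have S: "?S * \<psi> x (Suc k) = \<psi> z (Suc k)" using g by (simp add: T)
    have "\<psi> (z \<ominus>\<^bsub>E\<^esub> bmul E ?S x) i = 0" if "i > k" for i
    proof (cases "i = Suc k")
      case True then show ?thesis using S z x by (simp add: psi_minus psi_bmul)
    next
      case False then show ?thesis using out[of "z \<ominus>\<^bsub>E\<^esub> bmul E ?S x" i] z x that by auto
    qed
    then have "z \<ominus>\<^bsub>E\<^esub> bmul E ?S x \<in> fl k" using z x by (simp add: fl_def)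
    then show ?thesis by blast
  qed
  have "fl k \<subseteq> ?C"
  proof (cases "k = 0")
    case True then show ?thesis using fl_0 submodD(2)[OF C] by simp
  next
    case False
    then have k2: "2 \<le> Suc k" by simp
    obtain V' where V': "frame (E \<downharpoonright> fl k) k \<kappa> 0 \<psi> (\<lambda>j. n j + 1) (ab_lin (\<kappa> + of_nat (n (Suc k))) \<odot>\<^bsub>E\<^esub> bmul E V' e)"
      using frame_down[OF k2] by (metis diff_Suc_1)
    obtain W where W: "coords.vals (E \<downharpoonright> fl k) k \<psi> (\<lambda>j. n j + 1) (ab_lin (\<kappa> + of_nat (n (Suc k))) \<odot>\<^bsub>E\<^esub> bmul E W x)"
      using vals_down[OF k2 Suc.prems(2)] by (metis diff_Suc_1)
    have "cyc_sub Atilde E (ab_lin (\<kappa> + of_nat (n (Suc k))) \<odot>\<^bsub>E\<^esub> bmul E W x) = fl k"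
      using Suc.IH[OF V' W] by simp
    then show ?thesis using cyc_sub_least[OF C submodD(4)[OF C xC]] by metis
  qed
  then have "carrier E \<subseteq> ?C"
  proof -
    assume s: "fl k \<subseteq> ?C"
    show ?thesis
    proof
      fix z assume z: "z \<in> carrier E"
      then obtain S where "z \<ominus>\<^bsub>E\<^esub> bmul E S x \<in> ?C" using red s by blast
      then have "(z \<ominus>\<^bsub>E\<^esub> bmul E S x) \<oplus>\<^bsub>E\<^esub> bmul E S x \<in> ?C" using submodD(3)[OF C] xC by blast
      then show "z \<in> ?C" using z x by (simp add: minus_add_cancel)
    qed
  qed
  then show ?case using submodD(1)[OF C] by blast
qed

text \<open>F_j is reached by k - j descents from a module of rank r to its term of rank r - 1. Each
  raises the orders of the generator by 1, and the last coordinate of a generator generates the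
  ideal of values.\<close>

lemma frame_images:
  assumes "frame E k \<kappa> c \<psi> n e" "j \<in> {1..k}"
  shows "(\<forall>x\<in>coords.fl E \<psi> j. fps_X ^ (n j + k - j) dvd \<psi> x j) \<and> (\<exists>x\<in>coords.fl E \<psi> j. \<psi> x j = fps_X ^ (n j + k - j))"
  using assms
proof (induction k arbitrary: E c n e)
  case 0
  then interpret frame E 0 \<kappa> c \<psi> n e by simp
  show ?case using k by simp
next
  case (Suc k)
  interpret frame E "Suc k" \<kappa> c \<psi> n e by fact
  show ?case
  proof (cases "j = Suc k")
    case True
    obtain V where V: "V * \<psi> e (Suc k) = fps_const (\<psi> e (Suc k) $ n (Suc k)) * fps_X ^ n (Suc k)"
      using fps_normalize[of "\<psi> e (Suc k)" "n (Suc k)"] e(2) unfolding vals_def by auto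
    have g: "\<psi> e (Suc k) $ n (Suc k) \<noteq> 0" using e(2) by (auto simp: vals_def)
    have "\<psi> (bmul E (fps_const (inverse (\<psi> e (Suc k) $ n (Suc k))) * V) e) (Suc k)
       = fps_const (inverse (\<psi> e (Suc k) $ n (Suc k))) * (V * \<psi> e (Suc k))" by (simp add: psi_bmul mult.assoc)
    also have "\<dots> = fps_const (inverse (\<psi> e (Suc k) $ n (Suc k)) * (\<psi> e (Suc k) $ n (Suc k))) * fps_X ^ n (Suc k)"
      unfolding V by (simp only: fps_const_mult[symmetric] mult_ac)
    finally have "\<psi> (bmul E (fps_const (inverse (\<psi> e (Suc k) $ n (Suc k))) * V) e) (Suc k) = fps_X ^ n (Suc k)"
      using g by simp
    then show ?thesis using psi_k_dvd True by (auto simp: fl_k)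
  next
    case False
    then have j: "j \<in> {1..k}" and k2: "2 \<le> Suc k" using Suc.prems by auto
    obtain V where V: "frame (E \<downharpoonright> fl k) k \<kappa> 0 \<psi> (\<lambda>j. n j + 1) (ab_lin (\<kappa> + of_nat (n (Suc k))) \<odot>\<^bsub>E\<^esub> bmul E V e)"
      using frame_down[OF k2] by (metis diff_Suc_1)
    interpret F: frame "E \<downharpoonright> fl k" k \<kappa> 0 \<psi> "\<lambda>j. n j + 1" "ab_lin (\<kappa> + of_nat (n (Suc k))) \<odot>\<^bsub>E\<^esub> bmul E V e"
      by (rule V)
    have "F.fl j = fl j" unfolding F.fl_def using j by (auto simp: fl_def)
    then show ?thesis using Suc.IH[OF V j] by simp
  qed
qed

declare One_nat_def [simp del]

section \<open>The principal Jordan-Hoelder sequence of a frame\<close>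

lemma (in abmod) normal_subI:
  assumes "submodule H Atilde E" "\<And>z. z \<in> carrier E \<Longrightarrow> bmul E fps_X z \<in> H \<Longrightarrow> z \<in> H"
  shows "normal_sub H E"
proof -
  have "H \<inter> b_image E (carrier E) = b_image E H"
  proof
    show "H \<inter> b_image E (carrier E) \<subseteq> b_image E H" using assms(2) by (auto simp: b_image_def)
    show "b_image E H \<subseteq> H \<inter> b_image E (carrier E)"
      using submodD(4)[OF assms(1)] submodD(1)[OF assms(1)] by (auto simp: b_image_def)
  qed
  then show ?thesis using assms(1) by (simp add: normal_sub_def)
qed

context coords
begin

lemma fl_normal: "normal_sub (fl j) E"
  by (rule normal_subI[OF fl_sub]) (auto simp: fl_def psi_bmul)

end

context frame
begin

text \<open>The fundamental invariants: \<kappa> plus the order at which coordinate j starts on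
  F_j.\<close>

definition lam :: "nat \<Rightarrow> complex" where
  "lam j = \<kappa> + of_nat (n j) + of_nat k - of_nat j"

lemma fl_gen: "j \<in> {1..k} \<Longrightarrow> \<exists>y\<in>fl j. \<psi> y j = fps_X ^ (n j + k - j)"
  and fl_dvd: "j \<in> {1..k} \<Longrightarrow> x \<in> fl j \<Longrightarrow> fps_X ^ (n j + k - j) dvd \<psi> x j"
  using frame_images[OF frame_axioms] by blast+

text \<open>The factor \<kappa> + (n_j + k - j) - \<open>lam j\<close> at the only coefficient of
  coordinate j is zero. For j = 1 the term with c is absent as well: either k = 1 and c = 0, or
  \<psi>_k(y) = 0.\<close>

lemma fl_lin:
  assumes "j \<in> {1..k}" "y \<in> fl j" "\<psi> y j = fps_const g * fps_X ^ (n j + k - j)"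
  shows "ab_lin (lam j) \<odot> y \<in> fl (j - 1)"
proof -
  have y: "y \<in> carrier E" "\<And>i. j < i \<Longrightarrow> \<psi> y i = 0" using assms by (auto simp: fl_def)
  have "\<psi> (ab_lin (lam j) \<odot> y) i $ m = 0" if "j - 1 < i" for i m
  proof (cases m)
    case (Suc m')
    have "c * \<psi> y k $ m' = 0" if "j = 1" using c y(2)[of k] that k by (cases "k = 1") auto
    moreover have "(\<kappa> + of_nat m' - lam j) * \<psi> y i $ m' = 0"
    proof (cases "i = j")
      case True
      have "of_nat (n j + k - j) = (of_nat (n j) + of_nat k - of_nat j :: complex)"
        using assms(1) by (simp add: of_nat_diff)
      then show ?thesis unfolding True assms(3) monom_nth by (auto simp: lam_def)
    next
      case False then show ?thesis using y(2)[of i] that by simp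
    qed
    ultimately show ?thesis using Suc that assms(1) by (cases "i = 1") (auto simp: psi_lin_nth[OF y(1)])
  qed (simp add: psi_lin_nth[OF y(1)])
  then show ?thesis using y(1) unfolding fl_def by (auto simp: fps_eq_iff)
qed

text \<open>Coordinate j identifies the quotient with an ideal of C[[b]]. Division of u by a -
  \<open>lam j\<close> b leaves a remainder S that coordinate j detects, so the annihilator of the
  generator is the left ideal of this operator.\<close>

lemma fl_quot:
  assumes j: "j \<in> {1..k}"
  shows "(E \<downharpoonright> fl j) LQuot fl (j - 1) \<simeq> ab_cyclic (ab_lin (lam j))"
proof -
  interpret F: abmod "E \<downharpoonright> fl j" by (rule sub_abmod[OF fl_sub])
  have s: "submodule (fl (j - 1)) Atilde (E \<downharpoonright> fl j)"
    unfolding submodule_sub_iff[OF fl_sub] using fl_sub fl_mono[of "j - 1" j] by simp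
  interpret Q: abmod "(E \<downharpoonright> fl j) LQuot fl (j - 1)" by (rule F.quot_abmod[OF s])
  obtain y where y: "y \<in> fl j" "\<psi> y j = fps_X ^ (n j + k - j)" using fl_gen[OF j] by blast
  have yc: "y \<in> carrier E" using y fl_carrier by blast
  define Y where "Y = fl (j - 1) +>\<^bsub>E \<downharpoonright> fl j\<^esub> y"
  have smY: "u \<odot>\<^bsub>(E \<downharpoonright> fl j) LQuot fl (j - 1)\<^esub> Y = fl (j - 1) +>\<^bsub>E \<downharpoonright> fl j\<^esub> (u \<odot> y)" for u
    using F.quot_smul[OF s, of y u] y by (simp add: Y_def)
  have lin: "ab_lin (lam j) \<odot> y \<in> fl (j - 1)" using fl_lin[OF j y(1), of 1] y(2) by simp
  have fj: "x \<in> fl (j - 1) \<longleftrightarrow> x \<in> fl j \<and> \<psi> x j = 0" for x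
  proof
    assume "x \<in> fl j \<and> \<psi> x j = 0"
    then have "\<psi> x i = 0" if "i > j - 1" for i using that by (cases "i = j") (auto simp: fl_def)
    then show "x \<in> fl (j - 1)" using \<open>x \<in> fl j \<and> \<psi> x j = 0\<close> by (simp add: fl_def)
  qed (use fl_mono[of "j - 1" j] j in \<open>auto simp: fl_def\<close>)
  show ?thesis
  proof (rule ab_cyclic_iso[OF Q.abmod_axioms])
    show Yc: "Y \<in> carrier ((E \<downharpoonright> fl j) LQuot fl (j - 1))" using y by (auto simp: Y_def F.quot_carrier[OF s])
    show "cyc_sub Atilde ((E \<downharpoonright> fl j) LQuot fl (j - 1)) Y = carrier ((E \<downharpoonright> fl j) LQuot fl (j - 1))"
    proof
      show "cyc_sub Atilde ((E \<downharpoonright> fl j) LQuot fl (j - 1)) Y \<subseteq> carrier ((E \<downharpoonright> fl j) LQuot fl (j - 1))"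
        using Q.submodD(1)[OF Q.cyc_sub_submodule[OF Yc]] .
      show "carrier ((E \<downharpoonright> fl j) LQuot fl (j - 1)) \<subseteq> cyc_sub Atilde ((E \<downharpoonright> fl j) LQuot fl (j - 1)) Y"
      proof
        fix Z assume "Z \<in> carrier ((E \<downharpoonright> fl j) LQuot fl (j - 1))"
        then obtain z where z: "z \<in> fl j" "Z = fl (j - 1) +>\<^bsub>E \<downharpoonright> fl j\<^esub> z" by (auto simp: F.quot_carrier[OF s])
        obtain S where S: "\<psi> z j = fps_X ^ (n j + k - j) * S" using fl_dvd[OF j z(1)] by (auto simp: dvd_def)
        have zc: "z \<in> carrier E" "bmul E S y \<in> fl j" using z y fl_carrier submodD(4)[OF fl_sub] by auto
        have "z \<ominus> bmul E S y \<in> fl (j - 1)" unfolding fj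
          using submodD(5)[OF fl_sub z(1) zc(2)] S y(2) zc yc by (simp add: psi_minus psi_bmul)
        then have "Z = ab_of_b S \<odot>\<^bsub>(E \<downharpoonright> fl j) LQuot fl (j - 1)\<^esub> Y"
          unfolding smY z(2) using F.quot_coset_eq[OF s, of z "bmul E S y"] z(1) zc(2)
          by (simp add: minus_sub[OF fl_sub])
        then show "Z \<in> cyc_sub Atilde ((E \<downharpoonright> fl j) LQuot fl (j - 1)) Y" by (auto simp: cyc_sub_def)
      qed
    qed
    fix u
    have uj: "u \<odot> y \<in> fl j" using submodD(4)[OF fl_sub y(1)] .
    obtain q S where u: "u = ab_mult q (ab_lin (lam j)) + ab_of_b S" using ab_lin_division by blast
    have uy: "u \<odot> y = q \<odot> (ab_lin (lam j) \<odot> y) \<oplus> bmul E S y" using yc by (simp add: u smul_add_left smul_mult)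
    have qz: "q \<odot> (ab_lin (lam j) \<odot> y) \<in> fl (j - 1)" by (rule submodD(4)[OF fl_sub lin])
    have "u \<odot>\<^bsub>(E \<downharpoonright> fl j) LQuot fl (j - 1)\<^esub> Y = \<zero>\<^bsub>(E \<downharpoonright> fl j) LQuot fl (j - 1)\<^esub> \<longleftrightarrow> u \<odot> y \<in> fl (j - 1)"
      unfolding smY using F.quot_eq_zero[OF s, of "u \<odot> y"] uj by simp
    also have "\<dots> \<longleftrightarrow> \<psi> (u \<odot> y) j = 0" using uj fj by blast
    also have "\<psi> (u \<odot> y) j = S * fps_X ^ (n j + k - j)"
      unfolding uy using qz yc y(2) by (simp add: fj psi_add psi_bmul)
    also have "S * fps_X ^ (n j + k - j) = 0 \<longleftrightarrow> S = 0" by simp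
    also have "S = 0 \<longleftrightarrow> (\<exists>q. u = ab_mult q (ab_lin (lam j)))"
    proof
      assume "\<exists>q. u = ab_mult q (ab_lin (lam j))"
      then obtain q' where "u = ab_mult q' (ab_lin (lam j))" by blast
      moreover have "ab_mult q' p = ab_mult (q' - q) p + ab_mult q p" for p
        using ab_mult_add_left[of "q' - q" q p] by simp
      ultimately have "ab_mult (q' - q) (ab_lin (lam j)) = ab_of_b S" using u by simp
      then show "S = 0" by (rule ab_lin_division_unique)
    qed (use u in auto)
    finally show "u \<odot>\<^bsub>(E \<downharpoonright> fl j) LQuot fl (j - 1)\<^esub> Y = \<zero>\<^bsub>(E \<downharpoonright> fl j) LQuot fl (j - 1)\<^esub> \<longleftrightarrow>
      (\<exists>q. u = ab_mult q (ab_lin (lam j)))" .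
  qed
qed

text \<open>Since \<open>lam j\<close> + j = \<kappa> + n_j + k, the condition on the sequence is
  the monotonicity of n.\<close>

lemma frame_principal_JH: "principal_JH E k fl lam"
proof -
  have "JH_seq E k fl lam"
    unfolding JH_seq_def using fl_normal fl_quot fl_0 fl_k[of k] fl_mono by (auto)
  moreover have "\<exists>r::real. 0 \<le> r \<and> (lam j + of_nat j) - (lam i + of_nat i) = of_real r"
    if "i \<in> {1..k}" "j \<in> {i..k}" for i j
    using n_mono[of i j] that by (intro exI[of _ "real (n j) - real (n i)"]) (auto simp: lam_def)
  ultimately show ?thesis unfolding principal_JH_def by blast
qed

lemma frame_rank: "ab_rank E k"
proof (rule ab_rank_triangular[OF abmod_axioms, where \<psi> = \<psi> and d = "\<lambda>j. n j + k - j"])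
  have f: "x \<in> fl j" if "x \<in> carrier E" "\<forall>i\<in>{j<..k}. \<psi> x i = 0" for x j
    using that out[OF that(1)] unfolding fl_def by auto
  show "\<exists>y\<in>carrier E. (\<forall>i\<in>{j<..k}. \<psi> y i = 0) \<and> \<psi> y j = fps_X ^ (n j + k - j)" if "j \<in> {1..k}" for j
  proof -
    obtain y where "y \<in> fl j" "\<psi> y j = fps_X ^ (n j + k - j)" using fl_gen[OF \<open>j \<in> {1..k}\<close>] by blast
    then show ?thesis by (intro bexI[of _ y]) (auto simp: fl_def)
  qed
  show "fps_X ^ (n j + k - j) dvd \<psi> x j" if "x \<in> carrier E" "j \<in> {1..k}" "\<forall>i\<in>{j<..k}. \<psi> x i = 0" for x j
    using fl_dvd[OF that(2) f[OF that(1,3)]] .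
qed (auto simp: psi_add psi_bmul intro: inj)

lemma frame_ab_module: "ab_module E"
  using frame_rank left_module_axioms by (auto simp: ab_module_def)

end

section \<open>Reduction of the rank\<close>

context frame
begin

text \<open>Adding elements of F_(k-1) to a generator changes \<psi>_(k-1) by an arbitrary element
  of the ideal of b^(n_(k-1) + 1). All its coefficients above the leading one can therefore be
  prescribed, here so as to fit \<open>frame_step\<close> with the parameter w.\<close>

lemma frame_adjust:
  assumes k2: "2 \<le> k"
  obtains e' where "frame E k \<kappa> c \<psi> n e'" "\<And>j. \<psi> e' j $ n j = \<psi> e j $ n j"
    "\<psi> e' k = fps_const (\<psi> e k $ n k) * fps_X ^ n k"
    "\<psi> e' (k - 1) = fps_const w * \<psi> e' k + fps_const (\<psi> e (k - 1) $ n (k - 1)) * fps_X ^ n (k - 1)"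
proof -
  obtain V where V: "V $ 0 = 1" "\<psi> (bmul E V e) k = fps_const (\<psi> e k $ n k) * fps_X ^ n k" "vals (bmul E V e)"
    and fr: "frame (E \<downharpoonright> fl (k - 1)) (k - 1) \<kappa> 0 \<psi> (\<lambda>j. n j + 1) (ab_lin (\<kappa> + of_nat (n k)) \<odot> bmul E V e)"
    using frame_down[OF k2] by metis
  interpret F: frame "E \<downharpoonright> fl (k - 1)" "k - 1" \<kappa> 0 \<psi> "\<lambda>j. n j + 1" "ab_lin (\<kappa> + of_nat (n k)) \<odot> bmul E V e"
    by (rule fr)
  let ?x = "bmul E V e"
  have xl: "\<psi> ?x j $ n j = \<psi> e j $ n j" for j using vals_bmul(2)[OF e(2), of V j] V(1) by simp
  have xo: "i < n j \<Longrightarrow> \<psi> ?x j $ i = 0" for i j using V(3) by (auto simp: vals_def)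
  obtain y where y: "y \<in> fl (k - 1)" "\<psi> y (k - 1) = fps_X ^ (n (k - 1) + 1)"
  proof -
    have "k - 1 \<in> {1..k}" "n (k - 1) + k - (k - 1) = n (k - 1) + 1" using k2 by (simp, linarith)+
    then show ?thesis using fl_gen[of "k - 1"] that by auto
  qed
  have yc: "y \<in> carrier E" "\<psi> y k = 0" using y k2 by (auto simp: fl_def)
  have yo: "i < n j + 1 \<Longrightarrow> \<psi> y j $ i = 0" for i j using F.psi_order[of y i j] y by simp
  \<comment> \<open>The difference between the present and the desired coordinate. Its leading terms
    cancel and \<psi>_k has order n_k > n_(k-1), so it lies in the ideal just mentioned.\<close>
  let ?g = "\<psi> ?x (k - 1) - fps_const w * \<psi> ?x k - fps_const (\<psi> e (k - 1) $ n (k - 1)) * fps_X ^ n (k - 1)"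
  have "?g $ i = 0" if "i < n (k - 1) + 1" for i
  proof -
    have "n (k - 1) < n k" using mono[of "k - 1" k] k2 by auto
    then have "\<psi> ?x k $ i = 0" using xo[of i k] that by simp
    then show ?thesis using xo[of i "k - 1"] xl[of "k - 1"] that by (cases "i = n (k - 1)") (auto simp: monom_nth)
  qed
  then obtain T where T: "?g = fps_X ^ (n (k - 1) + 1) * T"
    using fps_X_power_dvd_iff[of "n (k - 1) + 1" ?g] by (auto simp: dvd_def)
  \<comment> \<open>Subtracting T y leaves \<psi>_k alone, and the coordinates of y have orders
    above n_j, so no leading coefficient changes.\<close>
  define e' where "e' = ?x \<ominus> bmul E T y"
  have e'c: "e' \<in> carrier E" using yc by (simp add: e'_def)
  have pe: "\<psi> e' j = \<psi> ?x j - T * \<psi> y j" for j using yc by (simp add: e'_def psi_minus psi_bmul)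
  have Ty: "(T * \<psi> y j) $ i = 0" if "i < n j + 1" for i j
    using yo[of _ j] that by (auto simp: fps_mult_nth intro!: sum.neutral)
  have lead: "\<psi> e' j $ n j = \<psi> e j $ n j" for j using xl Ty by (simp add: pe)
  have v: "vals e'" unfolding vals_def using e'c e(2) lead xo Ty by (auto simp: pe vals_def)
  then have fr: "frame E k \<kappa> c \<psi> n e'"
    using frame_gen_iff[OF frame_axioms v] by unfold_locales
  show ?thesis
  proof (rule that[OF fr lead])
    show 1: "\<psi> e' k = fps_const (\<psi> e k $ n k) * fps_X ^ n k" using V(2) yc by (simp add: pe)
    have "\<psi> e' k = \<psi> ?x k" using yc by (simp add: pe)
    then show "\<psi> e' (k - 1) = fps_const w * \<psi> e' k + fps_const (\<psi> e (k - 1) $ n (k - 1)) * fps_X ^ n (k - 1)"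
      using T unfolding pe[of "k - 1"] y(2) by (simp add: algebra_simps)
  qed
qed

definition step_sub :: "complex \<Rightarrow> 'a set" where
  "step_sub w = {x \<in> carrier E. \<psi> x (k - 1) = fps_const w * \<psi> x k}"

text \<open>Coordinate k - 1 is redundant on \<open>step_sub w\<close>. Its place is taken by
  \<psi>_k, so that the term with c again comes from the last coordinate.\<close>

definition step_psi :: "'a \<Rightarrow> nat \<Rightarrow> complex fps" where
  "step_psi x j = (if j = k - 1 then \<psi> x k else if j = k then 0 else \<psi> x j)"

definition step_n :: "nat \<Rightarrow> nat" where
  "step_n j = (if j = k - 1 then n k + 1 else n j + 1)"

text \<open>As k - 1 >= 2, \<chi> = \<psi>_(k-1) - w \<psi>_k is a homomorphism, and
  \<open>step_sub w\<close> is its kernel. On e it is the monomial h b^(n_(k-1)), which a -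
  (\<kappa> + n_(k-1)) b kills; this constant is \<open>lam (k - 1)\<close> - 1. The leading
  coefficients of the surviving coordinates are multiplied by n_j - n_(k-1). The factors for the
  first and the last one are recorded because their ratio enters \<alpha>.\<close>

lemma frame_step:
  assumes k3: "3 \<le> k"
    and ek: "\<psi> e k = fps_const g * fps_X ^ n k"
    and ek1: "\<psi> e (k - 1) = fps_const w * \<psi> e k + fps_const h * fps_X ^ n (k - 1)"
  shows "frame (E \<downharpoonright> step_sub w) (k - 1) \<kappa> c step_psi step_n (ab_lin (lam (k - 1) - 1) \<odot> e)"
    and "cyc_sub Atilde E (ab_lin (lam (k - 1) - 1) \<odot> e) = step_sub w"
    and "step_psi (ab_lin (lam (k - 1) - 1) \<odot> e) 1 $ step_n 1 = (of_nat (n 1) - of_nat (n (k - 1))) * \<psi> e 1 $ n 1"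
    and "step_psi (ab_lin (lam (k - 1) - 1) \<odot> e) (k - 1) $ step_n (k - 1) = (of_nat (n k) - of_nat (n (k - 1))) * \<psi> e k $ n k"
    and "normal_sub (step_sub w) E"
proof -
  define \<chi> where "\<chi> x = \<psi> x (k - 1) - fps_const w * \<psi> x k" for x
  define l where "l = lam (k - 1) - 1"
  have l: "l = \<kappa> + of_nat (n (k - 1))" using k3 by (simp add: l_def lam_def of_nat_diff)
  have \<chi>: "bhom E (fps_const \<kappa> * fps_X) \<chi>"
    unfolding \<chi>_def using k3 by (intro bhom_diff bhom_cmult bhom_psi) auto
  have G: "step_sub w = {x \<in> carrier E. \<chi> x = 0}" by (auto simp: step_sub_def \<chi>_def)
  have Gs: "submodule (step_sub w) Atilde E"
    using bhom_ker_sub[of "{()}" "\<lambda>_. \<chi>"] \<chi> unfolding G by auto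
  interpret G: abmod "E \<downharpoonright> step_sub w" by (rule sub_abmod[OF Gs])
  have nn: "n (k - 1) < n k" "n 1 < n (k - 1)" "n 1 < n k" using mono[of "k - 1" k] mono[of 1 "k - 1"] mono[of 1 k] k3 by auto
  let ?g = "ab_lin l \<odot> e"
  have \<chi>e: "\<chi> e = fps_const h * fps_X ^ n (k - 1)" by (simp add: \<chi>_def ek1)
  have h: "h \<noteq> 0"
  proof
    assume "h = 0"
    then have "\<psi> e (k - 1) $ n (k - 1) = 0" using nn by (simp add: ek1 ek monom_nth)
    then show False using e(2) k3 by (auto simp: vals_def)
  qed
  have \<chi>g: "\<chi> ?g = 0"
  proof (rule fps_ext)
    fix m show "\<chi> ?g $ m = 0 $ m"
      by (cases m) (auto simp: bhom_dop_lin_nth[OF \<chi>] \<chi>e monom_nth l)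
  qed
  have gG: "?g \<in> step_sub w" by (simp add: G \<chi>g)
  show cyc: "cyc_sub Atilde E (ab_lin (lam (k - 1) - 1) \<odot> e) = step_sub w"
    unfolding l_def[symmetric]
  proof
    show "cyc_sub Atilde E ?g \<subseteq> step_sub w" by (rule cyc_sub_least[OF Gs gG])
    show "step_sub w \<subseteq> cyc_sub Atilde E ?g"
    proof
      fix z assume z: "z \<in> step_sub w"
      then obtain u where u: "z = u \<odot> e" unfolding G by (auto elim: genE)
      obtain q S where "u = ab_mult q (ab_lin l) + ab_of_b S" using ab_lin_division by blast
      then have z': "z = q \<odot> ?g \<oplus> bmul E S e" using u by (simp add: smul_add_left smul_mult)
      \<comment> \<open>The first part of z lies in the kernel of \<chi>, so \<chi>(z) = 0 forces S
        h b^(n_(k-1)) = 0.\<close>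
      have "\<chi> (q \<odot> ?g) = 0" by (rule bhom_smul_0[OF \<chi> _ \<chi>g]) simp
      then have "S * \<chi> e = 0" using z z' by (simp add: G bhomD[OF \<chi>])
      then have "S = 0" using h by (simp add: \<chi>e)
      then show "z \<in> cyc_sub Atilde E ?g" using z' by (auto simp: cyc_sub_def)
    qed
  qed
  have gl: "\<psi> ?g j $ (n j + 1) = (of_nat (n j) - of_nat (n (k - 1))) * \<psi> e j $ n j" for j
    using vals_lin(2)[OF e(2), where j = j and l = l] k3 by (simp add: l)
  have Gc: "x \<in> carrier E" if "x \<in> step_sub w" for x using that by (simp add: G)
  have sp: "step_psi x j = 0" if "x \<in> step_sub w" "j \<notin> {1..k - 1}" for x j
    using that out[of x j] Gc k3 by (cases "j = k") (auto simp: step_psi_def)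
  have co: "coords (E \<downharpoonright> step_sub w) (k - 1) \<kappa> c step_psi step_n"
  proof
    show "eqv (E \<downharpoonright> step_sub w) (logop \<kappa> c (k - 1)) step_psi"
      unfolding eqv_def using k3 Gc
      by (auto simp: fun_eq_iff step_psi_def logop_def psi_add psi_bmul psi_a)
    show "x = \<zero>\<^bsub>E \<downharpoonright> step_sub w\<^esub>" if "x \<in> carrier (E \<downharpoonright> step_sub w)" "\<And>j. j \<in> {1..k - 1} \<Longrightarrow> step_psi x j = 0" for x
    proof -
      have x: "x \<in> step_sub w" using that by simp
      have pk: "\<psi> x k = 0" using that(2)[of "k - 1"] k3 by (simp add: step_psi_def)
      have "\<psi> x j = 0" if "j \<in> {1..k}" for j
      proof -
        have "j = k \<or> j = k - 1 \<or> j \<in> {1..k - 1} \<and> j \<noteq> k - 1 \<and> j \<noteq> k" using that by auto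
        then consider "j = k" | "j = k - 1" | "j \<in> {1..k - 1}" "j \<noteq> k - 1" "j \<noteq> k" by blast
        then show ?thesis
        proof cases
          case 2 then show ?thesis using x pk by (simp add: step_sub_def)
        next
          case 3 then show ?thesis using \<open>\<And>j. j \<in> {1..k - 1} \<Longrightarrow> step_psi x j = 0\<close>[of j] by (simp add: step_psi_def)
        qed (use pk in simp)
      qed
      then show ?thesis using inj Gc[OF x] by simp
    qed
    show "step_n i < step_n j" if "1 \<le> i" "i < j" "j \<le> k - 1" for i j
      using that mono[of i k] mono[of i j] by (auto simp: step_n_def)
  qed (use k3 sp in auto)
  interpret C: coords "E \<downharpoonright> step_sub w" "k - 1" \<kappa> c step_psi step_n by (rule co)
  have "C.vals ?g"
    unfolding C.vals_def
  proof (intro conjI allI ballI impI)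
    show "?g \<in> carrier (E \<downharpoonright> step_sub w)" using gG by simp
    show "step_psi ?g j $ i = 0" if "i < step_n j" for i j
      using that vals_lin(1)[OF e(2)] by (auto simp: step_psi_def step_n_def)
    show "step_psi ?g j $ step_n j \<noteq> 0" if "j \<in> {1..k - 1}" for j
    proof (cases "j = k - 1")
      case True then show ?thesis using gl[of k] nn e(2) k by (auto simp: step_psi_def step_n_def vals_def)
    next
      case False
      then have "n j < n (k - 1)" using mono[of j "k - 1"] that by auto
      then show ?thesis using gl[of j] False that e(2) by (auto simp: step_psi_def step_n_def vals_def)
    qed
  qed
  then show "frame (E \<downharpoonright> step_sub w) (k - 1) \<kappa> c step_psi step_n (ab_lin (lam (k - 1) - 1) \<odot> e)"
    using cyc by unfold_locales (auto simp: l_def)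
  show "step_psi (ab_lin (lam (k - 1) - 1) \<odot> e) 1 $ step_n 1 = (of_nat (n 1) - of_nat (n (k - 1))) * \<psi> e 1 $ n 1"
    using gl[of 1] k3 by (simp add: step_psi_def step_n_def l_def)
  show "step_psi (ab_lin (lam (k - 1) - 1) \<odot> e) (k - 1) $ step_n (k - 1) = (of_nat (n k) - of_nat (n (k - 1))) * \<psi> e k $ n k"
    using gl[of k] k3 by (simp add: step_psi_def step_n_def l_def)
  show "normal_sub (step_sub w) E"
    by (rule normal_subI[OF Gs]) (auto simp: G bhomD[OF \<chi>])
qed

text \<open>On coordinates other than the first, the two factors multiply the coefficient of b^i by
  (i - n_(k-1)) (i - n_k); the additional 1 in \<open>lam (k - 1)\<close> compensates the index
  gained from the first operator. The condition in the definition of \<alpha> thus says that e has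
  the shape treated by \<open>frame_step\<close>, for some w.\<close>

lemma double_lin_iff:
  assumes k3: "3 \<le> k"
  shows "ab_mult (ab_lin (lam (k - 1))) (ab_lin (lam k)) \<odot> e \<in> fl (k - 2) \<longleftrightarrow>
    (\<exists>g h w. \<psi> e k = fps_const g * fps_X ^ n k \<and>
       \<psi> e (k - 1) = fps_const w * \<psi> e k + fps_const h * fps_X ^ n (k - 1))"
proof -
  have nn: "n (k - 1) < n k" using mono[of "k - 1" k] k3 by auto
  have l1: "lam (k - 1) = \<kappa> + of_nat (n (k - 1)) + 1" and l2: "lam k = \<kappa> + of_nat (n k)"
    using k3 by (auto simp: lam_def of_nat_diff)
  let ?z = "ab_mult (ab_lin (lam (k - 1))) (ab_lin (lam k)) \<odot> e"
  have z: "?z \<in> carrier E" by simp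
  have zj: "\<psi> ?z j $ m = (if m < 2 then 0 else
      (of_nat (m - 2) - of_nat (n (k - 1))) * (of_nat (m - 2) - of_nat (n k)) * \<psi> e j $ (m - 2))"
    if "j \<noteq> 1" for j m
  proof -
    consider "m = 0" | "m = 1" | m' where "m = Suc (Suc m')" by (metis One_nat_def not0_implies_Suc)
    then show ?thesis by cases (use that in \<open>auto simp: smul_mult psi_lin_nth l1 l2 algebra_simps\<close>)
  qed
  have "?z \<in> fl (k - 2) \<longleftrightarrow> \<psi> ?z k = 0 \<and> \<psi> ?z (k - 1) = 0"
  proof
    assume "\<psi> ?z k = 0 \<and> \<psi> ?z (k - 1) = 0"
    moreover have "i = k \<or> i = k - 1 \<or> i \<notin> {1..k}" if "i > k - 2" for i using that by auto
    ultimately have "\<psi> ?z i = 0" if "i > k - 2" for i using out[OF z, of i] that by metis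
    then show "?z \<in> fl (k - 2)" using z by (simp add: fl_def)
  qed (use k3 in \<open>auto simp: fl_def\<close>)
  also have "\<dots> \<longleftrightarrow> (\<forall>i. i \<noteq> n k \<longrightarrow> i \<noteq> n (k - 1) \<longrightarrow> \<psi> e k $ i = 0 \<and> \<psi> e (k - 1) $ i = 0)"
  proof -
    have "\<psi> ?z j = 0 \<longleftrightarrow> (\<forall>i. i \<noteq> n k \<longrightarrow> i \<noteq> n (k - 1) \<longrightarrow> \<psi> e j $ i = 0)" if "j \<noteq> 1" for j
    proof
      assume z: "\<psi> ?z j = 0"
      show "\<forall>i. i \<noteq> n k \<longrightarrow> i \<noteq> n (k - 1) \<longrightarrow> \<psi> e j $ i = 0"
      proof (intro allI impI)
        fix i assume "i \<noteq> n k" "i \<noteq> n (k - 1)"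
        then show "\<psi> e j $ i = 0" using zj[OF that, of "i + 2"] z by simp
      qed
    next
      assume a: "\<forall>i. i \<noteq> n k \<longrightarrow> i \<noteq> n (k - 1) \<longrightarrow> \<psi> e j $ i = 0"
      have "\<psi> ?z j $ m = 0" for m
      proof (cases "m < 2")
        case False
        then obtain i where "m = i + 2" by (metis add.commute le_Suc_ex linorder_not_less)
        then show ?thesis using zj[OF that, of m] a by auto
      qed (simp add: zj[OF that])
      then show "\<psi> ?z j = 0" by (simp add: fps_eq_iff)
    qed
    from this[of k] this[of "k - 1"] show ?thesis using k3 by auto
  qed
  also have "\<dots> \<longleftrightarrow> (\<exists>g h w. \<psi> e k = fps_const g * fps_X ^ n k \<and>
       \<psi> e (k - 1) = fps_const w * \<psi> e k + fps_const h * fps_X ^ n (k - 1))"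
  proof
    assume a: "\<forall>i. i \<noteq> n k \<longrightarrow> i \<noteq> n (k - 1) \<longrightarrow> \<psi> e k $ i = 0 \<and> \<psi> e (k - 1) $ i = 0"
    let ?g = "\<psi> e k $ n k"
    \<comment> \<open>The order of \<psi>_k(e) is n_k > n_(k-1), so of the two admissible monomials
      only b^(n_k) occurs in it.\<close>
    have z: "\<psi> e k $ n (k - 1) = 0" using psi_order[of e "n (k - 1)" k] nn by simp
    then have 1: "\<psi> e k = fps_const ?g * fps_X ^ n k" using a by (auto simp: fps_eq_iff monom_nth)
    have g: "?g \<noteq> 0" using e(2) k by (auto simp: vals_def)
    have "\<psi> e (k - 1) $ i = (fps_const (\<psi> e (k - 1) $ n k / ?g) * \<psi> e k + fps_const (\<psi> e (k - 1) $ n (k - 1)) * fps_X ^ n (k - 1)) $ i" for i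
      using a g nn z by (cases "i = n k"; cases "i = n (k - 1)") (auto simp: monom_nth)
    then show "\<exists>g h w. \<psi> e k = fps_const g * fps_X ^ n k \<and>
       \<psi> e (k - 1) = fps_const w * \<psi> e k + fps_const h * fps_X ^ n (k - 1)" using 1 fps_ext by blast
  next
    assume "\<exists>g h w. \<psi> e k = fps_const g * fps_X ^ n k \<and>
       \<psi> e (k - 1) = fps_const w * \<psi> e k + fps_const h * fps_X ^ n (k - 1)"
    then show "\<forall>i. i \<noteq> n k \<longrightarrow> i \<noteq> n (k - 1) \<longrightarrow> \<psi> e k $ i = 0 \<and> \<psi> e (k - 1) $ i = 0"
      by (auto simp: monom_nth)
  qed
  finally show ?thesis .
qed

end

section \<open>The normal submodules of rank 2 and their isomorphism type\<close>

lemma frame_cong: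
  assumes "frame E k \<kappa> c \<psi> n e" "\<And>x. x \<in> carrier E \<Longrightarrow> \<psi>' x = \<psi> x" "\<And>j. j \<in> {1..k} \<Longrightarrow> n' j = n j"
  shows "frame E k \<kappa> c \<psi>' n' e"
proof -
  interpret frame E k \<kappa> c \<psi> n e by fact
  interpret C: coords E k \<kappa> c \<psi>' n'
  proof
    show "eqv E (logop \<kappa> c k) \<psi>'" using eqv assms(2) unfolding eqv_def by simp
  qed (use assms mono inj out k c in auto)
  have "C.vals e"
    unfolding C.vals_def
  proof (intro conjI allI impI ballI)
    fix j i assume "i < n' j"
    then show "\<psi>' e j $ i = 0" using e(2) out[of e j] assms(2)[of e] assms(3)[of j]
      by (cases "j \<in> {1..k}") (auto simp: vals_def)
  qed (use e(2) assms in \<open>auto simp: vals_def\<close>)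
  then show ?thesis using e(1) by unfold_locales
qed

text \<open>The result of k - 2 reduction steps, in which coordinate j is eliminated with the
  parameter \<open>w j\<close>.\<close>

definition tw :: "'m ab_mod \<Rightarrow> nat \<Rightarrow> ('m \<Rightarrow> nat \<Rightarrow> complex fps) \<Rightarrow> (nat \<Rightarrow> complex) \<Rightarrow> 'm set" where
  "tw E k \<psi> w = {x \<in> carrier E. \<forall>j\<in>{2..<k}. \<psi> x j = fps_const (w j) * \<psi> x k}"

definition pair2 :: "nat \<Rightarrow> ('m \<Rightarrow> nat \<Rightarrow> complex fps) \<Rightarrow> 'm \<Rightarrow> nat \<Rightarrow> complex fps" where
  "pair2 k \<psi> x j = (if j = 1 then \<psi> x 1 else if j = 2 then \<psi> x k else 0)"

text \<open>Each step raises the remaining exponents by 1, keeping their differences, and multiplies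
  the ratio of the last to the first leading coefficient by (n_k - n_j) / (n_1 - n_j). The final
  ratio does not involve w, which is why all these submodules will be isomorphic.\<close>

lemma frame_tw:
  assumes "2 \<le> k" "frame E k \<kappa> c \<psi> n e"
  shows "\<exists>e'. frame (E \<downharpoonright> tw E k \<psi> w) 2 \<kappa> c (pair2 k \<psi>) (\<lambda>j. (if j = 2 then n k else n 1) + (k - 2)) e' \<and>
    \<psi> e' k $ (n k + (k - 2)) / \<psi> e' 1 $ (n 1 + (k - 2)) =
      (\<Prod>j\<in>{2..<k}. (of_nat (n k) - of_nat (n j)) / (of_nat (n 1) - of_nat (n j))) * (\<psi> e k $ n k / \<psi> e 1 $ n 1)"
  using assms
proof (induction k arbitrary: E \<psi> n e rule: nat_induct_at_least)
  case base
  interpret frame E 2 \<kappa> c \<psi> n e by fact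
  have t: "tw E 2 \<psi> w = carrier E" by (auto simp: tw_def)
  have p: "pair2 2 \<psi> x = \<psi> x" if "x \<in> carrier E" for x
  proof
    fix j :: nat
    have "j = 1 \<or> j = 2 \<or> j \<notin> {1..2}" by auto
    then show "pair2 2 \<psi> x j = \<psi> x j" using out[OF that, of j] by (auto simp: pair2_def)
  qed
  have "frame E 2 \<kappa> c (pair2 2 \<psi>) (\<lambda>j. (if j = 2 then n 2 else n 1) + (2 - 2)) e"
  proof (rule frame_cong[OF base])
    fix j :: nat assume "j \<in> {1..2}"
    then have "j = 1 \<or> j = 2" by auto
    then show "(if j = 2 then n 2 else n 1) + (2 - 2) = n j" by auto
  qed (rule p)
  then show ?case unfolding t by auto
next
  case (Suc k)
  interpret E0: frame E "Suc k" \<kappa> c \<psi> n e by fact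
  have k3: "3 \<le> Suc k" and k2: "2 \<le> Suc k" and kp: "Suc k - 1 = k" using Suc.hyps by auto
  obtain e' where fr: "frame E (Suc k) \<kappa> c \<psi> n e'" and lead: "\<And>j. \<psi> e' j $ n j = \<psi> e j $ n j"
    and ek: "\<psi> e' (Suc k) = fps_const (\<psi> e (Suc k) $ n (Suc k)) * fps_X ^ n (Suc k)"
    and ek1: "\<psi> e' k = fps_const (w k) * \<psi> e' (Suc k) + fps_const (\<psi> e k $ n k) * fps_X ^ n k"
    using E0.frame_adjust[OF k2, of "w k"] unfolding kp by metis
  interpret frame E "Suc k" \<kappa> c \<psi> n e' by (rule fr)
  let ?g = "ab_lin (lam k - 1) \<odot>\<^bsub>E\<^esub> e'"
  note st = frame_step[OF k3 ek, unfolded kp, OF ek1]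
  \<comment> \<open>The first step imposes the relation on coordinate k; the others are imposed
    inside the result and together cut out the same set.\<close>
  have G: "E \<downharpoonright> step_sub (w k) \<downharpoonright> tw (E \<downharpoonright> step_sub (w k)) k step_psi w = E \<downharpoonright> tw E (Suc k) \<psi> w"
  proof -
    have "x \<in> tw (E \<downharpoonright> step_sub (w k)) k step_psi w \<longleftrightarrow> x \<in> tw E (Suc k) \<psi> w" for x
      using Suc.hyps unfolding tw_def step_sub_def step_psi_def kp by (auto simp: less_Suc_eq)
    then have "tw (E \<downharpoonright> step_sub (w k)) k step_psi w = tw E (Suc k) \<psi> w" by blast
    then show ?thesis by simp
  qed
  have p2: "pair2 k step_psi = pair2 (Suc k) \<psi>"
    using Suc.hyps by (auto simp: fun_eq_iff pair2_def step_psi_def kp)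
  have sn: "(\<lambda>j. (if j = 2 then step_n k else step_n 1) + (k - 2)) = (\<lambda>j. (if j = 2 then n (Suc k) else n 1) + (Suc k - 2))"
    "step_n k + (k - 2) = n (Suc k) + (Suc k - 2)" "step_n 1 + (k - 2) = n 1 + (Suc k - 2)"
    using Suc.hyps by (auto simp: fun_eq_iff step_n_def kp)
  have sp: "step_psi x k = \<psi> x (Suc k)" "step_psi x 1 = \<psi> x 1" for x
    using Suc.hyps by (auto simp: step_psi_def kp)
  obtain d where d: "frame (E \<downharpoonright> tw E (Suc k) \<psi> w) 2 \<kappa> c (pair2 (Suc k) \<psi>) (\<lambda>j. (if j = 2 then n (Suc k) else n 1) + (Suc k - 2)) d"
    and r: "\<psi> d (Suc k) $ (n (Suc k) + (Suc k - 2)) / \<psi> d 1 $ (n 1 + (Suc k - 2)) =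
      (\<Prod>j\<in>{2..<k}. (of_nat (step_n k) - of_nat (step_n j)) / (of_nat (step_n 1) - of_nat (step_n j))) *
      (step_psi ?g k $ step_n k / step_psi ?g 1 $ step_n 1)"
    using Suc.IH[OF st(1)] unfolding G p2 sn sp by blast
  have pr: "(\<Prod>j\<in>{2..<k}. (of_nat (step_n k) - of_nat (step_n j)) / (of_nat (step_n 1) - of_nat (step_n j))) =
     (\<Prod>j\<in>{2..<k}. (of_nat (n (Suc k)) - of_nat (n j)) / (of_nat (n 1) - of_nat (n j) :: complex))"
    using Suc.hyps by (intro prod.cong) (auto simp: step_n_def kp)
  have "\<psi> d (Suc k) $ (n (Suc k) + (Suc k - 2)) / \<psi> d 1 $ (n 1 + (Suc k - 2)) =
      (\<Prod>j\<in>{2..<Suc k}. (of_nat (n (Suc k)) - of_nat (n j)) / (of_nat (n 1) - of_nat (n j))) *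
      (\<psi> e (Suc k) $ n (Suc k) / \<psi> e 1 $ n 1)"
    unfolding r pr st(3,4) lead using Suc.hyps by simp
  with d show ?case by blast
qed

text \<open>Coordinates are injective and determine the action by \<open>eqv_transfer\<close>, so a
  module can be recovered from the set of its coordinate vectors.\<close>

lemma coords_iso:
  assumes "coords E k \<kappa> c \<psi> n" "coords E' k \<kappa> c \<psi>' n'" "\<psi> ` carrier E = \<psi>' ` carrier E'"
  shows "E \<simeq> E'"
proof -
  interpret A: coords E k \<kappa> c \<psi> n by fact
  interpret B: coords E' k \<kappa> c \<psi>' n' by fact
  define h where "h x = inv_into (carrier E') \<psi>' (\<psi> x)" for x
  have h: "h x \<in> carrier E'" "\<psi>' (h x) = \<psi> x" if "x \<in> carrier E" for x
  proof -
    have "\<psi> x \<in> \<psi>' ` carrier E'" using that assms(3) by blast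
    then show "h x \<in> carrier E'" "\<psi>' (h x) = \<psi> x" unfolding h_def by (auto intro: inv_into_into f_inv_into_f)
  qed
  have eqI: "x = y" if "x \<in> carrier E'" "y \<in> carrier E'" "\<psi>' x = \<psi>' y" for x y
    using B.psi_eqI that by simp
  have "h \<in> lmod_hom Atilde E E'"
  proof (rule lmod_homI)
    fix x y assume xy: "x \<in> carrier E" "y \<in> carrier E"
    show "h (x \<oplus>\<^bsub>E\<^esub> y) = h x \<oplus>\<^bsub>E'\<^esub> h y"
      by (rule eqI) (use xy h in \<open>auto simp: fun_eq_iff A.psi_add B.psi_add\<close>)
    fix u
    have "\<psi>' (u \<odot>\<^bsub>E'\<^esub> h x) = \<psi> (u \<odot>\<^bsub>E\<^esub> x)"
      by (rule eqv_transfer[OF B.abmod_axioms A.abmod_axioms B.eqv A.eqv]) (use xy h in auto)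
    then show "h (u \<odot>\<^bsub>E\<^esub> x) = u \<odot>\<^bsub>E'\<^esub> h x" by (intro eqI) (use xy h in auto)
  qed (rule h)
  moreover have "bij_betw h (carrier E) (carrier E')"
    unfolding bij_betw_def
  proof
    show "inj_on h (carrier E)" by (rule inj_onI) (metis h(2) A.psi_eqI)
    show "h ` carrier E = carrier E'"
    proof
      show "carrier E' \<subseteq> h ` carrier E"
      proof
        fix y assume y: "y \<in> carrier E'"
        then obtain x where "x \<in> carrier E" "\<psi>' y = \<psi> x" using assms(3) by (metis imageE imageI)
        then show "y \<in> h ` carrier E" using y h eqI by (metis imageI)
      qed
    qed (use h in auto)
  qed
  ultimately show ?thesis unfolding lmod_iso_def by blast
qed

lemma frame2_normal_form:
  assumes "frame E 2 \<kappa> c \<psi> n e"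
  obtains e' y where "frame E 2 \<kappa> c \<psi> n e'" "y \<in> carrier E"
    "\<psi> e' 1 = fps_const (\<psi> e 1 $ n 1) * fps_X ^ n 1" "\<psi> e' 2 = fps_const (\<psi> e 2 $ n 2) * fps_X ^ n 2"
    "\<psi> y 1 = fps_X ^ (n 1 + 1)" "\<psi> y 2 = 0"
    "\<And>x. x \<in> carrier E \<Longrightarrow> \<exists>S T. x = bmul E S e' \<oplus>\<^bsub>E\<^esub> bmul E T y"
proof -
  interpret coords E 2 \<kappa> c \<psi> n using assms by (rule frame.axioms(1))
  interpret E0: frame E 2 \<kappa> c \<psi> n e by fact
  have k1: "2 - 1 = (1 :: nat)" by simp
  obtain e' where fr: "frame E 2 \<kappa> c \<psi> n e'" and ek: "\<psi> e' 2 = fps_const (\<psi> e 2 $ n 2) * fps_X ^ n 2"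
    and e1: "\<psi> e' 1 = fps_const (\<psi> e 1 $ n 1) * fps_X ^ n 1"
    using E0.frame_adjust[of 0, unfolded k1] by auto
  interpret F: frame E 2 \<kappa> c \<psi> n e' by (rule fr)
  have "\<exists>y\<in>fl 1. \<psi> y 1 = fps_X ^ (n 1 + 1)" using F.fl_gen[of 1] by (simp add: power_add mult.commute)
  then obtain y where y: "y \<in> fl 1" "\<psi> y 1 = fps_X ^ (n 1 + 1)" by blast
  have yc: "y \<in> carrier E" "\<psi> y 2 = 0" using y by (auto simp: fl_def)
  have g: "\<psi> e 2 $ n 2 \<noteq> 0" using E0.e(2) by (auto simp: vals_def)
  have "\<exists>S T. x = bmul E S e' \<oplus>\<^bsub>E\<^esub> bmul E T y" if x: "x \<in> carrier E" for x
  proof -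
    obtain S where S: "\<psi> x 2 = fps_X ^ n 2 * S" using F.psi_k_dvd[OF x] by (auto simp: dvd_def)
    let ?S = "fps_const (inverse (\<psi> e 2 $ n 2)) * S"
    have "?S * \<psi> e' 2 = fps_const (inverse (\<psi> e 2 $ n 2) * (\<psi> e 2 $ n 2)) * (fps_X ^ n 2 * S)"
      unfolding ek by (simp only: fps_const_mult[symmetric] mult_ac)
    then have S': "?S * \<psi> e' 2 = \<psi> x 2" using g S by simp
    let ?z = "x \<ominus>\<^bsub>E\<^esub> bmul E ?S e'"
    have z2: "\<psi> ?z 2 = 0" using x S' by (simp add: psi_minus psi_bmul)
    have "\<psi> ?z i = 0" if "i > 1" for i
      using z2 out[of ?z i] x that by (cases "i = 2") auto
    then have "?z \<in> fl 1" using x by (simp add: fl_def)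
    from F.fl_dvd[OF _ this] have "fps_X ^ (n 1 + 1) dvd \<psi> ?z 1" by (simp add: power_add mult.commute)
    then obtain T where T: "\<psi> ?z 1 = fps_X ^ (n 1 + 1) * T" by (rule dvdE)
    have "x = bmul E ?S e' \<oplus>\<^bsub>E\<^esub> bmul E T y"
    proof (rule psi_eqI)
      fix j :: nat assume "j \<in> {1..2}"
      then have "j = 1 \<or> j = 2" by auto
      then show "\<psi> x j = \<psi> (bmul E ?S e' \<oplus>\<^bsub>E\<^esub> bmul E T y) j"
        using T S' x yc y(2) by (auto simp: psi_add psi_bmul psi_minus algebra_simps)
    qed (use x yc in auto)
    then show ?thesis by blast
  qed
  then show ?thesis using that[OF fr yc(1) e1 ek y(2) yc(2)] by blast
qed

text \<open>In normal form E is spanned over C[[b]] by (g_1 b^(n_1), g_2 b^(n_2)) and (b^(n_1 + 1),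
  0). After division of the first vector by g_1 only the ratio g_2 / g_1 remains.\<close>

lemma frame2_image:
  assumes fr: "frame E 2 \<kappa> c \<psi> n e"
  shows "\<psi> ` carrier E = {f. \<exists>S T. f = (\<lambda>j. if j = 1 then S * fps_X ^ n 1 + T * fps_X ^ (n 1 + 1)
        else if j = 2 then S * fps_const (\<psi> e 2 $ n 2 / \<psi> e 1 $ n 1) * fps_X ^ n 2 else 0)}" (is "_ = ?I")
proof -
  interpret coords E 2 \<kappa> c \<psi> n using fr by (rule frame.axioms(1))
  interpret E0: frame E 2 \<kappa> c \<psi> n e by fact
  obtain d y where d: "frame E 2 \<kappa> c \<psi> n d" "y \<in> carrier E"
    "\<psi> d 1 = fps_const (\<psi> e 1 $ n 1) * fps_X ^ n 1" "\<psi> d 2 = fps_const (\<psi> e 2 $ n 2) * fps_X ^ n 2"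
    "\<psi> y 1 = fps_X ^ (n 1 + 1)" "\<psi> y 2 = 0"
    and gen: "\<And>x. x \<in> carrier E \<Longrightarrow> \<exists>S T. x = bmul E S d \<oplus>\<^bsub>E\<^esub> bmul E T y"
    using frame2_normal_form[OF fr] by metis
  interpret D: frame E 2 \<kappa> c \<psi> n d by (rule d)
  let ?g = "\<psi> e 1 $ n 1"
  have g: "?g \<noteq> 0" using E0.e(2) by (auto simp: vals_def)
  have p: "\<psi> (bmul E S d \<oplus>\<^bsub>E\<^esub> bmul E T y) = (\<lambda>j. if j = 1 then (fps_const ?g * S) * fps_X ^ n 1 + T * fps_X ^ (n 1 + 1)
      else if j = 2 then (fps_const ?g * S) * fps_const (\<psi> e 2 $ n 2 / ?g) * fps_X ^ n 2 else 0)" for S T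
  proof
    fix j :: nat
    have e2: "fps_const (\<psi> e 2 $ n 2) = fps_const ?g * fps_const (\<psi> e 2 $ n 2 / ?g)" using g by simp
    have "j = 1 \<or> j = 2 \<or> j \<notin> {1..2}" by auto
    then consider "j = 1" | "j = 2" | "j \<notin> {1..2}" by blast
    then show "\<psi> (bmul E S d \<oplus>\<^bsub>E\<^esub> bmul E T y) j = (if j = 1 then (fps_const ?g * S) * fps_X ^ n 1 + T * fps_X ^ (n 1 + 1)
      else if j = 2 then (fps_const ?g * S) * fps_const (\<psi> e 2 $ n 2 / ?g) * fps_X ^ n 2 else 0)"
    proof cases
      case 2 then show ?thesis using d(2,6) by (simp add: psi_add psi_bmul d(4) e2 mult_ac del: fps_const_mult)
    next
      case 3 then show ?thesis using d(2) out[of "bmul E S d \<oplus>\<^bsub>E\<^esub> bmul E T y" j] by auto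
    qed (use d(2,5) in \<open>simp add: psi_add psi_bmul d(3) mult_ac\<close>)
  qed
  show ?thesis
  proof
    show "\<psi> ` carrier E \<subseteq> ?I"
    proof
      fix f assume "f \<in> \<psi> ` carrier E"
      then obtain S T where "f = \<psi> (bmul E S d \<oplus>\<^bsub>E\<^esub> bmul E T y)" using gen by blast
      then show "f \<in> ?I" unfolding p by blast
    qed
    show "?I \<subseteq> \<psi> ` carrier E"
    proof
      fix f assume "f \<in> ?I"
      then obtain S T where f: "f = (\<lambda>j. if j = 1 then S * fps_X ^ n 1 + T * fps_X ^ (n 1 + 1)
        else if j = 2 then S * fps_const (\<psi> e 2 $ n 2 / \<psi> e 1 $ n 1) * fps_X ^ n 2 else 0)" by blast
      have "fps_const ?g * (fps_const (inverse ?g) * S) = fps_const (?g * inverse ?g) * S"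
        by (simp only: fps_const_mult[symmetric] mult.assoc)
      then have S: "fps_const ?g * (fps_const (inverse ?g) * S) = S" using g by simp
      have "f = \<psi> (bmul E (fps_const (inverse ?g) * S) d \<oplus>\<^bsub>E\<^esub> bmul E T y)" 
        by (rule trans[OF f]) (subst p, subst S, subst S, rule refl)
      then show "f \<in> \<psi> ` carrier E" by (rule image_eqI) (use d(2) in simp)
    qed
  qed
qed

lemma frame2_iso:
  assumes "frame E 2 \<kappa> c \<psi> n e" "frame E' 2 \<kappa> c \<psi>' n e'"
    "\<psi> e 2 $ n 2 / \<psi> e 1 $ n 1 = \<psi>' e' 2 $ n 2 / \<psi>' e' 1 $ n 1"
  shows "E \<simeq> E'"
proof -
  have "coords E 2 \<kappa> c \<psi> n" "coords E' 2 \<kappa> c \<psi>' n" using assms(1,2) by (auto dest: frame.axioms(1))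
  then show ?thesis
    by (rule coords_iso) (simp only: frame2_image[OF assms(1)] frame2_image[OF assms(2)] assms(3))
qed

text \<open>Two divisions in succession, by a - l2 b and by a - l1 b, reduce an annihilator of f to
  remainders S and T, which freeness makes vanish. The unit 1 + x b^p is inverted in
  between.\<close>

lemma rank2_quot_iso:
  assumes "abmod M" "f \<in> carrier M" "y \<in> carrier M" "cyc_sub Atilde M f = carrier M" "1 \<le> p"
    and f: "ab_lin l2 \<odot>\<^bsub>M\<^esub> f = bmul M (1 + fps_const x * fps_X ^ p) y" and y: "ab_lin l1 \<odot>\<^bsub>M\<^esub> y = \<zero>\<^bsub>M\<^esub>"
    and free: "\<And>S T. bmul M S f \<oplus>\<^bsub>M\<^esub> bmul M T y = \<zero>\<^bsub>M\<^esub> \<Longrightarrow> S = 0 \<and> T = 0"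
  shows "M \<simeq> ab_rank2_quot l1 x p l2"
proof -
  interpret abmod M by fact
  let ?U = "1 + fps_const x * fps_X ^ p"
  have U0: "?U $ 0 \<noteq> 0" using assms(5) by simp
  have UU: "inverse ?U * ?U = 1" by (rule inverse_mult_eq_1[OF U0])
  let ?P = "ab_mult (ab_mult (ab_lin l1) (ab_of_b (inverse ?U))) (ab_lin l2)"
  have "M \<simeq> ab_cyclic ?P"
  proof (rule ab_cyclic_iso[OF assms(1,2,4)])
    fix u
    show "u \<odot>\<^bsub>M\<^esub> f = \<zero>\<^bsub>M\<^esub> \<longleftrightarrow> (\<exists>q. u = ab_mult q ?P)"
    proof
      assume uf: "u \<odot>\<^bsub>M\<^esub> f = \<zero>\<^bsub>M\<^esub>"
      obtain q S where u: "u = ab_mult q (ab_lin l2) + ab_of_b S" using ab_lin_division by blast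
      obtain q' T where q': "ab_mult q (ab_of_b ?U) = ab_mult q' (ab_lin l1) + ab_of_b T" using ab_lin_division by blast
      have "q \<odot>\<^bsub>M\<^esub> (ab_lin l2 \<odot>\<^bsub>M\<^esub> f) = ab_mult q (ab_of_b ?U) \<odot>\<^bsub>M\<^esub> y"
        unfolding f using assms(3) by (simp add: smul_mult)
      also have "\<dots> = bmul M T y" unfolding q' using assms(3) y by (simp add: smul_add_left smul_mult)
      finally have "u \<odot>\<^bsub>M\<^esub> f = bmul M T y \<oplus>\<^bsub>M\<^esub> bmul M S f"
        unfolding u using assms(2) by (simp add: smul_add_left smul_mult)
      then have "bmul M S f \<oplus>\<^bsub>M\<^esub> bmul M T y = \<zero>\<^bsub>M\<^esub>" using uf assms(2,3) by (simp add: M.a_comm)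
      then have "S = 0 \<and> T = 0" by (rule free)
      then have "u = ab_mult q (ab_lin l2)" "ab_mult q (ab_of_b ?U) = ab_mult q' (ab_lin l1)" using u q' by auto
      moreover have "q = ab_mult (ab_mult q (ab_of_b ?U)) (ab_of_b (inverse ?U))"
        using UU by (simp only: ab_mult_assoc ab_mult_of_b mult.commute[of ?U]) (simp add: ab_mult_1_right)
      ultimately have "u = ab_mult q' ?P" by (metis ab_mult_assoc)
      then show "\<exists>q. u = ab_mult q ?P" by blast
    next
      assume "\<exists>q. u = ab_mult q ?P"
      then obtain q where "u = ab_mult q ?P" by blast
      then have "u \<odot>\<^bsub>M\<^esub> f = q \<odot>\<^bsub>M\<^esub> (ab_lin l1 \<odot>\<^bsub>M\<^esub> (bmul M (inverse ?U) (bmul M ?U y)))"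
        using assms(2,3) by (simp add: smul_mult f)
      also have "bmul M (inverse ?U) (bmul M ?U y) = y"
        using UU assms(3) by (simp flip: bmul_mult)
      finally show "u \<odot>\<^bsub>M\<^esub> f = \<zero>\<^bsub>M\<^esub>" by (simp add: y)
    qed
  qed
  then show ?thesis by (simp add: ab_rank2_quot_def)
qed

text \<open>For the normal form d, the element (a - (\<kappa> + n_2) b) d has second coordinate 0
  and first coordinate (n_1 - n_2) g_1 b^(n_1 + 1) + c g_2 b^(n_2 + 1). The quotient of the two
  coefficients is x, the distance of the exponents is p.\<close>

lemma frame2_rank2_quot:
  assumes "frame E 2 \<kappa> c \<psi> n e"
  shows "E \<simeq> ab_rank2_quot (\<kappa> + of_nat (n 1) + 1) (c * \<psi> e 2 $ n 2 / ((of_nat (n 1) - of_nat (n 2)) * \<psi> e 1 $ n 1))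
    (n 2 - n 1) (\<kappa> + of_nat (n 2))"
proof -
  interpret coords E 2 \<kappa> c \<psi> n using assms by (rule frame.axioms(1))
  interpret E0: frame E 2 \<kappa> c \<psi> n e by fact
  obtain d y where d: "frame E 2 \<kappa> c \<psi> n d" "y \<in> carrier E"
    "\<psi> d 1 = fps_const (\<psi> e 1 $ n 1) * fps_X ^ n 1" "\<psi> d 2 = fps_const (\<psi> e 2 $ n 2) * fps_X ^ n 2"
    "\<psi> y 1 = fps_X ^ (n 1 + 1)" "\<psi> y 2 = 0"
    using frame2_normal_form[OF assms] by metis
  interpret D: frame E 2 \<kappa> c \<psi> n d by (rule d)
  have n12: "n 1 < n 2" using mono[of 1 2] by simp
  let ?g1 = "\<psi> e 1 $ n 1" let ?g2 = "\<psi> e 2 $ n 2"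
  have g: "?g1 \<noteq> 0" "?g2 \<noteq> 0" using E0.e(2) by (auto simp: vals_def)
  \<comment> \<open>The coefficient of b^(n_1 + 1) in that first coordinate; scaling y by it makes
    the unit start with 1.\<close>
  define h where "h = (of_nat (n 1) - of_nat (n 2)) * ?g1"
  have h: "h \<noteq> 0" using n12 g by (simp add: h_def)
  let ?y = "bmul E (fps_const h) y"
  have y1: "\<psi> ?y 1 $ m = (if m = n 1 + 1 then h else 0)" and y2: "\<psi> ?y 2 = 0" for m
    using d(2,5,6) by (auto simp: psi_bmul fps_X_power_nth)
  have yc: "?y \<in> carrier E" using d by simp
  have two: "j = 1 \<or> j = 2" if "j \<in> {1..2}" for j :: nat using that by auto
  show ?thesis
  proof (rule rank2_quot_iso[OF abmod_axioms D.e_car yc D.e(1)])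
    show "1 \<le> n 2 - n 1" using n12 by simp
    show "ab_lin (\<kappa> + of_nat (n 1) + 1) \<odot>\<^bsub>E\<^esub> ?y = \<zero>\<^bsub>E\<^esub>"
    proof (rule inj)
      fix j :: nat assume "j \<in> {1..2}"
      from two[OF this] have "\<psi> (ab_lin (\<kappa> + of_nat (n 1) + 1) \<odot>\<^bsub>E\<^esub> ?y) j $ m = 0" for m
        by (cases m) (auto simp: psi_lin_nth[OF yc] y1 y2)
      then show "\<psi> (ab_lin (\<kappa> + of_nat (n 1) + 1) \<odot>\<^bsub>E\<^esub> ?y) j = 0" by (simp add: fps_eq_iff)
    qed (use yc in simp)
    let ?x = "c * ?g2 / ((of_nat (n 1) - of_nat (n 2)) * ?g1)"
    have hx: "h * ?x = c * ?g2" using h by (simp add: h_def)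
    show "ab_lin (\<kappa> + of_nat (n 2)) \<odot>\<^bsub>E\<^esub> d = bmul E (1 + fps_const ?x * fps_X ^ (n 2 - n 1)) ?y"
    proof (rule psi_eqI)
      fix j :: nat assume "j \<in> {1..2}"
      from two[OF this] show "\<psi> (ab_lin (\<kappa> + of_nat (n 2)) \<odot>\<^bsub>E\<^esub> d) j = \<psi> (bmul E (1 + fps_const ?x * fps_X ^ (n 2 - n 1)) ?y) j"
      proof
        assume j: "j = 1"
        have "\<psi> ?y 1 = fps_const h * fps_X ^ (n 1 + 1)" using d(2,5) by (simp add: psi_bmul)
        then have "(1 + fps_const ?x * fps_X ^ (n 2 - n 1)) * \<psi> ?y 1
           = fps_const h * fps_X ^ (n 1 + 1) + fps_const (h * ?x) * (fps_X ^ (n 2 - n 1) * fps_X ^ (n 1 + 1))"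
          by (simp only: fps_const_mult[symmetric] algebra_simps mult_1_left)
        also have "fps_X ^ (n 2 - n 1) * fps_X ^ (n 1 + 1) = (fps_X ^ (n 2 + 1) :: complex fps)"
          using n12 by (simp flip: power_add)
        finally have r: "\<psi> (bmul E (1 + fps_const ?x * fps_X ^ (n 2 - n 1)) ?y) 1 $ m =
           (if m = n 1 + 1 then h else 0) + (if m = n 2 + 1 then c * ?g2 else 0)" for m
          using yc unfolding hx by (simp only: psi_bmul) (simp only: fps_add_nth monom_nth)
        show ?thesis unfolding j
        proof (rule fps_ext)
          fix m
          show "\<psi> (ab_lin (\<kappa> + of_nat (n 2)) \<odot>\<^bsub>E\<^esub> d) 1 $ m = \<psi> (bmul E (1 + fps_const ?x * fps_X ^ (n 2 - n 1)) ?y) 1 $ m"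
            unfolding r psi_lin_nth[OF D.e_car] d(3,4) monom_nth
            by (cases m) (use n12 in \<open>auto simp: h_def algebra_simps\<close>)
        qed
      next
        assume j: "j = 2"
        show ?thesis unfolding j
        proof (rule fps_ext)
          fix m
          show "\<psi> (ab_lin (\<kappa> + of_nat (n 2)) \<odot>\<^bsub>E\<^esub> d) 2 $ m = \<psi> (bmul E (1 + fps_const ?x * fps_X ^ (n 2 - n 1)) ?y) 2 $ m"
            using yc y2 by (cases m) (auto simp: psi_lin_nth[OF D.e_car] d(4) monom_nth psi_bmul[OF yc])
        qed
      qed
    qed (use yc in auto)
    fix S T assume z: "bmul E S d \<oplus>\<^bsub>E\<^esub> bmul E T ?y = \<zero>\<^bsub>E\<^esub>"
    have "S * \<psi> d 2 = 0" using arg_cong[OF z, of "\<lambda>x. \<psi> x 2"] yc y2 by (simp add: psi_add psi_bmul)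
    then have S: "S = 0" using g by (simp add: d(4))
    then have "T * \<psi> ?y 1 = 0" using arg_cong[OF z, of "\<lambda>x. \<psi> x 1"] yc by (simp add: psi_add psi_bmul)
    moreover have "\<psi> ?y 1 \<noteq> 0" using y1[of "n 1 + 1"] h by auto
    ultimately show "S = 0 \<and> T = 0" using S by simp
  qed
qed

section \<open>Uniqueness of the exponents\<close>

lemma (in abmod) unit_gen:
  assumes "V $ 0 \<noteq> 0" "x \<in> carrier E" "cyc_sub Atilde E x = carrier E"
  shows "cyc_sub Atilde E (bmul E V x) = carrier E"
proof
  show "cyc_sub Atilde E (bmul E V x) \<subseteq> carrier E" by (rule cyc_sub_least[OF submodule_carrier]) (use assms in simp)
  have "x = bmul E (inverse V * V) x" using assms by (simp add: inverse_mult_eq_1)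
  then have "x = ab_of_b (inverse V) \<odot> bmul E V x" using assms(2) by (metis bmul_mult)
  then have "x \<in> cyc_sub Atilde E (bmul E V x)" by (auto simp: cyc_sub_def)
  then show "carrier E \<subseteq> cyc_sub Atilde E (bmul E V x)"
    using cyc_sub_least[OF cyc_sub_submodule, of "bmul E V x" x] assms by simp
qed

text \<open>Applying k operators a - l b, one for each exponent and with units in between,
  annihilates e. On the functional \<open>L i\<close> such an operator acts as the scalar \<nu> + i
  - l, so one of these scalars vanishes. \<open>W\<close> and \<open>L\<close> abstract the order
  filtration and a leading coefficient of another frame.\<close>

lemma frame_roots:
  assumes "frame E k \<kappa> c \<psi> n e"
    and "\<And>i x V. x \<in> W i \<Longrightarrow> V $ 0 = 1 \<Longrightarrow> bmul E V x \<in> W i \<and> L i (bmul E V x) = (L i x :: complex)"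
    and "\<And>i x l. x \<in> W i \<Longrightarrow> ab_lin l \<odot>\<^bsub>E\<^esub> x \<in> W (Suc i) \<and> L (Suc i) (ab_lin l \<odot>\<^bsub>E\<^esub> x) = (\<nu> + of_nat i - l) * L i x"
    and "\<And>i. L i \<zero>\<^bsub>E\<^esub> = 0" "e \<in> W 0" "L 0 e \<noteq> 0"
  shows "\<exists>j\<in>{1..k}. \<nu> = \<kappa> + of_nat (n j)"
  using assms
proof (induction k arbitrary: E c n e W L \<nu>)
  case 0
  then interpret frame E 0 \<kappa> c \<psi> n e by simp
  show ?case using k by simp
next
  case (Suc k)
  interpret frame E "Suc k" \<kappa> c \<psi> n e by fact
  note W = Suc.prems(2,3)
  show ?case
  proof (cases "\<nu> = \<kappa> + of_nat (n (Suc k))")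
    case True then show ?thesis by auto
  next
    case False
    show ?thesis
    proof (cases "k = 0")
      case True
      obtain V where V: "V $ 0 = 1" "V * \<psi> e 1 = fps_const (\<psi> e 1 $ n 1) * fps_X ^ n 1"
        using fps_normalize[of "\<psi> e 1" "n 1"] e(2) True unfolding vals_def by auto
      let ?y = "ab_lin (\<kappa> + of_nat (n 1)) \<odot>\<^bsub>E\<^esub> bmul E V e"
      have p: "\<psi> (bmul E V e) 1 = fps_const (\<psi> e 1 $ n 1) * fps_X ^ n 1" using V by (simp add: psi_bmul)
      have "\<psi> ?y 1 $ m = 0" for m
        using c True by (cases m) (auto simp: psi_lin_nth p monom_nth)
      then have "\<psi> ?y 1 = 0" by (simp add: fps_eq_iff)
      moreover have "j = 1" if "j \<in> {1..Suc k}" for j using that True by (auto simp: One_nat_def)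
      ultimately have "?y = \<zero>\<^bsub>E\<^esub>" by (intro inj) auto
      moreover have "L 1 ?y = (\<nu> - (\<kappa> + of_nat (n 1))) * L 0 e"
        using W(1)[OF Suc.prems(5) V(1)] W(2)[of "bmul E V e" 0 "\<kappa> + of_nat (n 1)"] by (simp add: One_nat_def)
      ultimately have "\<nu> = \<kappa> + of_nat (n 1)" using Suc.prems(4,6) by simp
      then show ?thesis by (intro bexI[of _ 1]) auto
    next
      case k0: False
      then have k2: "2 \<le> Suc k" by simp
      obtain V where V: "V $ 0 = 1"
        and fr: "frame (E \<downharpoonright> fl k) k \<kappa> 0 \<psi> (\<lambda>j. n j + 1) (ab_lin (\<kappa> + of_nat (n (Suc k))) \<odot>\<^bsub>E\<^esub> bmul E V e)"
        using frame_down[OF k2] by (metis diff_Suc_1)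
      let ?y = "ab_lin (\<kappa> + of_nat (n (Suc k))) \<odot>\<^bsub>E\<^esub> bmul E V e"
      have y: "?y \<in> W 1" "L 1 ?y = (\<nu> - (\<kappa> + of_nat (n (Suc k)))) * L 0 e"
        using W(1)[OF Suc.prems(5) V(1)] W(2)[of "bmul E V e" 0 "\<kappa> + of_nat (n (Suc k))"] by (simp_all add: One_nat_def)
      \<comment> \<open>After one descent the functional and the exponents are both shifted by 1,
        hence the comparison of \<nu> + 1 with n_j + 1.\<close>
      have "\<exists>j\<in>{1..k}. \<nu> + 1 = \<kappa> + of_nat (n j + 1)"
      proof (rule Suc.IH[OF fr, where W = "\<lambda>i. W (Suc i)" and L = "\<lambda>i. L (Suc i)"])
        show "?y \<in> W (Suc 0)" "L (Suc 0) ?y \<noteq> 0" using y False Suc.prems(6) by (simp_all add: One_nat_def)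
      qed (use W Suc.prems(4) in \<open>auto simp: algebra_simps\<close>)
      then show ?thesis by force
    qed
  qed
qed

context frame
begin

text \<open>If x = u e, all leading coefficients are multiplied by the same scalar, the constant
  term of u; writing e = v x shows that it is nonzero. Ratios of leading coefficients thus depend on
  the coordinates only.\<close>

lemma gen_lead:
  assumes "x \<in> carrier E" "cyc_sub Atilde E x = carrier E"
  obtains t where "t \<noteq> 0" "\<And>j. \<psi> x j $ n j = t * \<psi> e j $ n j" "vals x"
proof -
  have d: "n 1 \<le> n k" using n_mono[of 1 k] k by auto
  obtain u where u: "x = u \<odot> e" using genE[OF assms(1)] by blast
  obtain v where v: "e = v \<odot> x" using assms(2) e_car by (metis cyc_subE)
  let ?t = "coeff (u $ 0) 0"
  have eo: "i < n j \<Longrightarrow> \<psi> e j $ i = 0" for i j using e(2) by (auto simp: vals_def)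
  have lead: "\<psi> x j $ n j = ?t * \<psi> e j $ n j" for j
    unfolding u by (rule psi_val(2)[OF d]) (use eo in auto)
  have xo: "i < n j \<Longrightarrow> \<psi> x j $ i = 0" for i j using psi_order[OF assms(1)] .
  have "\<psi> e j $ n j = coeff (v $ 0) 0 * \<psi> x j $ n j" for j
    by (subst v) (rule psi_val(2)[OF d assms(1) xo])
  moreover have "\<psi> e 1 $ n 1 \<noteq> 0" using e(2) k by (auto simp: vals_def)
  ultimately have t: "?t \<noteq> 0" using lead[of 1] by (metis mult_zero_left mult_zero_right)
  then have "vals x" using xo assms(1) e(2) lead by (auto simp: vals_def)
  with t lead that show ?thesis by blast
qed

lemma frame_change_gen:
  assumes "x \<in> carrier E" "cyc_sub Atilde E x = carrier E"
  shows "frame E k \<kappa> c \<psi> n x"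
proof -
  have "vals x" using gen_lead[OF assms] by blast
  then show ?thesis using assms(2) by unfold_locales
qed

end

text \<open>An instance of \<open>frame_roots\<close>: the functional is the leading coefficient of
  coordinate j of the second frame, whose generator is replaced by that of the first.\<close>

lemma frame_exponents_subset:
  assumes "frame E k \<kappa> c \<psi> n e" "frame E k' \<kappa>' c' \<psi>' n' e'" "j \<in> {1..k'}"
  shows "\<exists>i\<in>{1..k}. \<kappa>' + of_nat (n' j) = \<kappa> + of_nat (n i)"
proof -
  interpret A: frame E k \<kappa> c \<psi> n e by fact
  interpret B0: frame E k' \<kappa>' c' \<psi>' n' e' by fact
  interpret B: frame E k' \<kappa>' c' \<psi>' n' e by (rule B0.frame_change_gen) (use A.e in auto)
  define W where "W i = {x \<in> carrier E. \<forall>j. \<forall>m<n' j + i. \<psi>' x j $ m = 0}" for i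
  have d: "n' 1 + i \<le> n' k' + i" for i using B0.n_mono[of 1 k'] B0.k by auto
  show ?thesis
  proof (rule frame_roots[OF assms(1), where W = W and L = "\<lambda>i x. \<psi>' x j $ (n' j + i)"])
    fix i x V assume x: "x \<in> W i" and V: "V $ 0 = (1::complex)"
    then have xc: "x \<in> carrier E" and xo: "\<And>m j. m < n' j + i \<Longrightarrow> \<psi>' x j $ m = 0" by (auto simp: W_def)
    show "bmul E V x \<in> W i \<and> \<psi>' (bmul E V x) j $ (n' j + i) = \<psi>' x j $ (n' j + i)"
      using B0.psi_val[where d = "\<lambda>j. n' j + i" and x = x and u = "ab_of_b V", OF d xc xo] xc V unfolding W_def by auto
  next
    fix i x l assume x: "x \<in> W i"
    then have xc: "x \<in> carrier E" and xo: "\<And>m j. m < n' j + i \<Longrightarrow> \<psi>' x j $ m = 0" by (auto simp: W_def)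
    have "\<psi>' (ab_lin l \<odot>\<^bsub>E\<^esub> x) j $ m = 0" if "m < n' j + Suc i" for m j
    proof (cases m)
      case (Suc m')
      then have "\<psi>' x j $ m' = 0" "j = 1 \<Longrightarrow> \<psi>' x k' $ m' = 0" using that d[of i] by (auto intro!: xo)
      then show ?thesis using Suc by (auto simp: B0.psi_lin_nth[OF xc])
    qed (simp add: B0.psi_lin_nth[OF xc])
    then have "ab_lin l \<odot>\<^bsub>E\<^esub> x \<in> W (Suc i)" using xc by (simp add: W_def)
    moreover have "c' * \<psi>' x k' $ (n' j + i) = 0" if "j = 1"
    proof (cases "k' = 1")
      case True then show ?thesis using B0.c by simp
    next
      case False
      then have "n' 1 < n' k'" using B0.mono[of 1 k'] B0.k by auto
      then show ?thesis using xo[of "n' j + i" k'] that by simp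
    qed
    ultimately show "ab_lin l \<odot>\<^bsub>E\<^esub> x \<in> W (Suc i) \<and>
      \<psi>' (ab_lin l \<odot>\<^bsub>E\<^esub> x) j $ (n' j + Suc i) = (\<kappa>' + of_nat (n' j) + of_nat i - l) * \<psi>' x j $ (n' j + i)"
      by (auto simp: B0.psi_lin_nth[OF xc] algebra_simps)
  next
    show "e \<in> W 0" using B0.psi_order by (auto simp: W_def)
    show "\<psi>' e j $ (n' j + 0) \<noteq> 0" using B.e(2) assms(3) by (auto simp: B0.vals_def)
  qed simp
qed

lemma strict_enum_unique:
  fixes f g :: "nat \<Rightarrow> int"
  assumes "\<And>i j. 1 \<le> i \<Longrightarrow> i < j \<Longrightarrow> j \<le> k \<Longrightarrow> f i < f j" "\<And>i j. 1 \<le> i \<Longrightarrow> i < j \<Longrightarrow> j \<le> k' \<Longrightarrow> g i < g j"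
    "f ` {1..k} = g ` {1..k'}"
  shows "k = k' \<and> (\<forall>j\<in>{1..k}. f j = g j)"
proof -
  have s: "sorted_wrt (<) (map h [1..<Suc m])"
    if "\<And>i j. 1 \<le> i \<Longrightarrow> i < j \<Longrightarrow> j \<le> m \<Longrightarrow> h i < h j" for h :: "nat \<Rightarrow> int" and m
    unfolding sorted_wrt_map by (rule sorted_wrt_mono_rel[OF _ sorted_wrt_upt]) (use that in auto)
  have iv: "{1..<Suc m} = {1..m}" for m by auto
  have m: "map f [1..<Suc k] = map g [1..<Suc k']"
  proof (rule strict_sorted_equal)
    show "set (map f [1..<Suc k]) = set (map g [1..<Suc k'])" by (simp only: set_map set_upt iv assms(3))
  qed (rule s, use assms in blast)+
  have "length (map f [1..<Suc k]) = length (map g [1..<Suc k'])" by (simp only: m)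
  then have l: "k = k'" unfolding length_map length_upt by simp
  have "f j = g j" if "j \<in> {1..k}" for j
  proof -
    have a: "j - 1 < Suc k - 1" "1 + (j - 1) = j" using that by auto
    have "map f [1..<Suc k] ! (j - 1) = f j" using nth_map_upt[OF a(1), of f] unfolding a(2) .
    moreover have "map g [1..<Suc k'] ! (j - 1) = g j" using nth_map_upt[OF a(1), of g] unfolding a(2) l .
    ultimately show ?thesis using m by metis
  qed
  then show ?thesis using l by simp
qed

text \<open>The constants of two frames may differ by an integer, compensated by the exponents. Only
  the sums are invariant; being strictly increasing, they and their number are determined by the set
  they form.\<close>

lemma frame_exponents_unique:
  assumes "frame E k \<kappa> c \<psi> n e" "frame E k' \<kappa>' c' \<psi>' n' e'"
  shows "k = k'" "j \<in> {1..k} \<Longrightarrow> \<kappa> + of_nat (n j) = \<kappa>' + of_nat (n' j)"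
proof -
  interpret A: frame E k \<kappa> c \<psi> n e by fact
  interpret B: frame E k' \<kappa>' c' \<psi>' n' e' by fact
  obtain i where "\<kappa>' + of_nat (n' 1) = \<kappa> + of_nat (n i)"
    using frame_exponents_subset[OF assms, of 1] B.k by auto
  then have z: "\<kappa>' = \<kappa> + of_int (int (n i) - int (n' 1))" by (simp add: algebra_simps)
  let ?z = "int (n i) - int (n' 1)"
  have eq: "\<kappa>' + of_nat (n' j) = \<kappa> + of_nat (n i) \<longleftrightarrow> int (n' j) + ?z = int (n i)" for i j
  proof -
    have "\<kappa>' + of_nat (n' j) = \<kappa> + of_nat (n i) \<longleftrightarrow> (of_int (int (n' j) + ?z) :: complex) = of_int (int (n i))"
      unfolding z by (simp add: algebra_simps)
    then show ?thesis by (simp only: of_int_eq_iff)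
  qed
  have "(\<lambda>j. int (n j)) ` {1..k} = (\<lambda>j. int (n' j) + ?z) ` {1..k'}"
  proof
    show "(\<lambda>j. int (n j)) ` {1..k} \<subseteq> (\<lambda>j. int (n' j) + ?z) ` {1..k'}"
    proof
      fix y assume "y \<in> (\<lambda>j. int (n j)) ` {1..k}"
      then obtain j where j: "j \<in> {1..k}" "y = int (n j)" by blast
      obtain i' where "i' \<in> {1..k'}" "\<kappa> + of_nat (n j) = \<kappa>' + of_nat (n' i')"
        using frame_exponents_subset[OF assms(2,1) j(1)] by blast
      then show "y \<in> (\<lambda>j. int (n' j) + ?z) ` {1..k'}" using eq[of i' j] j(2) by (metis imageI)
    qed
    show "(\<lambda>j. int (n' j) + ?z) ` {1..k'} \<subseteq> (\<lambda>j. int (n j)) ` {1..k}"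
    proof
      fix y assume "y \<in> (\<lambda>j. int (n' j) + ?z) ` {1..k'}"
      then obtain j where j: "j \<in> {1..k'}" "y = int (n' j) + ?z" by blast
      obtain i' where "i' \<in> {1..k}" "\<kappa>' + of_nat (n' j) = \<kappa> + of_nat (n i')"
        using frame_exponents_subset[OF assms j(1)] by blast
      then show "y \<in> (\<lambda>j. int (n j)) ` {1..k}" using eq[of j i'] j(2) by (metis imageI)
    qed
  qed
  then have "k = k' \<and> (\<forall>j\<in>{1..k}. int (n j) = int (n' j) + ?z)"
    using A.mono B.mono by (intro strict_enum_unique) auto
  then show "k = k'" "j \<in> {1..k} \<Longrightarrow> \<kappa> + of_nat (n j) = \<kappa>' + of_nat (n' j)" using eq[of j j] by auto
qed

section \<open>Construction of coordinates\<close>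

text \<open>The ideals of values on the filtration dictate the orders of any generator. Its last
  coordinate must generate its ideal. The other orders are obtained in F_(k-1) for a - (\<kappa> +
  n_k) b applied to the generator, and are read back because the coefficient of index m has been
  scaled by m - n_k, nonzero for m <= n_j < n_k.\<close>

lemma coords_gen_frame:
  assumes "coords E k \<kappa> c \<psi> n" "e \<in> carrier E" "cyc_sub Atilde E e = carrier E"
    "\<And>j x. j \<in> {1..k} \<Longrightarrow> x \<in> coords.fl E \<psi> j \<Longrightarrow> fps_X ^ (n j + k - j) dvd \<psi> x j"
    "\<And>j. j \<in> {1..k} \<Longrightarrow> \<exists>x\<in>coords.fl E \<psi> j. \<psi> x j $ (n j + k - j) \<noteq> 0"
  shows "frame E k \<kappa> c \<psi> n e"
  using assms
proof (induction k arbitrary: E c n e)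
  case 0
  then interpret coords E 0 \<kappa> c \<psi> n by simp
  show ?case using k by simp
next
  case (Suc k)
  interpret coords E "Suc k" \<kappa> c \<psi> n by fact
  let ?K = "Suc k"
  note ec = Suc.prems(2)
  have ek0: "\<psi> e ?K $ i = 0" if "i < n ?K" for i
    using Suc.prems(4)[of ?K e] ec that by (auto simp: fl_k fps_X_power_dvd_iff)
  have ek: "\<psi> e ?K $ n ?K \<noteq> 0"
  proof
    assume z: "\<psi> e ?K $ n ?K = 0"
    obtain x where x: "x \<in> carrier E" "\<psi> x ?K $ n ?K \<noteq> 0" using Suc.prems(5)[of ?K] by (auto simp: fl_k)
    obtain u where u: "x = u \<odot>\<^bsub>E\<^esub> e" using x(1) Suc.prems(3) by (metis cyc_subE)
    \<comment> \<open>With orders 0 except n_k + 1 for the last coordinate, \<open>psi_val\<close>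
      makes the last coordinate of every multiple of e vanish at n_k.\<close>
    let ?d = "\<lambda>j. if j = ?K then n ?K + 1 else 0"
    have "\<psi> (u \<odot>\<^bsub>E\<^esub> e) ?K $ n ?K = 0"
    proof (rule psi_val(1)[where d = ?d])
      show "\<psi> e j $ i = 0" if "i < ?d j" for i j
        using that z ek0 by (cases "i = n ?K") (auto split: if_splits simp: less_Suc_eq)
    qed (use ec in auto)
    then show False using x u by simp
  qed
  show ?case
  proof (cases "k = 0")
    case True
    have "\<psi> e j $ i = 0" if "i < n j" for i j
      using ek0 out[OF ec, of j] that True by (cases "j = ?K") auto
    moreover have "j = ?K" if "j \<in> {1..?K}" for j using that True by (auto simp: One_nat_def)
    ultimately have "vals e" using ek ec unfolding vals_def by blast
    then show ?thesis using Suc.prems(3) by unfold_locales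
  next
    case False
    then have k2: "2 \<le> ?K" by simp
    obtain V where V: "V $ 0 = 1" "V * \<psi> e ?K = fps_const (\<psi> e ?K $ n ?K) * fps_X ^ n ?K"
      using fps_normalize[OF ek ek0] by blast
    let ?x = "bmul E V e" let ?y = "ab_lin (\<kappa> + of_nat (n ?K)) \<odot>\<^bsub>E\<^esub> ?x"
    have xc: "?x \<in> carrier E" "?y \<in> carrier E" using ec by auto
    have xg: "cyc_sub Atilde E ?x = carrier E" by (rule unit_gen) (use V ec Suc.prems(3) in auto)
    have pk: "\<psi> ?x ?K = fps_const (\<psi> e ?K $ n ?K) * fps_X ^ n ?K" using V ec by (simp add: psi_bmul)
    have "\<psi> ?y ?K $ m = 0" for m
      using k2 by (cases m) (auto simp: psi_lin_nth[OF xc(1)] pk monom_nth)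
    then have "\<psi> ?y i = 0" if "k < i" for i
      using out[OF xc(2), of i] that by (cases "i = ?K") (auto simp: fps_eq_iff)
    then have yfl: "?y \<in> fl k" using xc by (simp add: fl_def)
    have yg: "cyc_sub Atilde E ?y = fl k"
      using gen_down[OF k2 xc(1) xg pk ek] yfl by simp
    interpret F: coords "E \<downharpoonright> fl k" k \<kappa> 0 \<psi> "\<lambda>j. n j + 1"
      using coords_down[OF k2] by simp
    have Ffl: "F.fl j = fl j" if "j \<in> {1..k}" for j unfolding F.fl_def using that by (auto simp: fl_def)
    have "frame (E \<downharpoonright> fl k) k \<kappa> 0 \<psi> (\<lambda>j. n j + 1) ?y"
    proof (rule Suc.IH[OF F.coords_axioms])
      fix j assume j: "j \<in> {1..k}"
      then have e: "n j + 1 + k - j = n j + ?K - j" and j': "j \<in> {1..?K}" by auto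
      show "fps_X ^ (n j + 1 + k - j) dvd \<psi> x j" if "x \<in> F.fl j" for x
        using Suc.prems(4)[OF j', of x] that Ffl[OF j] e by simp
      show "\<exists>x\<in>F.fl j. \<psi> x j $ (n j + 1 + k - j) \<noteq> 0"
        using Suc.prems(5)[OF j'] Ffl[OF j] e by simp
    qed (use yfl yg in auto)
    then interpret G: frame "E \<downharpoonright> fl k" k \<kappa> 0 \<psi> "\<lambda>j. n j + 1" ?y .
    have yv: "i < n j + 1 \<Longrightarrow> \<psi> ?y j $ i = 0" "j \<in> {1..k} \<Longrightarrow> \<psi> ?y j $ (n j + 1) \<noteq> 0" for i j
      using G.e(2) by (auto simp: F.vals_def)
    have "\<psi> ?x j $ m = 0" if "m < n j" "j \<in> {1..k}" for m j
    proof -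
      have nj: "n j < n ?K" using mono[of j ?K] that by auto
      have "\<psi> ?x ?K $ m = 0" using nj that by (simp add: pk monom_nth)
      then have "(of_nat m - of_nat (n ?K)) * \<psi> ?x j $ m = 0"
        using yv(1)[of "m + 1" j] that by (auto simp: psi_lin_nth[OF xc(1)] algebra_simps split: if_splits)
      then show ?thesis using nj that by auto
    qed
    moreover have "\<psi> ?x j $ n j \<noteq> 0" if j: "j \<in> {1..k}" for j
    proof -
      have nj: "n j < n ?K" using mono[of j ?K] that by auto
      have "\<psi> ?x ?K $ n j = 0" using nj by (simp add: pk monom_nth)
      then show ?thesis using yv(2)[OF j] by (auto simp: psi_lin_nth[OF xc(1)] split: if_splits)
    qed
    moreover have "\<psi> ?x ?K $ m = 0" if "m < n ?K" for m using that by (simp add: pk monom_nth)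
    moreover have "\<psi> ?x ?K $ n ?K \<noteq> 0" using ek by (simp add: pk monom_nth)
    moreover have "\<psi> ?x j = 0" if "j \<notin> {1..?K}" for j using out[OF xc(1)] that by blast
    ultimately have xv: "vals ?x"
      using xc(1) unfolding vals_def by (metis atLeastAtMost_iff fps_zero_nth le_Suc_eq)
    have "e = bmul E (inverse V * V) e" using V(1) ec by (simp add: inverse_mult_eq_1)
    then have "e = bmul E (inverse V) ?x" using ec by (metis bmul_mult)
    moreover have "vals (bmul E (inverse V) ?x)" using vals_bmul(1)[OF xv, of "inverse V"] V(1) by simp
    ultimately have "vals e" by simp
    then show ?thesis using Suc.prems(3) by unfold_locales
  qed
qed

text \<open>The coordinate with respect to a basis vector y; R is the coordinate of a y.\<close>

lemma rank1_bhom: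
  assumes "abmod N" "ab_rank N 1"
  shows "\<exists>R \<chi>. bhom N R \<chi> \<and> (\<forall>x\<in>carrier N. \<chi> x = 0 \<longrightarrow> x = \<zero>\<^bsub>N\<^esub>)"
proof -
  interpret abmod N by fact
  from assms(2) obtain e where e: "e \<in> {..<1::nat} \<rightarrow> carrier N"
    and ex: "\<forall>x\<in>carrier N. \<exists>!S. S \<in> {..<1} \<rightarrow>\<^sub>E UNIV \<and> x = (\<Oplus>\<^bsub>N\<^esub>i\<in>{..<1}. bmul N (S i) (e i))"
    unfolding ab_rank_def by (elim bexE) (rule that, assumption, assumption)
  let ?y = "e 0"
  have y: "?y \<in> carrier N" using e by auto
  have "{..<1} = {0::nat}" by auto
  then have fs: "(\<Oplus>\<^bsub>N\<^esub>i\<in>{..<1}. bmul N (S i) (e i)) = bmul N (S 0) ?y" for S :: "nat \<Rightarrow> complex fps"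
    using y by simp
  have "\<exists>!s. x = bmul N s ?y" if x: "x \<in> carrier N" for x
  proof -
    have "\<exists>!S. S \<in> {..<1} \<rightarrow>\<^sub>E UNIV \<and> x = bmul N (S (0::nat)) ?y" using bspec[OF ex x] unfolding fs .
    then show ?thesis
    proof (rule ex1E)
      fix S assume S: "S \<in> {..<1} \<rightarrow>\<^sub>E UNIV \<and> x = bmul N (S (0::nat)) ?y"
        and u: "\<forall>S'. S' \<in> {..<1} \<rightarrow>\<^sub>E UNIV \<and> x = bmul N (S' (0::nat)) ?y \<longrightarrow> S' = S"
      show ?thesis
      proof (rule ex1I[of _ "S 0"])
        fix s assume "x = bmul N s ?y"
        then have "(\<lambda>i\<in>{..<1::nat}. s) = S" using u[rule_format, of "\<lambda>i\<in>{..<1::nat}. s"] by simp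
        then show "s = S 0" by auto
      qed (use S in simp)
    qed
  qed
  then obtain \<chi> where \<chi>: "\<And>x. x \<in> carrier N \<Longrightarrow> x = bmul N (\<chi> x) ?y"
    and un: "\<And>x s. x \<in> carrier N \<Longrightarrow> x = bmul N s ?y \<Longrightarrow> s = \<chi> x" by metis
  have "bhom N (\<chi> (ab_a \<odot>\<^bsub>N\<^esub> ?y)) \<chi>"
    unfolding bhom_def
  proof (intro conjI ballI allI)
    fix x assume x: "x \<in> carrier N"
    show "\<chi> (x \<oplus>\<^bsub>N\<^esub> z) = \<chi> x + \<chi> z" if z: "z \<in> carrier N" for z
      by (rule un[symmetric]) (use x z y \<chi>[OF x] \<chi>[OF z] in \<open>simp_all add: bmul_add\<close>)
    show "\<chi> (bmul N S x) = S * \<chi> x" for S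
      by (rule un[symmetric]) (use x y \<chi>[OF x] in \<open>simp_all add: bmul_mult\<close>)
    have "ab_a \<odot>\<^bsub>N\<^esub> x = ab_a \<odot>\<^bsub>N\<^esub> bmul N (\<chi> x) ?y" using \<chi>[OF x] by simp
    also have "\<dots> = bmul N (\<chi> x) (ab_a \<odot>\<^bsub>N\<^esub> ?y) \<oplus>\<^bsub>N\<^esub> bmul N (fps_X\<^sup>2 * fps_deriv (\<chi> x)) ?y"
      using y by (rule a_bmul)
    also have "ab_a \<odot>\<^bsub>N\<^esub> ?y = bmul N (\<chi> (ab_a \<odot>\<^bsub>N\<^esub> ?y)) ?y" using y by (intro \<chi>) simp
    also have "bmul N (\<chi> x) \<dots> \<oplus>\<^bsub>N\<^esub> bmul N (fps_X\<^sup>2 * fps_deriv (\<chi> x)) ?y = bmul N (rop (\<chi> (ab_a \<odot>\<^bsub>N\<^esub> ?y)) (\<chi> x)) ?y"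
      using y by (simp add: rop_def bmul_add bmul_mult[symmetric] mult.commute)
    finally show "\<chi> (ab_a \<odot>\<^bsub>N\<^esub> x) = rop (\<chi> (ab_a \<odot>\<^bsub>N\<^esub> ?y)) (\<chi> x)"
      using un[OF smul_closed[OF x]] by simp
  qed
  moreover have "x = \<zero>\<^bsub>N\<^esub>" if "x \<in> carrier N" "\<chi> x = 0" for x
    using \<chi>[OF that(1)] that(2) y by simp
  ultimately show ?thesis by blast
qed

text \<open>The components of an embedding into a sum of rank 1 modules. In this form
  semi-simplicity enters the construction of coordinates.\<close>

lemma semi_simple_bhoms:
  assumes "abmod M" "ab_semi_simple M"
  shows "\<exists>N R \<chi>. (\<forall>i<N::nat. bhom M (R i) (\<chi> i)) \<and> (\<forall>x\<in>carrier M. (\<forall>i<N. \<chi> i x = 0) \<longrightarrow> x = \<zero>\<^bsub>M\<^esub>)"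
proof -
  interpret abmod M by fact
  from assms(2) obtain N and K :: "nat \<Rightarrow> ab_coord ab_mod" and H where K: "\<And>i. i < N \<Longrightarrow> ab_regular (K i) \<and> ab_rank (K i) 1"
    and H: "submodule H Atilde (lmod_dsum N K)" and iso: "M \<simeq> lmod_dsum N K \<downharpoonright> H"
    unfolding ab_semi_simple_def by blast
  have Ka: "abmod (K i)" if "i < N" for i
    using K[OF that] by (auto simp: ab_regular_def ab_module_def abmod_def)
  from iso obtain f where f: "f \<in> lmod_hom Atilde M (lmod_dsum N K \<downharpoonright> H)" "bij_betw f (carrier M) H"
    by (auto simp: lmod_iso_def)
  have Hs: "H \<subseteq> carrier (lmod_dsum N K)"
    using H by (auto simp: submodule_def subgroup_def)
  have fc: "f x \<in> (\<Pi>\<^sub>E i\<in>{..<N}. carrier (K i))" if "x \<in> carrier M" for x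
    using lmod_homD(1)[OF f(1) that] Hs by (auto simp: lmod_dsum_def)
  have fi: "f x i \<in> carrier (K i)" if "x \<in> carrier M" "i < N" for x i using fc[OF that(1)] that(2) by auto
  have fa: "f (x \<oplus>\<^bsub>M\<^esub> y) i = f x i \<oplus>\<^bsub>K i\<^esub> f y i" if "x \<in> carrier M" "y \<in> carrier M" "i < N" for x y i
    using lmod_homD(2)[OF f(1) that(1,2)] that(3) by (simp add: lmod_dsum_def)
  have fm: "f (u \<odot>\<^bsub>M\<^esub> x) i = u \<odot>\<^bsub>K i\<^esub> f x i" if "x \<in> carrier M" "i < N" for x u i
    using lmod_homD(3)[OF f(1) that(1), of u] that(2) by (simp add: lmod_dsum_def)
  have "\<forall>i. \<exists>R \<chi>. i < N \<longrightarrow> bhom (K i) R \<chi> \<and> (\<forall>x\<in>carrier (K i). \<chi> x = 0 \<longrightarrow> x = \<zero>\<^bsub>K i\<^esub>)"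
    using rank1_bhom[OF Ka] K by blast
  then obtain R \<chi> where \<chi>: "\<And>i. i < N \<Longrightarrow> bhom (K i) (R i) (\<chi> i)"
    and \<chi>0: "\<And>i x. i < N \<Longrightarrow> x \<in> carrier (K i) \<Longrightarrow> \<chi> i x = 0 \<Longrightarrow> x = \<zero>\<^bsub>K i\<^esub>" by metis
  have "bhom M (R i) (\<lambda>x. \<chi> i (f x i))" if i: "i < N" for i
    using bhomD[OF \<chi>[OF i]] fi[OF _ i] unfolding bhom_def by (simp add: fa[OF _ _ i] fm[OF _ i])
  moreover have "x = \<zero>\<^bsub>M\<^esub>" if x: "x \<in> carrier M" and z: "\<forall>i<N. \<chi> i (f x i) = 0" for x
  proof -
    have "f x i = f \<zero>\<^bsub>M\<^esub> i" if i: "i < N" for i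
    proof -
      interpret K: abmod "K i" by (rule Ka[OF i])
      have "f (0 \<odot>\<^bsub>M\<^esub> x) i = 0 \<odot>\<^bsub>K i\<^esub> f x i" by (rule fm[OF x i])
      then have "f \<zero>\<^bsub>M\<^esub> i = \<zero>\<^bsub>K i\<^esub>" using x fi[OF x i] by simp
      then show ?thesis using \<chi>0[OF i fi[OF x i]] z i by simp
    qed
    then have "f x = f \<zero>\<^bsub>M\<^esub>" using fc[OF x] fc[OF M.zero_closed] by (intro PiE_ext) auto
    then show ?thesis using f(2) x by (auto simp: bij_betw_def inj_on_def)
  qed
  ultimately show ?thesis by (intro exI[of _ N] exI[of _ R] exI[of _ "\<lambda>i x. \<chi> i (f x i)"]) auto
qed

text \<open>If d is the order of f, the coefficients of b^d and b^(d+1) in the equation give R_0 = 0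
  and R_1 - l + d = 0. A homomorphism that does not vanish on a vector killed by a - l b therefore
  has a strongly restricted target.\<close>

lemma rop_kernel:
  assumes "rop (R - fps_const l * fps_X) f = 0" "f \<noteq> 0"
  shows "R $ 0 = 0" "R $ 1 = l - of_nat (subdegree f)"
proof -
  define d where "d = subdegree f"
  have fd: "f $ d \<noteq> 0" using assms(2) by (simp add: nth_subdegree_nonzero d_def)
  have fz: "f $ i = 0" if "i < d" for i using that unfolding d_def by (rule nth_less_subdegree_zero)
  let ?R = "R - fps_const l * fps_X"
  have n: "(?R * f) $ m + of_nat (m - 1) * f $ (m - 1) = 0" for m
    using arg_cong[OF assms(1), of "\<lambda>g. g $ m"] by (simp add: rop_def X2_deriv_nth)
  have "(?R * f) $ d = (\<Sum>i\<in>{0}. ?R $ i * f $ (d - i))"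
    unfolding fps_mult_nth by (rule sum.mono_neutral_right) (auto simp: fz)
  moreover have "of_nat (d - 1) * f $ (d - 1) = 0" using fz[of "d - 1"] by (cases d) auto
  ultimately have "R $ 0 * f $ d = 0" using n[of d] by (simp add: fz del: mult_eq_0_iff)
  then show R0: "R $ 0 = 0" using fd by simp
  have "(?R * f) $ (d + 1) = (\<Sum>i\<in>{0, 1}. ?R $ i * f $ (d + 1 - i))"
    unfolding fps_mult_nth by (rule sum.mono_neutral_right) (auto simp: fz)
  then have "(R $ 1 - l + of_nat d) * f $ d = 0" using n[of "d + 1"] R0 by (simp add: algebra_simps)
  then have "R $ 1 - l + of_nat d = 0" using fd by simp
  then show "R $ 1 = l - of_nat (subdegree f)" by (simp add: d_def algebra_simps eq_neg_iff_add_eq_0)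
qed

text \<open>The equation decouples into (\<kappa> - l + m) f_m = 0, so at most one coefficient
  survives.\<close>

lemma dop_kernel:
  assumes "rop (fps_const \<kappa> * fps_X - fps_const l * fps_X) f = 0" "f \<noteq> 0"
  obtains g d where "f = fps_const g * fps_X ^ d" "g \<noteq> 0" "l = \<kappa> + of_nat d"
proof -
  let ?d = "subdegree f"
  have l: "l = \<kappa> + of_nat ?d" using rop_kernel(2)[OF assms] by simp
  have e: "fps_const \<kappa> * fps_X - fps_const l * fps_X = fps_const (\<kappa> - l) * fps_X"
    by (simp add: fps_const_sub[symmetric] algebra_simps del: fps_const_sub)
  have n: "(\<kappa> - l + of_nat m) * f $ m = 0" for m
    using arg_cong[OF assms(1)[unfolded e], of "\<lambda>g. g $ (m + 1)"] by (simp add: dop_nth)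
  have "f = fps_const (f $ ?d) * fps_X ^ ?d"
  proof (rule fps_ext)
    fix m show "f $ m = (fps_const (f $ ?d) * fps_X ^ ?d) $ m"
      using n[of m] by (auto simp: monom_nth l)
  qed
  moreover have "f $ ?d \<noteq> 0" using assms(2) by (simp add: nth_subdegree_nonzero)
  ultimately show ?thesis using that l by blast
qed

lemma fps_ode_unit: "\<exists>U :: complex fps. U $ 0 = 1 \<and> fps_deriv U = R * U"
proof (intro exI conjI)
  let ?I = "fps_integral0 R"
  show "(fps_compose (fps_exp 1) ?I) $ 0 = 1" by (simp add: fps_compose_nth)
  have "fps_deriv (fps_compose (fps_exp 1) ?I) = fps_compose (fps_deriv (fps_exp 1)) ?I * fps_deriv ?I"
    by (rule fps_compose_deriv) simp
  then show "fps_deriv (fps_compose (fps_exp 1) ?I) = R * fps_compose (fps_exp 1) ?I"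
    by (simp add: fps_deriv_fps_integral mult.commute)
qed

text \<open>With R = (\<kappa> + d) b + b^2 R2, the factor b^d removes the integer d, and a unit
  solving U' = R2 U removes the terms of higher order.\<close>

lemma bhom_normalize:
  assumes "bhom E R \<chi>" "R $ 0 = 0" "R $ 1 = \<kappa> + of_nat d"
  obtains U where "U $ 0 = 1" "bhom E (fps_const \<kappa> * fps_X) (\<lambda>x. (fps_X ^ d * U) * \<chi> x)"
proof -
  define R2 where "R2 = fps_shift 2 R"
  have R: "R = fps_const (\<kappa> + of_nat d) * fps_X + fps_X\<^sup>2 * R2"
  proof (rule fps_ext)
    fix m :: nat
    have "m = 0 \<or> m = 1 \<or> (\<exists>m'. m = m' + 2)" by presburger
    then consider "m = 0" | "m = 1" | m' where "m = m' + 2" by blast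
    then show "R $ m = (fps_const (\<kappa> + of_nat d) * fps_X + fps_X\<^sup>2 * R2) $ m"
      by cases (use assms(2,3) in \<open>auto simp: R2_def power2_eq_square mult.assoc One_nat_def\<close>)
  qed
  obtain U where U: "U $ 0 = 1" "fps_deriv U = R2 * U" using fps_ode_unit by blast
  have Xd: "fps_X\<^sup>2 * fps_deriv (fps_X ^ d) = fps_const (of_nat d) * fps_X * (fps_X ^ d :: complex fps)"
  proof (rule fps_ext)
    fix m
    have "fps_const (of_nat d) * fps_X * fps_X ^ d = fps_const (of_nat d :: complex) * fps_X ^ Suc d"
      by (simp only: power_Suc mult.assoc)
    then show "(fps_X\<^sup>2 * fps_deriv (fps_X ^ d)) $ m = (fps_const (of_nat d) * fps_X * (fps_X ^ d :: complex fps)) $ m"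
      by (simp only: X2_deriv_nth monom_nth) (cases m; auto simp: fps_X_power_nth)
  qed
  have "fps_X\<^sup>2 * fps_deriv (fps_X ^ d * U) = (fps_X\<^sup>2 * fps_deriv (fps_X ^ d)) * U + fps_X ^ d * (fps_X\<^sup>2 * fps_deriv U)"
    by (simp add: algebra_simps)
  also have "\<dots> = (fps_const (of_nat d) * fps_X + fps_X\<^sup>2 * R2) * (fps_X ^ d * U)"
    unfolding Xd U(2) by (simp add: algebra_simps)
  also have "fps_const (of_nat d) * fps_X + fps_X\<^sup>2 * R2 = R - fps_const \<kappa> * fps_X"
    unfolding R by (simp add: fps_const_add[symmetric] algebra_simps del: fps_const_add)
  finally have "bhom E (fps_const \<kappa> * fps_X) (\<lambda>x. (fps_X ^ d * U) * \<chi> x)"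
    by (rule bhom_rescale[OF assms(1)])
  with U that show ?thesis by blast
qed

section \<open>Homomorphisms along a Jordan-Hoelder sequence\<close>

lemma JH_generators:
  assumes "abmod E" "JH_seq E k F l"
  shows "\<exists>x. \<forall>j\<in>{1..k}. x j \<in> F j \<and> ab_lin (l j) \<odot>\<^bsub>E\<^esub> x j \<in> F (j - 1) \<and>
    (\<forall>z\<in>F j. \<exists>S. z \<ominus>\<^bsub>E\<^esub> bmul E S (x j) \<in> F (j - 1)) \<and> (\<forall>S. bmul E S (x j) \<in> F (j - 1) \<longrightarrow> S = 0)"
proof -
  interpret abmod E by fact
  have sub: "submodule (F j) Atilde E" if "j \<le> k" for j
    using assms(2) that by (auto simp: JH_seq_def normal_sub_def)
  have "\<exists>x. x \<in> F j \<and> ab_lin (l j) \<odot>\<^bsub>E\<^esub> x \<in> F (j - 1) \<and>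
    (\<forall>z\<in>F j. \<exists>S. z \<ominus>\<^bsub>E\<^esub> bmul E S x \<in> F (j - 1)) \<and> (\<forall>S. bmul E S x \<in> F (j - 1) \<longrightarrow> S = 0)" if j: "j \<in> {1..k}" for j
  proof -
    have Fj: "submodule (F j) Atilde E" using sub j by simp
    interpret F: abmod "E \<downharpoonright> F j" by (rule sub_abmod[OF Fj])
    have s: "submodule (F (j - 1)) Atilde (E \<downharpoonright> F j)"
      unfolding submodule_sub_iff[OF Fj] using sub[of "j - 1"] j assms(2) by (auto simp: JH_seq_def)
    let ?Q = "(E \<downharpoonright> F j) LQuot F (j - 1)"
    interpret Q: abmod ?Q by (rule F.quot_abmod[OF s])
    have iso: "?Q \<simeq> ab_cyclic (ab_lin (l j))" using assms(2) j by (auto simp: JH_seq_def)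
    obtain X where X: "X \<in> carrier ?Q" "cyc_sub Atilde ?Q X = carrier ?Q"
      and ann: "\<And>u. u \<odot>\<^bsub>?Q\<^esub> X = \<zero>\<^bsub>?Q\<^esub> \<longleftrightarrow> (\<exists>q. u = ab_mult q (ab_lin (l j)))"
      using ab_cyclic_isoD[OF Q.abmod_axioms iso] by blast
    obtain x where x: "x \<in> F j" "X = F (j - 1) +>\<^bsub>E \<downharpoonright> F j\<^esub> x" using X(1) by (auto simp: F.quot_carrier[OF s])
    have uX: "u \<odot>\<^bsub>?Q\<^esub> X = F (j - 1) +>\<^bsub>E \<downharpoonright> F j\<^esub> (u \<odot>\<^bsub>E\<^esub> x)" for u
      using F.quot_smul[OF s, of x u] x by simp
    have uxF: "u \<odot>\<^bsub>E\<^esub> x \<in> F j" for u using submodD(4)[OF Fj x(1)] .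
    have mem: "u \<odot>\<^bsub>E\<^esub> x \<in> F (j - 1) \<longleftrightarrow> (\<exists>q. u = ab_mult q (ab_lin (l j)))" for u
      unfolding ann[symmetric] uX using F.quot_eq_zero[OF s, of "u \<odot>\<^bsub>E\<^esub> x"] uxF by simp
    have xc: "x \<in> carrier E" using x submodD(6)[OF Fj] by blast
    have 1: "ab_lin (l j) \<odot>\<^bsub>E\<^esub> x \<in> F (j - 1)" unfolding mem by (intro exI[of _ 1]) (simp add: ab_mult_1_left)
    have 2: "S = 0" if "bmul E S x \<in> F (j - 1)" for S
      using that unfolding mem by (metis ab_lin_division_unique(2))
    have 3: "\<exists>S. z \<ominus>\<^bsub>E\<^esub> bmul E S x \<in> F (j - 1)" if z: "z \<in> F j" for z
    proof -
      have "F (j - 1) +>\<^bsub>E \<downharpoonright> F j\<^esub> z \<in> carrier ?Q" using z by (auto simp: F.quot_carrier[OF s])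
      then obtain u where u: "F (j - 1) +>\<^bsub>E \<downharpoonright> F j\<^esub> z = u \<odot>\<^bsub>?Q\<^esub> X" using X(2) by (auto simp: cyc_sub_def)
      then have zu: "z \<ominus>\<^bsub>E\<^esub> u \<odot>\<^bsub>E\<^esub> x \<in> F (j - 1)"
        using F.quot_coset_eq[OF s, of z "u \<odot>\<^bsub>E\<^esub> x"] z uxF unfolding uX by (simp add: minus_sub[OF Fj])
      obtain q S where "u = ab_mult q (ab_lin (l j)) + ab_of_b S" using ab_lin_division by blast
      then have ux: "u \<odot>\<^bsub>E\<^esub> x = q \<odot>\<^bsub>E\<^esub> (ab_lin (l j) \<odot>\<^bsub>E\<^esub> x) \<oplus>\<^bsub>E\<^esub> bmul E S x" using xc by (simp add: smul_add_left smul_mult)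
      have sj: "submodule (F (j - 1)) Atilde E" by (rule sub) (use j in auto)
      have zc: "z \<in> carrier E" using z submodD(6)[OF Fj] by blast
      let ?w = "q \<odot>\<^bsub>E\<^esub> (ab_lin (l j) \<odot>\<^bsub>E\<^esub> x)"
      have "(z \<ominus>\<^bsub>E\<^esub> u \<odot>\<^bsub>E\<^esub> x) \<oplus>\<^bsub>E\<^esub> ?w \<in> F (j - 1)"
        using submodD(3)[OF sj zu submodD(4)[OF sj 1]] .
      moreover have "(z \<ominus>\<^bsub>E\<^esub> u \<odot>\<^bsub>E\<^esub> x) \<oplus>\<^bsub>E\<^esub> ?w = z \<ominus>\<^bsub>E\<^esub> bmul E S x"
      proof -
        have g: "(z \<ominus>\<^bsub>E\<^esub> (w \<oplus>\<^bsub>E\<^esub> v)) \<oplus>\<^bsub>E\<^esub> w = z \<ominus>\<^bsub>E\<^esub> v" if "w \<in> carrier E" "v \<in> carrier E" for w v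
        proof -
          let ?t = "z \<ominus>\<^bsub>E\<^esub> (w \<oplus>\<^bsub>E\<^esub> v)"
          have t: "?t \<in> carrier E" using zc that by simp
          have "(?t \<oplus>\<^bsub>E\<^esub> w) \<oplus>\<^bsub>E\<^esub> v = z" using zc that minus_add_cancel[of z "w \<oplus>\<^bsub>E\<^esub> v"] by (simp add: M.a_assoc)
          moreover have "((?t \<oplus>\<^bsub>E\<^esub> w) \<oplus>\<^bsub>E\<^esub> v) \<ominus>\<^bsub>E\<^esub> v = ?t \<oplus>\<^bsub>E\<^esub> w"
            using t that by (simp add: a_minus_def[of E] M.a_assoc M.r_neg)
          ultimately show ?thesis by simp
        qed
        show ?thesis unfolding ux by (rule g) (use xc in auto)
      qed
      ultimately show ?thesis by auto
    qed
    from x 1 2 3 show ?thesis by blast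
  qed
  then show ?thesis by (intro bchoice) blast
qed

locale chain = abmod E for E :: "'m ab_mod" (structure) +
  fixes k :: nat and F :: "nat \<Rightarrow> 'm set" and l :: "nat \<Rightarrow> complex" and x :: "nat \<Rightarrow> 'm"
  assumes F0: "F 0 = {\<zero>}" and Fk: "F k = carrier E"
    and Fsub: "\<And>j. j \<le> k \<Longrightarrow> submodule (F j) Atilde E"
    and Fsuc: "\<And>j. j \<in> {1..k} \<Longrightarrow> F (j - 1) \<subseteq> F j"
    and xF: "\<And>j. j \<in> {1..k} \<Longrightarrow> x j \<in> F j"
    and xlin: "\<And>j. j \<in> {1..k} \<Longrightarrow> ab_lin (l j) \<odot> x j \<in> F (j - 1)"
    and xgen: "\<And>j z. j \<in> {1..k} \<Longrightarrow> z \<in> F j \<Longrightarrow> \<exists>S. z \<ominus> bmul E S (x j) \<in> F (j - 1)"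
    and xfree: "\<And>j S. j \<in> {1..k} \<Longrightarrow> bmul E S (x j) \<in> F (j - 1) \<Longrightarrow> S = 0"
begin

lemma Fcar: "j \<le> k \<Longrightarrow> z \<in> F j \<Longrightarrow> z \<in> carrier E"
  using submodD(6)[OF Fsub] by blast

lemma xcar: "j \<in> {1..k} \<Longrightarrow> x j \<in> carrier E"
  using Fcar xF by auto

lemma Fmono: "i \<le> j \<Longrightarrow> j \<le> k \<Longrightarrow> F i \<subseteq> F j"
proof (induction j rule: dec_induct)
  case (step j) then show ?case using Fsuc[of "Suc j"] by auto
qed simp

lemma minus_minus: "z \<in> carrier E \<Longrightarrow> w \<in> carrier E \<Longrightarrow> z \<ominus> (z \<ominus> w) = w"
proof -
  assume zw: "z \<in> carrier E" "w \<in> carrier E"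
  have "z \<ominus> (z \<ominus> w) = z \<ominus> (z \<oplus> (- 1) \<odot> w)" using zw by (simp add: a_minus_def neg_eq)
  also have "\<dots> = z \<oplus> ((- 1) \<odot> z \<oplus> (- 1) \<odot> ((- 1) \<odot> w))" using zw by (simp add: a_minus_def neg_eq smul_add_right)
  also have "(- 1) \<odot> ((- 1) \<odot> w) = w"
    using smul_uminus[of "(- 1) \<odot> w" 1] smul_uminus[of w 1] zw by simp
  also have "z \<oplus> ((- 1) \<odot> z \<oplus> w) = w" using zw by (simp add: M.a_assoc[symmetric] neg_eq[symmetric] M.r_neg)
  finally show ?thesis .
qed

lemma F_coeff_0:
  assumes "j \<in> {1..k}" "z \<in> F (j - 1)" "z \<ominus> bmul E S (x j) \<in> F (j - 1)"
  shows "S = 0"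
proof -
  have s: "submodule (F (j - 1)) Atilde E" by (rule Fsub) (use assms in auto)
  have zc: "z \<in> carrier E" using submodD(6)[OF s assms(2)] .
  have "z \<ominus> (z \<ominus> bmul E S (x j)) \<in> F (j - 1)" using submodD(5)[OF s assms(2,3)] .
  then have "bmul E S (x j) \<in> F (j - 1)" using zc xcar[OF assms(1)] by (simp add: minus_minus)
  then show ?thesis by (rule xfree[OF assms(1)])
qed

text \<open>Every F_i/F_(i-1) is free over C[[b]], so an element that is torsion modulo F_j descends
  one term at a time.\<close>

lemma F_sat:
  assumes "j \<le> k" "z \<in> carrier E" "T \<noteq> 0" "bmul E T z \<in> F j"
  shows "z \<in> F j"
proof -
  have "m \<le> k - j \<Longrightarrow> z \<in> F (k - m)" for m
  proof (induction m)
    case 0 then show ?case using assms(2) by (simp add: Fk)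
  next
    case (Suc m)
    define i where "i = k - m"
    have i: "i \<in> {1..k}" "k - Suc m = i - 1" "j \<le> i - 1" using Suc.prems by (auto simp: i_def)
    have z: "z \<in> F i" using Suc by (simp add: i_def)
    obtain S where S: "z \<ominus> bmul E S (x i) \<in> F (i - 1)" using xgen[OF i(1) z] by blast
    have s: "submodule (F (i - 1)) Atilde E" by (rule Fsub) (use i in auto)
    have "i - 1 \<le> k" using i(1) by (meson atLeastAtMost_iff diff_le_self le_trans)
    then have Tz: "bmul E T z \<in> F (i - 1)" using assms(4) Fmono[OF i(3)] by blast
    have "bmul E T (z \<ominus> bmul E S (x i)) \<in> F (i - 1)" by (rule submodD(4)[OF s S])
    then have "bmul E T z \<ominus> bmul E (T * S) (x i) \<in> F (i - 1)"
      using assms(2) xcar[OF i(1)] by (simp add: smul_minus_right bmul_mult)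
    then have "T * S = 0" using F_coeff_0[OF i(1) Tz] by blast
    then have "S = 0" using assms(3) by simp
    then have "z \<ominus> \<zero> \<in> F (i - 1)" using S xcar[OF i(1)] by simp
    then show ?case using assms(2) neg_eq[of \<zero>] by (simp add: i(2) a_minus_def)
  qed
  from this[of "k - j"] show ?thesis using assms(1) by simp
qed

text \<open>Modulo F_(j-1), which \<chi> annihilates, x_j is killed by a - l_j b; its value
  satisfies the corresponding equation. The set \<open>H\<close> allows for homomorphisms defined on
  a submodule only.\<close>

lemma hom_lead:
  assumes "submodule H Atilde E" "F j \<subseteq> H" "bhom (E \<downharpoonright> H) R \<chi>" "\<forall>z\<in>F (j - 1). \<chi> z = 0" "j \<in> {1..k}"
  shows "rop (R - fps_const (l j) * fps_X) (\<chi> (x j)) = 0"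
proof -
  interpret H: abmod "E \<downharpoonright> H" by (rule sub_abmod[OF assms(1)])
  have "x j \<in> H" using xF assms(2,5) by blast
  then show ?thesis using H.bhom_lin[OF assms(3), of "x j" "l j"] xlin[OF assms(5)] assms(4) by simp
qed

lemma hom_vanish:
  assumes "bhom E R \<chi>" "\<forall>z\<in>F (j - 1). \<chi> z = 0" "\<chi> (x j) = 0" "j \<in> {1..k}" "z \<in> F j"
  shows "\<chi> z = 0"
proof -
  obtain S where S: "z \<ominus> bmul E S (x j) \<in> F (j - 1)" using xgen[OF assms(4,5)] by blast
  have "z \<in> carrier E" using assms(4,5) Fcar by auto
  then have "\<chi> (z \<ominus> bmul E S (x j)) = \<chi> z"
    using xcar[OF assms(4)] assms(3) by (simp add: bhom_minus[OF assms(1)] bhomD[OF assms(1)])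
  then show ?thesis using S assms(2) by simp
qed

text \<open>Climbing the sequence, \<open>rop_kernel\<close> makes the value at each x_j vanish as
  long as R_1 is not l_j minus a natural number. A nonzero homomorphism therefore ties R_1 to the
  invariants.\<close>

lemma hom_zero:
  assumes "bhom E R \<chi>" "\<And>j d. j \<in> {1..k} \<Longrightarrow> R $ 0 \<noteq> 0 \<or> R $ 1 \<noteq> l j - of_nat d" "z \<in> carrier E"
  shows "\<chi> z = 0"
proof -
  have "j \<le> k \<Longrightarrow> \<forall>z\<in>F j. \<chi> z = 0" for j
  proof (induction j)
    case 0 then show ?case using F0 bhom_zero[OF assms(1)] by simp
  next
    case (Suc j)
    have j: "Suc j \<in> {1..k}" using Suc.prems by auto
    have v: "\<forall>z\<in>F (Suc j - 1). \<chi> z = 0" using Suc by simp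
    have "rop (R - fps_const (l (Suc j)) * fps_X) (\<chi> (x (Suc j))) = 0"
      by (rule hom_lead[OF submodule_carrier _ _ v j]) (use assms(1) Fcar j in \<open>auto\<close>)
    then have "\<chi> (x (Suc j)) = 0" using rop_kernel assms(2)[OF j] by blast
    then show ?case using hom_vanish[OF assms(1) v _ j] by blast
  qed
  then show ?thesis using assms(3) Fk by auto
qed

definition khoms :: "complex \<Rightarrow> nat \<Rightarrow> ('m \<Rightarrow> complex fps) set" where
  "khoms \<kappa> m = {\<chi>. bhom E (fps_const \<kappa> * fps_X) \<chi> \<and> (\<forall>z\<in>F m. \<chi> z = 0)}"

text \<open>F m is a common kernel of homomorphisms to the one target with constant \<kappa>. For m
  = 1 this is what semi-simplicity of E/F_1 yields, see \<open>jker_start\<close>.\<close>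

definition jker :: "complex \<Rightarrow> nat \<Rightarrow> bool" where
  "jker \<kappa> m \<longleftrightarrow> (\<forall>z\<in>carrier E. (\<forall>\<chi>\<in>khoms \<kappa> m. \<chi> z = 0) \<longrightarrow> z \<in> F m)"

lemma khoms_lead:
  assumes "\<chi> \<in> khoms \<kappa> m" "m < k" "\<chi> (x (Suc m)) \<noteq> 0"
  obtains g d where "\<chi> (x (Suc m)) = fps_const g * fps_X ^ d" "g \<noteq> 0" "l (Suc m) = \<kappa> + of_nat d"
proof -
  have "rop (fps_const \<kappa> * fps_X - fps_const (l (Suc m)) * fps_X) (\<chi> (x (Suc m))) = 0"
    by (rule hom_lead[OF submodule_carrier]) (use assms(1,2) Fcar[of "Suc m"] in \<open>auto simp: khoms_def\<close>)
  then show ?thesis using dop_kernel assms(3) that by metis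
qed

text \<open>Gaussian elimination with the pivot x_(m+1): by \<open>dop_kernel\<close> the values at
  x_(m+1) of homomorphisms vanishing on F_m lie on one line over C, so subtracting a constant
  multiple of a pivot \<chi>1 makes any of them vanish on F_(m+1).\<close>

lemma elim_step:
  assumes J: "jker \<kappa> m" and m: "m < k"
  shows "(\<exists>\<chi>\<in>khoms \<kappa> m. \<chi> (x (Suc m)) \<noteq> 0) \<and> jker \<kappa> (Suc m)"
proof -
  have sm: "Suc m \<in> {1..k}" using m by auto
  have xc: "x (Suc m) \<in> carrier E" by (rule xcar[OF sm])
  have "x (Suc m) \<notin> F m"
  proof
    assume "x (Suc m) \<in> F m"
    then have "(1 :: complex fps) = 0" using xfree[OF sm, of 1] xc by simp
    then show False by simp
  qed
  then obtain \<chi>1 where \<chi>1: "\<chi>1 \<in> khoms \<kappa> m" "\<chi>1 (x (Suc m)) \<noteq> 0"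
    using J xc unfolding jker_def by blast
  obtain g d where g: "\<chi>1 (x (Suc m)) = fps_const g * fps_X ^ d" "g \<noteq> 0" "l (Suc m) = \<kappa> + of_nat d"
    using khoms_lead[OF \<chi>1(1) m \<chi>1(2)] by metis
  have h1: "bhom E (fps_const \<kappa> * fps_X) \<chi>1" using \<chi>1 by (simp add: khoms_def)
  have "jker \<kappa> (Suc m)" unfolding jker_def
  proof (intro ballI impI)
    fix z assume z: "z \<in> carrier E" "\<forall>\<chi>\<in>khoms \<kappa> (Suc m). \<chi> z = 0"
    \<comment> \<open>The pivot takes the same value on S x_(m+1) and on b^d z; the factor b^d
      clears the denominator and is removed by \<open>F_sat\<close> at the end.\<close>
    define S where "S = fps_const (inverse g) * \<chi>1 z"
    define w where "w = bmul E (fps_X ^ d) z \<ominus> bmul E S (x (Suc m))"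
    have wc: "w \<in> carrier E" using z xc by (simp add: w_def)
    have "S * (fps_const g * fps_X ^ d) = fps_const (inverse g * g) * (fps_X ^ d * \<chi>1 z)"
      unfolding S_def by (simp only: fps_const_mult[symmetric] mult_ac)
    then have w1: "\<chi>1 w = 0" using z xc g(2) by (simp add: w_def bhom_minus[OF h1] bhomD[OF h1] g(1))
    have "\<chi> w = 0" if \<chi>: "\<chi> \<in> khoms \<kappa> m" for \<chi>
    proof -
      have h: "bhom E (fps_const \<kappa> * fps_X) \<chi>" using \<chi> by (simp add: khoms_def)
      obtain t where t: "\<chi> (x (Suc m)) = fps_const t * \<chi>1 (x (Suc m))"
      proof (cases "\<chi> (x (Suc m)) = 0")
        case True then show ?thesis using that[of 0] by simp
      next
        case False
        obtain g' d' where g': "\<chi> (x (Suc m)) = fps_const g' * fps_X ^ d'" "l (Suc m) = \<kappa> + of_nat d'"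
          using khoms_lead[OF \<chi> m False] by metis
        then have "d' = d" using g(3) by simp
        then show ?thesis using that[of "g' / g"] g' g by (simp flip: mult.assoc)
      qed
      let ?\<chi> = "\<lambda>z. \<chi> z - fps_const t * \<chi>1 z"
      have h': "bhom E (fps_const \<kappa> * fps_X) ?\<chi>" by (intro bhom_diff bhom_cmult h h1)
      have "\<forall>z\<in>F (Suc m - 1). ?\<chi> z = 0" using \<chi> \<chi>1(1) by (auto simp: khoms_def)
      then have v: "?\<chi> y = 0" if "y \<in> F (Suc m)" for y
        using hom_vanish[OF h' _ _ sm that] t by simp
      then have "?\<chi> \<in> khoms \<kappa> (Suc m)" using h' by (simp add: khoms_def)
      from bspec[OF z(2) this] have "?\<chi> z = 0" .
      moreover have "?\<chi> (x (Suc m)) = 0" using t by simp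
      ultimately have "?\<chi> w = 0" using z(1) xc unfolding w_def by (simp only: bhom_minus[OF h'] bhomD[OF h'] smul_closed mult_zero_right diff_0_right)
      then show ?thesis using w1 by simp
    qed
    then have "w \<in> F m" using J wc unfolding jker_def by blast
    then have wF: "w \<in> F (Suc m)" using Fmono[of m "Suc m"] m by auto
    have s: "submodule (F (Suc m)) Atilde E" by (rule Fsub) (use m in auto)
    have "w \<oplus> bmul E S (x (Suc m)) \<in> F (Suc m)"
      using submodD(3)[OF s wF submodD(4)[OF s xF[OF sm]]] .
    then have Xz: "bmul E (fps_X ^ d) z \<in> F (Suc m)" using z xc by (simp add: w_def minus_add_cancel)
    show "z \<in> F (Suc m)" by (rule F_sat[OF _ z(1) _ Xz]) (use m in simp_all)
  qed
  with \<chi>1 show ?thesis by blast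
qed

lemma elim:
  assumes "jker \<kappa> 1" "j \<in> {2..k}"
  shows "\<exists>\<chi>\<in>khoms \<kappa> (j - 1). \<chi> (x j) \<noteq> 0"
proof -
  have "m < k \<Longrightarrow> 1 \<le> m \<Longrightarrow> jker \<kappa> m" for m
  proof (induction m)
    case (Suc m)
    show ?case
    proof (cases "m = 0")
      case True then show ?thesis using assms(1) by (simp add: One_nat_def)
    next
      case False then show ?thesis using Suc elim_step[of \<kappa> m] by simp
    qed
  qed simp
  from this[of "j - 1"] have "jker \<kappa> (j - 1)" using assms(2) by auto
  from elim_step[OF this] show ?thesis using assms(2) by auto
qed

text \<open>Finitely many targets occur for E/F_1, and by \<open>hom_zero\<close> each nonzero
  homomorphism has R_1 = l_1 - D_i with an integer D_i. The common constant l_1 - M with M at least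
  all D_i receives all of them through \<open>bhom_normalize\<close>.\<close>

lemma jker_start:
  assumes "1 \<le> k" "ab_semi_simple (E LQuot F 1)" "\<And>j. j \<in> {1..k} \<Longrightarrow> \<exists>z. l j = l 1 + of_int z"
  shows "\<exists>M0. \<forall>M\<ge>M0. jker (l 1 - of_nat M) 1"
proof -
  have s1: "submodule (F 1) Atilde E" by (rule Fsub[OF assms(1)])
  interpret Q: abmod "E LQuot F 1" by (rule quot_abmod[OF s1])
  obtain N R \<chi> where b': "\<forall>i<N::nat. bhom (E LQuot F 1) (R i) (\<chi> i)"
    and inj': "\<forall>X\<in>carrier (E LQuot F 1). (\<forall>i<N. \<chi> i X = 0) \<longrightarrow> X = \<zero>\<^bsub>E LQuot F 1\<^esub>"
    using semi_simple_bhoms[OF Q.abmod_axioms assms(2)] by (elim exE conjE) (rule that)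
  note b = b'[rule_format] and inj = bspec[OF inj', rule_format]
  define \<phi> where "\<phi> i z = \<chi> i (F 1 +> z)" for i z
  have \<phi>: "bhom E (R i) (\<phi> i)" if i: "i < N" for i
    using bhomD[OF b[OF i]] unfolding bhom_def \<phi>_def
    by (simp add: quot_add[OF s1, symmetric] quot_smul[OF s1, symmetric] quot_carrier[OF s1])
  have \<phi>1: "\<phi> i z = 0" if "i < N" "z \<in> F 1" for i z
  proof -
    have "F 1 +> z = \<zero>\<^bsub>E LQuot F 1\<^esub>" using quot_eq_zero[OF s1] that submodD(6)[OF s1] by blast
    then show ?thesis using Q.bhom_zero[OF b[OF that(1)]] by (simp add: \<phi>_def)
  qed
  have "\<exists>D. (\<exists>z\<in>carrier E. \<phi> i z \<noteq> 0) \<longrightarrow> R i $ 0 = 0 \<and> R i $ 1 = l 1 - of_int D" if i: "i < N" for i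
  proof (cases "\<exists>z\<in>carrier E. \<phi> i z \<noteq> 0")
    case True
    then obtain j d where "j \<in> {1..k}" "R i $ 0 = 0" "R i $ 1 = l j - of_nat d"
      using hom_zero[OF \<phi>[OF i]] by blast
    moreover obtain z where "l j = l 1 + of_int z" using assms(3) \<open>j \<in> {1..k}\<close> by blast
    ultimately show ?thesis by (intro exI[of _ "int d - z"]) (simp add: algebra_simps)
  qed auto
  then obtain D where D: "\<And>i. i < N \<Longrightarrow> \<exists>z\<in>carrier E. \<phi> i z \<noteq> 0 \<Longrightarrow> R i $ 0 = 0 \<and> R i $ 1 = l 1 - of_int (D i)"
    by metis
  \<comment> \<open>The sum of the positive parts of the D_i serves as a bound, also when there are
    no homomorphisms at all.\<close>
  show ?thesis
  proof (intro exI[of _ "\<Sum>i<N. nat (D i)"] allI impI)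
    fix M assume M: "(\<Sum>i<N. nat (D i)) \<le> M"
    have MD: "D i \<le> int M" if "i < N" for i
    proof -
      have "nat (D i) \<le> (\<Sum>i<N. nat (D i))" using that by (intro member_le_sum) auto
      then show ?thesis using M by linarith
    qed
    show "jker (l 1 - of_nat M) 1" unfolding jker_def
    proof (intro ballI impI)
      fix z assume z: "z \<in> carrier E" "\<forall>\<chi>\<in>khoms (l 1 - of_nat M) 1. \<chi> z = 0"
      have "\<phi> i z = 0" if i: "i < N" for i
      proof (rule ccontr)
        assume nz: "\<phi> i z \<noteq> 0"
        then have R: "R i $ 0 = 0" "R i $ 1 = l 1 - of_int (D i)" using D[OF i] z(1) by blast+
        have "(of_nat (nat (int M - D i)) :: complex) = of_int (int M - D i)" using MD[OF i] by simp
        then have "R i $ 1 = (l 1 - of_nat M) + of_nat (nat (int M - D i))" unfolding R(2) by simp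
        from bhom_normalize[OF \<phi>[OF i] R(1) this] obtain U where U: "U $ 0 = 1"
          "bhom E (fps_const (l 1 - of_nat M) * fps_X) (\<lambda>x. (fps_X ^ nat (int M - D i) * U) * \<phi> i x)" by blast
        then have "(\<lambda>x. (fps_X ^ nat (int M - D i) * U) * \<phi> i x) \<in> khoms (l 1 - of_nat M) 1"
          using \<phi>1[OF i] by (simp add: khoms_def)
        from bspec[OF z(2) this] have "(fps_X ^ nat (int M - D i) * U) * \<phi> i z = 0" .
        moreover have "U \<noteq> 0" using U(1) by auto
        ultimately show False using nz by simp
      qed
      then have "F 1 +> z = \<zero>\<^bsub>E LQuot F 1\<^esub>"
        using z(1) by (intro inj) (auto simp: \<phi>_def quot_carrier[OF s1])
      then show "z \<in> F 1" using quot_eq_zero[OF s1 z(1)] by blast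
    qed
  qed
qed

text \<open>By semi-simplicity of F_(k-1) some homomorphism is nonzero at x_1, and normalization
  gives it the constant l_1 - M. M is taken strictly larger than d so that all values are divisible
  by b; \<open>alpha_frame\<close> needs this for its equation at index 0.\<close>

lemma first_coord_start:
  assumes "2 \<le> k" "ab_semi_simple (E \<downharpoonright> F (k - 1))"
  shows "\<exists>M0. \<forall>M\<ge>M0. \<exists>\<chi>. bhom (E \<downharpoonright> F (k - 1)) (fps_const (l 1 - of_nat M) * fps_X) \<chi> \<and> \<chi> (x 1) \<noteq> 0 \<and>
    (\<forall>z\<in>F (k - 1). \<chi> z $ 0 = 0)"
proof -
  have s: "submodule (F (k - 1)) Atilde E" by (rule Fsub) simp
  interpret G: abmod "E \<downharpoonright> F (k - 1)" by (rule sub_abmod[OF s])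
  have one: "1 \<in> {1..k}" using assms(1) by auto
  have F1: "F 1 \<subseteq> F (k - 1)" by (rule Fmono) (use assms(1) in auto)
  then have x1: "x 1 \<in> F (k - 1)" using xF[OF one] by blast
  from semi_simple_bhoms[OF G.abmod_axioms assms(2)]
  have "\<exists>N R \<chi>. (\<forall>i<N::nat. bhom (E \<downharpoonright> F (k - 1)) (R i) (\<chi> i)) \<and> (\<forall>z\<in>F (k - 1). (\<forall>i<N. \<chi> i z = 0) \<longrightarrow> z = \<zero>)"
    by simp
  then obtain N R \<chi> where b': "\<forall>i<N::nat. bhom (E \<downharpoonright> F (k - 1)) (R i) (\<chi> i)"
    and inj': "\<forall>z\<in>F (k - 1). (\<forall>i<N. \<chi> i z = 0) \<longrightarrow> z = \<zero>"
    by (elim exE conjE) (rule that)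
  note b = b'[rule_format] and inj = bspec[OF inj', rule_format]
  have "x 1 \<noteq> \<zero>"
  proof
    assume "x 1 = \<zero>"
    then have "bmul E 1 (x 1) \<in> F (1 - 1)" using F0 by simp
    then have "(1 :: complex fps) = 0" using xfree[OF one] by blast
    then show False by simp
  qed
  then obtain i where i: "i < N" "\<chi> i (x 1) \<noteq> 0" using inj x1 by blast
  have "\<forall>z\<in>F (1 - 1). \<chi> i z = 0" using F0 G.bhom_zero[OF b[OF i(1)]] by simp
  from rop_kernel[OF hom_lead[OF s F1 b[OF i(1)] this one] i(2)]
  obtain d where R: "R i $ 0 = 0" "R i $ 1 = l 1 - of_nat d" by blast
  show ?thesis
  proof (intro exI[of _ "d + 1"] allI impI)
    fix M assume M: "d + 1 \<le> M"
    then have "R i $ 1 = (l 1 - of_nat M) + of_nat (M - d)" unfolding R(2) by (simp add: of_nat_diff)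
    from bhom_normalize[OF b[OF i(1)] R(1) this] obtain U where U: "U $ 0 = 1"
      "bhom (E \<downharpoonright> F (k - 1)) (fps_const (l 1 - of_nat M) * fps_X) (\<lambda>x. (fps_X ^ (M - d) * U) * \<chi> i x)" by blast
    show "\<exists>\<chi>. bhom (E \<downharpoonright> F (k - 1)) (fps_const (l 1 - of_nat M) * fps_X) \<chi> \<and> \<chi> (x 1) \<noteq> 0 \<and>
      (\<forall>z\<in>F (k - 1). \<chi> z $ 0 = 0)"
    proof (intro exI[of _ "\<lambda>x. (fps_X ^ (M - d) * U) * \<chi> i x"] conjI ballI)
      show "(fps_X ^ (M - d) * U) * \<chi> i (x 1) \<noteq> 0" using U(1) i(2) by auto
      show "((fps_X ^ (M - d) * U) * \<chi> i z) $ 0 = 0" for z using M by (simp add: mult.assoc)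
    qed (rule U(2))
  qed
qed

end

lemma JH_chain:
  assumes "abmod E" "JH_seq E k F l"
  obtains x where "chain E k F l x"
proof -
  interpret abmod E by fact
  obtain x where x: "\<forall>j\<in>{1..k}. x j \<in> F j \<and> ab_lin (l j) \<odot>\<^bsub>E\<^esub> x j \<in> F (j - 1) \<and>
    (\<forall>z\<in>F j. \<exists>S. z \<ominus>\<^bsub>E\<^esub> bmul E S (x j) \<in> F (j - 1)) \<and> (\<forall>S. bmul E S (x j) \<in> F (j - 1) \<longrightarrow> S = 0)"
    using JH_generators[OF assms] by blast
  have h0: "F 0 = {\<zero>\<^bsub>E\<^esub>}" and hk: "F k = carrier E" using assms(2) by (simp_all add: JH_seq_def)
  have hs: "submodule (F j) Atilde E" if "j \<le> k" for j using assms(2) that by (simp add: JH_seq_def normal_sub_def)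
  have hc: "F (j - 1) \<subseteq> F j" if "j \<in> {1..k}" for j using assms(2) that unfolding JH_seq_def by blast
  have hx: "x j \<in> F j" and hl: "ab_lin (l j) \<odot>\<^bsub>E\<^esub> x j \<in> F (j - 1)" if "j \<in> {1..k}" for j using x that by blast+
  have hg: "\<exists>S. z \<ominus>\<^bsub>E\<^esub> bmul E S (x j) \<in> F (j - 1)" if "j \<in> {1..k}" "z \<in> F j" for j z using x that by blast
  have hf: "S = 0" if "j \<in> {1..k}" "bmul E S (x j) \<in> F (j - 1)" for j S using x that by blast
  have "chain E k F l x"
    by (rule chain.intro[OF abmod_axioms chain_axioms.intro[OF h0 hk hs hc hx hl hg hf]])
  then show ?thesis by (rule that)
qed

text \<open>Coordinates 2 to k come from \<open>elim\<close>. The first one exists on F_(k-1) as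
  \<chi>1, and E is F_(k-1) plus the free part C[[b]] x_k, so only its value h at x_k has to be
  chosen. Compatibility with a is a first order equation for h, solvable at every index except the
  one where the operator degenerates; the obstruction there is absorbed by the term c b
  \<psi>_k.\<close>

lemma alpha_frame:
  assumes "abmod E" "2 \<le> k" "JH_seq E k F l"
    and l: "\<forall>j\<in>{1..k-1}. l (j + 1) = l j + of_nat (p j) - 1 \<and> 1 \<le> p j"
    and ss: "ab_semi_simple (E \<downharpoonright> F (k - 1))" "ab_semi_simple (E LQuot F 1)"
    and e: "e \<in> carrier E" "cyc_sub Atilde E e = carrier E"
  shows "\<exists>\<kappa> c \<psi> n. frame E k \<kappa> c \<psi> n e \<and> (\<forall>j\<in>{1..k}. l j = \<kappa> + of_nat (n j) + of_nat k - of_nat j) \<and>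
    (\<forall>j\<le>k. F j = coords.fl E \<psi> j) \<and> (\<forall>j\<in>{1..k-1}. n (j + 1) = n j + p j)"
proof -
  obtain x where "chain E k F l x" using JH_chain[OF assms(1,3)] .
  then interpret chain E k F l x .
  \<comment> \<open>These sums determine the exponents up to a common shift, since l_j + j = l_1 +
    P_j + 1.\<close>
  define P where "P j = (\<Sum>i\<in>{1..<j}. p i)" for j
  have P: "P (Suc j) = P j + p j" if "1 \<le> j" for j
    using that by (simp add: P_def sum.atLeastLessThan_Suc)
  have lP: "l j = l 1 + of_nat (P j) + 1 - of_nat j" if "1 \<le> j" "j \<le> k" for j
    using that
  proof (induction j rule: dec_induct)
    case base then show ?case by (simp add: P_def)
  next
    case (step j)
    then have "j \<in> {1..k-1}" by auto
    then have "l (Suc j) = l j + of_nat (p j) - 1" using l by (metis Suc_eq_plus1)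
    then show ?case using step P[of j] by simp
  qed
  have lz: "\<exists>z. l j = l 1 + of_int z" if "j \<in> {1..k}" for j
    using lP[of j] that by (intro exI[of _ "int (P j) + 1 - int j"]) auto
  obtain M1 where M1: "\<And>M. M1 \<le> M \<Longrightarrow> jker (l 1 - of_nat M) 1"
    using jker_start[OF _ ss(2) lz] assms(2) by auto
  obtain M2 where M2: "\<And>M. M2 \<le> M \<Longrightarrow> \<exists>\<chi>. bhom (E \<downharpoonright> F (k - 1)) (fps_const (l 1 - of_nat M) * fps_X) \<chi> \<and> \<chi> (x 1) \<noteq> 0 \<and>
    (\<forall>z\<in>F (k - 1). \<chi> z $ 0 = 0)"
    using first_coord_start[OF assms(2) ss(1)] by blast
  define M where "M = M1 + M2 + k"
  define \<kappa> where "\<kappa> = l 1 - of_nat M"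
  \<comment> \<open>The shift is dictated by l_j = \<kappa> + n_j + k - j at j = 1; the subtraction
    of k is exact because M >= k.\<close>
  define n where "n j = M + 1 - k + P j" for j
  have ln: "l j = \<kappa> + of_nat (n j + k - j)" if "j \<in> {1..k}" for j
  proof -
    have "n j + k - j + j = M + 1 + P j" using that by (auto simp: n_def M_def)
    then have "of_nat (n j + k - j) + of_nat j = (of_nat M + 1 + of_nat (P j) :: complex)" by (metis of_nat_add of_nat_1)
    then show ?thesis using lP[of j] that by (simp add: \<kappa>_def algebra_simps)
  qed
  have ndiff: "of_nat (n j + k - j) = (of_nat (n j) + of_nat k - of_nat j :: complex)" if "j \<in> {1..k}" for j
    using that by (simp add: of_nat_diff)
  let ?R = "fps_const \<kappa> * fps_X"
  obtain \<chi>1 where \<chi>1: "bhom (E \<downharpoonright> F (k - 1)) ?R \<chi>1" "\<chi>1 (x 1) \<noteq> 0" "\<And>z. z \<in> F (k - 1) \<Longrightarrow> \<chi>1 z $ 0 = 0"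
    using M2[of M] by (auto simp: M_def \<kappa>_def)
  have J: "jker \<kappa> 1" using M1[of M] by (simp add: M_def \<kappa>_def)
  have "\<forall>j\<in>{2..k}. \<exists>\<chi>. \<chi> \<in> khoms \<kappa> (j - 1) \<and> \<chi> (x j) \<noteq> 0" using elim[OF J] by blast
  from bchoice[OF this] obtain \<phi> where \<phi>: "\<And>j. j \<in> {2..k} \<Longrightarrow> \<phi> j \<in> khoms \<kappa> (j - 1)" "\<And>j. j \<in> {2..k} \<Longrightarrow> \<phi> j (x j) \<noteq> 0" by blast
  have \<phi>b: "bhom E ?R (\<phi> j)" and \<phi>v: "z \<in> F (j - 1) \<Longrightarrow> \<phi> j z = 0" if "j \<in> {2..k}" for j z
    using \<phi>(1)[OF that] by (auto simp: khoms_def)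
  have \<phi>x: "\<exists>g. g \<noteq> 0 \<and> \<phi> j (x j) = fps_const g * fps_X ^ (n j + k - j)" if j: "j \<in> {2..k}" for j
  proof -
    have sj: "Suc (j - 1) = j" "j - 1 < k" "j \<in> {1..k}" using j by auto
    obtain g d where g: "\<phi> j (x j) = fps_const g * fps_X ^ d" "g \<noteq> 0" "l j = \<kappa> + of_nat d"
      using khoms_lead[OF \<phi>(1)[OF j] sj(2)] \<phi>(2)[OF j] unfolding sj(1) by metis
    then have "d = n j + k - j" using ln[OF sj(3)] by (metis add_left_cancel of_nat_eq_iff)
    then show ?thesis using g by blast
  qed
  have kk: "k \<in> {1..k}" "k \<in> {2..k}" "1 \<in> {1..k}" using assms(2) by auto
  have sk: "submodule (F (k - 1)) Atilde E" by (rule Fsub) simp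
  interpret G: abmod "E \<downharpoonright> F (k - 1)" by (rule sub_abmod[OF sk])
  have F1: "F 1 \<subseteq> F (k - 1)" by (rule Fmono) (use assms(2) in auto)
  have xk: "x k \<in> carrier E" by (rule xcar[OF kk(1)])
  define D where "D = n k"
  obtain g where g: "g \<noteq> 0" "\<phi> k (x k) = fps_const g * fps_X ^ D" using \<phi>x[OF kk(2)] by (auto simp: D_def)
  have lD: "l k = \<kappa> + of_nat D" using ln[OF kk(1)] by (simp add: D_def)
  define y where "y = ab_lin (l k) \<odot>\<^bsub>E\<^esub> x k"
  have y: "y \<in> F (k - 1)" using xlin[OF kk(1)] by (simp add: y_def)
  define f where "f = \<chi>1 y"
  \<comment> \<open>At index D + 1 the factor \<kappa> + D - l_k of h_D is zero, so c has to match
    the coefficient of f. At the other indices h results from division by m - D.\<close>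
  define c where "c = f $ Suc D / g"
  define h where "h = Abs_fps (\<lambda>m. if m = D then 0 else f $ Suc m / (of_nat m - of_nat D))"
  have ode: "dop \<kappa> h + fps_const c * fps_X * \<phi> k (x k) = fps_const (l k) * fps_X * h + f"
  proof (rule fps_ext)
    fix m
    have f0: "f $ 0 = 0" using \<chi>1(3)[OF y] by (simp add: f_def)
    show "(dop \<kappa> h + fps_const c * fps_X * \<phi> k (x k)) $ m = (fps_const (l k) * fps_X * h + f) $ m"
    proof (cases m)
      case 0 then show ?thesis by (simp add: dop_nth mult.assoc f0)
    next
      case (Suc m')
      show ?thesis
      proof (cases "m' = D")
        case True then show ?thesis using g(1) by (simp add: Suc dop_nth mult.assoc g(2) monom_nth h_def c_def lD)
      next
        case False
        have "(of_nat m' - of_nat D) * h $ m' = f $ Suc m'" using False by (simp add: h_def)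
        then show ?thesis using False
          by (simp add: Suc dop_nth mult.assoc g(2) monom_nth lD) (simp add: algebra_simps)
      qed
    qed
  qed
  have "\<forall>z\<in>carrier E. \<exists>S. z \<ominus>\<^bsub>E\<^esub> bmul E S (x k) \<in> F (k - 1)" using xgen[OF kk(1)] by (simp add: Fk)
  from bchoice[OF this] obtain \<sigma> where \<sigma>: "\<And>z. z \<in> carrier E \<Longrightarrow> z \<ominus>\<^bsub>E\<^esub> bmul E (\<sigma> z) (x k) \<in> F (k - 1)" by blast
  \<comment> \<open>Every z is w + S x_k with w in F_(k-1), uniquely since \<phi>_k vanishes on
    F_(k-1) but not at x_k. So \<psi>1 extends \<chi>1 with the value h at x_k.\<close>
  define \<psi>1 where "\<psi>1 z = \<chi>1 (z \<ominus>\<^bsub>E\<^esub> bmul E (\<sigma> z) (x k)) + \<sigma> z * h" for z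
  have \<psi>1: "\<psi>1 (w \<oplus>\<^bsub>E\<^esub> bmul E S (x k)) = \<chi>1 w + S * h" if w: "w \<in> F (k - 1)" for w S
  proof -
    let ?z = "w \<oplus>\<^bsub>E\<^esub> bmul E S (x k)"
    have wc: "w \<in> carrier E" using submodD(6)[OF sk w] .
    have zc: "?z \<in> carrier E" using wc xk by simp
    have "\<phi> k ?z = S * \<phi> k (x k)" using \<phi>v[OF kk(2) w] wc xk by (simp add: bhomD[OF \<phi>b[OF kk(2)]])
    moreover have "\<phi> k (?z \<ominus>\<^bsub>E\<^esub> bmul E (\<sigma> ?z) (x k)) = \<phi> k ?z - \<sigma> ?z * \<phi> k (x k)"
      using zc xk by (simp add: bhom_minus[OF \<phi>b[OF kk(2)]] bhomD(2)[OF \<phi>b[OF kk(2)]])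
    ultimately have "(\<sigma> ?z - S) * \<phi> k (x k) = 0" using \<phi>v[OF kk(2) \<sigma>[OF zc]] by (simp add: algebra_simps)
    then have S: "\<sigma> ?z = S" using \<phi>(2)[OF kk(2)] by simp
    have "?z \<ominus>\<^bsub>E\<^esub> bmul E S (x k) = w" using wc xk by (simp add: a_minus_def M.a_assoc M.r_neg)
    then show ?thesis by (simp add: \<psi>1_def S)
  qed
  have dec: "\<exists>w S. w \<in> F (k - 1) \<and> z = w \<oplus>\<^bsub>E\<^esub> bmul E S (x k)" if z: "z \<in> carrier E" for z
    using \<sigma>[OF z] z xk by (intro exI[of _ "z \<ominus>\<^bsub>E\<^esub> bmul E (\<sigma> z) (x k)"] exI[of _ "\<sigma> z"]) (simp add: minus_add_cancel)
  have Fkc: "w \<in> F (k - 1) \<Longrightarrow> w \<in> carrier E" for w using submodD(6)[OF sk] .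
  define \<psi> where "\<psi> z j = (if j = 1 then \<psi>1 z else if j \<in> {2..k} then \<phi> j z else 0)" for z j
  have b1: "\<psi>1 (z \<oplus>\<^bsub>E\<^esub> z') = \<psi>1 z + \<psi>1 z'" if zz: "z \<in> carrier E" "z' \<in> carrier E" for z z'
  proof -
    obtain w S where w: "w \<in> F (k - 1)" "z = w \<oplus>\<^bsub>E\<^esub> bmul E S (x k)" using dec[OF zz(1)] by blast
    obtain w' S' where w': "w' \<in> F (k - 1)" "z' = w' \<oplus>\<^bsub>E\<^esub> bmul E S' (x k)" using dec[OF zz(2)] by blast
    have "z \<oplus>\<^bsub>E\<^esub> z' = (w \<oplus>\<^bsub>E\<^esub> w') \<oplus>\<^bsub>E\<^esub> bmul E (S + S') (x k)"
      unfolding w(2) w'(2) using Fkc[OF w(1)] Fkc[OF w'(1)] xk by (simp add: bmul_add M.a_ac)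
    then show ?thesis using \<psi>1[OF w(1)] \<psi>1[OF w'(1)] \<psi>1[OF submodD(3)[OF sk w(1) w'(1)]] w w'
      bhomD(1)[OF \<chi>1(1)] by (simp add: algebra_simps)
  qed
  have b2: "\<psi>1 (bmul E T z) = T * \<psi>1 z" if zz: "z \<in> carrier E" for z T
  proof -
    obtain w S where w: "w \<in> F (k - 1)" "z = w \<oplus>\<^bsub>E\<^esub> bmul E S (x k)" using dec[OF zz] by blast
    have "bmul E T z = bmul E T w \<oplus>\<^bsub>E\<^esub> bmul E (T * S) (x k)"
      unfolding w(2) using Fkc[OF w(1)] xk by (simp add: bmul_mult smul_add_right)
    then show ?thesis using \<psi>1[OF w(1)] \<psi>1[OF submodD(4)[OF sk w(1)]] w bhomD(2)[OF \<chi>1(1)] by (simp add: algebra_simps)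
  qed
  have b3: "\<psi>1 (ab_a \<odot>\<^bsub>E\<^esub> z) = dop \<kappa> (\<psi>1 z) + fps_const c * fps_X * \<phi> k z" if zz: "z \<in> carrier E" for z
  proof -
    obtain w S where w: "w \<in> F (k - 1)" "z = w \<oplus>\<^bsub>E\<^esub> bmul E S (x k)" using dec[OF zz] by blast
    have wc: "w \<in> carrier E" using Fkc[OF w(1)] .
    have yc: "y \<in> carrier E" using Fkc[OF y] .
    let ?w = "ab_a \<odot>\<^bsub>E\<^esub> w \<oplus>\<^bsub>E\<^esub> bmul E S y" let ?S = "S * (fps_const (l k) * fps_X) + fps_X\<^sup>2 * fps_deriv S"
    have "ab_a \<odot>\<^bsub>E\<^esub> z = ab_a \<odot>\<^bsub>E\<^esub> w \<oplus>\<^bsub>E\<^esub> (bmul E S (ab_a \<odot>\<^bsub>E\<^esub> x k) \<oplus>\<^bsub>E\<^esub> bmul E (fps_X\<^sup>2 * fps_deriv S) (x k))"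
      unfolding w(2) using wc xk by (simp add: smul_add_right a_bmul)
    also have "ab_a \<odot>\<^bsub>E\<^esub> x k = y \<oplus>\<^bsub>E\<^esub> bmul E (fps_const (l k) * fps_X) (x k)" unfolding y_def by (rule a_eq_lin[OF xk])
    also have "ab_a \<odot>\<^bsub>E\<^esub> w \<oplus>\<^bsub>E\<^esub> (bmul E S \<dots> \<oplus>\<^bsub>E\<^esub> bmul E (fps_X\<^sup>2 * fps_deriv S) (x k)) = ?w \<oplus>\<^bsub>E\<^esub> bmul E ?S (x k)"
      using wc yc xk by (simp add: smul_add_right bmul_add bmul_mult[symmetric] M.a_assoc)
    finally have e1: "ab_a \<odot>\<^bsub>E\<^esub> z = ?w \<oplus>\<^bsub>E\<^esub> bmul E ?S (x k)" .
    have wF: "ab_a \<odot>\<^bsub>E\<^esub> w \<in> F (k - 1)" "bmul E S y \<in> F (k - 1)" using submodD(4)[OF sk] w y by auto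
    have "\<chi>1 ?w = \<chi>1 (ab_a \<odot>\<^bsub>E\<^esub> w) + \<chi>1 (bmul E S y)" using bhomD(1)[OF \<chi>1(1)] wF by simp
    also have "\<dots> = dop \<kappa> (\<chi>1 w) + S * f" using bhomD(2,3)[OF \<chi>1(1)] w y by (simp add: f_def)
    finally have "\<psi>1 (ab_a \<odot>\<^bsub>E\<^esub> z) = dop \<kappa> (\<chi>1 w) + S * f + ?S * h"
      unfolding e1 using \<psi>1[OF submodD(3)[OF sk wF]] by simp
    also have "\<dots> = dop \<kappa> (\<chi>1 w) + S * (fps_const (l k) * fps_X * h + f) + fps_X\<^sup>2 * fps_deriv S * h"
      by (simp add: algebra_simps)
    also have "\<dots> = dop \<kappa> (\<chi>1 w) + (S * dop \<kappa> h + fps_X\<^sup>2 * fps_deriv S * h) + fps_const c * fps_X * (S * \<phi> k (x k))"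
      unfolding ode[symmetric] by (simp add: algebra_simps)
    also have "S * \<phi> k (x k) = \<phi> k z"
      unfolding w(2) using \<phi>v[OF kk(2) w(1)] wc xk by (simp add: bhomD[OF \<phi>b[OF kk(2)]])
    also have "dop \<kappa> (\<chi>1 w) + (S * dop \<kappa> h + fps_X\<^sup>2 * fps_deriv S * h) = dop \<kappa> (\<psi>1 z)"
      unfolding w(2) \<psi>1[OF w(1)] rop_add rop_mult by simp
    finally show ?thesis .
  qed
  \<comment> \<open>Descending from E, the homomorphism \<phi>_i detects the component along x_i, so
    the F_j are common kernels.\<close>
  have Fchar: "z \<in> F j \<longleftrightarrow> z \<in> carrier E \<and> (\<forall>i\<in>{Suc j..k}. \<phi> i z = 0)" if j: "1 \<le> j" "j \<le> k" for z j
  proof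
    assume z: "z \<in> F j"
    have "\<phi> i z = 0" if i: "i \<in> {Suc j..k}" for i
    proof -
      have "j \<le> i - 1" "i - 1 \<le> k" "i \<in> {2..k}" using i j by auto
      then show ?thesis using \<phi>v[of i z] Fmono[of j "i - 1"] z by blast
    qed
    then show "z \<in> carrier E \<and> (\<forall>i\<in>{Suc j..k}. \<phi> i z = 0)" using Fcar[OF j(2) z] by blast
  next
    assume z: "z \<in> carrier E \<and> (\<forall>i\<in>{Suc j..k}. \<phi> i z = 0)"
    have "m \<le> k - j \<Longrightarrow> z \<in> F (k - m)" for m
    proof (induction m)
      case 0 then show ?case using z by (simp add: Fk)
    next
      case (Suc m)
      define i where "i = k - m"
      have i: "i \<in> {1..k}" "k - Suc m = i - 1" "i \<in> {2..k}" "i \<in> {Suc j..k}" using Suc.prems j by (auto simp: i_def)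
      have zi: "z \<in> F i" using Suc by (simp add: i_def)
      obtain S where S: "z \<ominus>\<^bsub>E\<^esub> bmul E S (x i) \<in> F (i - 1)" using xgen[OF i(1) zi] by blast
      have xi: "x i \<in> carrier E" by (rule xcar[OF i(1)])
      have "S * \<phi> i (x i) = 0" using \<phi>v[OF i(3) S] z i(4) xi by (simp add: bhom_minus[OF \<phi>b[OF i(3)]] bhomD[OF \<phi>b[OF i(3)]])
      then have "S = 0" using \<phi>(2)[OF i(3)] by simp
      then have "z \<ominus>\<^bsub>E\<^esub> \<zero>\<^bsub>E\<^esub> \<in> F (i - 1)" using S xi by simp
      then show ?case using z neg_eq[of "\<zero>\<^bsub>E\<^esub>"] by (simp add: i(2) a_minus_def)
    qed
    from this[of "k - j"] show "z \<in> F j" using j by simp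
  qed
  have \<psi>F1: "\<psi>1 z = \<chi>1 z" if "z \<in> F (k - 1)" for z
    using \<psi>1[OF that, of 0] Fkc[OF that] xk by simp
  have co: "coords E k \<kappa> c \<psi> n"
  proof
    show "eqv E (logop \<kappa> c k) \<psi>" unfolding eqv_def
    proof (intro conjI ballI allI ext)
      fix z j assume z: "z \<in> carrier E"
      show "\<psi> (z \<oplus>\<^bsub>E\<^esub> z') j = \<psi> z j + \<psi> z' j" if "z' \<in> carrier E" for z'
        using b1[OF z that] bhomD(1)[OF \<phi>b z that] by (simp add: \<psi>_def)
      show "\<psi> (bmul E S z) j = S * \<psi> z j" for S
        using b2[OF z] bhomD(2)[OF \<phi>b z] by (simp add: \<psi>_def)
      show "\<psi> (ab_a \<odot>\<^bsub>E\<^esub> z) j = logop \<kappa> c k (\<psi> z) j"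
        using b3[OF z] bhomD(3)[OF \<phi>b z] assms(2) by (auto simp: \<psi>_def logop_def)
    qed
    show "z = \<zero>\<^bsub>E\<^esub>" if z: "z \<in> carrier E" "\<And>j. j \<in> {1..k} \<Longrightarrow> \<psi> z j = 0" for z
    proof -
      have "\<forall>i\<in>{Suc 1..k}. \<phi> i z = 0"
      proof
        fix i assume "i \<in> {Suc 1..k}"
        then have "i \<in> {1..k}" "i \<noteq> 1" "i \<in> {2..k}" by auto
        then show "\<phi> i z = 0" using z(2)[of i] by (simp add: \<psi>_def)
      qed
      then have zF: "z \<in> F 1" using Fchar[of 1 z] z(1) assms(2) by simp
      obtain S where S: "z \<ominus>\<^bsub>E\<^esub> bmul E S (x 1) \<in> F (1 - 1)" using xgen[OF kk(3) zF] by blast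
      then have zS: "z = bmul E S (x 1)" using F0 z(1) xcar[OF kk(3)] by (simp add: minus_eq_0_iff)
      have "\<psi>1 z = 0" using z(2)[OF kk(3)] by (simp add: \<psi>_def)
      then have "\<chi>1 z = 0" using \<psi>F1 zF F1 by auto
      then have "S * \<chi>1 (x 1) = 0" using bhomD(2)[OF \<chi>1(1)] F1 xF[OF kk(3)] unfolding zS by (simp add: subset_iff)
      then have "S = 0" using \<chi>1(2) by simp
      then show ?thesis using zS xcar[OF kk(3)] by simp
    qed
    show "n i < n j" if ij: "1 \<le> i" "i < j" "j \<le> k" for i j
    proof -
      have "\<forall>i\<in>{1..k-1}. 1 \<le> p i" using l by blast
      then have "1 \<le> p i" using ij by auto
      moreover have "p i \<le> (\<Sum>m\<in>{i..<j}. p m)" using ij by (intro member_le_sum) auto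
      moreover have "P j = P i + (\<Sum>m\<in>{i..<j}. p m)" unfolding P_def using ij by (simp add: sum.atLeastLessThan_concat)
      ultimately show ?thesis by (simp add: n_def)
    qed
  qed (use assms(2) in \<open>auto simp: \<psi>_def\<close>)
  interpret C: coords E k \<kappa> c \<psi> n by (rule co)
  have fl: "F j = C.fl j" if "j \<le> k" for j
  proof (cases "j = 0")
    case True then show ?thesis using F0 C.fl_0 by simp
  next
    case False
    have "z \<in> F j \<longleftrightarrow> z \<in> C.fl j" for z
    proof -
      have "(\<forall>i\<in>{Suc j..k}. \<phi> i z = 0) \<longleftrightarrow> (\<forall>i>j. \<psi> z i = 0)" using False by (auto simp: \<psi>_def)
      then show ?thesis using Fchar[of j z] False that by (simp add: C.fl_def)
    qed
    then show ?thesis by blast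
  qed
  have lead: "\<exists>g. g \<noteq> 0 \<and> \<psi> (x j) j = fps_const g * fps_X ^ (n j + k - j)" if j: "j \<in> {1..k}" for j
  proof (cases "j = 1")
    case True
    have "\<forall>z\<in>F (1 - 1). \<chi>1 z = 0" using F0 G.bhom_zero[OF \<chi>1(1)] by simp
    from dop_kernel[OF hom_lead[OF sk F1 \<chi>1(1) this kk(3)] \<chi>1(2)]
    obtain g d where g: "\<chi>1 (x 1) = fps_const g * fps_X ^ d" "g \<noteq> 0" "l 1 = \<kappa> + of_nat d" by metis
    then have "d = n 1 + k - 1" using ln[OF kk(3)] by (metis add_left_cancel of_nat_eq_iff)
    then show ?thesis using g \<psi>F1[of "x 1"] xF[OF kk(3)] F1 True by (auto simp: \<psi>_def)
  next
    case False then have "j \<in> {2..k}" using j by auto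
    then show ?thesis using \<phi>x[of j] False by (auto simp: \<psi>_def)
  qed
  have "frame E k \<kappa> c \<psi> n e"
  proof (rule coords_gen_frame[OF co e])
    fix j assume j: "j \<in> {1..k}"
    obtain g where g: "g \<noteq> 0" "\<psi> (x j) j = fps_const g * fps_X ^ (n j + k - j)" using lead[OF j] by blast
    have jk: "j \<le> k" "j - 1 \<le> k" using j by auto
    show "\<exists>x\<in>C.fl j. \<psi> x j $ (n j + k - j) \<noteq> 0"
      using xF[OF j] g fl[OF jk(1)] by (intro bexI[of _ "x j"]) (simp_all add: monom_nth)
    fix z assume "z \<in> C.fl j"
    then have z: "z \<in> F j" using fl[OF jk(1)] by simp
    obtain S where S: "z \<ominus>\<^bsub>E\<^esub> bmul E S (x j) \<in> F (j - 1)" using xgen[OF j z] by blast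
    then have "\<psi> (z \<ominus>\<^bsub>E\<^esub> bmul E S (x j)) j = 0" using fl[OF jk(2)] j by (auto simp: C.fl_def)
    then have "\<psi> z j = S * \<psi> (x j) j" using Fcar[OF jk(1) z] xcar[OF j] by (simp add: C.psi_minus C.psi_bmul)
    then show "fps_X ^ (n j + k - j) dvd \<psi> z j" using g(2) by simp
  qed
  moreover have "l j = \<kappa> + of_nat (n j) + of_nat k - of_nat j" if "j \<in> {1..k}" for j
    using ln[OF that] ndiff[OF that] by simp
  moreover have "n (j + 1) = n j + p j" if "j \<in> {1..k-1}" for j
    using P[of j] that unfolding Suc_eq_plus1 by (simp add: n_def)
  ultimately show ?thesis using fl by blast
qed

section \<open>Bernstein polynomials\<close>

lemma (in abmod) smul_finsum:
  assumes "\<And>i. i < m \<Longrightarrow> y i \<in> carrier E"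
  shows "u \<odot> (\<Oplus>i\<in>{..<m::nat}. y i) = (\<Oplus>i\<in>{..<m}. u \<odot> y i)"
  using assms
proof (induction m)
  case (Suc m)
  have "(\<Oplus>i\<in>{..<Suc m}. y i) = y m \<oplus> (\<Oplus>i\<in>{..<m}. y i)"
    "(\<Oplus>i\<in>{..<Suc m}. u \<odot> y i) = u \<odot> y m \<oplus> (\<Oplus>i\<in>{..<m}. u \<odot> y i)"
    unfolding lessThan_Suc using Suc.prems by (auto intro!: M.finsum_insert)
  then show ?case using Suc by (simp add: smul_add_right M.finsum_closed)
qed simp

lemma ab_rank_torsion_free:
  assumes "abmod E" "ab_rank E k" "x \<in> carrier E" "T \<noteq> 0" "bmul E T x = \<zero>\<^bsub>E\<^esub>"
  shows "x = \<zero>\<^bsub>E\<^esub>"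
proof -
  interpret abmod E by fact
  from assms(2) obtain e where e: "e \<in> {..<k} \<rightarrow> carrier E"
    and ex: "\<forall>x\<in>carrier E. \<exists>!S. S \<in> {..<k} \<rightarrow>\<^sub>E UNIV \<and> x = (\<Oplus>\<^bsub>E\<^esub>i\<in>{..<k}. bmul E (S i) (e i))"
    unfolding ab_rank_def by (elim bexE) (rule that, assumption, assumption)
  define G where "G S = (\<Oplus>\<^bsub>E\<^esub>i\<in>{..<k}. bmul E (S i) (e i))" for S
  note ex = ex[folded G_def]
  have ei: "e i \<in> carrier E" if "i < k" for i using e that by auto
  have cong: "G S = G S'" if "\<And>i. i < k \<Longrightarrow> S i = S' i" for S S'
    unfolding G_def by (rule M.finsum_cong') (use that ei in auto)
  have TG: "bmul E T (G S) = G (\<lambda>i. T * S i)" for S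
    unfolding G_def by (subst smul_finsum) (use ei in \<open>auto simp: bmul_mult intro!: M.finsum_cong'\<close>)
  have G0: "G (\<lambda>i. 0) = \<zero>\<^bsub>E\<^esub>"
    unfolding G_def using ei by (subst M.finsum_cong'[of "{..<k}" _ "\<lambda>i. \<zero>\<^bsub>E\<^esub>"]) auto
  from ex1_implies_ex[OF bspec[OF ex assms(3)]] obtain S where S: "S \<in> {..<k} \<rightarrow>\<^sub>E UNIV" "x = G S" by blast
  have "G (restrict (\<lambda>i. T * S i) {..<k}) = \<zero>\<^bsub>E\<^esub>"
    using TG[of S] assms(5) S(2) cong[of "restrict (\<lambda>i. T * S i) {..<k}" "\<lambda>i. T * S i"] by simp
  moreover have "G (restrict (\<lambda>i. 0) {..<k}) = \<zero>\<^bsub>E\<^esub>"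
    using G0 cong[of "restrict (\<lambda>i. 0) {..<k}" "\<lambda>i. 0"] by simp
  ultimately have "restrict (\<lambda>i. T * S i) {..<k} = restrict (\<lambda>i. 0) {..<k}"
    using ex1_implies_ex[OF bspec[OF ex M.zero_closed]] bspec[OF ex M.zero_closed]
    by (elim ex1E) (metis restrict_PiE_iff UNIV_I)
  then have "S i = 0" if "i < k" for i using that assms(4) by (metis lessThan_iff mult_eq_0_iff restrict_apply')
  then have "G S = G (\<lambda>i. 0)" by (intro cong)
  then show ?thesis using S G0 by simp
qed

text \<open>Stability under the algebra holds because u b = b w for a suitable w.\<close>

lemma (in abmod) b_image_sub: "submodule (b_image E (carrier E)) Atilde E"
proof (rule submodI)
  show "b_image E (carrier E) \<subseteq> carrier E" by (auto simp: b_image_def)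
  show "\<zero> \<in> b_image E (carrier E)" using smul_0_right[of ab_b] by (metis M.zero_closed b_image_def image_eqI)
  show "x \<oplus> y \<in> b_image E (carrier E)" if "x \<in> b_image E (carrier E)" "y \<in> b_image E (carrier E)" for x y
    using that by (auto simp: b_image_def simp flip: smul_add_right)
  show "u \<odot> x \<in> b_image E (carrier E)" if "x \<in> b_image E (carrier E)" for u x
  proof -
    from that obtain y where y: "y \<in> carrier E" "x = ab_b \<odot> y" by (auto simp: b_image_def)
    obtain w where "ab_mult u ab_b = ab_mult ab_b w" using ab_mult_b_right_shift by blast
    then have "u \<odot> x = ab_b \<odot> (w \<odot> y)" using y by (metis smul_mult)
    then show ?thesis using y by (auto simp: b_image_def)
  qed
qed

lemma prod_linear_dvd_iff:
  assumes "finite J" "inj_on \<nu> J"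
  shows "(\<Prod>j\<in>J. [: \<nu> j, 1 :]) dvd (Q :: complex poly) \<longleftrightarrow> (\<forall>j\<in>J. poly Q (- \<nu> j) = 0)"
  using assms
proof (induction J)
  case (insert a J)
  let ?P = "\<Prod>j\<in>J. [: \<nu> j, 1 :]"
  have "\<nu> j \<noteq> \<nu> a" if "j \<in> J" for j using insert.hyps insert.prems that by (auto simp: inj_on_def)
  then have "poly ?P (- \<nu> a) \<noteq> 0" using insert.hyps by (auto simp: poly_prod)
  show ?case
  proof
    assume "(\<Prod>j\<in>insert a J. [: \<nu> j, 1 :]) dvd Q"
    then obtain R where "Q = [: \<nu> a, 1 :] * ?P * R" using insert by (auto simp: dvd_def)
    then show "\<forall>j\<in>insert a J. poly Q (- \<nu> j) = 0" using insert by (auto simp: poly_prod)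
  next
    assume r: "\<forall>j\<in>insert a J. poly Q (- \<nu> j) = 0"
    then obtain R where R: "Q = ?P * R" using insert by (auto simp: dvd_def)
    then have "poly R (- \<nu> a) = 0" using r \<open>poly ?P (- \<nu> a) \<noteq> 0\<close> by auto
    then have "[: \<nu> a, 1 :] dvd R" using poly_eq_0_iff_dvd[of R "- \<nu> a"] by simp
    then show "(\<Prod>j\<in>insert a J. [: \<nu> j, 1 :]) dvd Q"
    proof -
      have "[: \<nu> a, 1 :] * ?P dvd R * ?P" using \<open>[: \<nu> a, 1 :] dvd R\<close> by (rule mult_dvd_mono) simp
      moreover have "(\<Prod>j\<in>insert a J. [: \<nu> j, 1 :]) = [: \<nu> a, 1 :] * ?P" using insert.hyps by (rule prod.insert)
      moreover have "Q = R * ?P" using R by (simp only: mult.commute)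
      ultimately show ?thesis by (simp only:)
    qed
  qed
qed simp

lemma monic_dvd_antisym:
  fixes P Q :: "complex poly"
  assumes "P dvd Q" "Q dvd P" "lead_coeff P = 1" "lead_coeff Q = 1"
  shows "P = Q"
proof -
  obtain A where A: "Q = P * A" using assms(1) by (rule dvdE)
  obtain B where B: "P = Q * B" using assms(2) by (rule dvdE)
  have nz: "P \<noteq> 0" "Q \<noteq> 0" using assms(3,4) by auto
  have "A \<noteq> 0" "B \<noteq> 0" using arg_cong[OF A, of "\<lambda>X. X = 0"] arg_cong[OF B, of "\<lambda>X. X = 0"] nz by auto
  then have "degree Q = degree P + degree A" "degree P = degree Q + degree B"
    using arg_cong[OF A, of degree] arg_cong[OF B, of degree] degree_mult_eq[OF nz(1)] degree_mult_eq[OF nz(2)] by metis+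
  then have "degree B = 0" by linarith
  then obtain b where b: "B = [:b:]" by (rule degree_eq_zeroE)
  have "lead_coeff P = lead_coeff Q * lead_coeff B" using arg_cong[OF B, of lead_coeff] by (simp only: lead_coeff_mult)
  then have "b = 1" using assms(3,4) b by simp
  then have "B = 1" using b by (simp add: one_pCons)
  then show ?thesis using B by (metis mult.right_neutral)
qed

text \<open>The functionals \<open>L j\<close> separate S/bS and are eigenvectors of b^(-1) a with
  distinct eigenvalues \<nu>_j. So -b^(-1) a is diagonalizable, and x0, having a nonzero component
  for each j, shows that every -\<nu>_j is a root.\<close>

lemma bernstein_sp_diag:
  fixes S :: "'m ab_mod" and L :: "'i \<Rightarrow> 'm \<Rightarrow> complex"
  assumes "abmod S"
    and pole: "\<And>x. x \<in> carrier S \<Longrightarrow> \<exists>y\<in>carrier S. ab_b \<odot>\<^bsub>S\<^esub> y = ab_a \<odot>\<^bsub>S\<^esub> x"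
    and J: "finite J" "inj_on \<nu> J"
    and add: "\<And>j x y. j \<in> J \<Longrightarrow> x \<in> carrier S \<Longrightarrow> y \<in> carrier S \<Longrightarrow> L j (x \<oplus>\<^bsub>S\<^esub> y) = L j x + L j y"
    and sc: "\<And>j x q. j \<in> J \<Longrightarrow> x \<in> carrier S \<Longrightarrow> L j (fps_const [:q:] \<odot>\<^bsub>S\<^esub> x) = q * L j x"
    and eig: "\<And>j x y. j \<in> J \<Longrightarrow> x \<in> carrier S \<Longrightarrow> y \<in> carrier S \<Longrightarrow> ab_b \<odot>\<^bsub>S\<^esub> y = ab_a \<odot>\<^bsub>S\<^esub> x \<Longrightarrow> L j y = \<nu> j * L j x"
    and ker: "\<And>x. x \<in> carrier S \<Longrightarrow> x \<in> b_image S (carrier S) \<longleftrightarrow> (\<forall>j\<in>J. L j x = 0)"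
    and x0: "x0 \<in> carrier S" "\<And>j. j \<in> J \<Longrightarrow> L j x0 \<noteq> 0"
  shows "bernstein_sp S = (\<Prod>j\<in>J. [: \<nu> j, 1 :])"
proof -
  interpret abmod S by fact
  let ?H = "b_image S (carrier S)" let ?V = "S LQuot ?H" let ?T = "neg_binv_a S"
  have H: "submodule ?H Atilde S" by (rule b_image_sub)
  interpret V: abmod ?V by (rule quot_abmod[OF H])
  have neg: "L j (\<ominus>\<^bsub>S\<^esub> x) = - L j x" if "j \<in> J" "x \<in> carrier S" for j x
  proof -
    have e: "- (1 :: ab_series) = fps_const [:- 1:]" by (rule fps_ext) (simp add: one_pCons)
    show ?thesis unfolding neg_eq[OF that(2)] e using sc[OF that, of "- 1"] by simp
  qed
  have minus: "L j (x \<ominus>\<^bsub>S\<^esub> y) = L j x - L j y" if "j \<in> J" "x \<in> carrier S" "y \<in> carrier S" for j x y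
    using that by (simp add: a_minus_def add neg)
  have coset: "?H +>\<^bsub>S\<^esub> x = ?H +>\<^bsub>S\<^esub> y \<longleftrightarrow> (\<forall>j\<in>J. L j x = L j y)" if "x \<in> carrier S" "y \<in> carrier S" for x y
    using that by (simp add: quot_coset_eq[OF H] ker minus)
  obtain D where D: "\<And>x. x \<in> carrier S \<Longrightarrow> D x \<in> carrier S" "\<And>x. x \<in> carrier S \<Longrightarrow> ab_b \<odot>\<^bsub>S\<^esub> D x = ab_a \<odot>\<^bsub>S\<^esub> x"
    using pole by metis
  \<comment> \<open>\<open>neg_binv_a\<close> is a union over all representatives and all solutions;
    since the functionals determine cosets, all of them contribute the same one.\<close>
  have T: "?T (?H +>\<^bsub>S\<^esub> x) = ?H +>\<^bsub>S\<^esub> (\<ominus>\<^bsub>S\<^esub> D x)" if x: "x \<in> carrier S" for x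
  proof -
    have 1: "?H +>\<^bsub>S\<^esub> (\<ominus>\<^bsub>S\<^esub> y) = ?H +>\<^bsub>S\<^esub> (\<ominus>\<^bsub>S\<^esub> D x)"
      if "x' \<in> ?H +>\<^bsub>S\<^esub> x" "y \<in> carrier S" "ab_b \<odot>\<^bsub>S\<^esub> y = ab_a \<odot>\<^bsub>S\<^esub> x'" for x' y
    proof -
      have x': "x' \<in> carrier S" "?H +>\<^bsub>S\<^esub> x' = ?H +>\<^bsub>S\<^esub> x" using rcos_memD[OF H that(1) x] by auto
      then have "\<forall>j\<in>J. L j x' = L j x" using coset x by blast
      then show ?thesis using that x x' D by (subst coset) (auto simp: neg eig)
    qed
    have "x \<in> ?H +>\<^bsub>S\<^esub> x" by (rule rcos_self[OF H x])
    then have "x \<in> ?H +>\<^bsub>S\<^esub> x" "D x \<in> {y \<in> carrier S. ab_b \<odot>\<^bsub>S\<^esub> y = ab_a \<odot>\<^bsub>S\<^esub> x}" using D[OF x] by auto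
    then have "?H +>\<^bsub>S\<^esub> (\<ominus>\<^bsub>S\<^esub> D x) \<subseteq> ?T (?H +>\<^bsub>S\<^esub> x)" unfolding neg_binv_a_def by (intro subsetI UN_I)
    moreover have "t \<in> ?H +>\<^bsub>S\<^esub> (\<ominus>\<^bsub>S\<^esub> D x)" if t: "t \<in> ?T (?H +>\<^bsub>S\<^esub> x)" for t
    proof -
      obtain x' y where "x' \<in> ?H +>\<^bsub>S\<^esub> x" "y \<in> carrier S" "ab_b \<odot>\<^bsub>S\<^esub> y = ab_a \<odot>\<^bsub>S\<^esub> x'" "t \<in> ?H +>\<^bsub>S\<^esub> (\<ominus>\<^bsub>S\<^esub> y)"
        using t unfolding neg_binv_a_def by (elim UN_E) (simp, elim conjE, rule that)
      then show ?thesis using 1 by simp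
    qed
    ultimately show ?thesis by blast
  qed
  define N where "N x = \<ominus>\<^bsub>S\<^esub> D x" for x
  have Tpow: "(N ^^ i) x \<in> carrier S \<and> (?T ^^ i) (?H +>\<^bsub>S\<^esub> x) = ?H +>\<^bsub>S\<^esub> (N ^^ i) x \<and> (\<forall>j\<in>J. L j ((N ^^ i) x) = (- \<nu> j) ^ i * L j x)"
    if x: "x \<in> carrier S" for x i
  proof (induction i)
    case (Suc i)
    let ?y = "(N ^^ i) x"
    have "L j (N ?y) = - \<nu> j * L j ?y" if "j \<in> J" for j
    proof -
      have y: "?y \<in> carrier S" using Suc by blast
      have "L j (N ?y) = - L j (D ?y)" unfolding N_def[of ?y] by (rule neg[OF that D(1)[OF y]])
      then show ?thesis using eig[OF that y D(1)[OF y] D(2)[OF y]] by simp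
    qed
    moreover have "?y \<in> carrier S" using Suc by blast
    moreover have "N ?y \<in> carrier S" "?T (?H +>\<^bsub>S\<^esub> ?y) = ?H +>\<^bsub>S\<^esub> N ?y"
      using T[OF \<open>?y \<in> carrier S\<close>] D(1)[OF \<open>?y \<in> carrier S\<close>] unfolding N_def[of ?y] by auto
    ultimately show ?case using Suc by simp
  qed (use x in simp)
  have ann: "annihilates ?V ?T Q \<longleftrightarrow> (\<forall>j\<in>J. poly Q (- \<nu> j) = 0)" for Q
  proof -
    have "(\<Oplus>\<^bsub>?V\<^esub>i\<in>{..degree Q}. fps_const [:coeff Q i:] \<odot>\<^bsub>?V\<^esub> (?T ^^ i) (?H +>\<^bsub>S\<^esub> x)) = \<zero>\<^bsub>?V\<^esub> \<longleftrightarrow>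
        (\<forall>j\<in>J. poly Q (- \<nu> j) * L j x = 0)" if x: "x \<in> carrier S" for x
    proof -
      let ?f = "\<lambda>i. fps_const [:coeff Q i:] \<odot>\<^bsub>S\<^esub> (N ^^ i) x"
      have fc: "?f i \<in> carrier S" for i using Tpow[OF x] by simp
      have "(\<Oplus>\<^bsub>?V\<^esub>i\<in>{..degree Q}. fps_const [:coeff Q i:] \<odot>\<^bsub>?V\<^esub> (?T ^^ i) (?H +>\<^bsub>S\<^esub> x)) =
        (\<Oplus>\<^bsub>?V\<^esub>i\<in>{..degree Q}. ?H +>\<^bsub>S\<^esub> ?f i)"
        by (rule V.M.finsum_cong') (use Tpow[OF x] quot_smul[OF H] in \<open>auto simp: quot_carrier[OF H]\<close>)
      also have "\<dots> = ?H +>\<^bsub>S\<^esub> (\<Oplus>\<^bsub>S\<^esub>i\<in>{..degree Q}. ?f i)"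
        by (rule lmod_hom_finsum[OF left_module_axioms V.left_module_axioms quot_proj_hom[OF H], symmetric])
           (use fc in auto)
      finally have 1: "(\<Oplus>\<^bsub>?V\<^esub>i\<in>{..degree Q}. fps_const [:coeff Q i:] \<odot>\<^bsub>?V\<^esub> (?T ^^ i) (?H +>\<^bsub>S\<^esub> x)) =
        ?H +>\<^bsub>S\<^esub> (\<Oplus>\<^bsub>S\<^esub>i\<in>{..degree Q}. ?f i)" .
      have fs: "(\<Oplus>\<^bsub>S\<^esub>i\<in>A. ?f i) \<in> carrier S \<and> L j (\<Oplus>\<^bsub>S\<^esub>i\<in>A. ?f i) = (\<Sum>i\<in>A. coeff Q i * (- \<nu> j) ^ i * L j x)"
        if "finite A" "j \<in> J" for A j
        using that
      proof (induction A)
        case empty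
        have "L j \<zero>\<^bsub>S\<^esub> = 0" using sc[of j "\<zero>\<^bsub>S\<^esub>" 0] empty by simp
        then show ?case by simp
      next
        case (insert a A)
        then show ?case using fc Tpow[OF x] by (simp add: add sc Pi_def mult.assoc)
      qed
      have "L j (\<Oplus>\<^bsub>S\<^esub>i\<in>{..degree Q}. ?f i) = poly Q (- \<nu> j) * L j x" if "j \<in> J" for j
        using fs[OF _ that, of "{..degree Q}"] by (simp add: poly_altdef sum_distrib_right)
      moreover have "(\<Oplus>\<^bsub>S\<^esub>i\<in>{..degree Q}. ?f i) \<in> carrier S" by (rule M.finsum_closed) (use fc in auto)
      ultimately show ?thesis unfolding 1 by (simp add: quot_eq_zero[OF H] ker)
    qed
    then have "annihilates ?V ?T Q \<longleftrightarrow> (\<forall>x\<in>carrier S. \<forall>j\<in>J. poly Q (- \<nu> j) * L j x = 0)"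
      unfolding annihilates_def quot_carrier[OF H] by simp
    also have "\<dots> \<longleftrightarrow> (\<forall>j\<in>J. poly Q (- \<nu> j) = 0)"
    proof
      assume a: "\<forall>x\<in>carrier S. \<forall>j\<in>J. poly Q (- \<nu> j) * L j x = 0"
      show "\<forall>j\<in>J. poly Q (- \<nu> j) = 0"
      proof
        fix j assume j: "j \<in> J"
        have "poly Q (- \<nu> j) * L j x0 = 0" using a x0(1) j by blast
        then show "poly Q (- \<nu> j) = 0" using x0(2)[OF j] by simp
      qed
    qed simp
    finally show ?thesis .
  qed
  let ?P = "\<Prod>j\<in>J. [: \<nu> j, 1 :]"
  have lc: "lead_coeff ?P = 1" by (simp add: lead_coeff_prod)
  show ?thesis unfolding bernstein_sp_def min_poly_def
  proof (rule the_equality)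
    show "lead_coeff ?P = 1 \<and> (\<forall>Q. annihilates ?V ?T Q \<longleftrightarrow> ?P dvd Q)"
      using lc prod_linear_dvd_iff[OF J] ann by blast
    fix P assume P: "lead_coeff P = 1 \<and> (\<forall>Q. annihilates ?V ?T Q \<longleftrightarrow> P dvd Q)"
    have "annihilates ?V ?T P" "annihilates ?V ?T ?P"
      using P unfolding ann using prod_linear_dvd_iff[OF J, of ?P] by (simp_all flip: ann)
    then have "?P dvd P" "P dvd ?P" using P unfolding ann prod_linear_dvd_iff[OF J] by (simp_all flip: ann)
    then show "P = ?P" using P lc by (intro monic_dvd_antisym) auto
  qed
qed

text \<open>E need not contain all vectors of orders n_j, but it contains those of orders n_j + k -
  1: a multiple of e divisible by b^(k-1) clears the last coordinate, and for F_(k-1), whose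
  exponents are n_j + 1 and whose rank is k - 1, the bound is the same.\<close>

lemma frame_surj:
  assumes "frame E k \<kappa> c \<psi> n e" "\<And>j. j \<notin> {1..k} \<Longrightarrow> g j = 0" "\<And>i j. i < n j + (k - 1) \<Longrightarrow> g j $ i = 0"
  shows "\<exists>x\<in>carrier E. \<psi> x = g"
  using assms
proof (induction k arbitrary: E c n e g)
  case 0
  then interpret frame E 0 \<kappa> c \<psi> n e by simp
  show ?case using k by simp
next
  case (Suc k)
  interpret frame E "Suc k" \<kappa> c \<psi> n e by fact
  let ?K = "Suc k"
  have g0: "\<psi> e ?K $ n ?K \<noteq> 0" using e(2) by (auto simp: vals_def)
  have eo: "i < n j \<Longrightarrow> \<psi> e j $ i = 0" for i j using e(2) by (auto simp: vals_def)
  obtain T where T: "T * \<psi> e ?K = g ?K" "fps_X ^ k dvd T"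
  proof -
    obtain V where V: "V * \<psi> e ?K = fps_const (\<psi> e ?K $ n ?K) * fps_X ^ n ?K"
      using fps_normalize[OF g0 eo] by blast
    have "fps_X ^ (n ?K + k) dvd g ?K" unfolding fps_X_power_dvd_iff using Suc.prems(3)[of _ ?K] by simp
    then obtain R where R: "g ?K = fps_X ^ (n ?K + k) * R" by (rule dvdE)
    have "(fps_const (inverse (\<psi> e ?K $ n ?K)) * (fps_X ^ k * R * V)) * \<psi> e ?K
        = fps_const (inverse (\<psi> e ?K $ n ?K)) * (fps_X ^ k * R * (V * \<psi> e ?K))" by (simp only: mult_ac)
    also have "\<dots> = fps_const (inverse (\<psi> e ?K $ n ?K) * (\<psi> e ?K $ n ?K)) * g ?K"
      unfolding V R by (simp only: fps_const_mult[symmetric] power_add mult_ac)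
    finally have "(fps_const (inverse (\<psi> e ?K $ n ?K)) * (fps_X ^ k * R * V)) * \<psi> e ?K = g ?K" using g0 by simp
    moreover have "fps_X ^ k dvd fps_const (inverse (\<psi> e ?K $ n ?K)) * (fps_X ^ k * R * V)" by (simp add: mult.assoc)
    ultimately show ?thesis by (rule that)
  qed
  define g' where "g' j = g j - T * \<psi> e j" for j
  have g'K: "g' j = 0" if "j \<notin> {1..k}" for j
    using that T(1) Suc.prems(2)[of j] out[OF e_car, of j] by (cases "j = ?K") (auto simp: g'_def)
  have g'o: "g' j $ i = 0" if "i < n j + k" for i j
  proof -
    have "fps_X ^ k * fps_X ^ n j dvd T * \<psi> e j" using T(2) eo by (intro mult_dvd_mono) (auto simp: fps_X_power_dvd_iff)
    then have "(T * \<psi> e j) $ i = 0" using that fps_X_power_dvd_iff[of "k + n j"] by (simp add: power_add)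
    then show ?thesis using Suc.prems(3)[of i j] that by (simp add: g'_def)
  qed
  have "\<exists>x\<in>carrier E. \<psi> x = g'"
  proof (cases "k = 0")
    case True
    then have "g' = (\<lambda>j. 0)" using g'K by auto
    then show ?thesis by (intro bexI[of _ "\<zero>\<^bsub>E\<^esub>"]) (auto simp: fun_eq_iff)
  next
    case False
    then have k2: "2 \<le> ?K" by simp
    obtain V where fr: "frame (E \<downharpoonright> fl k) k \<kappa> 0 \<psi> (\<lambda>j. n j + 1) (ab_lin (\<kappa> + of_nat (n ?K)) \<odot>\<^bsub>E\<^esub> bmul E V e)"
      using frame_down[OF k2] by (metis diff_Suc_1)
    have "\<exists>x\<in>carrier (E \<downharpoonright> fl k). \<psi> x = g'"
      by (rule Suc.IH[OF fr g'K g'o]) (use False in auto)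
    then show ?thesis using fl_carrier by auto
  qed
  then obtain x where x: "x \<in> carrier E" "\<psi> x = g'" by blast
  have "\<psi> (x \<oplus>\<^bsub>E\<^esub> bmul E T e) j = g j" for j using x by (simp add: psi_add psi_bmul g'_def)
  then show ?case using x(1) by (intro bexI[of _ "x \<oplus>\<^bsub>E\<^esub> bmul E T e"]) auto
qed

text \<open>Since a b^m = b^m (a + m b), the commutator is absorbed in the constant l.\<close>

lemma (in abmod) lin_Xpow:
  assumes "z \<in> carrier E"
  shows "ab_lin l \<odot> bmul E (fps_X ^ m) z = bmul E (fps_X ^ m) (ab_lin (l - of_nat m) \<odot> z)"
proof -
  have d: "fps_X\<^sup>2 * fps_deriv (fps_X ^ m) = fps_X ^ m * (fps_const (of_nat m) * (fps_X :: complex fps))"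
  proof (rule fps_ext)
    fix i
    have "fps_X ^ m * (fps_const (of_nat m) * fps_X) = fps_const (of_nat m :: complex) * fps_X ^ Suc m"
      by (simp only: power_Suc mult_ac)
    then show "(fps_X\<^sup>2 * fps_deriv (fps_X ^ m)) $ i = (fps_X ^ m * (fps_const (of_nat m) * (fps_X :: complex fps))) $ i"
      by (simp only: X2_deriv_nth monom_nth) (cases i; auto simp: fps_X_power_nth)
  qed
  have "ab_lin l \<odot> bmul E (fps_X ^ m) z = (bmul E (fps_X ^ m) (ab_a \<odot> z) \<oplus> bmul E (fps_X ^ m * (fps_const (of_nat m) * fps_X)) z)
     \<ominus> bmul E (fps_const l * fps_X * fps_X ^ m) z"
    using assms by (simp only: lin_smul smul_closed a_bmul d bmul_mult)
  also have "\<dots> = bmul E (fps_X ^ m) (ab_a \<odot> z) \<oplus> bmul E (fps_X ^ m * (fps_const (of_nat m) * fps_X) - fps_const l * fps_X * fps_X ^ m) z"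
  proof -
    have "ab_of_b (S - R) = ab_of_b S - ab_of_b R" for S R using ab_of_b_add[of S "- R"] by (simp add: ab_of_b_minus)
    then show ?thesis using assms by (simp add: smul_minus a_minus_def M.a_assoc)
  qed
  also have "fps_X ^ m * (fps_const (of_nat m) * fps_X) - fps_const l * fps_X * fps_X ^ m
      = fps_X ^ m * (- (fps_const (l - of_nat m) * fps_X))"
    by (simp add: fps_const_sub[symmetric] algebra_simps del: fps_const_sub)
  also have "bmul E (fps_X ^ m) (ab_a \<odot> z) \<oplus> bmul E (fps_X ^ m * (- (fps_const (l - of_nat m) * fps_X))) z
      = bmul E (fps_X ^ m) (ab_a \<odot> z \<oplus> bmul E (- (fps_const (l - of_nat m) * fps_X)) z)"
    using assms by (simp only: bmul_mult smul_add_right smul_closed)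
  also have "ab_a \<odot> z \<oplus> bmul E (- (fps_const (l - of_nat m) * fps_X)) z = ab_lin (l - of_nat m) \<odot> z"
    using assms by (simp add: lin_smul ab_of_b_minus smul_uminus a_minus_def)
  finally show ?thesis .
qed

text \<open>Suppose \<open>H\<close>, stable under b^(-1) a, contains b^(-m) f(e). Then it contains
  b^(-m-1) times the image of the generator of F_(k-1), which is some a - l b applied to a unit
  multiple of e. Every descent gains one division by b, and after k - 1 of them the vectors of
  orders n_j + k - 1 are divided by b^(m+k-1).\<close>

lemma frame_divide:
  assumes "frame E k \<kappa> c \<psi> n e" "abmod M" "f \<in> lmod_hom Atilde E M" "submodule H Atilde M"
    and cl: "\<And>s. s \<in> H \<Longrightarrow> \<exists>y\<in>H. bmul M fps_X y = ab_a \<odot>\<^bsub>M\<^esub> s"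
    and z: "z \<in> H" "bmul M (fps_X ^ m) z = f e"
    and x: "x \<in> carrier E" "\<And>i j. i < n j + (k - 1) \<Longrightarrow> \<psi> x j $ i = 0"
  shows "\<exists>s\<in>H. bmul M (fps_X ^ (m + (k - 1))) s = f x"
  using assms(1,3) z x
proof (induction k arbitrary: E c n e m x z)
  case 0
  then interpret frame E 0 \<kappa> c \<psi> n e by simp
  show ?case using k by simp
next
  case (Suc k)
  interpret frame E "Suc k" \<kappa> c \<psi> n e by fact
  interpret M: abmod M by fact
  let ?K = "Suc k"
  note f = lmod_homD[OF Suc.prems(2)]
  note Hs = M.submodD[OF assms(4)]
  obtain V where V: "V $ 0 = 1" "V * \<psi> e ?K = fps_const (\<psi> e ?K $ n ?K) * fps_X ^ n ?K"
    using fps_normalize[of "\<psi> e ?K" "n ?K"] e(2) unfolding vals_def by auto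
  have g0: "\<psi> e ?K $ n ?K \<noteq> 0" using e(2) by (auto simp: vals_def)
  show ?case
  proof (cases "k = 0")
    case True
    obtain R where R: "\<psi> x ?K = fps_X ^ n ?K * R" using psi_k_dvd[OF Suc.prems(5)] by (rule dvdE)
    let ?T = "fps_const (inverse (\<psi> e ?K $ n ?K)) * R * V"
    have "?T * \<psi> e ?K = fps_const (inverse (\<psi> e ?K $ n ?K)) * R * (V * \<psi> e ?K)" by (simp only: mult_ac)
    also have "\<dots> = fps_const (inverse (\<psi> e ?K $ n ?K) * (\<psi> e ?K $ n ?K)) * \<psi> x ?K"
      unfolding V(2) R by (simp only: fps_const_mult[symmetric] mult_ac)
    finally have T: "?T * \<psi> e ?K = \<psi> x ?K" using g0 by simp
    have "x = bmul E ?T e"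
    proof (rule psi_eqI[OF Suc.prems(5)])
      fix j assume "j \<in> {1..?K}"
      then have "j = ?K" using True by (auto simp: One_nat_def)
      then show "\<psi> x j = \<psi> (bmul E ?T e) j" using T by (simp add: psi_bmul)
    qed simp
    then have "f x = bmul M ?T (bmul M (fps_X ^ m) z)" using f(3)[OF e_car] Suc.prems(4) by simp
    also have "\<dots> = bmul M (fps_X ^ (m + (?K - 1))) (bmul M ?T z)"
      using Hs(6)[OF Suc.prems(3)] True by (simp add: M.bmul_mult[symmetric] mult.commute)
    finally show ?thesis using Hs(4)[OF Suc.prems(3)] by metis
  next
    case False
    then have k2: "2 \<le> ?K" by simp
    obtain V where V: "V $ 0 = 1" "\<psi> (bmul E V e) ?K = fps_const (\<psi> e ?K $ n ?K) * fps_X ^ n ?K" "vals (bmul E V e)"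
      and fr: "frame (E \<downharpoonright> fl k) k \<kappa> 0 \<psi> (\<lambda>j. n j + 1) (ab_lin (\<kappa> + of_nat (n ?K)) \<odot>\<^bsub>E\<^esub> bmul E V e)"
      using frame_down[OF k2] by (metis diff_Suc_1)
    let ?l = "\<kappa> + of_nat (n ?K)" let ?e = "bmul E V e" let ?z = "bmul M V z"
    have zH: "?z \<in> H" using Hs(4)[OF Suc.prems(3)] .
    have zc: "z \<in> carrier M" using Hs(6)[OF Suc.prems(3)] .
    have fe: "f ?e = bmul M (fps_X ^ m) ?z"
      using f(3)[OF e_car] Suc.prems(4) zc by (simp add: M.bmul_mult[symmetric] mult.commute) (metis M.bmul_mult mult.commute)
    obtain y where y: "y \<in> H" "bmul M fps_X y = ab_a \<odot>\<^bsub>M\<^esub> ?z" using cl[OF zH] by blast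
    \<comment> \<open>By this choice b z' is a - (l - m) b applied to V z, where l = \<kappa> + n_k.
      Moving this operator through b^m shows that b^(m+1) z' is the image of the generator of
      F_(k-1).\<close>
    define z' where "z' = y \<ominus>\<^bsub>M\<^esub> bmul M (fps_const (?l - of_nat m)) ?z"
    have z'H: "z' \<in> H" unfolding z'_def using Hs(5)[OF y(1) Hs(4)[OF zH]] .
    have yc: "y \<in> carrier M" using Hs(6)[OF y(1)] .
    have "bmul M fps_X z' = ab_lin (?l - of_nat m) \<odot>\<^bsub>M\<^esub> ?z"
      unfolding z'_def using yc zc y(2) by (simp add: M.smul_minus_right M.lin_smul M.bmul_mult[symmetric] mult.commute)
        (simp add: M.smul_mult[symmetric] ab_mult_of_b mult_ac)
    then have z'e: "bmul M (fps_X ^ (m + 1)) z' = f (ab_lin ?l \<odot>\<^bsub>E\<^esub> ?e)"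
      using f(3)[of ?e] fe zc Hs(6)[OF z'H] M.lin_Xpow[of ?z ?l m]
      by (simp add: M.bmul_mult power_add)
    have "fps_X ^ (n ?K + k) dvd \<psi> x ?K" unfolding fps_X_power_dvd_iff using Suc.prems(6)[of _ ?K] by simp
    then obtain R where R: "\<psi> x ?K = fps_X ^ (n ?K + k) * R" by (rule dvdE)
    let ?R = "fps_const (inverse (\<psi> e ?K $ n ?K)) * R"
    let ?T = "fps_X ^ k * ?R"
    have "?T * \<psi> ?e ?K = fps_const (inverse (\<psi> e ?K $ n ?K) * (\<psi> e ?K $ n ?K)) * \<psi> x ?K"
      unfolding V(2) R by (simp only: fps_const_mult[symmetric] power_add mult_ac)
    then have T: "?T * \<psi> ?e ?K = \<psi> x ?K" using g0 by simp
    let ?x = "x \<ominus>\<^bsub>E\<^esub> bmul E ?T ?e"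
    have px: "\<psi> ?x j = \<psi> x j - ?T * \<psi> ?e j" for j
      using Suc.prems(5) by (simp only: psi_minus psi_bmul smul_closed e_car)
    have xc: "?x \<in> carrier E" using Suc.prems(5) by simp
    have "\<psi> ?x j = 0" if "k < j" for j
      using out[OF xc, of j] that T px[of ?K] by (cases "j = ?K") auto
    then have xfl: "?x \<in> fl k" using xc by (simp add: fl_def)
    have xo: "\<psi> ?x j $ i = 0" if "i < n j + 1 + (k - 1)" for i j
    proof -
      have "fps_X ^ (k + n j) dvd ?T * \<psi> ?e j"
        unfolding power_add using V(3) by (intro mult_dvd_mono) (auto simp: fps_X_power_dvd_iff[of "n j"] vals_def)
      moreover have "i < k + n j" using that False by simp
      ultimately have "(?T * \<psi> ?e j) $ i = 0" unfolding fps_X_power_dvd_iff by blast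
      then show ?thesis using Suc.prems(6)[of i j] that False by (simp add: px)
    qed
    have fF: "f \<in> lmod_hom Atilde (E \<downharpoonright> fl k) M"
      by (rule lmod_homI) (use f fl_carrier in auto)
    obtain s where s: "s \<in> H" "bmul M (fps_X ^ (m + 1 + (k - 1))) s = f ?x"
      using Suc.IH[OF fr fF z'H z'e, of ?x] xfl xo by auto
    have mk: "m + 1 + (k - 1) = m + (?K - 1)" using False by simp
    have sc: "s \<in> carrier M" using Hs(6)[OF s(1)] .
    have "x = ?x \<oplus>\<^bsub>E\<^esub> bmul E ?T ?e" using Suc.prems(5) by (simp add: minus_add_cancel)
    then have "f x = f ?x \<oplus>\<^bsub>M\<^esub> bmul M ?T (f ?e)" using f(2)[OF xc] f(3) e_car by (metis smul_closed)
    also have "\<dots> = bmul M (fps_X ^ (m + (?K - 1))) s \<oplus>\<^bsub>M\<^esub> bmul M (fps_X ^ (m + (?K - 1)) * ?R) ?z"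
    proof -
      have "?T * fps_X ^ m = fps_X ^ (m + (?K - 1)) * ?R" by (simp add: power_add mult_ac)
      then have "bmul M ?T (f ?e) = bmul M (fps_X ^ (m + (?K - 1)) * ?R) ?z"
        unfolding fe using zc by (metis M.bmul_mult M.smul_closed)
      then show ?thesis using s(2) unfolding mk by simp
    qed
    also have "\<dots> = bmul M (fps_X ^ (m + (?K - 1))) (s \<oplus>\<^bsub>M\<^esub> bmul M ?R ?z)"
      using sc zc by (simp only: M.bmul_mult M.smul_add_right M.smul_closed)
    finally show ?thesis using Hs(3)[OF s(1) Hs(4)[OF zH]] by metis
  qed
qed

text \<open>What is retained of a simple pole module S containing E: it is torsion free, and a is
  divisible by b on it.\<close>

locale frame_pole = frame E k \<kappa> c \<psi> n e + S: abmod S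
  for E :: "'m ab_mod" (structure) and k \<kappa> c \<psi> n e and S :: "'n ab_mod" +
  fixes f :: "'m \<Rightarrow> 'n"
  assumes tf: "\<And>T s. T \<noteq> 0 \<Longrightarrow> s \<in> carrier S \<Longrightarrow> bmul S T s = \<zero>\<^bsub>S\<^esub> \<Longrightarrow> s = \<zero>\<^bsub>S\<^esub>"
    and pole: "\<And>s. s \<in> carrier S \<Longrightarrow> \<exists>y\<in>carrier S. bmul S fps_X y = ab_a \<odot>\<^bsub>S\<^esub> s"
    and f: "f \<in> lmod_hom Atilde E S" "inj_on f (carrier E)"
begin

text \<open>By \<open>frame_surj\<close> the coordinate vectors of these elements are all vectors of
  orders at least n_j + k - 1 supported on 1, ..., k.\<close>

definition good :: "'m \<Rightarrow> bool" where
  "good x \<longleftrightarrow> x \<in> carrier E \<and> (\<forall>j i. i < n j + (k - 1) \<longrightarrow> \<psi> x j $ i = 0)"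

text \<open>
  The saturation of \<open>E\<close> in \<open>S\<close>: its elements have coordinates in \<open>\<complex>((b))\<close> of orders at least \<open>n j\<close>, and the
  factor \<open>b^(k-1)\<close> moves them into \<open>E\<close>.
\<close>

definition sat :: "'n set" where
  "sat = {s \<in> carrier S. \<exists>x. good x \<and> bmul S (fps_X ^ (k - 1)) s = f x}"

lemma fD: "x \<in> carrier E \<Longrightarrow> f x \<in> carrier S" "x \<in> carrier E \<Longrightarrow> y \<in> carrier E \<Longrightarrow> f (x \<oplus> y) = f x \<oplus>\<^bsub>S\<^esub> f y"
  "x \<in> carrier E \<Longrightarrow> f (u \<odot> x) = u \<odot>\<^bsub>S\<^esub> f x"
  using lmod_homD[OF f(1)] by auto

lemma f_eq: "x \<in> carrier E \<Longrightarrow> y \<in> carrier E \<Longrightarrow> f x = f y \<Longrightarrow> x = y"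
  using f(2) by (auto simp: inj_on_def)

lemma S_inj: "s \<in> carrier S \<Longrightarrow> t \<in> carrier S \<Longrightarrow> T \<noteq> 0 \<Longrightarrow> bmul S T s = bmul S T t \<Longrightarrow> s = t"
  using tf[of T "s \<ominus>\<^bsub>S\<^esub> t"] by (simp add: S.smul_minus_right S.minus_eq_0_iff)

lemma good_smul: "good x \<Longrightarrow> good (u \<odot> x)"
  using psi_val(1)[where d = "\<lambda>j. n j + (k - 1)" and x = x and u = u] n_mono[of 1 k] k
  unfolding good_def by auto

lemma good_add: "good x \<Longrightarrow> good y \<Longrightarrow> good (x \<oplus> y)"
  by (simp add: good_def psi_add)

lemma good_ex:
  assumes "\<And>j. j \<notin> {1..k} \<Longrightarrow> g j = 0" "\<And>i j. i < n j + (k - 1) \<Longrightarrow> g j $ i = 0"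
  obtains x where "good x" "\<psi> x = g"
proof -
  obtain x where "x \<in> carrier E" "\<psi> x = g" using frame_surj[where g = g, OF frame_axioms assms] by blast
  then show ?thesis using assms(2) by (intro that[of x]) (simp_all add: good_def)
qed

lemma good_div_b:
  assumes "x \<in> carrier E" "\<And>j i. i < n j + k \<Longrightarrow> \<psi> x j $ i = 0"
  obtains x' where "good x'" "x = bmul E fps_X x'"
proof -
  have s: "\<psi> x j = fps_X * fps_shift 1 (\<psi> x j)" for j
  proof (rule fps_ext)
    fix i show "\<psi> x j $ i = (fps_X * fps_shift 1 (\<psi> x j)) $ i"
      using assms(2)[of 0 j] k by (cases i) (simp_all add: Suc_eq_plus1)
  qed
  obtain x' where x': "good x'" "\<psi> x' = (\<lambda>j. fps_shift 1 (\<psi> x j))"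
  proof (rule good_ex)
    show "fps_shift 1 (\<psi> x j) = 0" if "j \<notin> {1..k}" for j using out[OF assms(1) that] by simp
    show "fps_shift 1 (\<psi> x j) $ i = 0" if "i < n j + (k - 1)" for i j using assms(2)[of "i + 1" j] that k by simp
  qed
  have "x = bmul E fps_X x'"
  proof (rule psi_eqI[OF assms(1)])
    show "\<psi> x j = \<psi> (bmul E fps_X x') j" for j
      using x' s by (simp add: psi_bmul good_def)
  qed (use x' in \<open>simp add: good_def\<close>)
  with x' that show ?thesis by blast
qed

lemma sat_sub: "submodule sat Atilde S"
proof (rule S.submodI)
  have z: "good \<zero>" by (simp add: good_def)
  show "\<zero>\<^bsub>S\<^esub> \<in> sat" unfolding sat_def
    using z lmod_hom_zero[OF abmod_axioms S.abmod_axioms f(1)] by auto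
  show "sat \<subseteq> carrier S" by (auto simp: sat_def)
  show "s \<oplus>\<^bsub>S\<^esub> t \<in> sat" if st: "s \<in> sat" "t \<in> sat" for s t
  proof -
    obtain x y where "good x" "bmul S (fps_X ^ (k - 1)) s = f x" "good y" "bmul S (fps_X ^ (k - 1)) t = f y"
      using st by (auto simp: sat_def)
    then show ?thesis using st good_add[of x y] fD(2)[of x y] unfolding sat_def
      by (auto simp: S.smul_add_right good_def[of x] good_def[of y] intro!: exI[of _ "x \<oplus> y"])
  qed
  show "u \<odot>\<^bsub>S\<^esub> s \<in> sat" if s: "s \<in> sat" for u s
  proof -
    obtain x where x: "good x" "bmul S (fps_X ^ (k - 1)) s = f x" and sc: "s \<in> carrier S" using s by (auto simp: sat_def)
    obtain w where w: "ab_mult (ab_of_b (fps_X ^ (k - 1))) u = ab_mult w (ab_of_b (fps_X ^ (k - 1)))"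
      using ab_mult_b_left_commute by blast
    have "bmul S (fps_X ^ (k - 1)) (u \<odot>\<^bsub>S\<^esub> s) = w \<odot>\<^bsub>S\<^esub> f x"
      using w x(2) sc by (metis S.smul_mult)
    also have "\<dots> = f (w \<odot> x)" using x(1) fD(3)[of x w] by (simp add: good_def)
    finally show ?thesis using good_smul[OF x(1)] sc by (auto simp: sat_def)
  qed
qed

lemma sat_contains: "f ` carrier E \<subseteq> sat"
proof
  fix s assume "s \<in> f ` carrier E"
  then obtain x where x: "x \<in> carrier E" "s = f x" by blast
  have "good (bmul E (fps_X ^ (k - 1)) x)"
    using x psi_order[OF x(1)] by (auto simp: good_def psi_bmul fps_X_power_mult_nth)
  then show "s \<in> sat" using x fD by (auto simp: sat_def)
qed

text \<open>The relation b y = a s is moved into E by b^(k-1): passing it through a replaces a by a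
  - (k-1) b.\<close>

lemma sat_lin:
  assumes "s \<in> carrier S" "y \<in> carrier S" "bmul S fps_X y = ab_a \<odot>\<^bsub>S\<^esub> s" "x \<in> carrier E" "bmul S (fps_X ^ (k - 1)) s = f x"
  shows "bmul S fps_X (bmul S (fps_X ^ (k - 1)) y) = f (ab_lin (of_nat (k - 1)) \<odot> x)"
proof -
  have "f (ab_lin (of_nat (k - 1)) \<odot> x) = ab_lin (of_nat (k - 1)) \<odot>\<^bsub>S\<^esub> bmul S (fps_X ^ (k - 1)) s"
    using assms fD(3) by simp
  also have "\<dots> = bmul S (fps_X ^ (k - 1)) (ab_lin 0 \<odot>\<^bsub>S\<^esub> s)" using S.lin_Xpow[OF assms(1)] by simp
  also have "ab_lin 0 \<odot>\<^bsub>S\<^esub> s = bmul S fps_X y"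
    using S.lin_smul[OF assms(1), of 0] S.neg_eq[of "\<zero>\<^bsub>S\<^esub>"] assms(1,3) by (simp add: a_minus_def)
  finally show ?thesis using assms(2) by (simp add: S.bmul_mult[symmetric] mult.commute)
qed

lemma lin_vals:
  assumes "good x"
  shows "i < n j + k \<Longrightarrow> \<psi> (ab_lin l \<odot> x) j $ i = 0"
    "\<psi> (ab_lin l \<odot> x) j $ (n j + k) = (\<kappa> + of_nat (n j + (k - 1)) - l) * \<psi> x j $ (n j + (k - 1))"
proof -
  have x: "x \<in> carrier E" "\<And>i j. i < n j + (k - 1) \<Longrightarrow> \<psi> x j $ i = 0" using assms by (auto simp: good_def)
  show "\<psi> (ab_lin l \<odot> x) j $ i = 0" if "i < n j + k"
  proof (cases i)
    case (Suc m)
    have "\<psi> x j $ m = 0" using that Suc by (intro x(2)) auto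
    moreover have "\<psi> x k $ m = 0" if "j = 1" using \<open>i < n j + k\<close> Suc n_mono[of 1 k] k that by (intro x(2)) auto
    ultimately show ?thesis using Suc by (auto simp: psi_lin_nth[OF x(1)])
  qed (simp add: psi_lin_nth[OF x(1)])
  have "c * \<psi> x k $ (n j + (k - 1)) = 0" if "j = 1"
  proof (cases "k = 1")
    case False
    then have "n 1 < n k" using mono[of 1 k] k by auto
    then show ?thesis using that x(2)[of "n j + (k - 1)" k] by simp
  qed (use c in simp)
  moreover have "n j + k - 1 = n j + (k - 1)" using k by simp
  ultimately show "\<psi> (ab_lin l \<odot> x) j $ (n j + k) = (\<kappa> + of_nat (n j + (k - 1)) - l) * \<psi> x j $ (n j + (k - 1))"
    using k by (auto simp: psi_lin_nth[OF x(1)])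
qed

lemma sat_closed:
  assumes "s \<in> sat" "y \<in> carrier S" "bmul S fps_X y = ab_a \<odot>\<^bsub>S\<^esub> s"
  shows "y \<in> sat"
proof -
  obtain x where x: "good x" "bmul S (fps_X ^ (k - 1)) s = f x" and sc: "s \<in> carrier S" using assms by (auto simp: sat_def)
  have xc: "x \<in> carrier E" using x by (simp add: good_def)
  obtain x' where x': "good x'" "ab_lin (of_nat (k - 1)) \<odot> x = bmul E fps_X x'"
    using good_div_b[of "ab_lin (of_nat (k - 1)) \<odot> x"] lin_vals(1)[OF x(1)] xc by auto
  have x'c: "x' \<in> carrier E" using x' by (simp add: good_def)
  have "bmul S fps_X (bmul S (fps_X ^ (k - 1)) y) = bmul S fps_X (f x')"
    using sat_lin[OF sc assms(2,3) xc x(2)] x'(2) fD(3)[OF x'c] by simp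
  then have "bmul S (fps_X ^ (k - 1)) y = f x'"
    by (rule S_inj[rotated 3]) (use assms(2) x'c fD in auto)
  then show ?thesis using x'(1) assms(2) by (auto simp: sat_def)
qed

text \<open>\<open>frame_divide\<close>, started at f(e) with m = 0, reaches every element of
  \<open>sat\<close>.\<close>

lemma sat_least:
  assumes "submodule H Atilde S" "f ` carrier E \<subseteq> H" "H \<subseteq> sat"
    and "\<And>s y. s \<in> H \<Longrightarrow> y \<in> sat \<Longrightarrow> bmul S fps_X y = ab_a \<odot>\<^bsub>S\<^esub> s \<Longrightarrow> y \<in> H"
  shows "sat \<subseteq> H"
proof
  fix s assume s: "s \<in> sat"
  obtain x where x: "good x" "bmul S (fps_X ^ (k - 1)) s = f x" and sc: "s \<in> carrier S" using s by (auto simp: sat_def)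
  have cl: "\<exists>y\<in>H. bmul S fps_X y = ab_a \<odot>\<^bsub>S\<^esub> s" if "s \<in> H" for s
  proof -
    have "s \<in> sat" using that assms(3) by blast
    then obtain y where "y \<in> carrier S" "bmul S fps_X y = ab_a \<odot>\<^bsub>S\<^esub> s" using pole by (auto simp: sat_def)
    then show ?thesis using assms(4)[OF that] sat_closed[OF \<open>s \<in> sat\<close>] by blast
  qed
  have feH: "f e \<in> H" using assms(2) by auto
  have "bmul S (fps_X ^ 0) (f e) = f e" using fD(1)[OF e_car] by simp
  then obtain t where t: "t \<in> H" "bmul S (fps_X ^ (0 + (k - 1))) t = f x"
    using frame_divide[OF frame_axioms S.abmod_axioms f(1) assms(1) cl feH, of 0 x] x by (auto simp: good_def)
  have "t = s" by (rule S_inj[of _ _ "fps_X ^ (k - 1)"]) (use t x sc S.submodD(6)[OF assms(1)] in auto)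
  then show "s \<in> H" using t by simp
qed

lemma sat_ex:
  assumes "good x"
  obtains s where "s \<in> sat" "bmul S (fps_X ^ (k - 1)) s = f x"
proof -
  have feH: "f e \<in> sat" using sat_contains by auto
  have cl: "\<exists>y\<in>sat. bmul S fps_X y = ab_a \<odot>\<^bsub>S\<^esub> s" if "s \<in> sat" for s
    using pole[of s] sat_closed[OF that] that by (auto simp: sat_def)
  have "bmul S (fps_X ^ 0) (f e) = f e" using fD(1)[OF e_car] by simp
  then show ?thesis
    using frame_divide[OF frame_axioms S.abmod_axioms f(1) sat_sub cl feH, of 0 x] assms that by (auto simp: good_def)
qed

text \<open>The element b^(k-1) s of E; the coordinates of s itself would have denominators.\<close>

definition \<rho> :: "'n \<Rightarrow> 'm" where
  "\<rho> s = (SOME x. good x \<and> bmul S (fps_X ^ (k - 1)) s = f x)"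

lemma \<rho>: "s \<in> sat \<Longrightarrow> good (\<rho> s)" "s \<in> sat \<Longrightarrow> bmul S (fps_X ^ (k - 1)) s = f (\<rho> s)" "s \<in> sat \<Longrightarrow> \<rho> s \<in> carrier E"
proof -
  assume "s \<in> sat"
  then have "\<exists>x. good x \<and> bmul S (fps_X ^ (k - 1)) s = f x" by (auto simp: sat_def)
  from someI_ex[OF this] show "good (\<rho> s)" "bmul S (fps_X ^ (k - 1)) s = f (\<rho> s)" "\<rho> s \<in> carrier E"
    unfolding \<rho>_def[symmetric] by (auto simp: good_def)
qed

lemma \<rho>_eq: "s \<in> sat \<Longrightarrow> x \<in> carrier E \<Longrightarrow> bmul S (fps_X ^ (k - 1)) s = f x \<Longrightarrow> \<rho> s = x"
  using \<rho>[of s] by (intro f_eq) auto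

lemma sat_carrier: "s \<in> sat \<Longrightarrow> s \<in> carrier S" by (simp add: sat_def)

lemma \<rho>_add: "s \<in> sat \<Longrightarrow> t \<in> sat \<Longrightarrow> \<rho> (s \<oplus>\<^bsub>S\<^esub> t) = \<rho> s \<oplus> \<rho> t"
  by (rule \<rho>_eq) (use \<rho> S.submodD(3)[OF sat_sub] sat_carrier fD in \<open>auto simp: S.smul_add_right\<close>)

lemma \<rho>_bmul: "s \<in> sat \<Longrightarrow> \<rho> (bmul S T s) = bmul E T (\<rho> s)"
proof (rule \<rho>_eq)
  assume s: "s \<in> sat"
  show "bmul S T s \<in> sat" by (rule S.submodD(4)[OF sat_sub s])
  show "bmul E T (\<rho> s) \<in> carrier E" using \<rho>[OF s] by simp
  show "bmul S (fps_X ^ (k - 1)) (bmul S T s) = f (bmul E T (\<rho> s))"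
    using \<rho>[OF s] fD(3) sat_carrier[OF s] by (metis S.bmul_mult mult.commute)
qed

lemma sat_eq_0: "s \<in> sat \<Longrightarrow> \<rho> s = \<zero> \<Longrightarrow> s = \<zero>\<^bsub>S\<^esub>"
  using \<rho>(2)[of s] lmod_hom_zero[OF abmod_axioms S.abmod_axioms f(1)] tf[of "fps_X ^ (k - 1)" s] sat_carrier by simp

lemma sat_rank: "ab_rank (S \<downharpoonright> sat) k"
proof (rule ab_rank_triangular[where \<psi> = "\<lambda>s. \<psi> (\<rho> s)" and d = "\<lambda>j. n j + (k - 1)"])
  show "abmod (S \<downharpoonright> sat)" by (rule S.sub_abmod[OF sat_sub])
  show "\<psi> (\<rho> (x \<oplus>\<^bsub>S \<downharpoonright> sat\<^esub> y)) j = \<psi> (\<rho> x) j + \<psi> (\<rho> y) j" if "x \<in> carrier (S \<downharpoonright> sat)" "y \<in> carrier (S \<downharpoonright> sat)" for x y j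
    using that \<rho> by (simp add: \<rho>_add psi_add)
  show "\<psi> (\<rho> (bmul (S \<downharpoonright> sat) T x)) j = T * \<psi> (\<rho> x) j" if "x \<in> carrier (S \<downharpoonright> sat)" for x T j
    using that \<rho> by (simp add: \<rho>_bmul psi_bmul)
  show "x = \<zero>\<^bsub>S \<downharpoonright> sat\<^esub>" if "x \<in> carrier (S \<downharpoonright> sat)" "\<And>j. j \<in> {1..k} \<Longrightarrow> \<psi> (\<rho> x) j = 0" for x
    using that \<rho>(3)[of x] inj[of "\<rho> x"] sat_eq_0[of x] by simp
  show "\<exists>y\<in>carrier (S \<downharpoonright> sat). (\<forall>i\<in>{j<..k}. \<psi> (\<rho> y) i = 0) \<and> \<psi> (\<rho> y) j = fps_X ^ (n j + (k - 1))" if j: "j \<in> {1..k}" for j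
  proof -
    obtain x where x: "good x" "\<psi> x = (\<lambda>i. if i = j then fps_X ^ (n j + (k - 1)) else 0)"
      by (rule good_ex[of "\<lambda>i. if i = j then fps_X ^ (n j + (k - 1)) else 0"]) (use j in \<open>auto simp: fps_X_power_nth\<close>)
    obtain s where s: "s \<in> sat" "bmul S (fps_X ^ (k - 1)) s = f x" using sat_ex[OF x(1)] .
    have "\<rho> s = x" by (rule \<rho>_eq[OF s(1) _ s(2)]) (use x in \<open>simp add: good_def\<close>)
    then show ?thesis using s(1) x(2) by (intro bexI[of _ s]) auto
  qed
  show "fps_X ^ (n j + (k - 1)) dvd \<psi> (\<rho> x) j" if "x \<in> carrier (S \<downharpoonright> sat)" for x j
    using that \<rho>(1)[of x] by (simp add: fps_X_power_dvd_iff good_def)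
qed

lemma sat_is_saturation: "is_saturation E (S \<downharpoonright> sat)"
proof -
  interpret T: abmod "S \<downharpoonright> sat" by (rule S.sub_abmod[OF sat_sub])
  have "simple_pole (S \<downharpoonright> sat)"
    unfolding simple_pole_def ab_module_def
  proof (intro conjI exI[of _ k])
    show "left_module Atilde (S \<downharpoonright> sat)" by (rule T.left_module_axioms)
    show "ab_rank (S \<downharpoonright> sat) k" by (rule sat_rank)
    show "(\<lambda>x. ab_a \<odot>\<^bsub>S \<downharpoonright> sat\<^esub> x) ` carrier (S \<downharpoonright> sat) \<subseteq> b_image (S \<downharpoonright> sat) (carrier (S \<downharpoonright> sat))"
    proof
      fix t assume "t \<in> (\<lambda>x. ab_a \<odot>\<^bsub>S \<downharpoonright> sat\<^esub> x) ` carrier (S \<downharpoonright> sat)"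
      then obtain s where s: "s \<in> sat" "t = ab_a \<odot>\<^bsub>S\<^esub> s" by auto
      obtain y where y: "y \<in> carrier S" "bmul S fps_X y = ab_a \<odot>\<^bsub>S\<^esub> s" using pole[OF sat_carrier[OF s(1)]] by blast
      then show "t \<in> b_image (S \<downharpoonright> sat) (carrier (S \<downharpoonright> sat))"
        using sat_closed[OF s(1) y] s(2) y(2) unfolding b_image_def by (intro image_eqI[of _ _ y]) simp_all
    qed
  qed
  moreover have "is_embedding E (S \<downharpoonright> sat) f"
    unfolding is_embedding_def using f(2) sat_contains fD by (auto intro!: lmod_homI)
  moreover have "H = sat" if "submodule H Atilde (S \<downharpoonright> sat)" "f ` carrier E \<subseteq> H"
    "\<forall>x\<in>H. \<forall>y\<in>sat. bmul S fps_X y = ab_a \<odot>\<^bsub>S\<^esub> x \<longrightarrow> y \<in> H" for H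
    using sat_least[of H] that unfolding S.submodule_sub_iff[OF sat_sub] by blast
  ultimately show ?thesis unfolding is_saturation_def by (intro conjI exI[of _ f] allI impI) simp_all
qed

lemma bernstein_saturated:
  assumes all: "sat = carrier S"
  shows "bernstein_sp S = (\<Prod>j\<in>{1..k}. [: \<kappa> + of_nat (n j), 1 :])"
proof -
  \<comment> \<open>The leading coefficients of b^(k-1) s. The operator b^(-1) a multiplies the j-th
    one by \<kappa> + n_j, since the k - 1 gained from b^(k-1) is subtracted again in
    \<open>sat_lin\<close>.\<close>
  define L where "L j s = \<psi> (\<rho> s) j $ (n j + (k - 1))" for j s
  have s: "s \<in> sat" if "s \<in> carrier S" for s using that all by simp
  show ?thesis
  proof (rule bernstein_sp_diag[where L = L and ?x0.0 = "f e" and \<nu> = "\<lambda>j. \<kappa> + of_nat (n j)"])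
    show "abmod S" by (rule S.abmod_axioms)
    show "\<exists>y\<in>carrier S. ab_b \<odot>\<^bsub>S\<^esub> y = ab_a \<odot>\<^bsub>S\<^esub> x" if "x \<in> carrier S" for x using pole[OF that] .
    show "inj_on (\<lambda>j. \<kappa> + of_nat (n j)) {1..k}"
    proof (rule inj_onI)
      fix i j assume "i \<in> {1..k}" "j \<in> {1..k}" "\<kappa> + of_nat (n i) = \<kappa> + of_nat (n j)"
      then show "i = j" using mono[of i j] mono[of j i] by (cases i j rule: linorder_cases) auto
    qed
    show "L j (x \<oplus>\<^bsub>S\<^esub> y) = L j x + L j y" if "x \<in> carrier S" "y \<in> carrier S" for j x y
      using s that \<rho> by (simp add: L_def \<rho>_add psi_add)
    show "L j (fps_const [:q:] \<odot>\<^bsub>S\<^esub> x) = q * L j x" if "x \<in> carrier S" for j x q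
      using s that \<rho> by (simp add: L_def ab_of_b_const[symmetric] \<rho>_bmul psi_bmul)
    show "L j y = (\<kappa> + of_nat (n j)) * L j x" if "x \<in> carrier S" "y \<in> carrier S" "ab_b \<odot>\<^bsub>S\<^esub> y = ab_a \<odot>\<^bsub>S\<^esub> x" for j x y
    proof -
      note xs = s[OF that(1)] and ys = s[OF that(2)]
      have "f (bmul E fps_X (\<rho> y)) = bmul S fps_X (bmul S (fps_X ^ (k - 1)) y)" using \<rho>[OF ys] fD(3) by simp
      also have "\<dots> = f (ab_lin (of_nat (k - 1)) \<odot> \<rho> x)" by (rule sat_lin[OF that \<rho>(3,2)[OF xs]])
      finally have "bmul E fps_X (\<rho> y) = ab_lin (of_nat (k - 1)) \<odot> \<rho> x" using \<rho>[OF ys] \<rho>[OF xs] by (intro f_eq) auto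
      then have "\<psi> (bmul E fps_X (\<rho> y)) j $ (n j + k) = \<psi> (ab_lin (of_nat (k - 1)) \<odot> \<rho> x) j $ (n j + k)" by simp
      then show ?thesis unfolding lin_vals(2)[OF \<rho>(1)[OF xs]] using \<rho>[OF ys] k by (simp add: L_def psi_bmul algebra_simps)
    qed
    show "x \<in> b_image S (carrier S) \<longleftrightarrow> (\<forall>j\<in>{1..k}. L j x = 0)" if x: "x \<in> carrier S" for x
    proof
      assume "x \<in> b_image S (carrier S)"
      then obtain y where y: "y \<in> carrier S" "x = bmul S fps_X y" by (auto simp: b_image_def)
      have "\<psi> (\<rho> x) j $ (n j + (k - 1)) = 0" for j
      proof (cases "n j + (k - 1)")
        case (Suc m)
        then have "\<psi> (\<rho> y) j $ m = 0" using \<rho>(1)[OF s[OF y(1)]] by (simp add: good_def)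
        then show ?thesis using \<rho>[OF s[OF y(1)]] Suc unfolding y(2) by (simp add: \<rho>_bmul[OF s[OF y(1)]] psi_bmul)
      qed (use \<rho>[OF s[OF y(1)]] in \<open>simp add: y(2) \<rho>_bmul[OF s[OF y(1)]] psi_bmul\<close>)
      then show "\<forall>j\<in>{1..k}. L j x = 0" unfolding L_def by blast
    next
      assume z: "\<forall>j\<in>{1..k}. L j x = 0"
      note xs = s[OF x]
      have "\<psi> (\<rho> x) j $ i = 0" if "i < n j + k" for i j
      proof (cases "j \<in> {1..k}")
        case True
        then have "i < n j + (k - 1) \<or> i = n j + (k - 1)" using that by auto
        then show ?thesis using z True \<rho>(1)[OF xs] by (auto simp: good_def L_def)
      qed (use out[OF \<rho>(3)[OF xs]] in simp)
      from good_div_b[OF \<rho>(3)[OF xs] this] obtain x' where x': "good x'" "\<rho> x = bmul E fps_X x'" by blast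
      obtain t where t: "t \<in> sat" "bmul S (fps_X ^ (k - 1)) t = f x'" using sat_ex[OF x'(1)] .
      have "bmul S (fps_X ^ (k - 1)) x = bmul S fps_X (bmul S (fps_X ^ (k - 1)) t)"
        using \<rho>(2)[OF xs] x' t(2) fD(3) by (simp add: good_def)
      also have "\<dots> = bmul S (fps_X ^ (k - 1)) (bmul S fps_X t)"
        using sat_carrier[OF t(1)] by (metis S.bmul_mult mult.commute)
      finally have "x = bmul S fps_X t"
        by (rule S_inj[of _ _ "fps_X ^ (k - 1)", rotated 3]) (use x sat_carrier[OF t(1)] in auto)
      then show "x \<in> b_image S (carrier S)" using sat_carrier[OF t(1)] by (auto simp: b_image_def)
    qed
    show "f e \<in> carrier S" using fD(1) by simp
    show "L j (f e) \<noteq> 0" if "j \<in> {1..k}" for j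
    proof -
      have "\<rho> (f e) = bmul E (fps_X ^ (k - 1)) e"
        by (rule \<rho>_eq) (use sat_contains fD in auto)
      then show ?thesis using e(2) that by (simp add: L_def psi_bmul fps_X_power_mult_nth vals_def)
    qed
  qed simp
qed

end

section \<open>The Bernstein polynomial in terms of the exponents\<close>

lemma simple_pole_frame_pole:
  assumes "frame E k \<kappa> c \<psi> n e" "simple_pole S" "is_embedding E S f"
  shows "frame_pole E k \<kappa> c \<psi> n e S f"
proof -
  from assms(2) obtain m where S: "abmod S" "ab_rank S m" by (auto simp: simple_pole_def ab_module_def abmod_def)
  interpret frame E k \<kappa> c \<psi> n e by fact
  interpret S: abmod S by fact
  show ?thesis
  proof unfold_locales
    show "s = \<zero>\<^bsub>S\<^esub>" if "T \<noteq> 0" "s \<in> carrier S" "bmul S T s = \<zero>\<^bsub>S\<^esub>" for T s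
      using ab_rank_torsion_free[OF S that(2,1,3)] .
    show "\<exists>y\<in>carrier S. bmul S fps_X y = ab_a \<odot>\<^bsub>S\<^esub> s" if "s \<in> carrier S" for s
    proof -
      have "ab_a \<odot>\<^bsub>S\<^esub> s \<in> b_image S (carrier S)" using assms(2) that by (auto simp: simple_pole_def)
      then show ?thesis by (auto simp: b_image_def)
    qed
    show "f \<in> lmod_hom Atilde E S" "inj_on f (carrier E)" using assms(3) by (auto simp: is_embedding_def)
  qed
qed

text \<open>In any saturation S the set \<open>sat\<close> is stable under b^(-1) a and contains E,
  so it is all of S and the polynomial is the same for every choice. That a saturation exists on the
  type \<open>ab_coord\<close> follows by forming \<open>sat\<close> in the simple pole module given
  by regularity.\<close>

lemma frame_bernstein:
  assumes "frame E k \<kappa> c \<psi> n e" "ab_regular E"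
  shows "bernstein E = (\<Prod>j\<in>{1..k}. [: \<kappa> + of_nat (n j), 1 :])"
proof -
  have sp: "bernstein_sp S = (\<Prod>j\<in>{1..k}. [: \<kappa> + of_nat (n j), 1 :])" if sat: "is_saturation E S" for S :: "ab_coord ab_mod"
  proof -
    from sat obtain f where f: "simple_pole S" "is_embedding E S f"
      and least: "\<forall>H. submodule H Atilde S \<and> f ` carrier E \<subseteq> H \<and>
         (\<forall>x\<in>H. \<forall>y\<in>carrier S. ab_b \<odot>\<^bsub>S\<^esub> y = ab_a \<odot>\<^bsub>S\<^esub> x \<longrightarrow> y \<in> H) \<longrightarrow> H = carrier S"
      unfolding is_saturation_def by (elim conjE exE) (rule that)
    interpret frame_pole E k \<kappa> c \<psi> n e S f by (rule simple_pole_frame_pole[OF assms(1) f])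
    have "sat = carrier S" using sat_sub sat_contains sat_closed by (intro mp[OF spec[OF least]] conjI ballI impI)
    then show ?thesis by (rule bernstein_saturated)
  qed
  from assms(2) obtain S :: "ab_coord ab_mod" and f where S: "simple_pole S" "is_embedding E S f"
    by (auto simp: ab_regular_def)
  interpret frame_pole E k \<kappa> c \<psi> n e S f by (rule simple_pole_frame_pole[OF assms(1) S])
  have "\<exists>S :: ab_coord ab_mod. is_saturation E S" using sat_is_saturation by blast
  from sp[OF someI_ex[OF this]] show ?thesis unfolding bernstein_def .
qed

lemma frame_bernstein_root:
  assumes "frame E k \<kappa> c \<psi> n e" "ab_regular E"
  shows "poly (bernstein E) z = 0 \<longleftrightarrow> (\<exists>j\<in>{1..k}. z = - (\<kappa> + of_nat (n j)))"
proof -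
  have "\<kappa> + of_nat (n j) + z = 0 \<longleftrightarrow> z = - (\<kappa> + of_nat (n j))" for j
    by (metis add.commute add_eq_0_iff)
  then show ?thesis unfolding frame_bernstein[OF assms] by (simp add: poly_prod)
qed

section \<open>Regularity and semi-simplicity of submodules\<close>

lemma regular_sub:
  assumes "ab_regular E" "abmod E" "submodule G Atilde E" "ab_module (E \<downharpoonright> G)"
  shows "ab_regular (E \<downharpoonright> G)"
proof -
  interpret abmod E by fact
  from assms(1) obtain S :: "ab_coord ab_mod" and f where "simple_pole S" "is_embedding E S f"
    by (auto simp: ab_regular_def)
  then have "is_embedding (E \<downharpoonright> G) S f"
    using submodD(1)[OF assms(3)] unfolding is_embedding_def
    by (auto intro!: lmod_homI intro: inj_on_subset simp: lmod_homD subset_iff)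
  with assms(4) \<open>simple_pole S\<close> show ?thesis by (auto simp: ab_regular_def)
qed

lemma dsum_abmod:
  assumes K: "\<And>i. i < N \<Longrightarrow> abmod (K i)"
  shows "abmod (lmod_dsum N K)"
proof -
  have ag: "abelian_group (lmod_dsum N K)"
  proof (rule abelian_groupI)
    have c: "x i \<in> carrier (K i)" if "x \<in> carrier (lmod_dsum N K)" "i < N" for x i
      using that by (auto simp: lmod_dsum_def)
    have A: "abelian_group (K i)" if "i < N" for i using K[OF that] by (simp add: abmod_def left_module_def)
    note M = abelian_monoid.a_closed[OF abelian_group.axioms(1)[OF A]] abelian_monoid.a_assoc[OF abelian_group.axioms(1)[OF A]]
      abelian_monoid.a_comm[OF abelian_group.axioms(1)[OF A]] abelian_monoid.l_zero[OF abelian_group.axioms(1)[OF A]]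
      abelian_monoid.zero_closed[OF abelian_group.axioms(1)[OF A]]
    show "\<zero>\<^bsub>lmod_dsum N K\<^esub> \<in> carrier (lmod_dsum N K)" using M by (auto simp: lmod_dsum_def)
    fix x assume x: "x \<in> carrier (lmod_dsum N K)"
    show "\<zero>\<^bsub>lmod_dsum N K\<^esub> \<oplus>\<^bsub>lmod_dsum N K\<^esub> x = x"
      using M(4) c[OF x] x by (auto simp: lmod_dsum_def restrict_def fun_eq_iff PiE_def extensional_def)
    show "\<exists>y\<in>carrier (lmod_dsum N K). y \<oplus>\<^bsub>lmod_dsum N K\<^esub> x = \<zero>\<^bsub>lmod_dsum N K\<^esub>"
      using abelian_group.l_neg[OF A] abelian_group.a_inv_closed[OF A] c[OF x]
      by (intro bexI[of _ "\<lambda>i\<in>{..<N}. \<ominus>\<^bsub>K i\<^esub> x i"]) (auto simp: lmod_dsum_def restrict_def fun_eq_iff PiE_def extensional_def)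
    fix y assume y: "y \<in> carrier (lmod_dsum N K)"
    show "x \<oplus>\<^bsub>lmod_dsum N K\<^esub> y \<in> carrier (lmod_dsum N K)" using M c[OF x] c[OF y] by (auto simp: lmod_dsum_def)
    show "x \<oplus>\<^bsub>lmod_dsum N K\<^esub> y = y \<oplus>\<^bsub>lmod_dsum N K\<^esub> x"
      using M(3) c[OF x] c[OF y] by (auto simp: lmod_dsum_def restrict_def fun_eq_iff)
    fix z assume z: "z \<in> carrier (lmod_dsum N K)"
    show "x \<oplus>\<^bsub>lmod_dsum N K\<^esub> y \<oplus>\<^bsub>lmod_dsum N K\<^esub> z = x \<oplus>\<^bsub>lmod_dsum N K\<^esub> (y \<oplus>\<^bsub>lmod_dsum N K\<^esub> z)"
      using M(2) c[OF x] c[OF y] c[OF z] by (auto simp: lmod_dsum_def restrict_def fun_eq_iff)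
  qed
  have "left_module Atilde (lmod_dsum N K)"
  proof (intro left_module.intro left_module_axioms.intro Atilde_ring ag)
    fix u v x y assume x: "x \<in> carrier (lmod_dsum N K)"
    have c: "x i \<in> carrier (K i)" if "i < N" for i using x that by (auto simp: lmod_dsum_def)
    show "u \<odot>\<^bsub>lmod_dsum N K\<^esub> x \<in> carrier (lmod_dsum N K)"
      using abmod.smul_closed[OF K] c by (auto simp: lmod_dsum_def)
    show "(u \<oplus>\<^bsub>Atilde\<^esub> v) \<odot>\<^bsub>lmod_dsum N K\<^esub> x = u \<odot>\<^bsub>lmod_dsum N K\<^esub> x \<oplus>\<^bsub>lmod_dsum N K\<^esub> v \<odot>\<^bsub>lmod_dsum N K\<^esub> x"
      using abmod.smul_add_left[OF K] c by (auto simp: lmod_dsum_def restrict_def fun_eq_iff)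
    show "(u \<otimes>\<^bsub>Atilde\<^esub> v) \<odot>\<^bsub>lmod_dsum N K\<^esub> x = u \<odot>\<^bsub>lmod_dsum N K\<^esub> (v \<odot>\<^bsub>lmod_dsum N K\<^esub> x)"
      using abmod.smul_mult[OF K] c by (auto simp: lmod_dsum_def restrict_def fun_eq_iff)
    show "\<one>\<^bsub>Atilde\<^esub> \<odot>\<^bsub>lmod_dsum N K\<^esub> x = x"
      using abmod.smul_1[OF K] c x by (auto simp: lmod_dsum_def restrict_def fun_eq_iff PiE_def extensional_def)
    assume y: "y \<in> carrier (lmod_dsum N K)"
    have d: "y i \<in> carrier (K i)" if "i < N" for i using y that by (auto simp: lmod_dsum_def)
    show "u \<odot>\<^bsub>lmod_dsum N K\<^esub> (x \<oplus>\<^bsub>lmod_dsum N K\<^esub> y) = u \<odot>\<^bsub>lmod_dsum N K\<^esub> x \<oplus>\<^bsub>lmod_dsum N K\<^esub> u \<odot>\<^bsub>lmod_dsum N K\<^esub> y"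
      using abmod.smul_add_right[OF K] c d by (auto simp: lmod_dsum_def restrict_def fun_eq_iff)
  qed
  then show ?thesis by (rule abmod.intro)
qed

lemma semi_simple_sub:
  assumes "ab_semi_simple M" "abmod M" "submodule G Atilde M" "ab_module (M \<downharpoonright> G)"
  shows "ab_semi_simple (M \<downharpoonright> G)"
proof -
  interpret abmod M by fact
  from assms(1) obtain N and K :: "nat \<Rightarrow> ab_coord ab_mod" and H where K: "\<forall>i<N. ab_regular (K i) \<and> ab_rank (K i) 1"
    and H: "submodule H Atilde (lmod_dsum N K)" and iso: "M \<simeq> lmod_dsum N K \<downharpoonright> H" and reg: "ab_regular M"
    unfolding ab_semi_simple_def by blast
  from iso obtain f where f: "f \<in> lmod_hom Atilde M (lmod_dsum N K \<downharpoonright> H)" "bij_betw f (carrier M) H"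
    by (auto simp: lmod_iso_def)
  interpret D: abmod "lmod_dsum N K"
    by (rule dsum_abmod) (use K in \<open>auto simp: ab_regular_def ab_module_def abmod_def\<close>)
  interpret H: abmod "lmod_dsum N K \<downharpoonright> H" by (rule D.sub_abmod[OF H])
  note fD = lmod_homD[OF f(1), simplified]
  note G = submodD[OF assms(3)]
  have fG: "f ` G \<subseteq> H" using f(2) G(1) by (auto simp: bij_betw_def)
  have f0: "f \<zero>\<^bsub>M\<^esub> = \<zero>\<^bsub>lmod_dsum N K\<^esub>" using lmod_hom_zero[OF abmod_axioms H.abmod_axioms f(1)] by simp
  have sub: "submodule (f ` G) Atilde (lmod_dsum N K)"
  proof (rule D.submodI)
    show "f ` G \<subseteq> carrier (lmod_dsum N K)" using fG D.submodD(1)[OF H] by blast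
    show "\<zero>\<^bsub>lmod_dsum N K\<^esub> \<in> f ` G" using f0 G(2) by (metis imageI)
    show "x \<oplus>\<^bsub>lmod_dsum N K\<^esub> y \<in> f ` G" if "x \<in> f ` G" "y \<in> f ` G" for x y
    proof -
      from that obtain x' y' where "x' \<in> G" "x = f x'" "y' \<in> G" "y = f y'" by (elim imageE)
      then show ?thesis using fD(2)[of x' y'] G(3)[of x' y'] G(6) by (metis imageI)
    qed
    show "u \<odot>\<^bsub>lmod_dsum N K\<^esub> x \<in> f ` G" if "x \<in> f ` G" for u x
    proof -
      from that obtain x' where "x' \<in> G" "x = f x'" by (elim imageE)
      then show ?thesis using fD(3)[of x' u] G(4)[of x' u] G(6) by (metis imageI)
    qed
  qed
  have "M \<downharpoonright> G \<simeq> lmod_dsum N K \<downharpoonright> (f ` G)" unfolding lmod_iso_def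
  proof (rule bexI[of _ f])
    show "bij_betw f (carrier (M \<downharpoonright> G)) (carrier (lmod_dsum N K \<downharpoonright> (f ` G)))"
      using f(2) G(1) by (auto simp: bij_betw_def intro: inj_on_subset)
    show "f \<in> lmod_hom Atilde (M \<downharpoonright> G) (lmod_dsum N K \<downharpoonright> (f ` G))"
      using fD G(6) by (intro lmod_homI) auto
  qed
  then show ?thesis unfolding ab_semi_simple_def using regular_sub[OF reg assms(2-4)] K sub by blast
qed

section \<open>The inductive construction of \<open>\<alpha>\<close>\<close>

context frame
begin

text \<open>Regularity, and with it semi-simplicity, includes freeness of finite rank over C[[b]].
  This is the part that does not restrict automatically to submodules; coordinates supply
  it.\<close>

lemma fl_ab_module: "1 \<le> m \<Longrightarrow> m \<le> k \<Longrightarrow> ab_module (E \<downharpoonright> fl m)"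
proof -
  assume m: "1 \<le> m" "m \<le> k"
  interpret H: abmod "E \<downharpoonright> fl m" by (rule sub_abmod[OF fl_sub])
  have f: "x \<in> fl j" if "x \<in> fl m" "\<forall>i\<in>{j<..m}. \<psi> x i = 0" for x j
    using that unfolding fl_def by (auto simp: not_le)
  have "ab_rank (E \<downharpoonright> fl m) m"
  proof (rule ab_rank_triangular[OF H.abmod_axioms, where \<psi> = \<psi> and d = "\<lambda>j. n j + k - j"])
    show "\<exists>y\<in>carrier (E \<downharpoonright> fl m). (\<forall>i\<in>{j<..m}. \<psi> y i = 0) \<and> \<psi> y j = fps_X ^ (n j + k - j)" if "j \<in> {1..m}" for j
    proof -
      have "j \<in> {1..k}" using that m by auto
      from fl_gen[OF this] obtain y where "y \<in> fl j" "\<psi> y j = fps_X ^ (n j + k - j)" by blast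
      then show ?thesis using fl_mono[of j m] that by (intro bexI[of _ y]) (auto simp: fl_def)
    qed
    show "fps_X ^ (n j + k - j) dvd \<psi> x j" if "x \<in> carrier (E \<downharpoonright> fl m)" "j \<in> {1..m}" "\<forall>i\<in>{j<..m}. \<psi> x i = 0" for x j
      using fl_dvd[of j x] f[of x j] that m by simp
    show "x = \<zero>\<^bsub>E \<downharpoonright> fl m\<^esub>" if "x \<in> carrier (E \<downharpoonright> fl m)" "\<And>j. j \<in> {1..m} \<Longrightarrow> \<psi> x j = 0" for x
    proof -
      have "x = \<zero>"
      proof (rule inj)
        show "\<psi> x j = 0" if "j \<in> {1..k}" for j
          using \<open>x \<in> carrier (E \<downharpoonright> fl m)\<close> \<open>\<And>j. j \<in> {1..m} \<Longrightarrow> \<psi> x j = 0\<close> that by (cases "j \<le> m") (auto simp: fl_def)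
      qed (use that fl_carrier in auto)
      then show ?thesis by simp
    qed
  qed (use fl_carrier in \<open>simp_all add: psi_add psi_bmul\<close>)
  then show ?thesis using H.left_module_axioms by (auto simp: ab_module_def)
qed

lemma quot_fl1_ab_module:
  assumes "2 \<le> k"
  shows "ab_module (E LQuot fl 1)"
proof -
  note Q = quot_coset_eq[OF fl_sub[of 1]] quot_carrier[OF fl_sub[of 1]] quot_add[OF fl_sub[of 1]] quot_smul[OF fl_sub[of 1]]
    quot_eq_zero[OF fl_sub[of 1]] rcos_self[OF fl_sub[of 1]] rcos_memD[OF fl_sub[of 1]]
  interpret Q: abmod "E LQuot fl 1" by (rule quot_abmod[OF fl_sub])
  \<comment> \<open>For j >= 1 any representative gives the same value, since the coordinates beyond
    the first vanish on F_1.\<close>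
  define \<Psi> where "\<Psi> X j = \<psi> (SOME x. x \<in> X) (j + 1)" for X j
  have \<Psi>: "\<Psi> (fl 1 +> x) j = \<psi> x (j + 1)" if "x \<in> carrier E" "1 \<le> j" for x j
  proof -
    let ?y = "SOME y. y \<in> fl 1 +> x"
    have y: "?y \<in> fl 1 +> x" using Q(6)[OF that(1)] by (rule someI)
    have yc: "?y \<in> carrier E" "fl 1 +> ?y = fl 1 +> x" using Q(7)[OF y that(1)] by auto
    then have "?y \<ominus> x \<in> fl 1" using Q(1)[OF yc(1) that(1)] by blast
    then have "\<psi> (?y \<ominus> x) (j + 1) = 0" using that by (simp add: fl_def)
    then show ?thesis using psi_minus[OF yc(1) that(1)] by (simp add: \<Psi>_def)
  qed
  have f: "x \<in> fl (j + 1)" if "x \<in> carrier E" "\<forall>i\<in>{j<..k - 1}. \<Psi> (fl 1 +> x) i = 0" for x j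
  proof -
    note jx = that
    have "\<psi> x i = 0" if i: "j + 1 < i" for i
    proof (cases "i \<le> k")
      case True
      then have "i - 1 \<in> {j<..k - 1}" "i - 1 + 1 = i" "1 \<le> i - 1" using i by auto
      then show ?thesis using \<Psi>[OF jx(1), of "i - 1"] bspec[OF jx(2), of "i - 1"] \<open>i - 1 + 1 = i\<close> by (simp only:)
    qed (use out[OF jx(1)] in auto)
    then show ?thesis using jx(1) by (simp add: fl_def)
  qed
  \<comment> \<open>Index 0 would be the first coordinate of a representative, which depends on the
    representative; it is replaced by 0.\<close>
  have "ab_rank (E LQuot fl 1) (k - 1)"
  proof (rule ab_rank_triangular[OF Q.abmod_axioms, where \<psi> = "\<lambda>X j. if j = 0 then 0 else \<Psi> X j" and d = "\<lambda>j. n (j + 1) + k - (j + 1)"], goal_cases add bm inj ex dv)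
    case (add X Y j)
    then obtain x y where "x \<in> carrier E" "y \<in> carrier E" "X = fl 1 +> x" "Y = fl 1 +> y" by (auto simp: Q(2))
    then show ?case by (simp add: Q(3) \<Psi> psi_add)
  next
    case (bm X T j)
    then obtain x where "x \<in> carrier E" "X = fl 1 +> x" by (auto simp: Q(2))
    then show ?case by (simp add: Q(4) \<Psi> psi_bmul)
  next
    case (inj X)
    then obtain x where x: "x \<in> carrier E" "X = fl 1 +> x" by (auto simp: Q(2))
    have "x \<in> fl (0 + 1)"
    proof (rule f[OF x(1)], rule ballI)
      fix i assume "i \<in> {0<..k - 1}"
      then show "\<Psi> (fl 1 +> x) i = 0" using inj(2)[of i] x by simp
    qed
    then show ?case using Q(5) x by simp
  next
    case (ex j)
    then have j: "j + 1 \<in> {1..k}" "1 \<le> j" by auto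
    from fl_gen[OF j(1)] obtain y where y: "y \<in> fl (j + 1)" "\<psi> y (j + 1) = fps_X ^ (n (j + 1) + k - (j + 1))" by blast
    then have "y \<in> carrier E" by (simp add: fl_def)
    then show ?case
      using y j by (intro bexI[of _ "fl 1 +> y"]) (auto simp: \<Psi> Q(2), simp add: fl_def)
  next
    case (dv X j)
    then obtain x where x: "x \<in> carrier E" "X = fl 1 +> x" by (auto simp: Q(2))
    have j: "j + 1 \<in> {1..k}" "1 \<le> j" using dv(2) by auto
    have "x \<in> fl (j + 1)" by (rule f[OF x(1)]) (use dv(3) x in auto)
    then show ?case using fl_dvd[OF j(1)] \<Psi>[OF x(1) j(2)] x(2) j(2) by simp
  qed
  then show ?thesis using Q.left_module_axioms by (auto simp: ab_module_def)
qed

end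

lemma fresco_abmod: "fresco E \<Longrightarrow> abmod E"
  by (auto simp: fresco_def ab_geometric_def ab_regular_def ab_module_def abmod_def)

lemma alpha_data_frame:
  assumes "alpha_data lam E k F l p" "e \<in> carrier E" "cyc_sub Atilde E e = carrier E"
  obtains \<kappa> c \<psi> n where "frame E k \<kappa> c \<psi> n e" "\<And>j. j \<in> {1..k} \<Longrightarrow> l j = \<kappa> + of_nat (n j) + of_nat k - of_nat j"
    "\<And>j. j \<le> k \<Longrightarrow> F j = coords.fl E \<psi> j" "\<And>j. j \<in> {1..k-1} \<Longrightarrow> n (j + 1) = n j + p j"
proof -
  have "\<exists>\<kappa> c \<psi> n. frame E k \<kappa> c \<psi> n e \<and> (\<forall>j\<in>{1..k}. l j = \<kappa> + of_nat (n j) + of_nat k - of_nat j) \<and>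
    (\<forall>j\<le>k. F j = coords.fl E \<psi> j) \<and> (\<forall>j\<in>{1..k-1}. n (j + 1) = n j + p j)"
    by (rule alpha_frame) (use assms fresco_abmod[of E] in \<open>simp_all add: alpha_data_def principal_JH_def\<close>)
  then show ?thesis by (elim exE conjE) (rule that, assumption, blast+)
qed

lemma alpha_data_gen:
  assumes "alpha_data lam E k F l p"
  obtains e where "e \<in> carrier E" "cyc_sub Atilde E e = carrier E"
  using assms unfolding alpha_data_def fresco_def by (elim conjE bexE) (rule that)

text \<open>Both sets of data give frames with the same generator, compared by
  \<open>frame_exponents_unique\<close>. Each stage of \<open>alpha_value\<close> carries its own
  data, which have to be matched with the given ones.\<close>

lemma alpha_data_unique:
  assumes "alpha_data lam E k F l p" "alpha_data lam' E k' F' l' p'"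
  shows "k = k'" "j \<in> {1..k} \<Longrightarrow> l j = l' j" "j \<in> {1..k-1} \<Longrightarrow> p j = p' j"
proof -
  obtain e where e: "e \<in> carrier E" "cyc_sub Atilde E e = carrier E" using alpha_data_gen[OF assms(1)] .
  obtain \<kappa> c \<psi> n where A: "frame E k \<kappa> c \<psi> n e" "\<And>j. j \<in> {1..k} \<Longrightarrow> l j = \<kappa> + of_nat (n j) + of_nat k - of_nat j"
    using alpha_data_frame[OF assms(1) e] by metis
  obtain \<kappa>' c' \<psi>' n' where B: "frame E k' \<kappa>' c' \<psi>' n' e" "\<And>j. j \<in> {1..k'} \<Longrightarrow> l' j = \<kappa>' + of_nat (n' j) + of_nat k' - of_nat j"
    using alpha_data_frame[OF assms(2) e] by metis
  show k: "k = k'" by (rule frame_exponents_unique(1)[OF A(1) B(1)])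
  show l: "l j = l' j" if "j \<in> {1..k}" for j
    using A(2)[OF that] B(2)[of j] frame_exponents_unique(2)[OF A(1) B(1) that] that k by simp
  show "p j = p' j" if "j \<in> {1..k-1}"
  proof -
    have "j \<in> {1..k}" "j + 1 \<in> {1..k}" "j \<in> {1..k'-1}" using that k by auto
    then have "(of_nat (p j) :: complex) = of_nat (p' j)"
      using l[of j] l[of "j + 1"] assms that unfolding alpha_data_def by auto
    then show ?thesis by simp
  qed
qed

lemma (in abmod) coset_image_sub:
  assumes "submodule H Atilde E" "submodule G Atilde E"
  shows "submodule ((\<lambda>x. H +> x) ` G) Atilde (E LQuot H)"
proof -
  interpret Q: abmod "E LQuot H" by (rule quot_abmod[OF assms(1)])
  note G = submodD[OF assms(2)]
  show ?thesis
  proof (rule Q.submodI)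
    show "(\<lambda>x. H +> x) ` G \<subseteq> carrier (E LQuot H)" using G(1) by (auto simp: quot_carrier[OF assms(1)])
    show "\<zero>\<^bsub>E LQuot H\<^esub> \<in> (\<lambda>x. H +> x) ` G" using G(2) by (simp add: quot_zero[OF assms(1)])
    show "X \<oplus>\<^bsub>E LQuot H\<^esub> Y \<in> (\<lambda>x. H +> x) ` G" if XY: "X \<in> (\<lambda>x. H +> x) ` G" "Y \<in> (\<lambda>x. H +> x) ` G" for X Y
    proof -
      from XY obtain x y where "x \<in> G" "X = H +> x" "y \<in> G" "Y = H +> y" by (elim imageE)
      then show ?thesis using G(3)[of x y] G(6) by (simp add: quot_add[OF assms(1)])
    qed
    show "u \<odot>\<^bsub>E LQuot H\<^esub> X \<in> (\<lambda>x. H +> x) ` G" if X: "X \<in> (\<lambda>x. H +> x) ` G" for u X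
    proof -
      from X obtain x where "x \<in> G" "X = H +> x" by (elim imageE)
      then show ?thesis using G(4)[of x u] G(6) by (simp add: quot_smul[OF assms(1)])
    qed
  qed
qed

text \<open>By \<open>double_lin_iff\<close> the submodule in the definition of \<alpha> is
  \<open>step_sub w\<close> for some w, with the frame of \<open>frame_step\<close>. Its Bernstein
  roots are roots of E lowered by 1, so it stays geometric and primitive. Semi-simplicity is
  inherited because its term of rank k - 2 lies in F_(k-1) and its first term is F_1. The sum of the
  p_j is n_k - n_1, which a step preserves.\<close>

lemma alpha_data_step:
  assumes ad: "alpha_data lm E k F l p" and k3: "3 \<le> k"
    and fr: "frame E k \<kappa> c \<psi> n e" and F: "\<And>j. j \<le> k \<Longrightarrow> F j = coords.fl E \<psi> j"
    and l: "\<And>j. j \<in> {1..k} \<Longrightarrow> l j = \<kappa> + of_nat (n j) + of_nat k - of_nat j"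
    and p: "\<And>j. j \<in> {1..k-1} \<Longrightarrow> n (j + 1) = n j + p j"
    and dl: "(ab_lin (l (k - 1)) \<otimes>\<^bsub>Atilde\<^esub> ab_lin (l k)) \<odot>\<^bsub>E\<^esub> e \<in> F (k - 2)"
  obtains F' l' p' where "alpha_data lm (E \<downharpoonright> cyc_sub Atilde E (ab_lin (l (k - 1) - 1) \<odot>\<^bsub>E\<^esub> e)) (k - 1) F' l' p'"
    "l' 1 = l 1" "l' (k - 1) = l k + 1" "(\<Sum>j=1..k-2. p' j) = (\<Sum>j=1..k-1. p j)"
    "normal_sub (cyc_sub Atilde E (ab_lin (l (k - 1) - 1) \<odot>\<^bsub>E\<^esub> e)) E"
proof -
  interpret frame E k \<kappa> c \<psi> n e by fact
  have lk: "l k = lam k" "l (k - 1) = lam (k - 1)" using l[of k] l[of "k - 1"] k3 by (auto simp: lam_def)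
  obtain g h w where w: "\<psi> e k = fps_const g * fps_X ^ n k" "\<psi> e (k - 1) = fps_const w * \<psi> e k + fps_const h * fps_X ^ n (k - 1)"
  proof -
    have "ab_mult (ab_lin (lam (k - 1))) (ab_lin (lam k)) \<odot>\<^bsub>E\<^esub> e \<in> fl (k - 2)" using dl F[of "k - 2"] by (simp add: lk)
    then show ?thesis unfolding double_lin_iff[OF k3] by (elim exE conjE) (rule that)
  qed
  note S = frame_step[OF k3 w]
  define G where "G = step_sub w"
  have cyc: "cyc_sub Atilde E (ab_lin (l (k - 1) - 1) \<odot>\<^bsub>E\<^esub> e) = G" using S(2) by (simp add: lk G_def)
  interpret S: frame "E \<downharpoonright> G" "k - 1" \<kappa> c step_psi step_n "ab_lin (lam (k - 1) - 1) \<odot>\<^bsub>E\<^esub> e"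
    unfolding G_def by (rule S(1))
  have Gn: "normal_sub G E" using S(5) by (simp add: G_def)
  then have Gs: "submodule G Atilde E" by (simp add: normal_sub_def)
  have nn: "\<exists>i\<in>{1..k}. step_n j = n i + 1" if "j \<in> {1..k-1}" for j
    using that k3 by (cases "j = k - 1") (auto simp: step_n_def intro: bexI[of _ k] bexI[of _ j])
  have reg: "ab_regular E" using ad by (simp add: alpha_data_def ab_primitive_def)
  have regG: "ab_regular (E \<downharpoonright> G)" by (rule regular_sub[OF reg abmod_axioms Gs S.frame_ab_module])
  have root: "poly (bernstein E) (z + 1) = 0" if z: "poly (bernstein (E \<downharpoonright> G)) z = 0" for z
  proof -
    from z frame_bernstein_root[OF S.frame_axioms regG] obtain j where "j \<in> {1..k-1}" "z = - (\<kappa> + of_nat (step_n j))" by blast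
    with nn obtain i where "i \<in> {1..k}" "z + 1 = - (\<kappa> + of_nat (n i))" by force
    then show ?thesis using frame_bernstein_root[OF frame_axioms reg] by blast
  qed
  have prim: "ab_primitive lm (E \<downharpoonright> G)" unfolding ab_primitive_def
  proof (intro conjI regG allI impI)
    fix z assume "poly (bernstein (E \<downharpoonright> G)) z = 0"
    from root[OF this] obtain m :: int where "z + 1 = - lm + of_int m"
      using ad unfolding alpha_data_def ab_primitive_def by blast
    then show "\<exists>m::int. z = - lm + of_int m" by (intro exI[of _ "m - 1"]) (simp add: algebra_simps)
  qed
  have geo: "ab_geometric (E \<downharpoonright> G)" unfolding ab_geometric_def
  proof (intro conjI regG allI impI)
    fix z assume "poly (bernstein (E \<downharpoonright> G)) z = 0"
    from root[OF this] obtain q :: rat where "q < 0" "z + 1 = of_rat q"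
      using ad unfolding alpha_data_def fresco_def ab_geometric_def by blast
    then show "\<exists>q::rat. q < 0 \<and> z = of_rat q" by (intro exI[of _ "q - 1"]) (simp add: of_rat_diff algebra_simps)
  qed
  have fresco: "fresco (E \<downharpoonright> G)" unfolding fresco_def using geo S.e_car S.e(1) by blast
  have mono': "n i < n (i + 1)" if "1 \<le> i" "i < k" for i using mono[of i "i + 1"] that by simp
  define p' where "p' j = step_n (j + 1) - step_n j" for j
  have p': "step_n (j + 1) = step_n j + p' j" "1 \<le> p' j" if "j \<in> {1..k-2}" for j
  proof -
    have "j + 1 \<le> k - 1" using that k3 by auto
    then show "step_n (j + 1) = step_n j + p' j" "1 \<le> p' j" using S.mono[of j "j + 1"] that by (simp_all add: p'_def)
  qed
  have sum_tel: "N m = N 1 + (\<Sum>j=1..m-1. P j)" if "1 \<le> m" "\<And>j. j \<in> {1..m-1} \<Longrightarrow> N (j + 1) = N j + P j"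
    for N P :: "nat \<Rightarrow> nat" and m using that
  proof (induction m rule: nat_induct_at_least)
    case (Suc m)
    have "N m = N 1 + (\<Sum>j=1..m-1. P j)" by (rule Suc.IH, rule Suc.prems) auto
    moreover have "N (m + 1) = N m + P m" by (rule Suc.prems) (use Suc.hyps in auto)
    moreover have "{1..Suc m - 1} = insert m {1..m-1}" "m \<notin> {1..m-1}" using Suc.hyps by auto
    ultimately show ?case by (simp add: Suc_eq_plus1)
  qed simp
  have sums: "(\<Sum>j=1..k-2. p' j) = (\<Sum>j=1..k-1. p j)"
  proof -
    have kk: "k - 1 - 1 = k - 2" by simp
    have "step_n (k - 1) = step_n 1 + (\<Sum>j=1..k-2. p' j)"
      using sum_tel[of "k - 1" step_n p', unfolded kk, OF _ p'(1)] k3 by simp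
    moreover have "n k = n 1 + (\<Sum>j=1..k-1. p j)" by (rule sum_tel[where N = n and P = p]) (use k p in auto)
    moreover have "step_n (k - 1) = n k + 1" "step_n 1 = n 1 + 1"
    proof -
      have "1 \<noteq> k - 1" using k3 by simp
      then show "step_n (k - 1) = n k + 1" "step_n 1 = n 1 + 1" by (simp_all add: step_n_def)
    qed
    ultimately show ?thesis by simp
  qed
  have F1: "S.fl 1 = fl 1"
  proof
    show "S.fl 1 \<subseteq> fl 1"
    proof
      fix x assume x: "x \<in> S.fl 1"
      then have "x \<in> G" and z: "\<And>i. 1 < i \<Longrightarrow> step_psi x i = 0" by (auto simp: S.fl_def)
      then have xE: "x \<in> carrier E" and w: "\<psi> x (k - 1) = fps_const w * \<psi> x k" by (auto simp: G_def step_sub_def)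
      have k0: "\<psi> x k = 0" using z[of "k - 1"] k3 by (simp add: step_psi_def)
      have "\<psi> x i = 0" if "1 < i" for i
        using z[OF that] k0 w by (cases "i = k"; cases "i = k - 1") (auto simp: step_psi_def)
      then show "x \<in> fl 1" using xE by (simp add: fl_def)
    qed
    show "fl 1 \<subseteq> S.fl 1"
    proof
      fix x assume "x \<in> fl 1"
      then have x: "x \<in> carrier E" "\<And>i. 1 < i \<Longrightarrow> \<psi> x i = 0" by (auto simp: fl_def)
      then have "x \<in> carrier (E \<downharpoonright> G)" using k3 by (simp add: G_def step_sub_def)
      then show "x \<in> S.fl 1" using x(2) k3 unfolding S.fl_def by (auto simp: step_psi_def)
    qed
  qed
  have F2: "S.fl (k - 1 - 1) \<subseteq> fl (k - 1)"
  proof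
    fix x assume x: "x \<in> S.fl (k - 1 - 1)"
    then have "x \<in> G" and z: "\<And>i. k - 1 - 1 < i \<Longrightarrow> step_psi x i = 0" by (auto simp: S.fl_def)
    then have xE: "x \<in> carrier E" by (simp add: G_def step_sub_def)
    have "\<psi> x k = 0" using z[of "k - 1"] k3 by (simp add: step_psi_def)
    then have "\<psi> x i = 0" if "k - 1 < i" for i using out[OF xE, of i] that by (cases "i = k") auto
    then show "x \<in> fl (k - 1)" using xE by (simp add: fl_def)
  qed
  have ss1: "ab_semi_simple (E \<downharpoonright> S.fl (k - 1 - 1))"
  proof -
    interpret M: abmod "E \<downharpoonright> fl (k - 1)" by (rule sub_abmod[OF fl_sub])
    have s: "submodule (S.fl (k - 1 - 1)) Atilde E" using S.fl_sub submodule_sub_iff[OF Gs] by blast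
    have "ab_semi_simple ((E \<downharpoonright> fl (k - 1)) \<downharpoonright> S.fl (k - 1 - 1))"
    proof (rule semi_simple_sub[OF _ M.abmod_axioms])
      show "ab_semi_simple (E \<downharpoonright> fl (k - 1))" using ad F[of "k - 1"] by (simp add: alpha_data_def)
      show "submodule (S.fl (k - 1 - 1)) Atilde (E \<downharpoonright> fl (k - 1))" using s F2 submodule_sub_iff[OF fl_sub] by blast
      show "ab_module ((E \<downharpoonright> fl (k - 1)) \<downharpoonright> S.fl (k - 1 - 1))" using S.fl_ab_module[of "k - 1 - 1"] k3 by simp
    qed
    then show ?thesis by simp
  qed
  have ss2: "ab_semi_simple ((E \<downharpoonright> G) LQuot S.fl 1)"
  proof -
    interpret Q: abmod "E LQuot fl 1" by (rule quot_abmod[OF fl_sub])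
    have eq: "(E \<downharpoonright> G) LQuot S.fl 1 = (E LQuot fl 1) \<downharpoonright> ((\<lambda>x. fl 1 +>\<^bsub>E\<^esub> x) ` G)"
      unfolding F1 by (rule lmod_quot_sub[OF submodD(1)[OF Gs]])
    show ?thesis unfolding eq
    proof (rule semi_simple_sub[OF _ Q.abmod_axioms coset_image_sub[OF fl_sub Gs]])
      show "ab_semi_simple (E LQuot fl 1)" using ad F[of 1] k by (simp add: alpha_data_def)
      show "ab_module ((E LQuot fl 1) \<downharpoonright> ((\<lambda>x. fl 1 +>\<^bsub>E\<^esub> x) ` G))"
        unfolding eq[symmetric] using S.quot_fl1_ab_module k3 by simp
    qed
  qed
  have "alpha_data lm (E \<downharpoonright> G) (k - 1) S.fl S.lam p'"
    unfolding alpha_data_def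
  proof (intro conjI ballI)
    show "S.lam (j + 1) = S.lam j + of_nat (p' j) - 1" "1 \<le> p' j" if "j \<in> {1..k - 1 - 1}" for j
      using p'[of j] that by (auto simp: S.lam_def)
  qed (use k3 fresco prim S.frame_rank S.frame_principal_JH ss1 ss2 in auto)
  moreover have "S.lam 1 = l 1" "S.lam (k - 1) = l k + 1"
    using l[of 1] l[of k] k3 by (auto simp: S.lam_def step_n_def of_nat_diff)
  ultimately show ?thesis using that[of S.fl S.lam p'] sums Gn unfolding cyc by blast
qed

text \<open>\<open>frame_adjust\<close>, here with w = 0, supplies a generator of the required shape
  at each step; in rank 2 the value comes from \<open>frame2_rank2_quot\<close>. This makes the
  choice in \<open>alpha_inv\<close> meaningful.\<close>

lemma alpha_value_exists:
  assumes "alpha_data lm E k F l p"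
  shows "\<exists>x. alpha_value E x"
  using assms
proof (induction k arbitrary: E F l p)
  case (Suc m E F l p)
  define k where "k = Suc m"
  have ad: "alpha_data lm E k F l p" using Suc.prems by (simp add: k_def)
  obtain e0 where e0: "e0 \<in> carrier E" "cyc_sub Atilde E e0 = carrier E" using alpha_data_gen[OF ad] .
  obtain \<kappa> c \<psi> n where fr0: "frame E k \<kappa> c \<psi> n e0" and l: "\<And>j. j \<in> {1..k} \<Longrightarrow> l j = \<kappa> + of_nat (n j) + of_nat k - of_nat j"
    and F: "\<And>j. j \<le> k \<Longrightarrow> F j = coords.fl E \<psi> j" and p: "\<And>j. j \<in> {1..k-1} \<Longrightarrow> n (j + 1) = n j + p j"
    using alpha_data_frame[OF ad e0] by metis
  show ?case
  proof (cases "k = 2")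
    case True
    have "l 1 = \<kappa> + of_nat (n 1) + 1" "l 2 = \<kappa> + of_nat (n 2)" "p 1 = n 2 - n 1"
      using l[of 1] l[of 2] p[of 1] True by (simp_all add: one_add_one)
    then have "E \<simeq> ab_rank2_quot (l 1) (c * \<psi> e0 2 $ n 2 / ((of_nat (n 1) - of_nat (n 2)) * \<psi> e0 1 $ n 1)) (p 1) (l 2)"
      using frame2_rank2_quot[of E \<kappa> c \<psi> n e0] fr0 True by (simp only:)
    then show ?thesis using alpha_value.rank2[of lm E F l p] ad True by blast
  next
    case False
    then have k3: "3 \<le> k" using ad by (simp add: alpha_data_def)
    obtain e where ee: "frame E k \<kappa> c \<psi> n e" "\<psi> e k = fps_const (\<psi> e0 k $ n k) * fps_X ^ n k"
      "\<psi> e (k - 1) = fps_const 0 * \<psi> e k + fps_const (\<psi> e0 (k - 1) $ n (k - 1)) * fps_X ^ n (k - 1)"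
      using frame.frame_adjust[OF fr0, of 0] k3 by (metis (no_types, lifting) One_nat_def Suc_le_eq numeral_2_eq_2 numeral_3_eq_3 Suc_leD)
    interpret frame E k \<kappa> c \<psi> n e by (rule ee(1))
    have lk: "l k = lam k" "l (k - 1) = lam (k - 1)" using l[of k] l[of "k - 1"] k3 by (auto simp: lam_def)
    have m: "(ab_lin (l (k - 1)) \<otimes>\<^bsub>Atilde\<^esub> ab_lin (l k)) \<odot>\<^bsub>E\<^esub> e \<in> F (k - 2)"
    proof -
      have "\<exists>g h w. \<psi> e k = fps_const g * fps_X ^ n k \<and> \<psi> e (k - 1) = fps_const w * \<psi> e k + fps_const h * fps_X ^ n (k - 1)"
        using ee(2,3) by blast
      then show ?thesis using double_lin_iff[OF k3] F[of "k - 2"] by (simp only: lk) simp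
    qed
    from alpha_data_step[OF ad k3 ee(1) F l p m] obtain F' l' p' where
      "alpha_data lm (E \<downharpoonright> cyc_sub Atilde E (ab_lin (l (k - 1) - 1) \<odot>\<^bsub>E\<^esub> e)) (k - 1) F' l' p'" by metis
    from Suc.IH[OF this[unfolded k_def diff_Suc_1]]
    obtain x where "alpha_value (E \<downharpoonright> cyc_sub Atilde E (ab_lin (l (k - 1) - 1) \<odot>\<^bsub>E\<^esub> e)) x"
      unfolding k_def diff_Suc_1 by (rule exE)
    with alpha_value.step[OF ad k3 e_car e(1) m] show ?thesis by blast
  qed
qed (simp add: alpha_data_def)

lemma (in frame) normal_sub_trans:
  assumes "normal_sub G E" "normal_sub T (E \<downharpoonright> G)"
  shows "normal_sub T E"
proof (rule normal_subI)
  have G: "submodule G Atilde E" using assms by (simp add: normal_sub_def)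
  have T: "submodule T Atilde (E \<downharpoonright> G)" using assms by (simp add: normal_sub_def)
  then show "submodule T Atilde E" using submodule_sub_iff[OF G] by blast
  have TG: "T \<subseteq> G" using T submodule_sub_iff[OF G] by blast
  fix z assume z: "z \<in> carrier E" "bmul E fps_X z \<in> T"
  have z_eq: "z = y" if "bmul E fps_X z = bmul E fps_X y" "y \<in> G" for y
    using b_inj[OF z(1) submodD(6)[OF G that(2)] fps_X_neq_zero that(1)] .
  have "bmul E fps_X z \<in> G \<inter> b_image E (carrier E)" using z TG by (auto simp: b_image_def)
  then have "bmul E fps_X z \<in> b_image E G" using assms(1) unfolding normal_sub_def by blast
  then have zG: "z \<in> G" using z_eq by (auto simp: b_image_def)
  have TT: "T \<inter> b_image (E \<downharpoonright> G) (carrier (E \<downharpoonright> G)) = b_image (E \<downharpoonright> G) T" using assms(2) unfolding normal_sub_def by (rule conjunct2)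
  have "bmul E fps_X z \<in> T \<inter> b_image (E \<downharpoonright> G) (carrier (E \<downharpoonright> G))" using z zG by (auto simp: b_image_def)
  then have "bmul E fps_X z \<in> b_image (E \<downharpoonright> G) T" unfolding TT .
  then show "z \<in> T" using z_eq TG by (auto simp: b_image_def)
qed

text \<open>A step keeps \<lambda>_1, the sum of the p_j and \<lambda>_k + k, because the last
  invariant rises by 1 while the rank drops by 1. At rank 2 the sum is p_1 and the last parameter is
  \<lambda>_2, that is \<lambda>_k + k - 2 in terms of the initial module.\<close>

lemma alpha_value_normal_sub:
  assumes "alpha_value E x" "alpha_data lam E k F l p"
  shows "\<exists>T. normal_sub T E \<and> ab_rank (E \<downharpoonright> T) 2 \<and>
    E \<downharpoonright> T \<simeq> ab_rank2_quot (l 1) x (\<Sum>j=1..k-1. p j) (l k + of_nat k - 2)"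
  using assms
proof (induction arbitrary: lam k F l p rule: alpha_value.induct)
  case (rank2 lam0 E F0 l0 p0 x lam k F l p)
  note u = alpha_data_unique[OF rank2(3,1)]
  have k: "k = 2" by (rule u(1))
  have eq: "l 1 = l0 1" "l 2 = l0 2" "(\<Sum>j=1..2-1. p j) = p0 1" using u(2)[of 1] u(2)[of 2] u(3)[of 1] k by (auto simp: One_nat_def)
  have ab: "abmod E" using rank2(1) fresco_abmod[of E] by (simp add: alpha_data_def)
  then interpret abmod E .
  obtain e where e: "e \<in> carrier E" "cyc_sub Atilde E e = carrier E" using alpha_data_gen[OF rank2(1)] .
  have "normal_sub (carrier E) E" by (rule normal_subI[OF submodule_carrier])
  moreover have "ab_rank E 2" using rank2(1) by (simp add: alpha_data_def)
  moreover have "E \<downharpoonright> carrier E = E" by simp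
  ultimately show ?case using rank2(2) eq k by (intro exI[of _ "carrier E"]) simp
next
  case (step lam0 E k0 F0 l0 p0 e x lam k F l p)
  note u = alpha_data_unique[OF step.prems step.hyps(1)]
  have k: "k0 = k" by (rule u(1)[symmetric])
  have k3: "3 \<le> k" using step.hyps k by simp
  have eq: "l0 1 = l 1" "l0 k = l k" using u(2)[of 1] u(2)[of k] k3 by auto
  have sp: "(\<Sum>j=1..k-1. p0 j) = (\<Sum>j=1..k-1. p j)" using u(3) by (intro sum.cong) auto
  let ?G = "cyc_sub Atilde E (ab_lin (l0 (k - 1) - 1) \<odot>\<^bsub>E\<^esub> e)"
  note hyps = step.hyps(1-5)[unfolded k]
  obtain \<kappa> c \<psi> n where fr: "frame E k \<kappa> c \<psi> n e" and l: "\<And>j. j \<in> {1..k} \<Longrightarrow> l0 j = \<kappa> + of_nat (n j) + of_nat k - of_nat j"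
    and F: "\<And>j. j \<le> k \<Longrightarrow> F0 j = coords.fl E \<psi> j" and p: "\<And>j. j \<in> {1..k-1} \<Longrightarrow> n (j + 1) = n j + p0 j"
    using alpha_data_frame[OF hyps(1,3,4)] by metis
  obtain F' l' p' where G: "alpha_data lam0 (E \<downharpoonright> ?G) (k - 1) F' l' p'" "l' 1 = l0 1" "l' (k - 1) = l0 k + 1"
    "(\<Sum>j=1..k-2. p' j) = (\<Sum>j=1..k-1. p0 j)" "normal_sub ?G E"
    using alpha_data_step[OF hyps(1) k3 fr F l p hyps(5)] by metis
  from step.IH[unfolded k, OF G(1)] obtain T where T: "normal_sub T (E \<downharpoonright> ?G)" "ab_rank (E \<downharpoonright> T) 2"
    "E \<downharpoonright> T \<simeq> ab_rank2_quot (l' 1) x (\<Sum>j=1..k-1-1. p' j) (l' (k - 1) + of_nat (k - 1) - 2)" by auto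
  interpret frame E k \<kappa> c \<psi> n e by (rule fr)
  have "normal_sub T E" by (rule normal_sub_trans[OF G(5) T(1)])
  moreover have "l' (k - 1) + of_nat (k - 1) - 2 = l k + of_nat k - 2" "k - 1 - 1 = k - 2"
    using G(3) eq k3 by (simp_all add: of_nat_diff)
  ultimately show ?case using T(2,3) G(2,4) eq sp by auto
qed

section \<open>Logarithmic modules\<close>

lemma log_nz: "\<Lambda> \<subseteq> {0<..1} \<Longrightarrow> \<mu> \<in> \<Lambda> \<Longrightarrow> of_rat \<mu> + of_nat m \<noteq> (0::complex)"
proof -
  assume "\<Lambda> \<subseteq> {0<..1}" "\<mu> \<in> \<Lambda>"
  then have "\<mu> + of_nat m > 0" by (auto intro: add_pos_nonneg)
  then have "of_rat (\<mu> + of_nat m) \<noteq> (0 :: complex)" by (simp only: of_rat_eq_0_iff)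
  then show ?thesis by (simp add: of_rat_add)
qed

lemma log_abmod: "\<Lambda> \<subseteq> {0<..1} \<Longrightarrow> abmod (log_module \<Lambda> N)"
  by (rule abmod.intro, rule left_module_log_module) auto

lemma log_carrier: "\<phi> \<in> carrier (log_module \<Lambda> N) \<longleftrightarrow> (\<forall>\<mu> j. \<phi> \<mu> j \<noteq> 0 \<longrightarrow> \<mu> \<in> \<Lambda> \<and> j \<le> N)"
  by (simp add: log_module_def)

lemma log_add: "\<phi> \<oplus>\<^bsub>log_module \<Lambda> N\<^esub> \<psi> = (\<lambda>\<mu> j. \<phi> \<mu> j + \<psi> \<mu> j)"
  and log_zero: "\<zero>\<^bsub>log_module \<Lambda> N\<^esub> = (\<lambda>\<mu> j. 0)"
  and log_smul: "u \<odot>\<^bsub>log_module \<Lambda> N\<^esub> \<phi> = (\<lambda>\<mu>. log_act (of_rat \<mu>) N u (\<phi> \<mu>))"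
  by (simp_all add: log_module_def)

lemma log_act_of_b_const: "log_act \<mu> N (ab_of_b (fps_const c)) \<phi> = (\<lambda>j. fps_const c * \<phi> j)"
proof -
  have "ab_of_b (fps_const c) = fps_const [:c:]" by (rule fps_ext) simp
  then show ?thesis by (simp add: log_act_const fps_of_poly_const)
qed

lemma log_act_uminus: "log_act \<mu> N (- u) \<phi> = (\<lambda>j. - log_act \<mu> N u \<phi> j)"
  by (auto simp: fun_eq_iff fps_eq_iff log_act_def fps_of_poly_uminus sum_negf)

lemma log_act_of_b_cX: "log_act \<mu> N (ab_of_b (fps_const c * fps_X)) \<phi> = (\<lambda>j. fps_const c * log_prim \<mu> N \<phi> j)"
proof (intro ext fps_ext)
  fix j n
  have "log_act \<mu> N (ab_of_b (fps_const c * fps_X)) \<phi> j $ n =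
      (\<Sum>\<nu>\<in>{1}. (fps_of_poly (ab_of_b (fps_const c * fps_X) $ \<nu>) * (log_prim \<mu> N ^^ \<nu>) \<phi> j) $ n)"
    unfolding log_act_nth[OF le_SucI[OF order.refl]]
    by (rule sum.mono_neutral_right) auto
  then show "log_act \<mu> N (ab_of_b (fps_const c * fps_X)) \<phi> j $ n = (fps_const c * log_prim \<mu> N \<phi> j) $ n"
    by (simp add: fps_of_poly_const One_nat_def)
qed

lemma log_act_lin: "log_act \<mu> N (ab_lin l) \<phi> = (\<lambda>j. fps_X * \<phi> j - fps_const l * log_prim \<mu> N \<phi> j)"
proof -
  have "ab_lin l = ab_a + - ab_of_b (fps_const l * fps_X)" by (simp add: ab_lin_eq)
  moreover have "log_act \<mu> N ab_a \<phi> = (\<lambda>j. fps_X * \<phi> j)"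
    by (simp add: ab_a_def log_act_const fps_of_poly_fps_X flip: monom_Suc)
  ultimately show ?thesis by (simp only: log_act_add_left log_act_uminus log_act_of_b_cX) simp
qed

lemma log_act_X_power: "log_act \<mu> N (ab_of_b (fps_X ^ d)) \<phi> = (log_prim \<mu> N ^^ d) \<phi>"
proof (intro ext fps_ext)
  fix j n
  have "log_act \<mu> N (ab_of_b (fps_X ^ d)) \<phi> j $ n =
      (\<Sum>\<nu>\<in>{d}. (fps_of_poly (ab_of_b (fps_X ^ d) $ \<nu>) * (log_prim \<mu> N ^^ \<nu>) \<phi> j) $ n)"
    unfolding log_act_nth[OF le_add1[of n d]]
    by (rule sum.mono_neutral_right) (auto simp: fps_X_power_nth)
  then show "log_act \<mu> N (ab_of_b (fps_X ^ d)) \<phi> j $ n = (log_prim \<mu> N ^^ d) \<phi> j $ n"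
    by (simp add: fps_X_power_nth fps_of_poly_const)
qed

text \<open>The operator s d/ds undoes the primitive up to a factor s, and its component of log
  degree i involves only the log degrees i and i + 1.\<close>

lemma log_prim_injective:
  assumes "\<And>m. \<mu> + of_nat m \<noteq> 0" "log_prim \<mu> N \<phi> i = 0" "log_prim \<mu> N \<phi> (Suc i) = 0" "i \<le> N"
  shows "\<phi> i = 0"
proof -
  have "fps_X * \<phi> i = log_theta \<mu> (log_prim \<mu> N \<phi>) i" using log_theta_prim[OF assms(1,4)] by simp
  also have "\<dots> = 0" by (rule fps_ext) (simp add: log_theta_def assms(2,3))
  finally show ?thesis by simp
qed

lemma log_prim_top:
  assumes "\<And>j. i < j \<Longrightarrow> \<phi> j = 0" "i < j"
  shows "log_prim \<mu> N \<phi> j = 0"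
  using assms by (auto simp: log_prim_def fps_eq_iff split: nat.splits intro!: sum.neutral)

lemma log_prim_pow_top: "(\<And>j. i < j \<Longrightarrow> \<phi> j = 0) \<Longrightarrow> i < j \<Longrightarrow> (log_prim \<mu> N ^^ d) \<phi> j = 0"
proof (induction d arbitrary: j)
  case (Suc d) then show ?case using log_prim_top[of i "(log_prim \<mu> N ^^ d) \<phi>" j] by simp
qed simp

lemma log_act_top: "(\<And>j. i < j \<Longrightarrow> \<phi> j = 0) \<Longrightarrow> i < j \<Longrightarrow> log_act \<mu> N u \<phi> j = 0"
proof (rule fps_ext)
  fix n
  assume "\<And>j. i < j \<Longrightarrow> \<phi> j = 0" "i < j"
  then have "(log_prim \<mu> N ^^ \<nu>) \<phi> j = 0" for \<nu> by (rule log_prim_pow_top)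
  then show "log_act \<mu> N u \<phi> j $ n = 0 $ n" by (simp add: log_act_def)
qed

lemma log_prim_pow_injective:
  assumes "\<And>m. \<mu> + of_nat m \<noteq> 0" "\<And>j. i < j \<Longrightarrow> \<phi> j = 0" "(log_prim \<mu> N ^^ d) \<phi> i = 0" "i \<le> N"
  shows "\<phi> i = 0"
  using assms(3)
proof (induction d)
  case (Suc d)
  have "(log_prim \<mu> N ^^ d) \<phi> i = 0"
  proof (rule log_prim_injective[OF assms(1) _ _ assms(4)])
    show "log_prim \<mu> N ((log_prim \<mu> N ^^ d) \<phi>) i = 0" using Suc.prems by simp
    show "log_prim \<mu> N ((log_prim \<mu> N ^^ d) \<phi>) (Suc i) = 0"
      by (rule log_prim_top[where i = i]) (use log_prim_pow_top[OF assms(2)] in auto)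
  qed
  then show ?case by (rule Suc.IH)
qed simp

lemma fps_unit_X_power:
  assumes "S \<noteq> (0 :: complex fps)"
  obtains V d where "V * S = fps_X ^ d"
proof -
  define d where "d = subdegree S"
  have d: "S $ d \<noteq> 0" using assms by (simp add: d_def)
  have "\<exists>V. V $ 0 = 1 \<and> V * S = fps_const (S $ d) * fps_X ^ d"
    by (rule fps_normalize[OF d]) (simp only: d_def nth_less_subdegree_zero)
  then obtain V where V: "V * S = fps_const (S $ d) * fps_X ^ d" by blast
  have "(fps_const (inverse (S $ d)) * V) * S = (fps_const (inverse (S $ d)) * fps_const (S $ d)) * fps_X ^ d"
    by (simp only: mult.assoc V)
  also have "fps_const (inverse (S $ d)) * fps_const (S $ d) = 1" using d unfolding fps_const_mult by simp
  finally have "(fps_const (inverse (S $ d)) * V) * S = fps_X ^ d" by simp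
  then show ?thesis by (rule that)
qed

text \<open>The log degrees of \<phi> and \<xi> at \<mu> are 1 and 0, so in log degree 1 a relation
  only sees S \<phi>. A unit turns S into a power of b, and powers of the primitive are injective on
  the top log degree.\<close>

lemma log_module_free:
  assumes \<Lambda>: "\<Lambda> \<subseteq> {0<..1}" "\<mu> \<in> \<Lambda>" "0 < N"
    and \<phi>: "\<phi> \<in> carrier (log_module \<Lambda> N)" "\<And>j. 1 < j \<Longrightarrow> \<phi> \<mu> j = 0" "\<phi> \<mu> 1 \<noteq> 0"
    and \<xi>: "\<xi> \<in> carrier (log_module \<Lambda> N)" "\<And>j. 0 < j \<Longrightarrow> \<xi> \<mu> j = 0" "\<xi> \<mu> 0 \<noteq> 0"
    and z: "bmul (log_module \<Lambda> N) S \<phi> \<oplus>\<^bsub>log_module \<Lambda> N\<^esub> bmul (log_module \<Lambda> N) T \<xi> = \<zero>\<^bsub>log_module \<Lambda> N\<^esub>"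
  shows "S = 0 \<and> T = 0"
proof -
  interpret abmod "log_module \<Lambda> N" by (rule log_abmod[OF \<Lambda>(1)])
  note nz = log_nz[OF \<Lambda>(1,2)]
  have S: "S = 0"
  proof (rule ccontr)
    assume "S \<noteq> 0"
    then obtain V d where V: "V * S = fps_X ^ d" by (rule fps_unit_X_power)
    have "bmul (log_module \<Lambda> N) V (bmul (log_module \<Lambda> N) S \<phi> \<oplus>\<^bsub>log_module \<Lambda> N\<^esub> bmul (log_module \<Lambda> N) T \<xi>) = \<zero>\<^bsub>log_module \<Lambda> N\<^esub>"
      unfolding z by simp
    then have "bmul (log_module \<Lambda> N) (fps_X ^ d) \<phi> \<oplus>\<^bsub>log_module \<Lambda> N\<^esub> bmul (log_module \<Lambda> N) (V * T) \<xi> = \<zero>\<^bsub>log_module \<Lambda> N\<^esub>"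
      using \<phi> \<xi> V by (simp add: smul_add_right flip: bmul_mult)
    then have "log_act (of_rat \<mu>) N (ab_of_b (fps_X ^ d)) (\<phi> \<mu>) 1 + log_act (of_rat \<mu>) N (ab_of_b (V * T)) (\<xi> \<mu>) 1 = 0"
      by (simp add: log_add log_zero log_smul fun_eq_iff)
    then have "(log_prim (of_rat \<mu>) N ^^ d) (\<phi> \<mu>) 1 = 0"
      using log_act_top[where \<phi> = "\<xi> \<mu>" and i = 0, OF \<xi>(2)] by (simp add: log_act_X_power)
    then have "\<phi> \<mu> 1 = 0" by (intro log_prim_pow_injective[OF nz \<phi>(2)]) (use \<Lambda> in auto)
    with \<phi>(3) show False by simp
  qed
  have T: "T = 0"
  proof (rule ccontr)
    assume "T \<noteq> 0"
    then obtain V d where V: "V * T = fps_X ^ d" by (rule fps_unit_X_power)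
    have "bmul (log_module \<Lambda> N) T \<xi> = \<zero>\<^bsub>log_module \<Lambda> N\<^esub>" using z \<phi> \<xi> by (simp add: S)
    then have "bmul (log_module \<Lambda> N) V (bmul (log_module \<Lambda> N) T \<xi>) = \<zero>\<^bsub>log_module \<Lambda> N\<^esub>" by simp
    then have "bmul (log_module \<Lambda> N) (fps_X ^ d) \<xi> = \<zero>\<^bsub>log_module \<Lambda> N\<^esub>"
      using \<xi> V by (simp flip: bmul_mult)
    then have "(log_prim (of_rat \<mu>) N ^^ d) (\<xi> \<mu>) 0 = 0"
      by (simp add: log_zero log_smul fun_eq_iff log_act_X_power)
    then have "\<xi> \<mu> 0 = 0" by (intro log_prim_pow_injective[OF nz \<xi>(2)]) (use \<Lambda> in auto)
    with \<xi>(3) show False by simp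
  qed
  show ?thesis using S T by simp
qed

text \<open>Applying s d/ds to s y = \<nu> b y gives (\<mu> + m - \<nu>) y_(i,m) + (i + 1) y_(i+1,m)
  = 0. From the top log degree downwards everything vanishes unless \<nu> = \<mu> + m, and then all
  positive log degrees vanish. Only multiples of s^(\<nu>-1) remain.\<close>

lemma log_eigenvector:
  assumes \<Lambda>: "\<Lambda> \<subseteq> {0<..1}" and y: "y \<in> carrier (log_module \<Lambda> N)"
    and e: "ab_lin \<nu> \<odot>\<^bsub>log_module \<Lambda> N\<^esub> y = \<zero>\<^bsub>log_module \<Lambda> N\<^esub>" and nz: "y \<mu> j $ m \<noteq> 0"
  shows "\<mu> \<in> \<Lambda> \<and> j = 0 \<and> \<nu> = of_rat \<mu> + of_nat m"
proof -
  have \<mu>: "\<mu> \<in> \<Lambda>" using y nz by (metis fps_zero_nth log_carrier)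
  have big: "y \<mu> i = 0" if "N < i" for i using y that by (auto simp: log_carrier not_le[symmetric])
  have eq: "fps_X * y \<mu> i = fps_const \<nu> * log_prim (of_rat \<mu>) N (y \<mu>) i" for i
    using e by (simp add: log_smul log_zero log_act_lin fun_eq_iff)
  have rec: "(of_rat \<mu> + of_nat m - \<nu>) * y \<mu> i $ m + of_nat (Suc i) * y \<mu> (Suc i) $ m = 0" if "i \<le> N" for i m
  proof -
    have "log_theta (of_rat \<mu>) (\<lambda>i. fps_X * y \<mu> i) i $ Suc m =
        \<nu> * log_theta (of_rat \<mu>) (log_prim (of_rat \<mu>) N (y \<mu>)) i $ Suc m"
      unfolding eq by (simp add: log_theta_def algebra_simps)
    also have "\<dots> = \<nu> * y \<mu> i $ m" unfolding log_theta_prim[OF log_nz[OF \<Lambda> \<mu>] that] by simp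
    finally show ?thesis by (simp add: log_theta_def algebra_simps)
  qed
  have \<nu>: "\<nu> = of_rat \<mu> + of_nat m"
  proof (rule ccontr)
    assume ne: "\<nu> \<noteq> of_rat \<mu> + of_nat m"
    have "y \<mu> (Suc N - d) $ m = 0" for d
    proof (induction d)
      case (Suc d)
      show ?case
      proof (cases "d \<le> N")
        case True
        then have "Suc (Suc N - Suc d) = Suc N - d" "Suc N - Suc d \<le> N" by auto
        then show ?thesis using rec[of "Suc N - Suc d" m] Suc ne by (simp add: )
      qed (use Suc in simp)
    qed (simp add: big)
    from this[of "Suc N - j"] big[of j] nz show False by (cases "j \<le> Suc N") auto
  qed
  moreover have "j = 0"
  proof (cases j)
    case (Suc i)
    have "j \<le> N" using big[of j] nz by (cases "N < j") auto
    then have "of_nat (Suc i) * y \<mu> j $ m = 0" using rec[of i m] \<nu> Suc by simp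
    then show ?thesis using nz by (simp del: of_nat_Suc)
  qed
  ultimately show ?thesis using \<mu> by simp
qed

text \<open>Since \<Lambda> lies in ]0,1], the equation \<nu> = \<mu> + m determines \<mu> and m, so
  the kernel of a - \<nu> b has dimension at most 1.\<close>

lemma log_eigenvectors_proportional:
  assumes \<Lambda>: "\<Lambda> \<subseteq> {0<..1}" and y: "y \<in> carrier (log_module \<Lambda> N)" "y' \<in> carrier (log_module \<Lambda> N)"
    and e: "ab_lin \<nu> \<odot>\<^bsub>log_module \<Lambda> N\<^esub> y = \<zero>\<^bsub>log_module \<Lambda> N\<^esub>" "ab_lin \<nu> \<odot>\<^bsub>log_module \<Lambda> N\<^esub> y' = \<zero>\<^bsub>log_module \<Lambda> N\<^esub>"
  obtains s t where "s \<noteq> 0 \<or> t \<noteq> 0" "bmul (log_module \<Lambda> N) (fps_const s) y = bmul (log_module \<Lambda> N) (fps_const t) y'"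
proof (cases "y = (\<lambda>\<mu> j. 0)")
  case True
  then show ?thesis by (intro that[of 1 0]) (simp, simp only: log_smul log_act_of_b_const, simp)
next
  case False
  then obtain \<mu>0 j0 m0 where nz: "y \<mu>0 j0 $ m0 \<noteq> 0" by (auto simp: fun_eq_iff fps_eq_iff)
  note E = log_eigenvector[OF \<Lambda> y(1) e(1) nz]
  have "y' \<mu>0 j0 $ m0 * y \<mu> j $ m = y \<mu>0 j0 $ m0 * y' \<mu> j $ m" for \<mu> j m
  proof (cases "\<mu> = \<mu>0 \<and> j = j0 \<and> m = m0")
    case ne: False
    have "y \<mu> j $ m = 0 \<and> y' \<mu> j $ m = 0"
    proof (rule ccontr)
      assume "\<not> ?thesis"
      then have E': "\<mu> \<in> \<Lambda> \<and> j = 0 \<and> \<nu> = of_rat \<mu> + of_nat m"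
        using log_eigenvector[OF \<Lambda> y(1) e(1), of \<mu> j m] log_eigenvector[OF \<Lambda> y(2) e(2), of \<mu> j m] by auto
      with E have "(of_rat (\<mu> + of_nat m) :: complex) = of_rat (\<mu>0 + of_nat m0)" by (simp add: of_rat_add)
      then have eq: "\<mu> + of_nat m = \<mu>0 + of_nat m0" by (simp only: of_rat_eq_iff)
      have b: "0 < \<mu>" "\<mu> \<le> 1" "0 < \<mu>0" "\<mu>0 \<le> 1" using E E' \<Lambda> by auto
      have "(of_nat m :: rat) < of_nat m0 + 1" "(of_nat m0 :: rat) < of_nat m + 1" using eq b by auto
      then have "m < m0 + 1" "m0 < m + 1" by (simp_all flip: of_nat_Suc add: of_nat_less_iff)
      then have "m = m0" by simp
      then show False using eq ne E E' by simp
    qed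
    then show ?thesis by simp
  qed simp
  then have "bmul (log_module \<Lambda> N) (fps_const (y' \<mu>0 j0 $ m0)) y = bmul (log_module \<Lambda> N) (fps_const (y \<mu>0 j0 $ m0)) y'"
    by (simp add: log_smul log_act_of_b_const fun_eq_iff fps_eq_iff)
  then show ?thesis using that nz by blast
qed

text \<open>With c = \<mu> + q, the primitive of s^(c-1) log s is s^c log s / c - s^c / c^2.\<close>

lemma log_prim_monomials:
  fixes \<mu> :: complex
  shows "log_prim \<mu> 1 (\<lambda>j. if j = 0 then fps_const a * fps_X ^ m else if j = 1 then fps_const b * fps_X ^ q else 0) =
    (\<lambda>j. if j = 0 then fps_const (a / (\<mu> + of_nat m)) * fps_X ^ (m + 1) - fps_const (b / (\<mu> + of_nat q)\<^sup>2) * fps_X ^ (q + 1)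
      else if j = 1 then fps_const (b / (\<mu> + of_nat q)) * fps_X ^ (q + 1) else 0)" (is "log_prim \<mu> 1 ?f = ?g")
proof (intro ext fps_ext)
  fix j i :: nat
  have s: "{0..1::nat} = {0, 1}" by auto
  consider "j = 0" | "j = 1" | "1 < j" by linarith
  then show "log_prim \<mu> 1 ?f j $ i = ?g j $ i"
  proof cases
    case 1 then show ?thesis by (cases i) (auto simp: log_prim_def s monom_nth power2_eq_square)
  next
    case 2 then show ?thesis by (cases i) (auto simp: log_prim_def monom_nth)
  next
    case 3 then show ?thesis by (cases i) (auto simp: log_prim_def)
  qed
qed

lemma log_prim_pow_monomial:
  "(log_prim \<mu> 1 ^^ d) (\<lambda>j. if j = 0 then fps_X ^ m else 0) =
    (\<lambda>j. if j = 0 then fps_const (1 / (\<Prod>i<d. \<mu> + of_nat (m + i))) * fps_X ^ (m + d) else 0)"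
proof (induction d)
  case (Suc d)
  have 1: "(log_prim \<mu> 1 ^^ Suc d) (\<lambda>j. if j = 0 then fps_X ^ m else 0) =
      log_prim \<mu> 1 (\<lambda>j. if j = 0 then fps_const (1 / (\<Prod>i<d. \<mu> + of_nat (m + i))) * fps_X ^ (m + d)
        else if j = 1 then fps_const 0 * fps_X ^ 0 else 0)"
    by (simp add: Suc cong: if_cong)
  have 2: "1 / (\<Prod>i<d. \<mu> + of_nat (m + i)) / (\<mu> + of_nat (m + d)) = 1 / (\<Prod>i<Suc d. \<mu> + of_nat (m + i))"
    by (simp add: prod.lessThan_Suc)
  have 3: "m + d + 1 = m + Suc d" by simp
  show ?case unfolding 1 log_prim_monomials 2 3
    by (simp only: div_0 fps_const_0_eq_0 mult_zero_left diff_zero if_cancel)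
qed (simp cong: if_cong)

text \<open>The model is generated by \<phi> = A s^(q-1) + B s^(q+P-1) log s, and \<xi> = s^q; the
  constants are determined by (a - (q + P) b) \<phi> = (1 + x b^P) \<xi>. As B is a nonzero multiple
  of x, the logarithm is present because x is nonzero, and it makes \<phi> and \<xi> independent
  over C[[b]].\<close>

lemma theme_model:
  fixes q :: rat
  assumes "abmod M" "0 < q" "1 \<le> P" "x \<noteq> 0"
    and iso: "M \<simeq> ab_rank2_quot (of_rat q + 1) x P (of_rat q + of_nat P)"
  shows "theme M"
proof -
  \<comment> \<open>This splits q as \<mu> + r with \<mu> in ]0,1], so that s^(q-1) is s^(\<mu>-1)
    times s^r.\<close>
  define r where "r = nat (\<lceil>q\<rceil> - 1)"
  define \<mu> where "\<mu> = q - of_nat r"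
  have "of_int (\<lceil>q\<rceil> - 1) = (of_nat r :: rat)" using assms(2) by (simp add: r_def)
  then have "of_int \<lceil>q\<rceil> = (of_nat r + 1 :: rat)" by simp
  then have \<mu>: "0 < \<mu>" "\<mu> \<le> 1" using ceiling_correct[of q] unfolding \<mu>_def by linarith+
  have q: "of_rat \<mu> + of_nat r = (of_rat q :: complex)" by (simp add: \<mu>_def of_rat_diff)
  define L where "L = log_module {\<mu>} 1"
  have \<Lambda>: "{\<mu>} \<subseteq> {0<..1}" using \<mu> by simp
  interpret abmod L unfolding L_def by (rule log_abmod[OF \<Lambda>])
  note nz = log_nz[OF \<Lambda>, of \<mu>, simplified]
  let ?q = "of_rat q :: complex"
  let ?l = "?q + of_nat P"
  \<comment> \<open>The denominator in b^P s^q = s^(q+P) / D.\<close>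
  define D where "D = (\<Prod>i<P. of_rat \<mu> + of_nat (r + 1 + i) :: complex)"
  have q0: "?q \<noteq> 0" using nz[of r] q by simp
  have l0: "?l \<noteq> 0" using nz[of "r + P"] q by (simp add: add.assoc[symmetric])
  have D0: "D \<noteq> 0" using nz by (auto simp: D_def simp del: of_nat_add)
  have P0: "of_nat P \<noteq> (0::complex)" using assms(3) by simp
  \<comment> \<open>With l = q + P, the operator a - l b sends s^(q-1) to -(P/q) s^q and s^(l-1) log
    s to s^l / l. So A produces \<xi>, and B produces x b^P \<xi>.\<close>
  define A where "A = - ?q / of_nat P"
  define B where "B = ?l * x / D"
  have B0: "B \<noteq> 0" using assms(4) l0 D0 by (simp add: B_def)
  define \<phi> :: "rat \<Rightarrow> nat \<Rightarrow> complex fps" where "\<phi> = (\<lambda>m j. if m = \<mu> then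
    (if j = 0 then fps_const A * fps_X ^ r else if j = 1 then fps_const B * fps_X ^ (r + P) else 0) else 0)"
  define \<xi> :: "rat \<Rightarrow> nat \<Rightarrow> complex fps" where "\<xi> = (\<lambda>m j. if m = \<mu> then (if j = 0 then fps_X ^ (r + 1) else 0) else 0)"
  have c: "\<phi> \<in> carrier L" "\<xi> \<in> carrier L" by (auto simp: L_def log_carrier \<phi>_def \<xi>_def)
  have z0: "log_act \<nu> N u (\<lambda>j. 0) = (\<lambda>j. 0)" for \<nu> N u
    using log_act_add_right[of \<nu> N u "\<lambda>j. 0" "\<lambda>j. 0"] by (simp add: fun_eq_iff)
  have e1: "ab_lin ?l \<odot>\<^bsub>L\<^esub> \<phi> = bmul L (1 + fps_const x * fps_X ^ P) \<xi>"
  proof (intro ext)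
    fix m j
    have b: "bmul L (1 + fps_const x * fps_X ^ P) \<xi> = \<xi> \<oplus>\<^bsub>L\<^esub> bmul L (fps_const x) (bmul L (fps_X ^ P) \<xi>)"
      using c by (simp add: bmul_add bmul_mult)
    have A': "A - ?l * (A / ?q) = 1" using q0 P0 by (simp add: A_def field_simps)
    have B': "?l * (B / ?l\<^sup>2) = x * (1 / D)" using l0 by (simp add: B_def power2_eq_square)
    have C: "B = ?l * (B / ?l)" using l0 by simp
    have E: "of_rat \<mu> + of_nat (r + P) = ?l" using q by (simp add: add.assoc[symmetric])
    have m1: "fps_X * (fps_const a * fps_X ^ i) = (fps_const a * fps_X ^ (i + 1) :: complex fps)" for a i
      by (simp only: power_add power_one_right mult_ac)
    have m2: "fps_const a * fps_X ^ i + fps_const b * fps_X ^ i = (fps_const (a + b) * fps_X ^ i :: complex fps)" for a b i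
      by (simp add: distrib_right flip: fps_const_add)
    show "(ab_lin ?l \<odot>\<^bsub>L\<^esub> \<phi>) m j = bmul L (1 + fps_const x * fps_X ^ P) \<xi> m j"
    proof (cases "m = \<mu>")
      case False
      then show ?thesis unfolding b by (simp add: L_def log_smul log_add \<phi>_def \<xi>_def z0)
    next
      case True
      have lhs: "(ab_lin ?l \<odot>\<^bsub>L\<^esub> \<phi>) m j = fps_X * \<phi> \<mu> j - fps_const ?l * log_prim (of_rat \<mu>) 1 (\<phi> \<mu>) j"
        using True by (simp add: L_def log_smul log_act_lin)
      have rhs: "bmul L (1 + fps_const x * fps_X ^ P) \<xi> m j = \<xi> \<mu> j + fps_const x * (log_prim (of_rat \<mu>) 1 ^^ P) (\<xi> \<mu>) j"
        unfolding b using True by (simp add: L_def log_smul log_add log_act_of_b_const log_act_X_power)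
      have \<phi>: "\<phi> \<mu> = (\<lambda>j. if j = 0 then fps_const A * fps_X ^ r else if j = 1 then fps_const B * fps_X ^ (r + P) else 0)"
        and \<xi>: "\<xi> \<mu> = (\<lambda>j. if j = 0 then fps_X ^ (r + 1) else 0)" by (simp_all add: \<phi>_def \<xi>_def)
      show ?thesis unfolding lhs rhs \<phi> \<xi> log_prim_monomials log_prim_pow_monomial E q D_def[symmetric]
      proof (rule fps_ext)
        fix i
        consider "j = 0" | "j = 1" | "1 < j" by linarith
        then show "(fps_X * (if j = 0 then fps_const A * fps_X ^ r else if j = 1 then fps_const B * fps_X ^ (r + P) else 0) -
            fps_const ?l * (if j = 0 then fps_const (A / ?q) * fps_X ^ (r + 1) - fps_const (B / ?l\<^sup>2) * fps_X ^ (r + P + 1)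
              else if j = 1 then fps_const (B / ?l) * fps_X ^ (r + P + 1) else 0)) $ i =
           ((if j = 0 then fps_X ^ (r + 1) else 0) + fps_const x * (if j = 0 then fps_const (1 / D) * fps_X ^ (r + 1 + P) else 0)) $ i"
        proof cases
          case 1
          have "(fps_X * (fps_const A * fps_X ^ r) - fps_const ?l * (fps_const (A / ?q) * fps_X ^ (r + 1) - fps_const (B / ?l\<^sup>2) * fps_X ^ (r + P + 1))) $ i
             = (if i = r + 1 then A - ?l * (A / ?q) else 0) + (if i = r + 1 + P then ?l * (B / ?l\<^sup>2) else 0)"
            unfolding m1 right_diff_distrib fps_sub_nth fps_mult_left_const_nth monom_nth using q0 by (simp add: algebra_simps add_divide_distrib)
          also have "\<dots> = (fps_X ^ (r + 1) + fps_const x * (fps_const (1 / D) * fps_X ^ (r + 1 + P))) $ i"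
            unfolding A' B' fps_add_nth fps_mult_left_const_nth monom_nth fps_X_power_nth by simp
          finally show ?thesis using 1 by simp
        next
          case 2
          have "(fps_X * (fps_const B * fps_X ^ (r + P)) - fps_const ?l * (fps_const (B / ?l) * fps_X ^ (r + P + 1))) $ i = 0"
            unfolding m1 fps_sub_nth fps_mult_left_const_nth monom_nth using l0 by simp
          then show ?thesis using 2 by simp
        qed simp
      qed
    qed
  qed
  have e2: "ab_lin (?q + 1) \<odot>\<^bsub>L\<^esub> \<xi> = \<zero>\<^bsub>L\<^esub>"
  proof (intro ext)
    fix m j
    have \<xi>: "\<xi> \<mu> = (\<lambda>j. if j = 0 then fps_X ^ (r + 1) else 0)" by (simp add: \<xi>_def)
    have E: "of_rat \<mu> + of_nat (r + 1) = ?q + 1" using q by (simp add: add.assoc[symmetric])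
    have q1: "?q + 1 \<noteq> 0" using nz[of "r + 1"] E by metis
    have "log_prim (of_rat \<mu>) 1 (\<xi> \<mu>) = (\<lambda>j. if j = 0 then fps_const (1 / (?q + 1)) * fps_X ^ (r + 1 + 1) else 0)"
    proof -
      have "(\<Prod>i<1. of_rat \<mu> + of_nat (r + 1 + i)) = ?q + 1" using E by (simp add: lessThan_Suc One_nat_def)
      moreover have "log_prim (of_rat \<mu>) 1 ^^ 1 = log_prim (of_rat \<mu>) 1" by (simp add: One_nat_def fun_eq_iff)
      ultimately show ?thesis
        using log_prim_pow_monomial[where \<mu> = "of_rat \<mu>" and d = 1 and m = "r + 1"] unfolding \<xi> by (simp only:)
    qed
    moreover have "fps_X * fps_X ^ (r + 1) = (fps_X ^ (r + 1 + 1) :: complex fps)" by (simp only: power_add power_one_right mult_ac)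
    moreover have "fps_const (?q + 1) * (fps_const (1 / (?q + 1)) * f) = f" for f
    proof -
      have "fps_const (?q + 1) * fps_const (1 / (?q + 1)) = 1" unfolding fps_const_mult using q1 by simp
      then show ?thesis by (simp only: mult.assoc[symmetric] mult_1_left)
    qed
    ultimately have "fps_X * \<xi> \<mu> j - fps_const (?q + 1) * log_prim (of_rat \<mu>) 1 (\<xi> \<mu>) j = 0"
      unfolding \<xi> by (cases "j = 0") (simp_all only: simp_thms if_True if_False mult_zero_right diff_self)
    then show "(ab_lin (?q + 1) \<odot>\<^bsub>L\<^esub> \<xi>) m j = \<zero>\<^bsub>L\<^esub> m j"
    proof (cases "m = \<mu>")
      case True
      then show ?thesis
        using \<open>fps_X * \<xi> \<mu> j - fps_const (?q + 1) * log_prim (of_rat \<mu>) 1 (\<xi> \<mu>) j = 0\<close>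
        by (simp only: L_def log_smul log_zero log_act_lin)
    next
      case False
      then have "\<xi> m = (\<lambda>j. 0)" by (simp add: \<xi>_def)
      then show ?thesis by (simp only: L_def log_smul log_zero z0)
    qed
  qed
  let ?C = "cyc_sub Atilde L \<phi>" let ?U = "1 + fps_const x * fps_X ^ P"
  have Cs: "submodule ?C Atilde L" by (rule cyc_sub_submodule[OF c(1)])
  interpret C: abmod "L \<downharpoonright> ?C" by (rule sub_abmod[OF Cs])
  have \<phi>C: "\<phi> \<in> ?C" by (rule cyc_sub_self[OF c(1)])
  have U: "inverse ?U * ?U = 1" by (rule inverse_mult_eq_1) (use assms(3) in simp)
  have "\<xi> = bmul L (inverse ?U) (ab_lin ?l \<odot>\<^bsub>L\<^esub> \<phi>)" unfolding e1 using c U by (simp flip: bmul_mult)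
  then have \<xi>C: "\<xi> \<in> ?C" using submodD(4)[OF Cs submodD(4)[OF Cs \<phi>C]] by simp
  have "L \<downharpoonright> ?C \<simeq> ab_rank2_quot (?q + 1) x P ?l"
  proof (rule rank2_quot_iso[OF C.abmod_axioms])
    show "S = 0 \<and> T = 0" if z: "bmul (L \<downharpoonright> ?C) S \<phi> \<oplus>\<^bsub>L \<downharpoonright> ?C\<^esub> bmul (L \<downharpoonright> ?C) T \<xi> = \<zero>\<^bsub>L \<downharpoonright> ?C\<^esub>" for S T
    proof (rule log_module_free[OF \<Lambda>, where \<mu> = \<mu> and N = 1 and \<phi> = \<phi> and \<xi> = \<xi>])
      show "bmul (log_module {\<mu>} 1) S \<phi> \<oplus>\<^bsub>log_module {\<mu>} 1\<^esub> bmul (log_module {\<mu>} 1) T \<xi> = \<zero>\<^bsub>log_module {\<mu>} 1\<^esub>"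
        using z by (simp add: L_def)
    qed (use c B0 in \<open>auto simp: L_def \<phi>_def \<xi>_def\<close>)
  qed (use \<phi>C \<xi>C assms(3) e1 e2 in auto)
  then have "M \<simeq> L \<downharpoonright> ?C" using ab_iso_trans[OF iso] ab_iso_sym[OF C.abmod_axioms] by blast
  moreover have "left_module Atilde M" using assms(1) by (rule abmod.axioms)
  ultimately show ?thesis unfolding theme_def using \<Lambda> c(1)
    by (intro conjI exI[of _ "{\<mu>}"] exI[of _ 1] exI[of _ \<phi>]) (simp_all add: L_def)
qed

section \<open>Normal themes of rank two\<close>

lemma ab_rank2_basis:
  assumes "abmod M" "ab_rank M 2"
  obtains e0 e1 where "e0 \<in> carrier M" "e1 \<in> carrier M"
    "\<And>x. x \<in> carrier M \<Longrightarrow> \<exists>P Q. x = bmul M P e0 \<oplus>\<^bsub>M\<^esub> bmul M Q e1"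
    "\<And>P Q. bmul M P e0 \<oplus>\<^bsub>M\<^esub> bmul M Q e1 = \<zero>\<^bsub>M\<^esub> \<Longrightarrow> P = 0 \<and> Q = 0"
proof -
  interpret abmod M by fact
  from assms(2) obtain e where e: "e \<in> {..<2::nat} \<rightarrow> carrier M"
    and ex: "\<forall>x\<in>carrier M. \<exists>!S. S \<in> {..<2::nat} \<rightarrow>\<^sub>E UNIV \<and> x = (\<Oplus>\<^bsub>M\<^esub>i\<in>{..<2::nat}. bmul M (S i) (e i))"
    unfolding ab_rank_def by (elim bexE) (rule that)
  have ec: "e 0 \<in> carrier M" "e 1 \<in> carrier M" using e by auto
  have s: "{..<2::nat} = {0, 1}" by auto
  have fs: "(\<Oplus>\<^bsub>M\<^esub>i\<in>{..<2}. bmul M (S i) (e i)) = bmul M (S 0) (e 0) \<oplus>\<^bsub>M\<^esub> bmul M (S 1) (e 1)" for S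
    unfolding s using ec by (subst M.finsum_insert) auto
  have uniq: "a = b" if "\<exists>!S. R S" "R a" "R b" for R and a b :: "nat \<Rightarrow> complex fps" using that by blast
  show ?thesis
  proof (rule that[OF ec])
    show "\<exists>P Q. x = bmul M P (e 0) \<oplus>\<^bsub>M\<^esub> bmul M Q (e 1)" if "x \<in> carrier M" for x
      using ex1_implies_ex[OF bspec[OF ex that]] unfolding fs by blast
    show "P = 0 \<and> Q = 0" if z: "bmul M P (e 0) \<oplus>\<^bsub>M\<^esub> bmul M Q (e 1) = \<zero>\<^bsub>M\<^esub>" for P Q
    proof -
      let ?S = "restrict (\<lambda>i. if i = 0 then P else Q) {..<2::nat}" let ?Z = "restrict (\<lambda>i. 0) {..<2::nat} :: nat \<Rightarrow> complex fps"
      have "?S \<in> {..<2} \<rightarrow>\<^sub>E UNIV \<and> \<zero>\<^bsub>M\<^esub> = (\<Oplus>\<^bsub>M\<^esub>i\<in>{..<2}. bmul M (?S i) (e i))" unfolding fs using z by simp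
      moreover have "?Z \<in> {..<2} \<rightarrow>\<^sub>E UNIV \<and> \<zero>\<^bsub>M\<^esub> = (\<Oplus>\<^bsub>M\<^esub>i\<in>{..<2}. bmul M (?Z i) (e i))" unfolding fs using ec by simp
      ultimately have "?S = ?Z" by (rule uniq[OF bspec[OF ex M.zero_closed]])
      from fun_cong[OF this, of 0] fun_cong[OF this, of 1] show ?thesis by simp
    qed
  qed
qed

text \<open>If one of the three 2 by 2 minors is nonzero, they are the coefficients of a relation,
  as in a cross product; otherwise x and y are already dependent.\<close>

lemma ab_rank2_dependent:
  assumes "abmod M" "ab_rank M 2" "x \<in> carrier M" "y \<in> carrier M" "z \<in> carrier M"
  obtains P Q S where "P \<noteq> 0 \<or> Q \<noteq> 0 \<or> S \<noteq> 0"
    "bmul M P x \<oplus>\<^bsub>M\<^esub> bmul M Q y \<oplus>\<^bsub>M\<^esub> bmul M S z = \<zero>\<^bsub>M\<^esub>"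
proof -
  note fin = that
  interpret abmod M by fact
  obtain e0 e1 where e: "e0 \<in> carrier M" "e1 \<in> carrier M"
    "\<And>x. x \<in> carrier M \<Longrightarrow> \<exists>P Q. x = bmul M P e0 \<oplus>\<^bsub>M\<^esub> bmul M Q e1"
    using ab_rank2_basis[OF assms(1,2)] by metis
  obtain x0 x1 y0 y1 z0 z1 where c: "x = bmul M x0 e0 \<oplus>\<^bsub>M\<^esub> bmul M x1 e1" "y = bmul M y0 e0 \<oplus>\<^bsub>M\<^esub> bmul M y1 e1"
    "z = bmul M z0 e0 \<oplus>\<^bsub>M\<^esub> bmul M z1 e1" using e(3) assms(3-5) by metis
  have comb: "bmul M P x \<oplus>\<^bsub>M\<^esub> bmul M Q y \<oplus>\<^bsub>M\<^esub> bmul M S z =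
      bmul M (P * x0 + Q * y0 + S * z0) e0 \<oplus>\<^bsub>M\<^esub> bmul M (P * x1 + Q * y1 + S * z1) e1" for P Q S
    unfolding c using e(1,2) by (simp add: smul_add_right bmul_add bmul_mult M.a_ac)
  have ok: thesis if "P \<noteq> 0 \<or> Q \<noteq> 0 \<or> S \<noteq> 0" "P * x0 + Q * y0 + S * z0 = 0" "P * x1 + Q * y1 + S * z1 = 0" for P Q S
    using fin[OF that(1)] unfolding comb that(2,3) using e by simp
  show thesis
  proof (cases "y0 * z1 - y1 * z0 = 0 \<and> z0 * x1 - z1 * x0 = 0 \<and> x0 * y1 - x1 * y0 = 0")
    case False
    then show thesis by (intro ok[of "y0 * z1 - y1 * z0" "z0 * x1 - z1 * x0" "x0 * y1 - x1 * y0"]) (auto simp: algebra_simps)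
  next
    case True
    show thesis
    proof (cases "x0 = 0 \<and> x1 = 0")
      case True then show thesis by (intro ok[of 1 0 0]) auto
    next
      case ne: False
      show thesis
      proof (cases "x0 = 0")
        case False with True show thesis by (intro ok[of "- y0" x0 0]) (auto simp: algebra_simps)
      next
        case x0: True
        with ne True show thesis by (intro ok[of "- y1" x1 0]) (auto simp: algebra_simps)
      qed
    qed
  qed
qed

text \<open>Two independent homomorphisms to the same target give, by Cramer's rule, elements with
  values (b^m, 0) and (0, b^m). Both are killed by a - (\<kappa> + m) b, whereas in a theme this
  kernel has dimension at most 1.\<close>

lemma theme_not_semisimple:
  assumes M: "abmod M" "ab_rank M 2" "theme M"
    and \<chi>: "\<And>j. j \<in> J \<Longrightarrow> bhom M (fps_const \<kappa> * fps_X) (\<chi> j)"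
    and inj: "\<And>x. x \<in> carrier M \<Longrightarrow> (\<And>j. j \<in> J \<Longrightarrow> \<chi> j x = 0) \<Longrightarrow> x = \<zero>\<^bsub>M\<^esub>"
  shows False
proof -
  interpret abmod M by fact
  obtain t1 t2 where t: "t1 \<in> carrier M" "t2 \<in> carrier M"
    "\<And>P Q. bmul M P t1 \<oplus>\<^bsub>M\<^esub> bmul M Q t2 = \<zero>\<^bsub>M\<^esub> \<Longrightarrow> P = 0 \<and> Q = 0"
    using ab_rank2_basis[OF M(1,2)] by metis
  have lin: "\<chi> j (bmul M P x \<oplus>\<^bsub>M\<^esub> bmul M Q y) = P * \<chi> j x + Q * \<chi> j y" if "j \<in> J" "x \<in> carrier M" "y \<in> carrier M" for j P Q x y
    using that by (simp add: bhomD(1,2)[OF \<chi>[OF that(1)]])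
  have z: "\<chi> j \<zero>\<^bsub>M\<^esub> = 0" if "j \<in> J" for j using lin[OF that, of t1 t1 0 0] t by simp
  have "\<exists>i\<in>J. \<exists>j\<in>J. \<chi> i t1 * \<chi> j t2 - \<chi> j t1 * \<chi> i t2 \<noteq> 0"
  proof (rule ccontr)
    assume "\<not> ?thesis"
    then have d: "\<chi> i t1 * \<chi> j t2 = \<chi> j t1 * \<chi> i t2" if "i \<in> J" "j \<in> J" for i j using that by auto
    have "t1 \<noteq> \<zero>\<^bsub>M\<^esub>" using t(3)[of 1 0] t(1,2) by auto
    then obtain i where i: "i \<in> J" "\<chi> i t1 \<noteq> 0" using inj[OF t(1)] by blast
    have "bmul M (\<chi> i t2) t1 \<oplus>\<^bsub>M\<^esub> bmul M (- \<chi> i t1) t2 = \<zero>\<^bsub>M\<^esub>"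
      by (rule inj) (use t lin d[OF i(1)] in \<open>auto simp: mult.commute\<close>)
    then show False using t(3) i(2) by fastforce
  qed
  then obtain i j where ij: "i \<in> J" "j \<in> J" "\<chi> i t1 * \<chi> j t2 - \<chi> j t1 * \<chi> i t2 \<noteq> 0" by blast
  \<comment> \<open>Once the determinant is a monomial, the values b^m are killed by the operator
    that a - (\<kappa> + m) b induces on C[[b]].\<close>
  obtain V m where V: "V * (\<chi> i t1 * \<chi> j t2 - \<chi> j t1 * \<chi> i t2) = fps_X ^ m" using fps_unit_X_power[OF ij(3)] .
  define z1 where "z1 = bmul M (V * \<chi> j t2) t1 \<oplus>\<^bsub>M\<^esub> bmul M (- (V * \<chi> j t1)) t2"
  define z2 where "z2 = bmul M (- (V * \<chi> i t2)) t1 \<oplus>\<^bsub>M\<^esub> bmul M (V * \<chi> i t1) t2"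
  have zc: "z1 \<in> carrier M" "z2 \<in> carrier M" using t by (auto simp: z1_def z2_def)
  have zv: "\<chi> i z1 = fps_X ^ m" "\<chi> j z1 = 0" "\<chi> i z2 = 0" "\<chi> j z2 = fps_X ^ m"
    unfolding z1_def z2_def lin[OF ij(1) t(1,2)] lin[OF ij(2) t(1,2)] V[symmetric] by (simp_all add: algebra_simps)
  have eig: "ab_lin (\<kappa> + of_nat m) \<odot>\<^bsub>M\<^esub> x = \<zero>\<^bsub>M\<^esub>"
    if x: "x \<in> carrier M" "\<chi> i x = 0 \<or> \<chi> i x = fps_X ^ m" "\<chi> j x = 0 \<or> \<chi> j x = fps_X ^ m" for x
  proof -
    let ?w = "ab_lin (\<kappa> + of_nat m) \<odot>\<^bsub>M\<^esub> x"
    have wc: "?w \<in> carrier M" using x by simp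
    have w0: "\<chi> j' ?w = 0" if "j' \<in> J" "\<chi> j' x = 0 \<or> \<chi> j' x = fps_X ^ m" for j'
    proof (rule fps_ext)
      fix n show "\<chi> j' ?w $ n = 0 $ n"
        unfolding bhom_dop_lin_nth[OF \<chi>[OF that(1)] x(1)] by (cases n) (use that(2) in \<open>auto simp: fps_X_power_nth split: if_splits\<close>)
    qed
    note wi = w0[OF ij(1) x(2)] and wj = w0[OF ij(2) x(3)]
    \<comment> \<open>In rank 2 the three elements are dependent. The homomorphisms i and j, which
      vanish on the first element, eliminate the coefficients of z1 and z2, so a nonzero multiple of
      it has all values 0.\<close>
    obtain P Q S where D: "P \<noteq> 0 \<or> Q \<noteq> 0 \<or> S \<noteq> 0"
      "bmul M P ?w \<oplus>\<^bsub>M\<^esub> bmul M Q z1 \<oplus>\<^bsub>M\<^esub> bmul M S z2 = \<zero>\<^bsub>M\<^esub>"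
      by (rule ab_rank2_dependent[OF M(1,2) wc zc])
    have D': "P * \<chi> j' ?w + Q * \<chi> j' z1 + S * \<chi> j' z2 = 0" if "j' \<in> J" for j'
    proof -
      have "\<chi> j' (bmul M P ?w \<oplus>\<^bsub>M\<^esub> bmul M Q z1 \<oplus>\<^bsub>M\<^esub> bmul M S z2) = P * \<chi> j' ?w + Q * \<chi> j' z1 + S * \<chi> j' z2"
        using wc zc by (simp add: bhomD(1,2)[OF \<chi>[OF that]])
      then show ?thesis using D(2) z[OF that] by simp
    qed
    have "Q = 0" "S = 0" using D'[OF ij(1)] D'[OF ij(2)] zv wi wj by auto
    then have "\<chi> j' ?w = 0" if "j' \<in> J" for j' using D(1) D'[OF that] by simp
    then show ?thesis by (rule inj[OF wc])
  qed
  note e1 = eig[OF zc(1)] and e2 = eig[OF zc(2)]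
  from M(3) obtain \<Lambda> N \<phi> where \<Lambda>: "\<Lambda> \<subseteq> {0<..1}" "\<phi> \<in> carrier (log_module \<Lambda> N)"
    "M \<simeq> log_module \<Lambda> N \<downharpoonright> cyc_sub Atilde (log_module \<Lambda> N) \<phi>" unfolding theme_def by blast
  interpret L: abmod "log_module \<Lambda> N" by (rule log_abmod[OF \<Lambda>(1)])
  note Cs = L.cyc_sub_submodule[OF \<Lambda>(2)]
  interpret C: abmod "log_module \<Lambda> N \<downharpoonright> cyc_sub Atilde (log_module \<Lambda> N) \<phi>" by (rule L.sub_abmod[OF Cs])
  from \<Lambda>(3) obtain f where f: "f \<in> lmod_hom Atilde M (log_module \<Lambda> N \<downharpoonright> cyc_sub Atilde (log_module \<Lambda> N) \<phi>)"
    "inj_on f (carrier M)" by (auto simp: lmod_iso_def bij_betw_def)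
  note fD = lmod_homD[OF f(1), simplified]
  have f0: "f \<zero>\<^bsub>M\<^esub> = \<zero>\<^bsub>log_module \<Lambda> N\<^esub>" using lmod_hom_zero[OF abmod_axioms C.abmod_axioms f(1)] by simp
  have fc: "f x \<in> carrier (log_module \<Lambda> N)" if "x \<in> carrier M" for x using fD(1)[OF that] L.submodD(6)[OF Cs] by blast
  have ey: "ab_lin (\<kappa> + of_nat m) \<odot>\<^bsub>log_module \<Lambda> N\<^esub> f x = \<zero>\<^bsub>log_module \<Lambda> N\<^esub>"
    if "x \<in> carrier M" "ab_lin (\<kappa> + of_nat m) \<odot>\<^bsub>M\<^esub> x = \<zero>\<^bsub>M\<^esub>" for x using fD(3)[OF that(1), of "ab_lin (\<kappa> + of_nat m)"] that f0 by simp
  obtain s t where st: "s \<noteq> 0 \<or> t \<noteq> 0" "bmul (log_module \<Lambda> N) (fps_const s) (f z1) = bmul (log_module \<Lambda> N) (fps_const t) (f z2)"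
    by (rule log_eigenvectors_proportional[OF \<Lambda>(1) fc[OF zc(1)] fc[OF zc(2)] ey[OF zc(1) e1] ey[OF zc(2) e2]]) (use zv in auto)
  have "f (bmul M (fps_const s) z1) = f (bmul M (fps_const t) z2)" using st(2) fD(3) zc by simp
  then have "bmul M (fps_const s) z1 = bmul M (fps_const t) z2" using f(2) zc by (auto simp: inj_on_def)
  then have "\<chi> j' (bmul M (fps_const s) z1) = \<chi> j' (bmul M (fps_const t) z2)" for j' by simp
  from this[of i] this[of j] have "fps_const s * fps_X ^ m = 0" "fps_const t * fps_X ^ m = 0"
    using zc zv z[OF ij(1)] z[OF ij(2)] by (simp_all add: bhomD(2)[OF \<chi>[OF ij(1)]] bhomD(2)[OF \<chi>[OF ij(2)]])
  then show False using st(1) by auto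
qed

lemma fps_low_mult_nth:
  fixes f g :: "complex fps"
  assumes "\<And>i. i < m \<Longrightarrow> f $ i = 0" "\<And>i. i < d \<Longrightarrow> g $ i = 0"
  shows "(f * g) $ (m + d) = f $ m * g $ d"
proof -
  have "(f * g) $ (m + d) = (\<Sum>i=0..m+d. f $ i * g $ (m + d - i))" by (rule fps_mult_nth)
  also have "\<dots> = (\<Sum>i\<in>{m}. f $ i * g $ (m + d - i))"
  proof (rule sum.mono_neutral_right)
    show "\<forall>i\<in>{0..m+d} - {m}. f $ i * g $ (m + d - i) = 0"
    proof
      fix i assume "i \<in> {0..m+d} - {m}"
      then have "i < m \<or> m + d - i < d" by auto
      then show "f $ i * g $ (m + d - i) = 0" using assms by auto
    qed
  qed auto
  finally show ?thesis by simp
qed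

text \<open>The terms with \<open>\<kappa>\<close> cancel: the hypothesis says that the Wronskian of \<open>f\<close> and \<open>g\<close> vanishes.\<close>

lemma dop_proportional:
  fixes f g :: "complex fps"
  assumes "dop \<kappa> f * g = f * dop \<kappa> g" "g \<noteq> 0"
  shows "\<exists>w. f = fps_const w * g"
proof -
  define d where "d = subdegree g"
  have g: "g $ d \<noteq> 0" "\<And>i. i < d \<Longrightarrow> g $ i = 0"
    using assms(2) unfolding d_def by (simp, simp only: nth_less_subdegree_zero)
  define h where "h = f - fps_const (f $ d / g $ d) * g"
  have dl: "dop \<kappa> h = dop \<kappa> f - fps_const (f $ d / g $ d) * dop \<kappa> g"
    by (rule fps_ext, simp only: dop_nth h_def fps_sub_nth fps_mult_left_const_nth) (simp add: algebra_simps)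
  have eq: "dop \<kappa> h * g = h * dop \<kappa> g" unfolding dl using assms(1) by (simp add: h_def algebra_simps)
  have "h = 0"
  proof (rule ccontr)
    assume "h \<noteq> 0"
    define m where "m = subdegree h"
    have h: "h $ m \<noteq> 0" "\<And>i. i < m \<Longrightarrow> h $ i = 0" using \<open>h \<noteq> 0\<close> unfolding m_def by (simp, simp only: nth_less_subdegree_zero)
    have "(dop \<kappa> h * g) $ ((m + 1) + d) = dop \<kappa> h $ (m + 1) * g $ d"
      by (rule fps_low_mult_nth) (use g h in \<open>auto simp: dop_nth\<close>)
    moreover have "(h * dop \<kappa> g) $ (m + (d + 1)) = h $ m * dop \<kappa> g $ (d + 1)"
      by (rule fps_low_mult_nth) (use g h in \<open>auto simp: dop_nth\<close>)
    moreover have "(m + 1) + d = m + (d + 1)" by simp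
    ultimately have "(\<kappa> + of_nat m) * h $ m * g $ d = h $ m * ((\<kappa> + of_nat d) * g $ d)"
      using eq by (auto simp: dop_nth)
    then have "(of_nat m :: complex) = of_nat d" using g(1) h(1) by (auto simp: algebra_simps)
    then have "m = d" by simp
    then show False using h(1) g(1) by (simp add: h_def)
  qed
  then show ?thesis by (auto simp: h_def)
qed

text \<open>Semi-simplicity is excluded twice. If T met F_1 only in 0, coordinates 2 to k would
  embed it; if T lay in F_(k-1), the term with c would disappear and all coordinates would be
  homomorphisms. The resulting u and t span T up to torsion, and normality makes T
  saturated.\<close>

lemma (in frame) theme_eq_tw:
  assumes k2: "2 \<le> k" and T: "normal_sub T E" "ab_rank (E \<downharpoonright> T) 2" "theme (E \<downharpoonright> T)"
  obtains w where "T = tw E k \<psi> w"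
proof -
  have Ts: "submodule T Atilde E" using T by (simp add: normal_sub_def)
  note TD = submodD[OF Ts]
  interpret M: abmod "E \<downharpoonright> T" by (rule sub_abmod[OF Ts])
  have "\<exists>u\<in>T. u \<noteq> \<zero> \<and> (\<forall>j\<in>{2..k}. \<psi> u j = 0)"
  proof (rule ccontr)
    assume H: "\<not> ?thesis"
    show False
    proof (rule theme_not_semisimple[OF M.abmod_axioms T(2,3), where J = "{2..k}" and \<chi> = "\<lambda>j x. \<psi> x j" and \<kappa> = \<kappa>])
      show "bhom (E \<downharpoonright> T) (fps_const \<kappa> * fps_X) (\<lambda>x. \<psi> x j)" if "j \<in> {2..k}" for j
        by (rule bhom_sub[OF bhom_psi TD(1)]) (use that in auto)
      show "x = \<zero>\<^bsub>E \<downharpoonright> T\<^esub>" if "x \<in> carrier (E \<downharpoonright> T)" "\<And>j. j \<in> {2..k} \<Longrightarrow> \<psi> x j = 0" for x using H that by auto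
    qed
  qed
  then obtain u where u: "u \<in> T" "u \<noteq> \<zero>" "\<And>j. j \<in> {2..k} \<Longrightarrow> \<psi> u j = 0" by blast
  have u1: "\<psi> u 1 \<noteq> 0"
  proof
    assume "\<psi> u 1 = 0"
    then have "\<psi> u j = 0" if "j \<in> {1..k}" for j using u(3)[of j] that by (cases "j = 1") auto
    then show False using inj[OF TD(6)[OF u(1)]] u(2) by blast
  qed
  have "\<exists>t\<in>T. \<psi> t k \<noteq> 0"
  proof (rule ccontr)
    assume "\<not> ?thesis"
    then have H: "\<psi> x k = 0" if "x \<in> T" for x using that by blast
    show False
    proof (rule theme_not_semisimple[OF M.abmod_axioms T(2,3), where J = "{1..k}" and \<chi> = "\<lambda>j x. \<psi> x j" and \<kappa> = \<kappa>])
      show "bhom (E \<downharpoonright> T) (fps_const \<kappa> * fps_X) (\<lambda>x. \<psi> x j)" for j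
        unfolding bhom_def using TD(6) H by (simp add: psi_add psi_bmul psi_a)
      show "x = \<zero>\<^bsub>E \<downharpoonright> T\<^esub>" if "x \<in> carrier (E \<downharpoonright> T)" "\<And>j. j \<in> {1..k} \<Longrightarrow> \<psi> x j = 0" for x
        using inj[of x] TD(6) that by auto
    qed
  qed
  then obtain t where t: "t \<in> T" "\<psi> t k \<noteq> 0" by blast
  \<comment> \<open>The elements v, u and t are dependent and u is invisible to coordinates 2 to k,
    so the coordinates j and k of v are proportional to those of t.\<close>
  have prp: "\<psi> v j * \<psi> t k = \<psi> t j * \<psi> v k" if v: "v \<in> T" and j: "j \<in> {2..k}" for v j
  proof -
    obtain P Q S where D: "P \<noteq> 0 \<or> Q \<noteq> 0 \<or> S \<noteq> 0"
      "bmul (E \<downharpoonright> T) P v \<oplus>\<^bsub>E \<downharpoonright> T\<^esub> bmul (E \<downharpoonright> T) Q u \<oplus>\<^bsub>E \<downharpoonright> T\<^esub> bmul (E \<downharpoonright> T) S t = \<zero>\<^bsub>E \<downharpoonright> T\<^esub>"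
      by (rule ab_rank2_dependent[OF M.abmod_axioms T(2), of v u t]) (use v u t in auto)
    have D': "P * \<psi> v i + Q * \<psi> u i + S * \<psi> t i = 0" for i
    proof -
      have "\<psi> (bmul E P v \<oplus> bmul E Q u \<oplus> bmul E S t) i = P * \<psi> v i + Q * \<psi> u i + S * \<psi> t i"
        using TD(6) v u t by (simp add: psi_add psi_bmul)
      then show ?thesis using D(2) by simp
    qed
    have Dk: "P * \<psi> v k = - (S * \<psi> t k)" using D'[of k] u(3)[of k] k2 by (simp add: eq_neg_iff_add_eq_0)
    have Dj: "P * \<psi> v j = - (S * \<psi> t j)" using D'[of j] u(3)[OF j] by (simp add: eq_neg_iff_add_eq_0)
    have "P \<noteq> 0"
    proof
      assume P: "P = 0"
      then have "S = 0" using Dk t(2) by simp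
      then show False using D(1) D'[of 1] P u1 by simp
    qed
    moreover have "P * (\<psi> v j * \<psi> t k) = P * (\<psi> t j * \<psi> v k)"
    proof -
      have "P * (\<psi> v j * \<psi> t k) = (P * \<psi> v j) * \<psi> t k" by (simp add: mult.assoc)
      also have "\<dots> = \<psi> t j * (P * \<psi> v k)" unfolding Dj Dk by (simp add: mult_ac)
      finally show ?thesis by (simp add: mult_ac)
    qed
    ultimately show ?thesis by simp
  qed
  have "\<exists>w. \<psi> t j = fps_const w * \<psi> t k" if "j \<in> {2..k}" for j
  proof (rule dop_proportional[OF _ t(2), of \<kappa>])
    \<comment> \<open>For v = a t the proportionality becomes the vanishing of a Wronskian.\<close>
    have at: "ab_a \<odot> t \<in> T" using TD(4) t by simp
    have "\<psi> (ab_a \<odot> t) i = dop \<kappa> (\<psi> t i)" if "2 \<le> i" for i using psi_a[OF TD(6)[OF t(1)], of i] that by simp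
    then show "dop \<kappa> (\<psi> t j) * \<psi> t k = \<psi> t j * dop \<kappa> (\<psi> t k)" using prp[OF at that] k2 that by simp
  qed
  then obtain w where w: "\<And>j. j \<in> {2..k} \<Longrightarrow> \<psi> t j = fps_const (w j) * \<psi> t k" by metis
  have vw: "\<psi> v j = fps_const (w j) * \<psi> v k" if "v \<in> T" "j \<in> {2..k}" for v j
  proof -
    have "\<psi> t k * \<psi> v j = \<psi> t k * (fps_const (w j) * \<psi> v k)" using prp[OF that] w[OF that(2)] by (simp add: mult_ac)
    then show ?thesis using t(2) by simp
  qed
  have T1: "z \<in> T" if "z \<in> carrier E" "bmul E fps_X z \<in> T" for z
  proof -
    have "bmul E fps_X z \<in> T \<inter> b_image E (carrier E)" using that by (auto simp: b_image_def)
    then have "bmul E fps_X z \<in> b_image E T" using T(1) unfolding normal_sub_def by blast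
    then obtain y where "y \<in> T" "bmul E fps_X z = bmul E fps_X y" by (auto simp: b_image_def)
    then show ?thesis using b_inj[OF that(1) TD(6) fps_X_neq_zero] by blast
  qed
  have Td: "bmul E (fps_X ^ d) z \<in> T \<Longrightarrow> z \<in> T" if "z \<in> carrier E" for z d
  proof (induction d)
    case (Suc d)
    then have "bmul E fps_X (bmul E (fps_X ^ d) z) \<in> T" using that by (simp flip: bmul_mult)
    then show ?case using T1[of "bmul E (fps_X ^ d) z"] that Suc.IH by simp
  qed (use that in simp)
  have TS: "z \<in> T" if "z \<in> carrier E" "bmul E S z \<in> T" "S \<noteq> 0" for z S
  proof -
    note S = that
    obtain V d where "V * S = fps_X ^ d" using fps_unit_X_power[OF S(3)] .
    then have "bmul E (fps_X ^ d) z = bmul E V (bmul E S z)" using that by (simp flip: bmul_mult)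
    then show ?thesis using Td[OF that(1), of d] TD(4)[OF that(2)] by simp
  qed
  have "T = tw E k \<psi> w"
  proof
    show "T \<subseteq> tw E k \<psi> w" unfolding tw_def by (intro subsetI CollectI conjI ballI TD(6) vw) auto
    show "tw E k \<psi> w \<subseteq> T"
    proof
      fix v assume v: "v \<in> tw E k \<psi> w"
      then have vc: "v \<in> carrier E" by (simp add: tw_def)
      note tc = TD(6)[OF t(1)] and uc = TD(6)[OF u(1)]
      \<comment> \<open>All coordinates of x except the first vanish, as for u. So x is proportional
        to u and lies in T by saturation.\<close>
      define x where "x = bmul E (\<psi> t k) v \<ominus> bmul E (\<psi> v k) t"
      have xc: "x \<in> carrier E" using vc tc by (simp add: x_def)
      have x0: "\<psi> x j = 0" if "j \<in> {2..k}" for j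
      proof -
        have "\<psi> v j = fps_const (w j) * \<psi> v k"
        proof (cases "j = k")
          case True
          have "fps_const (w k) * \<psi> t k = 1 * \<psi> t k" using w[of k] k2 by simp
          then have "fps_const (w k) = 1" using mult_right_cancel[OF t(2)] by blast
          then show ?thesis using True by simp
        next
          case False
          then show ?thesis using v that by (simp add: tw_def)
        qed
        then show ?thesis using w[OF that] vc tc by (simp add: x_def psi_minus psi_bmul mult_ac)
      qed
      have "bmul E (\<psi> u 1) x = bmul E (\<psi> x 1) u"
      proof (rule psi_eqI)
        show "\<psi> (bmul E (\<psi> u 1) x) j = \<psi> (bmul E (\<psi> x 1) u) j" for j
        proof (cases "j = 1")
          case False
          have "\<psi> x j = 0 \<and> \<psi> u j = 0"
          proof (cases "j \<in> {2..k}")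
            case True then show ?thesis using x0 u(3) by simp
          next
            case False
            then have "j \<notin> {1..k}" using \<open>j \<noteq> 1\<close> by auto
            then show ?thesis using out xc uc by simp
          qed
          then show ?thesis using xc uc by (simp add: psi_bmul)
        qed (use xc uc in \<open>simp add: psi_bmul mult.commute\<close>)
      qed (use xc uc in auto)
      then have "bmul E (\<psi> u 1) x \<in> T" using TD(4)[OF u(1)] by simp
      then have xT: "x \<in> T" using TS[OF xc _ u1] by blast
      have "bmul E (\<psi> t k) v = x \<oplus> bmul E (\<psi> v k) t" unfolding x_def using vc tc by (simp add: minus_add_cancel)
      then have "bmul E (\<psi> t k) v \<in> T" using TD(3)[OF xT TD(4)[OF t(1)]] by simp
      then show "v \<in> T" using TS[OF vc _ t(2)] by blast
    qed
  qed
  then show ?thesis by (rule that)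
qed

theorem proposition3p2p4:
  fixes lam :: rat and E :: "'m ab_mod" and k :: nat
    and F :: "nat \<Rightarrow> 'm set" and l :: "nat \<Rightarrow> complex" and p :: "nat \<Rightarrow> nat"
  assumes "0 < lam" and "lam \<le> 1" and "2 \<le> k"
    and "fresco E" and "ab_rank E k" and "ab_primitive (of_rat lam) E"
    and "principal_JH E k F l"
    and "\<forall>j\<in>{1..k-1}. l (j + 1) = l j + of_nat (p j) - 1"
    and "\<forall>j\<in>{1..k-1}. 1 \<le> p j"
    and "ab_semi_simple (E \<downharpoonright> F (k - 1))" and "ab_semi_simple (E LQuot F 1)"
    and "alpha_inv E \<noteq> 0"
  shows "(\<exists>T. normal_sub T E \<and> ab_rank (E \<downharpoonright> T) 2 \<and> theme (E \<downharpoonright> T)) \<and>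
    (\<forall>T. normal_sub T E \<and> ab_rank (E \<downharpoonright> T) 2 \<and> theme (E \<downharpoonright> T) \<longrightarrow>
       E \<downharpoonright> T \<simeq> ab_rank2_quot (l 1) (alpha_inv E) (\<Sum>j=1..k-1. p j) (l k + of_nat k - 2))"
proof -
  have k2: "2 \<le> k" by fact
  let ?x = "alpha_inv E" let ?P = "\<Sum>j=1..k-1. p j"
  have ad: "alpha_data (of_rat lam) E k F l p" using assms by (simp add: alpha_data_def)
  have "\<exists>x. alpha_value E x" by (rule alpha_value_exists[OF ad])
  then have av: "alpha_value E ?x" unfolding alpha_inv_def by (rule someI_ex)
  obtain e where e: "e \<in> carrier E" "cyc_sub Atilde E e = carrier E" using alpha_data_gen[OF ad] .
  obtain \<kappa> c \<psi> n where fr: "frame E k \<kappa> c \<psi> n e" and l: "\<And>j. j \<in> {1..k} \<Longrightarrow> l j = \<kappa> + of_nat (n j) + of_nat k - of_nat j"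
    using alpha_data_frame[OF ad e] by metis
  interpret frame E k \<kappa> c \<psi> n e by (rule fr)
  have reg: "ab_regular E" using assms(6) by (simp add: ab_primitive_def)
  \<comment> \<open>The submodule in which the construction of the chosen value ends. It has the
    required presentation, will be the theme whose existence is claimed, and is the model for all
    others.\<close>
  obtain T0 where T0: "normal_sub T0 E" "ab_rank (E \<downharpoonright> T0) 2"
    "E \<downharpoonright> T0 \<simeq> ab_rank2_quot (l 1) ?x ?P (l k + of_nat k - 2)"
    using alpha_value_normal_sub[OF av ad] by blast
  have ab0: "abmod (E \<downharpoonright> T0)" using sub_abmod T0(1) by (simp add: normal_sub_def)
  \<comment> \<open>The logarithmic model needs q = \<lambda>_1 - 1 to be a positive rational. It
    equals \<kappa> + n_1 + k - 2, and -(\<kappa> + n_1) is a Bernstein root, hence a negative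
    rational.\<close>
  have "poly (bernstein E) (- (\<kappa> + of_nat (n 1))) = 0" using frame_bernstein_root[OF fr reg] k by auto
  then obtain q0 :: rat where q0: "q0 < 0" "- (\<kappa> + of_nat (n 1)) = of_rat q0"
    using assms(4) unfolding fresco_def ab_geometric_def by blast
  define q where "q = - q0 + of_nat (k - 2)"
  have q: "0 < q" using q0(1) by (simp add: q_def add_pos_nonneg)
  have "\<kappa> + of_nat (n 1) = of_rat (- q0)" by (simp add: of_rat_minus flip: q0(2))
  then have l1: "l 1 = of_rat q + 1" using l[of 1] k2 by (simp add: q_def of_rat_add of_rat_diff of_rat_minus of_nat_diff algebra_simps)
  have tel: "m \<le> k - 1 \<Longrightarrow> l (m + 1) = l 1 + of_nat (\<Sum>j=1..m. p j) - of_nat m" for m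
  proof (induction m)
    case (Suc m)
    have "l (Suc m + 1) = l (Suc m) + of_nat (p (Suc m)) - 1" by (rule bspec[OF assms(8)]) (use Suc.prems in auto)
    moreover have "l (Suc m) = l 1 + of_nat (\<Sum>j=1..m. p j) - of_nat m" using Suc by (simp add: Suc_eq_plus1)
    ultimately show ?case by simp
  qed simp
  have lk: "l k + of_nat k - 2 = of_rat q + of_nat ?P"
    using tel[of "k - 1"] k2 by (simp add: l1 of_nat_diff algebra_simps)
  have "p 1 \<le> ?P" by (rule member_le_sum) (use k2 in auto)
  moreover have "1 \<le> p 1" by (rule bspec[OF assms(9)]) (use k2 in auto)
  ultimately have P1: "1 \<le> ?P" by simp
  have th0: "theme (E \<downharpoonright> T0)"
    by (rule theme_model[OF ab0 q P1 assms(12)]) (use T0(3) lk l1 in simp)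
  moreover have "E \<downharpoonright> T \<simeq> ab_rank2_quot (l 1) ?x ?P (l k + of_nat k - 2)"
    if T: "normal_sub T E" "ab_rank (E \<downharpoonright> T) 2" "theme (E \<downharpoonright> T)" for T
  proof -
    \<comment> \<open>Both themes are cut out by proportional coordinates, with different constants.
      Their frames have the same exponents and the same ratio of leading coefficients, so they are
      isomorphic.\<close>
    obtain w w0 where w: "T = tw E k \<psi> w" "T0 = tw E k \<psi> w0"
      using theme_eq_tw[OF k2 T] theme_eq_tw[OF k2 T0(1,2) th0] by metis
    obtain e1 where e1: "frame (E \<downharpoonright> T) 2 \<kappa> c (pair2 k \<psi>) (\<lambda>j. (if j = 2 then n k else n 1) + (k - 2)) e1"
      "\<psi> e1 k $ (n k + (k - 2)) / \<psi> e1 1 $ (n 1 + (k - 2)) =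
        (\<Prod>j\<in>{2..<k}. (of_nat (n k) - of_nat (n j)) / (of_nat (n 1) - of_nat (n j))) * (\<psi> e k $ n k / \<psi> e 1 $ n 1)"
      using frame_tw[OF k2 fr, of w] unfolding w(1) by blast
    obtain e2 where e2: "frame (E \<downharpoonright> T0) 2 \<kappa> c (pair2 k \<psi>) (\<lambda>j. (if j = 2 then n k else n 1) + (k - 2)) e2"
      "\<psi> e2 k $ (n k + (k - 2)) / \<psi> e2 1 $ (n 1 + (k - 2)) =
        (\<Prod>j\<in>{2..<k}. (of_nat (n k) - of_nat (n j)) / (of_nat (n 1) - of_nat (n j))) * (\<psi> e k $ n k / \<psi> e 1 $ n 1)"
      using frame_tw[OF k2 fr, of w0] unfolding w(2) by blast
    have "E \<downharpoonright> T \<simeq> E \<downharpoonright> T0"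
      by (rule frame2_iso[OF e1(1) e2(1)]) (simp add: pair2_def e1(2) e2(2))
    then show ?thesis using ab_iso_trans T0(3) by blast
  qed
  ultimately show ?thesis using T0(1,2) by blast
qed

end
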